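(* Let $N\ge 2$, let $\Omega\subset\mathbb{R}^N$ be a bounded domain with smooth boundary, $s\in(0,1)$, $1<p<q<N$, $p^*:=\frac{Np}{N-p}$ and $1<k<p<q<p^*$. Let $w_1\in L^\infty(\Omega)$ with $w_1>0$ a.e. in $\Omega$ and $0\le a\in C^{0,1}(\overline\Omega)$. Then there exists $\lambda_1>0$ such that for every $\lambda\in(0,\lambda_1)$ the problem $$(-\Delta)^s_p u-\operatorname{div}\big(|\nabla u|^{p-2}\nabla u+a(x)|\nabla u|^{q-2}\nabla u\big)=\lambda w_1(x)|u|^{k-2}u+|u|^{p^*-2}u\ \text{in }\Omega,\qquad u=0\ \text{in }\mathbb{R}^N\setminus\Omega,$$ admits a nontrivial, nonnegative weak solution $u\in W$ with negative energy, i.e. $u\ne 0$, $u\ge 0$ a.e. in $\Omega$, and $\mathfrak{I}_\lambda(u)<0$.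
   Context: The coefficient $a$ is extended by $0$ to $\mathbb{R}^N$, and functions on $\Omega$ are extended by zero. For $u\in C_c^\infty(\Omega)$ set $$\xi(u)=\int_{\mathbb{R}^N}\int_{\mathbb{R}^N}\frac{|u(x)-u(y)|^p}{|x-y|^{N+sp}}\,dx\,dy+\int_{\mathbb{R}^N}\big(|\nabla u|^p+a(x)|\nabla u|^q\big)\,dx,\qquad \|u\|_W=\inf\{\tau>0:\ \xi(u/\tau)\le 1\}.$$ $W$ is the completion (closure) of $C_c^\infty(\Omega)$ with respect to $\|\cdot\|_W$. A function $u\in W$ is a weak solution if for all $v\in W$ $$\int_{\mathbb{R}^N}\int_{\mathbb{R}^N}\frac{|u(x)-u(y)|^{p-2}(u(x)-u(y))(v(x)-v(y))}{|x-y|^{N+ps}}\,dx\,dy+\int_\Omega\big(|\nabla u|^{p-2}\nabla u+a(x)|\nabla u|^{q-2}\nabla u\big)\cdot\nabla v\,dx=\int_\Omega\big(\lambda w_1|u|^{k-2}u+|u|^{p^*-2}u\big)v\,dx.$$ The energy functional $\mathfrak{I}_\lambda:W\to\mathbb{R}$ is $$\mathfrak{I}_\lambda(u)=\frac1p\int_{\mathbb{R}^N}\int_{\mathbb{R}^N}\frac{|u(x)-u(y)|^p}{|x-y|^{N+sp}}\,dx\,dy+\int_\Omega\Big(\frac{|\nabla u|^p}{p}+a(x)\frac{|\nabla u|^q}{q}\Big)dx-\frac{\lambda}{k}\int_\Omega w_1|u|^k\,dx-\frac1{p^*}\int_\Omega|u|^{p^*}dx.$$ *)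

theory Defs
  imports "HOL-Analysis.Analysis"
begin

section \<open>Smooth functions, test functions, smooth boundaries\<close>

text \<open>Meant for open \<open>S\<close>: \<open>f\<close> is \<open>n\<close> times continuously differentiable on \<open>S\<close>.\<close>

primrec Ck_on :: "nat \<Rightarrow> 'a::euclidean_space set \<Rightarrow> ('a \<Rightarrow> real) \<Rightarrow> bool" where
  "Ck_on 0 S f \<longleftrightarrow> continuous_on S f"
| "Ck_on (Suc n) S f \<longleftrightarrow>
     (\<forall>x\<in>S. f differentiable (at x)) \<and> (\<forall>h. Ck_on n S (\<lambda>x. frechet_derivative f (at x) h))"

definition Cinf_on :: "'a::euclidean_space set \<Rightarrow> ('a \<Rightarrow> real) \<Rightarrow> bool" where
  "Cinf_on S f \<longleftrightarrow> (\<forall>n. Ck_on n S f)"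

definition Cc_inf :: "'a::euclidean_space set \<Rightarrow> ('a \<Rightarrow> real) set" where
  "Cc_inf \<Omega> = {\<phi>. Cinf_on UNIV \<phi> \<and> compact (closure {x. \<phi> x \<noteq> 0}) \<and> closure {x. \<phi> x \<noteq> 0} \<subseteq> \<Omega>}"

text \<open>Near each boundary point, \<open>\<Omega>\<close> is the region above the graph of a smooth function \<open>g\<close>
  over the hyperplane orthogonal to some unit vector \<open>e\<close>. Only the values of \<open>g\<close> on that
  hyperplane matter.\<close>

definition smooth_boundary :: "'a::euclidean_space set \<Rightarrow> bool" where
  "smooth_boundary \<Omega> \<longleftrightarrow>
     (\<forall>z\<in>frontier \<Omega>. \<exists>r>0. \<exists>e g. norm e = 1 \<and> Cinf_on UNIV g \<and>
        \<Omega> \<inter> ball z r = {x \<in> ball z r. x \<bullet> e > g (x - (x \<bullet> e) *\<^sub>R e)})"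

definition smooth_bounded_domain :: "'a::euclidean_space set \<Rightarrow> bool" where
  "smooth_bounded_domain \<Omega> \<longleftrightarrow>
     open \<Omega> \<and> connected \<Omega> \<and> \<Omega> \<noteq> {} \<and> bounded \<Omega> \<and> smooth_boundary \<Omega>"

section \<open>Weak gradients\<close>

definition has_weak_gradient :: "('a::euclidean_space \<Rightarrow> real) \<Rightarrow> ('a \<Rightarrow> 'a) \<Rightarrow> bool" where
  "has_weak_gradient u G \<longleftrightarrow>
     (\<forall>K. compact K \<longrightarrow> u absolutely_integrable_on K \<and> G absolutely_integrable_on K) \<and>
     (\<forall>\<phi>\<in>Cc_inf UNIV. \<forall>b\<in>Basis.
        (LINT x|lebesgue. u x * frechet_derivative \<phi> (at x) b) =
        - (LINT x|lebesgue. (G x \<bullet> b) * \<phi> x))"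

text \<open>Weak gradients are unique almost everywhere, so the choice below is immaterial
  wherever it occurs under an integral. For a smooth function it agrees almost everywhere with
  the classical gradient.\<close>

definition weak_gradient :: "('a::euclidean_space \<Rightarrow> real) \<Rightarrow> 'a \<Rightarrow> 'a" where
  "weak_gradient u = (SOME G. has_weak_gradient u G)"

section \<open>The function space\<close>

definition modular_W ::
  "real \<Rightarrow> real \<Rightarrow> real \<Rightarrow> ('a::euclidean_space \<Rightarrow> real) \<Rightarrow> ('a \<Rightarrow> real) \<Rightarrow> ennreal" where
  "modular_W s p q a u =
     (\<integral>\<^sup>+ x. (\<integral>\<^sup>+ y. ennreal (\<bar>u x - u y\<bar> powr p / norm (x - y) powr (real DIM('a) + s * p))
        \<partial>lebesgue) \<partial>lebesgue) +
     (\<integral>\<^sup>+ x. ennreal (norm (weak_gradient u x) powr p + a x * norm (weak_gradient u x) powr q)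
        \<partial>lebesgue)"

text \<open>Values in \<^typ>\<open>ennreal\<close>, so that the infimum of the empty set is infinite.\<close>

definition norm_W ::
  "real \<Rightarrow> real \<Rightarrow> real \<Rightarrow> ('a::euclidean_space \<Rightarrow> real) \<Rightarrow> ('a \<Rightarrow> real) \<Rightarrow> ennreal" where
  "norm_W s p q a u = Inf {ennreal t | t. t > 0 \<and> modular_W s p q a (\<lambda>x. u x / t) \<le> 1}"

text \<open>The completion of \<^term>\<open>Cc_inf \<Omega>\<close>, realised as its closure among the weakly
  differentiable functions on the whole space that vanish outside \<open>\<Omega>\<close>. Elements are
  representatives of classes modulo equality almost everywhere.\<close>

definition space_W ::
  "'a::euclidean_space set \<Rightarrow> real \<Rightarrow> real \<Rightarrow> real \<Rightarrow> ('a \<Rightarrow> real) \<Rightarrow> ('a \<Rightarrow> real) set" where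
  "space_W \<Omega> s p q a =
     {u. (\<exists>G. has_weak_gradient u G) \<and> (\<forall>x. x \<notin> \<Omega> \<longrightarrow> u x = 0) \<and>
         (\<exists>\<phi> :: nat \<Rightarrow> 'a \<Rightarrow> real. (\<forall>n. \<phi> n \<in> Cc_inf \<Omega>) \<and>
            (\<lambda>n. norm_W s p q a (\<lambda>x. u x - \<phi> n x)) \<longlonglongrightarrow> 0)}"

section \<open>Weak solutions and energy\<close>

definition sobolev_exponent :: "real \<Rightarrow> real \<Rightarrow> real" where
  "sobolev_exponent N p = N * p / (N - p)"

text \<open>Here and in the energy, every integral converges absolutely for functions in
  \<^const>\<open>space_W\<close>, by the Hoelder and Sobolev inequalities, so the convention
  that a non-integrable function has integral \<open>0\<close> plays no role. Since \<open>0 powr t = 0\<close>, the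
  expressions \<open>\<bar>t\<bar> powr (r - 2) * t\<close> vanish at \<open>t = 0\<close>, also for \<open>r < 2\<close>.\<close>

definition weak_solution ::
  "'a::euclidean_space set \<Rightarrow> real \<Rightarrow> real \<Rightarrow> real \<Rightarrow> real \<Rightarrow> ('a \<Rightarrow> real) \<Rightarrow> ('a \<Rightarrow> real) \<Rightarrow> real \<Rightarrow>
   ('a \<Rightarrow> real) \<Rightarrow> bool" where
  "weak_solution \<Omega> s p q k a w lam u \<longleftrightarrow>
     u \<in> space_W \<Omega> s p q a \<and>
     (\<forall>v\<in>space_W \<Omega> s p q a.
        (LINT x|lebesgue. (LINT y|lebesgue.
           \<bar>u x - u y\<bar> powr (p - 2) * (u x - u y) * (v x - v y) /
           norm (x - y) powr (real DIM('a) + p * s))) +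
        (LINT x:\<Omega>|lebesgue.
           (norm (weak_gradient u x) powr (p - 2) *\<^sub>R weak_gradient u x +
            (a x * norm (weak_gradient u x) powr (q - 2)) *\<^sub>R weak_gradient u x)
           \<bullet> weak_gradient v x) =
        (LINT x:\<Omega>|lebesgue.
           (lam * w x * \<bar>u x\<bar> powr (k - 2) * u x +
            \<bar>u x\<bar> powr (sobolev_exponent (real DIM('a)) p - 2) * u x) * v x))"

definition energy ::
  "'a::euclidean_space set \<Rightarrow> real \<Rightarrow> real \<Rightarrow> real \<Rightarrow> real \<Rightarrow> ('a \<Rightarrow> real) \<Rightarrow> ('a \<Rightarrow> real) \<Rightarrow> real \<Rightarrow>
   ('a \<Rightarrow> real) \<Rightarrow> real" where
  "energy \<Omega> s p q k a w lam u =
     1 / p * (LINT x|lebesgue. (LINT y|lebesgue.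
        \<bar>u x - u y\<bar> powr p / norm (x - y) powr (real DIM('a) + s * p))) +
     (LINT x:\<Omega>|lebesgue.
        norm (weak_gradient u x) powr p / p + a x * (norm (weak_gradient u x) powr q / q)) -
     lam / k * (LINT x:\<Omega>|lebesgue. w x * \<bar>u x\<bar> powr k) -
     1 / sobolev_exponent (real DIM('a)) p *
       (LINT x:\<Omega>|lebesgue. \<bar>u x\<bar> powr (sobolev_exponent (real DIM('a)) p))"

end

theory Submission
  imports Defs
begin

text \<open>
  Replace the right-hand side by its truncation at a height \<open>M\<close>, which is nondecreasing in \<open>u\<close> and
  bounded by some \<open>\<epsilon>\<close>. If \<open>u\<close> solves the truncated problem, testing with \<open>(u - t)\<^sup>+\<close> and iterating in
  the manner of Stampacchia gives \<open>u \<le> c \<epsilon> powr (1 / (p - 1))\<close>. Since \<open>p < p\<^sup>*\<close>, for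
  small \<open>M\<close> and then small \<open>\<lambda>\<close> one may take \<open>\<epsilon>\<close> with \<open>c \<epsilon> powr (1 / (p - 1)) = M\<close>, so that \<open>u\<close> solves
  the original problem; criticality of the exponent plays no role. The Sobolev inequality in this argument can be replaced by an
  elementary one, because the Gagliardo term controls the \<open>p\<close>-norm with a gain in the measure of the
  support.

  The truncated energy \<open>J\<close> is minimized without compact embeddings. It is submodular,
  \<open>J (max u v) + J (min u v) \<le> J u + J v\<close>, so suprema of a fast minimizing sequence are again
  minimizing, and they converge in \<open>L\<^sup>1\<close> by monotonicity. Uniform convexity of the leading part
  upgrades this to convergence in \<open>W\<close>. The minimum is negative because \<open>k < p\<close>.
\<close>

section \<open>Smooth functions\<close>

text \<open>Two features of the truncated problem carry the minimization. \<open>Phi\<close> is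
  Lipschitz for the L1 distance, so two near-minimizers that are close in L1 have almost the same
  \<open>Phi\<close> as their midpoint, and their near-minimality is spent entirely on the convexity
  defect of the leading part: closeness in L1 is all the compactness required. Moreover
  \<open>Phi\<close> and the gradient terms are additive under \<open>max\<close> and
  \<open>min\<close>, so the submodularity rests on the Gagliardo integrand alone. The price is that
  W, a closure of test functions, must be shown to contain positive parts and maxima; hence the
  smooth ramps built from a flat function. In the pointwise bound only the Gagliardo term works:
  against a positive part the gradient terms are nonnegative and are dropped. Modulars replace norms
  throughout, so that no roots are taken; elementary inequalities with a free parameter \<eta> take
  the place of the Hoelder and Minkowski inequalities.\<close>

lemma frechet_derivative_eqI:
  "(f has_derivative f') (at x) \<Longrightarrow> frechet_derivative f (at x) = f'"
  by (metis frechet_derivative_at)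

text \<open>\<open>Ck_on (Suc n)\<close> does not ask for \<open>Ck_on n\<close> of \<open>f\<close>
  itself, only of its derivatives. The lower order is recovered by induction, ultimately because
  differentiable functions are continuous.\<close>

lemma Ck_on_Suc_imp: "Ck_on (Suc n) UNIV f \<Longrightarrow> Ck_on n UNIV f"
proof (induction n arbitrary: f)
  case 0
  then show ?case
    by (auto intro!: continuous_at_imp_continuous_on differentiable_imp_continuous_within)
next
  case (Suc n)
  have "\<forall>x\<in>UNIV. f differentiable (at x)" and "\<forall>h. Ck_on (Suc n) UNIV (\<lambda>x. frechet_derivative f (at x) h)"
    using Suc.prems unfolding Ck_on.simps(2)[of "Suc n"] by blast+
  with Suc.IH show ?case by simp
qed

lemma Ck_on_const: "Ck_on n UNIV (\<lambda>x. c)"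
proof (induction n arbitrary: c)
  case (Suc n)
  then show ?case by (auto simp: frechet_derivative_eqI[OF has_derivative_const])
qed simp

lemma Ck_on_add:
  assumes "Ck_on n UNIV f" "Ck_on n UNIV g"
  shows "Ck_on n UNIV (\<lambda>x. f x + g x)"
  using assms
proof (induction n arbitrary: f g)
  case (Suc n)
  have d: "f differentiable (at x)" "g differentiable (at x)" for x
    using Suc.prems by auto
  have "frechet_derivative (\<lambda>x. f x + g x) (at x) = (\<lambda>h. frechet_derivative f (at x) h + frechet_derivative g (at x) h)" for x
    by (intro frechet_derivative_eqI has_derivative_add) (use d frechet_derivative_works in blast)+
  with Suc d show ?case by auto
qed (auto intro: continuous_intros)

lemma Ck_on_mult:
  assumes "Ck_on n UNIV f" "Ck_on n UNIV g"
  shows "Ck_on n UNIV (\<lambda>x. f x * g x)"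
  using assms
proof (induction n arbitrary: f g)
  case (Suc n)
  have d: "f differentiable (at x)" "g differentiable (at x)" for x
    using Suc.prems by auto
  have e: "frechet_derivative (\<lambda>x. f x * g x) (at x) = (\<lambda>h. f x * frechet_derivative g (at x) h + frechet_derivative f (at x) h * g x)" for x
    by (intro frechet_derivative_eqI has_derivative_mult) (use d frechet_derivative_works in blast)+
  have "Ck_on n UNIV f" "Ck_on n UNIV g"
    using Suc.prems Ck_on_Suc_imp by blast+
  then have "Ck_on n UNIV (\<lambda>x. f x * frechet_derivative g (at x) h + frechet_derivative f (at x) h * g x)" for h
    by (intro Ck_on_add Suc.IH) (use Suc.prems in auto)
  with d show ?case by (auto simp: e)
qed (auto intro: continuous_intros)

text \<open>A whole chain of derivatives \<open>T i\<close> is assumed, so that the induction on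
  \<open>n\<close> can pass from \<open>T i\<close> to \<open>T (Suc i)\<close>; higher chain rules
  are never written out.\<close>

lemma Ck_on_compose:
  assumes T: "\<And>i r. (T i has_real_derivative T (Suc i) r) (at r)" and f: "Ck_on n UNIV f"
  shows "Ck_on n UNIV (\<lambda>x. T i (f x))"
  using f
proof (induction n arbitrary: i)
  case 0
  have "continuous_on UNIV (T i)"
    using T DERIV_isCont continuous_at_imp_continuous_on by blast
  with 0 show ?case
    by (auto intro: continuous_on_compose2)
next
  case (Suc n)
  have d: "f differentiable (at x)" for x
    using Suc.prems by auto
  have hd: "((\<lambda>x. T i (f x)) has_derivative (\<lambda>h. T (Suc i) (f x) * frechet_derivative f (at x) h)) (at x)" for x
    using has_derivative_compose[OF _ T[unfolded has_field_derivative_def], of f "frechet_derivative f (at x)" x UNIV i] d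
      frechet_derivative_works by auto
  have "Ck_on n UNIV f"
    using Suc.prems Ck_on_Suc_imp by blast
  then have "Ck_on n UNIV (\<lambda>x. T (Suc i) (f x) * frechet_derivative f (at x) h)" for h
    by (intro Ck_on_mult Suc.IH) (use Suc.prems in auto)
  with hd show ?case
    by (auto simp: frechet_derivative_eqI[OF hd] differentiable_def)
qed

lemma Ck_on_inner: "Ck_on n UNIV (\<lambda>x. x \<bullet> b)"
proof (cases n)
  case (Suc m)
  have hd: "((\<lambda>x. x \<bullet> b) has_derivative (\<lambda>h. h \<bullet> b)) (at x)" for x
    by (auto intro!: derivative_eq_intros)
  then show ?thesis
    unfolding Suc by (auto simp: frechet_derivative_eqI[OF hd] differentiable_def intro: Ck_on_const)
qed (auto intro: continuous_intros)

lemma Ck_on_prod: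
  assumes "\<And>i. i \<in> I \<Longrightarrow> Ck_on n UNIV (f i)"
  shows "Ck_on n UNIV (\<lambda>x. \<Prod>i\<in>I. f i x)"
  using assms
  by (induction I rule: infinite_finite_induct) (auto intro: Ck_on_const Ck_on_mult)

subsection \<open>A flat function\<close>

text \<open>\<open>flat i\<close> is the \<open>i\<close>-th derivative of \<open>exp (- 1 / r)\<close>, extended by \<open>0\<close> to \<open>r \<le> 0\<close>.\<close>

fun flat_poly :: "nat \<Rightarrow> real poly" where
  "flat_poly 0 = 1"
| "flat_poly (Suc i) = [:0, 0, 1:] * (flat_poly i - pderiv (flat_poly i))"

definition flat :: "nat \<Rightarrow> real \<Rightarrow> real" where
  "flat i r = (if r \<le> 0 then 0 else poly (flat_poly i) (1 / r) * exp (- (1 / r)))"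

lemma poly_exp_neg_tendsto_0: "((\<lambda>x::real. poly P x * exp (- x)) \<longlongrightarrow> 0) at_top"
proof -
  have "((\<lambda>x::real. \<Sum>i\<le>degree P. coeff P i * (x ^ i / exp x)) \<longlongrightarrow> (\<Sum>i\<le>degree P. coeff P i * 0)) at_top"
    by (intro tendsto_intros tendsto_power_div_exp_0)
  then show ?thesis
    by (simp add: poly_altdef exp_minus field_simps sum_distrib_left sum_divide_distrib)
qed

text \<open>Only \<open>r = 0\<close> is delicate. From the right the difference quotient is a
  polynomial in \<open>1 / r\<close> times \<open>exp (- (1 / r))\<close>, and the exponential
  wins.\<close>

lemma flat_has_derivative: "(flat i has_real_derivative flat (Suc i) r) (at r)"
proof -
  consider "r < 0" | "r = 0" | "r > 0" by linarith
  then show ?thesis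
  proof cases
    case 1
    have "((\<lambda>_. 0) has_real_derivative 0) (at r)" by simp
    moreover have "eventually (\<lambda>x. x < 0) (nhds r)"
      using 1 by (intro eventually_nhds_in_open[of "{..<0}", simplified]) auto
    then have "eventually (\<lambda>x. flat i x = 0) (nhds r)"
      by eventually_elim (auto simp: flat_def)
    ultimately show ?thesis
      using 1 by (subst DERIV_cong_ev[OF refl _ refl]) (auto simp: flat_def)
  next
    case 3
    \<comment> \<open>Differentiating \<open>P(1/x) exp(-1/x)\<close> produces the factor
      \<open>1/x^2\<close> and the difference \<open>P - P'\<close>, which is the recursion of
      \<open>flat_poly\<close>.\<close>
    have "((\<lambda>x. poly (flat_poly i) (1 / x) * exp (- (1 / x))) has_real_derivative flat (Suc i) r) (at r)"
      using 3
      by (auto intro!: derivative_eq_intros DERIV_chain2[OF poly_DERIV] simp: flat_def field_simps power2_eq_square)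
    moreover have "eventually (\<lambda>x. x > 0) (nhds r)"
      using 3 by (intro eventually_nhds_in_open[of "{0<..}", simplified]) auto
    then have "eventually (\<lambda>x. flat i x = poly (flat_poly i) (1 / x) * exp (- (1 / x))) (nhds r)"
      by eventually_elim (auto simp: flat_def)
    ultimately show ?thesis
      by (subst DERIV_cong_ev[OF refl _ refl]) auto
  next
    case 2
    have "((\<lambda>h. flat i h / h) \<longlongrightarrow> 0) (at_right 0)"
    proof -
      \<comment> \<open>With \<open>x = 1 / h\<close>, the factor \<open>[:0,1:]\<close> accounts
        for the division by \<open>h\<close>.\<close>
      have "((\<lambda>x. poly ([:0,1:] * flat_poly i) x * exp (-x)) \<longlongrightarrow> 0) at_top"
        by (rule poly_exp_neg_tendsto_0)
      then have "((\<lambda>h::real. poly ([:0,1:] * flat_poly i) (inverse h) * exp (- inverse h)) \<longlongrightarrow> 0) (at_right 0)"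
        using filterlim_compose filterlim_inverse_at_top_right by blast
      then show ?thesis
        by (rule Lim_transform_eventually)
          (auto simp: eventually_at_filter flat_def field_simps)
    qed
    moreover have "((\<lambda>h. flat i h / h) \<longlongrightarrow> 0) (at_left 0)"
      by (rule Lim_transform_eventually[OF tendsto_const])
        (auto simp: eventually_at_filter flat_def)
    ultimately have "((\<lambda>h. flat i h / h) \<longlongrightarrow> 0) (at 0)"
      by (simp add: filterlim_split_at)
    then show ?thesis
      unfolding 2 DERIV_def by (simp add: flat_def)
  qed
qed

lemma Ck_on_flat: "Ck_on n UNIV f \<Longrightarrow> Ck_on n UNIV (\<lambda>x. flat i (f x))"
  by (rule Ck_on_compose[of flat, OF flat_has_derivative])

lemma flat0: "flat 0 r = (if r \<le> 0 then 0 else exp (- (1 / r)))"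
  by (simp add: flat_def)

lemma flat1: "flat 1 r = (if r \<le> 0 then 0 else exp (- (1 / r)) / r\<^sup>2)"
  by (simp add: flat_def power2_eq_square)

lemma flat0_nonneg: "0 \<le> flat 0 r" and flat0_le_1: "flat 0 r \<le> 1"
  by (auto simp: flat0)

lemma flat0_tendsto:
  assumes "r > 0"
  shows "(\<lambda>j. flat 0 (real j * r)) \<longlonglongrightarrow> 1"
proof -
  have "(\<lambda>j. exp (- (inverse r * inverse (real j)))) \<longlonglongrightarrow> exp (- (inverse r * 0))"
    by (intro tendsto_intros lim_inverse_n)
  then have "(\<lambda>j. exp (- (inverse r * inverse (real j)))) \<longlonglongrightarrow> 1" by simp
  moreover have "eventually (\<lambda>j. exp (- (inverse r * inverse (real j))) = flat 0 (real j * r)) sequentially"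
    using eventually_gt_at_top[of 0]
    by eventually_elim (use assms in \<open>auto simp: flat0 field_simps mult_le_0_iff\<close>)
  ultimately show ?thesis by (rule Lim_transform_eventually)
qed

lemma flat0_tendsto_indicator:
  "(\<lambda>j. flat 0 (real j * r)) \<longlonglongrightarrow> (if r > 0 then 1 else 0)"
  using flat0_tendsto[of r] by (auto simp: flat0 mult_le_0_iff not_less)

subsection \<open>Test functions\<close>

text \<open>A product over the coordinates, so that smoothness and convergence reduce to one real
  variable. Growing \<open>j\<close> sharpens the bump towards the indicator of the open
  box.\<close>

definition box_bump :: "'a::euclidean_space \<Rightarrow> 'a \<Rightarrow> nat \<Rightarrow> 'a \<Rightarrow> real" where
  "box_bump c d j x = (\<Prod>b\<in>Basis. flat 0 (real j * (x \<bullet> b - c \<bullet> b)) * flat 0 (real j * (d \<bullet> b - x \<bullet> b)))"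

lemma Cc_infI:
  assumes "\<And>n. Ck_on n UNIV f" "\<And>x. f x \<noteq> 0 \<Longrightarrow> x \<in> K" "compact K" "K \<subseteq> \<Omega>"
  shows "f \<in> Cc_inf \<Omega>"
proof -
  have c: "closure {x. f x \<noteq> 0} \<subseteq> K"
    using assms(2,3) by (intro closure_minimal) (auto intro: compact_imp_closed)
  moreover have "compact (closure {x. f x \<noteq> 0})"
    using assms(3) c by (metis closed_closure compact_Int_closed inf.absorb_iff2)
  ultimately show ?thesis
    using assms(1,4) by (auto simp: Cc_inf_def Cinf_on_def)
qed

lemma box_bump_in_Cc_inf:
  assumes "cbox c d \<subseteq> \<Omega>"
  shows "box_bump c d j \<in> Cc_inf \<Omega>"
proof (rule Cc_infI[OF _ _ compact_cbox assms])
  fix n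
  have 1: "Ck_on n UNIV (\<lambda>x::'a. real j * (x \<bullet> b - c \<bullet> b))" for b
    using Ck_on_mult[OF Ck_on_const[where c="real j"] Ck_on_add[OF Ck_on_inner[of n b] Ck_on_const[where c="- (c \<bullet> b)"]]]
    by simp
  have 2: "Ck_on n UNIV (\<lambda>x::'a. real j * (d \<bullet> b - x \<bullet> b))" for b
    using Ck_on_mult[OF Ck_on_const[where c="real j"] Ck_on_add[OF Ck_on_const[where c="(d \<bullet> b)"] Ck_on_inner[of n "-b"]]]
    by simp
  show "Ck_on n UNIV (box_bump c d j)"
    unfolding box_bump_def by (intro Ck_on_prod Ck_on_mult Ck_on_flat 1 2)
next
  fix x assume *: "box_bump c d j x \<noteq> 0"
  show "x \<in> cbox c d"
    unfolding mem_box
  proof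
    fix i :: 'a assume "i \<in> Basis"
    then have "flat 0 (real j * (x \<bullet> i - c \<bullet> i)) * flat 0 (real j * (d \<bullet> i - x \<bullet> i)) \<noteq> 0"
      using * by (auto simp: box_bump_def)
    then show "c \<bullet> i \<le> x \<bullet> i \<and> x \<bullet> i \<le> d \<bullet> i"
      by (auto simp: flat0 mult_le_0_iff split: if_splits)
  qed
qed

lemma box_bump_tendsto: "(\<lambda>j. box_bump c d j x) \<longlonglongrightarrow> indicator (box c d) x"
proof -
  have "(\<lambda>j. box_bump c d j x) \<longlonglongrightarrow> (\<Prod>b\<in>Basis. (if x \<bullet> b - c \<bullet> b > 0 then 1 else 0) * (if d \<bullet> b - x \<bullet> b > 0 then 1 else 0))"
    unfolding box_bump_def by (intro tendsto_intros flat0_tendsto_indicator)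
  also have "(\<Prod>b\<in>Basis. (if x \<bullet> b - c \<bullet> b > 0 then 1 else 0) * (if d \<bullet> b - x \<bullet> b > 0 then 1 else (0::real))) = indicator (box c d) x"
    by (auto simp: indicator_def mem_box intro!: prod.neutral)
  finally show ?thesis .
qed

lemma box_bump_bounds: "0 \<le> box_bump c d j x" "box_bump c d j x \<le> 1"
  unfolding box_bump_def
  by (auto intro!: prod_nonneg prod_le_1 mult_nonneg_nonneg mult_le_one flat0_nonneg flat0_le_1)

section \<open>Gradients of test functions\<close>

definition grad :: "('a::euclidean_space \<Rightarrow> real) \<Rightarrow> 'a \<Rightarrow> 'a" where
  "grad f x = (\<Sum>b\<in>Basis. frechet_derivative f (at x) b *\<^sub>R b)"

lemma grad_inner:
  assumes "f differentiable (at x)"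
  shows "grad f x \<bullet> h = frechet_derivative f (at x) h"
proof -
  have lin: "linear (frechet_derivative f (at x))"
    using assms linear_frechet_derivative by blast
  have "frechet_derivative f (at x) h = frechet_derivative f (at x) (\<Sum>b\<in>Basis. (h \<bullet> b) *\<^sub>R b)"
    by (simp add: euclidean_representation)
  also have "\<dots> = (\<Sum>b\<in>Basis. (h \<bullet> b) * frechet_derivative f (at x) b)"
    using lin by (simp add: linear_sum linear_cmul)
  finally show ?thesis
    by (simp add: grad_def inner_sum_right inner_commute[of _ h] mult.commute)
qed

lemma grad_eqI:
  assumes "\<And>h. frechet_derivative f (at x) h = g \<bullet> h"
  shows "grad f x = g"
  unfolding grad_def assms by (simp add: euclidean_representation)

lemma Cc_inf_CkD: "f \<in> Cc_inf \<Omega> \<Longrightarrow> Ck_on n UNIV f"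
  by (auto simp: Cc_inf_def Cinf_on_def)

lemma Cc_inf_differentiable: "f \<in> Cc_inf \<Omega> \<Longrightarrow> f differentiable (at x)"
  using Cc_inf_CkD[of f \<Omega> 1] by simp

lemma Cc_inf_derivative_continuous:
  "f \<in> Cc_inf \<Omega> \<Longrightarrow> continuous_on UNIV (\<lambda>x. frechet_derivative f (at x) h)"
  using Cc_inf_CkD[of f \<Omega> 1] by simp

lemma Cc_inf_continuous: "f \<in> Cc_inf \<Omega> \<Longrightarrow> continuous_on UNIV f"
  using Cc_inf_CkD[of f \<Omega> 0] by simp

lemma grad_continuous: "f \<in> Cc_inf \<Omega> \<Longrightarrow> continuous_on UNIV (grad f)"
  unfolding grad_def[abs_def] by (intro continuous_intros Cc_inf_derivative_continuous)

lemma Cc_inf_supportE: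
  assumes "f \<in> Cc_inf \<Omega>"
  obtains K where "compact K" "K \<subseteq> \<Omega>" "\<forall>x. x \<notin> K \<longrightarrow> f x = 0" "\<forall>x. x \<notin> K \<longrightarrow> grad f x = 0"
    "\<forall>x h. x \<notin> K \<longrightarrow> frechet_derivative f (at x) h = 0"
proof
  let ?K = "closure {x. f x \<noteq> 0}"
  show "compact ?K" "?K \<subseteq> \<Omega>"
    using assms by (auto simp: Cc_inf_def)
  show 0: "\<forall>x. x \<notin> ?K \<longrightarrow> f x = 0"
    using closure_subset[of "{x. f x \<noteq> 0}"] by auto
  have d: "frechet_derivative f (at x) h = 0" if "x \<notin> ?K" for x h
  proof -
    have "open (- ?K)" "x \<in> - ?K"
      using that by auto
    moreover have "0 = f y" if "y \<in> - ?K" for y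
      using 0[rule_format, of y] that by simp
    ultimately have "(f has_derivative (\<lambda>h. 0)) (at x)"
      using has_derivative_transform_within_open[OF has_derivative_const] by blast
    from frechet_derivative_eqI[OF this] show ?thesis by simp
  qed
  then show "\<forall>x h. x \<notin> ?K \<longrightarrow> frechet_derivative f (at x) h = 0" by blast
  show "\<forall>x. x \<notin> ?K \<longrightarrow> grad f x = 0"
    by (simp add: grad_def d)
qed

lemma compact_support_bounded:
  fixes f :: "'a::euclidean_space \<Rightarrow> 'b::euclidean_space"
  assumes "compact K" "continuous_on UNIV f" "\<And>x. x \<notin> K \<Longrightarrow> f x = 0"
  obtains B where "B > 0" "\<forall>x. norm (f x) \<le> B"
proof -
  have "compact (f ` K)"
    using assms by (meson compact_continuous_image continuous_on_subset subset_UNIV)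
  then have "bounded (f ` K)"
    by (rule compact_imp_bounded)
  then obtain B where B: "B > 0" "\<And>x. x \<in> K \<Longrightarrow> norm (f x) \<le> B"
    unfolding bounded_pos by blast
  have "norm (f x) \<le> B" for x
    using B assms(3)[of x] by (cases "x \<in> K") auto
  with that B(1) show ?thesis by blast
qed

lemma compact_support_integrable:
  fixes f :: "'a::euclidean_space \<Rightarrow> 'b::euclidean_space"
  assumes "compact K" "continuous_on UNIV f" "\<And>x. x \<notin> K \<Longrightarrow> f x = 0"
  shows "integrable lborel f" "integrable lebesgue f"
proof -
  have "integrable lborel (\<lambda>x. indicator K x *\<^sub>R f x)"
    using assms by (intro borel_integrable_compact) (auto intro: continuous_on_subset)
  also have "(\<lambda>x. indicator K x *\<^sub>R f x) = f"
    using assms(3) by (auto simp: indicator_def)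
  finally show *: "integrable lborel f" .
  have "f \<in> borel_measurable lborel"
    using assms(2) borel_measurable_continuous_onI by simp
  with * show "integrable lebesgue f"
    by (simp add: integrable_completion)
qed

lemma Cc_inf_lipschitz:
  assumes "f \<in> Cc_inf \<Omega>"
  obtains L where "L > 0" "\<forall>x y. \<bar>f x - f y\<bar> \<le> L * norm (x - y)" "\<forall>x. norm (grad f x) \<le> L"
proof -
  obtain K where K: "compact K" "K \<subseteq> \<Omega>" "\<forall>x. x \<notin> K \<longrightarrow> f x = 0" "\<forall>x. x \<notin> K \<longrightarrow> grad f x = 0"
     "\<forall>x h. x \<notin> K \<longrightarrow> frechet_derivative f (at x) h = 0"
    by (rule Cc_inf_supportE[OF assms])
  obtain L where L: "L > 0" "\<forall>x. norm (grad f x) \<le> L"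
    by (rule compact_support_bounded[OF K(1) grad_continuous[OF assms] K(4)[rule_format]])
  have "norm (f x - f y) \<le> L * norm (x - y)" for x y
  proof (rule differentiable_bound[of UNIV f "\<lambda>x. frechet_derivative f (at x)"])
    show "(f has_derivative frechet_derivative f (at x)) (at x within UNIV)" for x
      using Cc_inf_differentiable[OF assms] frechet_derivative_works by auto
    show "onorm (frechet_derivative f (at x)) \<le> L" for x
    proof (rule onorm_bound)
      fix h
      have "norm (frechet_derivative f (at x) h) \<le> norm (grad f x) * norm h"
        using Cauchy_Schwarz_ineq2[of "grad f x" h] grad_inner[OF Cc_inf_differentiable[OF assms], of x h] by simp
      also have "\<dots> \<le> L * norm h"
        using L by (intro mult_right_mono) auto
      finally show "norm (frechet_derivative f (at x) h) \<le> L * norm h" .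
    qed (use L in auto)
  qed auto
  with that L show ?thesis by auto
qed

lemma Cc_inf_mult:
  assumes "f \<in> Cc_inf \<Omega>" "g \<in> Cc_inf \<Omega>'"
  shows "(\<lambda>x. f x * g x) \<in> Cc_inf \<Omega>"
proof -
  obtain K where K: "compact K" "K \<subseteq> \<Omega>" "\<forall>x. x \<notin> K \<longrightarrow> f x = 0" "\<forall>x. x \<notin> K \<longrightarrow> grad f x = 0"
     "\<forall>x h. x \<notin> K \<longrightarrow> frechet_derivative f (at x) h = 0"
    by (rule Cc_inf_supportE[OF assms(1)])
  with K show ?thesis
    by (intro Cc_infI[of _ K] Ck_on_mult Cc_inf_CkD[OF assms(1)] Cc_inf_CkD[OF assms(2)]) auto
qed

lemma Cc_inf_add:
  assumes "f \<in> Cc_inf \<Omega>" "g \<in> Cc_inf \<Omega>"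
  shows "(\<lambda>x. f x + g x) \<in> Cc_inf \<Omega>"
proof -
  obtain K where K: "compact K" "K \<subseteq> \<Omega>" "\<forall>x. x \<notin> K \<longrightarrow> f x = 0" "\<forall>x. x \<notin> K \<longrightarrow> grad f x = 0"
     "\<forall>x h. x \<notin> K \<longrightarrow> frechet_derivative f (at x) h = 0"
    by (rule Cc_inf_supportE[OF assms(1)])
  obtain K' where K': "compact K'" "K' \<subseteq> \<Omega>" "\<forall>x. x \<notin> K' \<longrightarrow> g x = 0" "\<forall>x. x \<notin> K' \<longrightarrow> grad g x = 0"
     "\<forall>x h. x \<notin> K' \<longrightarrow> frechet_derivative g (at x) h = 0"
    by (rule Cc_inf_supportE[OF assms(2)])
  have "x \<in> K \<union> K'" if "f x + g x \<noteq> 0" for x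
    using that K(3)[rule_format, of x] K'(3)[rule_format, of x] by (cases "x \<in> K"; cases "x \<in> K'") auto
  then show ?thesis
    using K K' by (intro Cc_infI[of _ "K \<union> K'"] Ck_on_add Cc_inf_CkD[OF assms(1)] Cc_inf_CkD[OF assms(2)]) auto
qed

lemma Cc_inf_cmult:
  assumes "f \<in> Cc_inf \<Omega>"
  shows "(\<lambda>x. c * f x) \<in> Cc_inf \<Omega>"
proof -
  obtain K where K: "compact K" "K \<subseteq> \<Omega>" "\<forall>x. x \<notin> K \<longrightarrow> f x = 0" "\<forall>x. x \<notin> K \<longrightarrow> grad f x = 0"
     "\<forall>x h. x \<notin> K \<longrightarrow> frechet_derivative f (at x) h = 0"
    by (rule Cc_inf_supportE[OF assms(1)])
  with K show ?thesis
    by (intro Cc_infI[of _ K] Ck_on_mult Cc_inf_CkD[OF assms(1)] Ck_on_const) auto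
qed

lemma grad_add:
  assumes "f \<in> Cc_inf \<Omega>" "g \<in> Cc_inf \<Omega>"
  shows "grad (\<lambda>x. f x + g x) x = grad f x + grad g x"
proof (rule grad_eqI)
  fix h
  have "frechet_derivative (\<lambda>x. f x + g x) (at x) = (\<lambda>h. frechet_derivative f (at x) h + frechet_derivative g (at x) h)"
    by (intro frechet_derivative_eqI has_derivative_add)
      (use assms Cc_inf_differentiable frechet_derivative_works in blast)+
  then show "frechet_derivative (\<lambda>x. f x + g x) (at x) h = (grad f x + grad g x) \<bullet> h"
    using assms by (simp add: inner_add_left grad_inner Cc_inf_differentiable)
qed

lemma grad_cmult:
  assumes "f \<in> Cc_inf \<Omega>"
  shows "grad (\<lambda>x. c * f x) x = c *\<^sub>R grad f x"
proof (rule grad_eqI)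
  fix h
  have "frechet_derivative (\<lambda>x. c * f x) (at x) = (\<lambda>h. c * frechet_derivative f (at x) h)"
    by (intro frechet_derivative_eqI has_derivative_mult_right)
      (use assms Cc_inf_differentiable frechet_derivative_works in blast)+
  then show "frechet_derivative (\<lambda>x. c * f x) (at x) h = (c *\<^sub>R grad f x) \<bullet> h"
    using assms by (simp add: grad_inner Cc_inf_differentiable)
qed

lemma grad_compose:
  assumes "f \<in> Cc_inf \<Omega>" "(T has_real_derivative T') (at (f x))"
  shows "grad (\<lambda>x. T (f x)) x = T' *\<^sub>R grad f x"
proof (rule grad_eqI)
  fix h
  have "(f has_derivative frechet_derivative f (at x)) (at x)"
    using assms(1) Cc_inf_differentiable frechet_derivative_works by blast
  from has_derivative_compose[OF this assms(2)[unfolded has_field_derivative_def]]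
  have "frechet_derivative (\<lambda>x. T (f x)) (at x) = (\<lambda>h. T' * frechet_derivative f (at x) h)"
    by (rule frechet_derivative_eqI)
  then show "frechet_derivative (\<lambda>x. T (f x)) (at x) h = (T' *\<^sub>R grad f x) \<bullet> h"
    using assms by (simp add: grad_inner Cc_inf_differentiable)
qed

text \<open>Lebesgue measure is translation invariant, so every difference quotient of
  \<open>F\<close> has integral 0. The quotients are uniformly bounded and supported in one ball, so
  dominated convergence passes to the derivative.\<close>

lemma integral_derivative_Cc_inf:
  fixes F :: "'a::euclidean_space \<Rightarrow> real"
  assumes F: "F \<in> Cc_inf \<Omega>"
  shows "(LINT x|lebesgue. frechet_derivative F (at x) b) = 0"
proof -
  obtain K where K: "compact K" "K \<subseteq> \<Omega>" "\<forall>x. x \<notin> K \<longrightarrow> F x = 0" "\<forall>x. x \<notin> K \<longrightarrow> grad F x = 0"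
     "\<forall>x h. x \<notin> K \<longrightarrow> frechet_derivative F (at x) h = 0"
    by (rule Cc_inf_supportE[OF F])
  obtain L where L: "L > 0" "\<forall>x y. \<bar>F x - F y\<bar> \<le> L * norm (x - y)" "\<forall>x. norm (grad F x) \<le> L"
    by (rule Cc_inf_lipschitz[OF F])
  obtain R where R: "\<And>x. x \<in> K \<Longrightarrow> norm x \<le> R"
    using compact_imp_bounded[OF K(1)] unfolding bounded_iff by blast
  let ?g = "\<lambda>n x. (F (inverse (real (Suc n)) *\<^sub>R b + x) - F x) / inverse (real (Suc n))"
  have cF: "continuous_on UNIV F" using F Cc_inf_continuous by blast
  then have mF[measurable]: "F \<in> borel_measurable borel"
    using borel_measurable_continuous_onI by blast
  have mD: "(\<lambda>x. frechet_derivative F (at x) b) \<in> borel_measurable borel"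
    using Cc_inf_derivative_continuous[OF F] borel_measurable_continuous_onI by blast
  have int: "integrable lborel F"
    using compact_support_integrable(1)[OF K(1) cF  K(3)[rule_format]] .
  have shift: "integrable lborel (\<lambda>x. F (c + x))" "(LINT x|lborel. F (c + x)) = (LINT x|lborel. F x)" for c
  proof -
    have "integrable (distr lborel borel ((+) c)) F" "(LINT x|distr lborel borel ((+) c). F x) = (LINT x|lborel. F x)"
      using int by (simp_all add: lborel_distr_plus)
    then show "integrable lborel (\<lambda>x. F (c + x))" "(LINT x|lborel. F (c + x)) = (LINT x|lborel. F x)"
      by (simp_all add: integrable_distr_eq integral_distr)
  qed
  have zero: "(LINT x|lborel. ?g n x) = 0" for n
    using shift[of "inverse (real (Suc n)) *\<^sub>R b"] int
    by (simp del: of_nat_Suc)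
  have lim: "(\<lambda>n. ?g n x) \<longlonglongrightarrow> frechet_derivative F (at x) b" for x
  proof -
    have "(F has_derivative frechet_derivative F (at x)) (at x)"
      using F Cc_inf_differentiable frechet_derivative_works by blast
    moreover have "((\<lambda>t. t *\<^sub>R b + x) has_derivative (\<lambda>t. t *\<^sub>R b)) (at 0)"
      by (auto intro!: derivative_eq_intros)
    ultimately have "((\<lambda>t. F (t *\<^sub>R b + x)) has_derivative (\<lambda>t. frechet_derivative F (at x) (t *\<^sub>R b))) (at 0)"
      using has_derivative_compose[of "\<lambda>t. t *\<^sub>R b + x" _ 0 UNIV F] by auto
    then have "((\<lambda>t. F (t *\<^sub>R b + x)) has_derivative (\<lambda>t. frechet_derivative F (at x) b * t)) (at 0)"
      using linear_frechet_derivative[OF Cc_inf_differentiable[OF F]] by (simp add: linear_cmul mult.commute)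
    then have "((\<lambda>t. F (t *\<^sub>R b + x)) has_real_derivative frechet_derivative F (at x) b) (at 0)"
      by (simp add: has_field_derivative_def)
    then have "((\<lambda>h. (F (h *\<^sub>R b + x) - F x) / h) \<longlongrightarrow> frechet_derivative F (at x) b) (at 0)"
      by (simp add: DERIV_def)
    moreover have "filterlim (\<lambda>n. inverse (real (Suc n))) (at 0) sequentially"
      unfolding filterlim_at using LIMSEQ_inverse_real_of_nat by (auto simp del: of_nat_Suc)
    ultimately show ?thesis
      using filterlim_compose by blast
  qed
  \<comment> \<open>The shifts have length at most \<open>norm b\<close>, so all quotients vanish
    outside this ball; \<open>L * norm b\<close> is the Lipschitz bound for them.\<close>
  let ?w = "\<lambda>x::'a. L * norm b * indicator (cball 0 (R + norm b)) x"
  have "(\<lambda>n. LINT x|lborel. ?g n x) \<longlonglongrightarrow> (LINT x|lborel. frechet_derivative F (at x) b)"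
  proof (rule integral_dominated_convergence[where w="?w"])
    show "(\<lambda>x. frechet_derivative F (at x) b) \<in> borel_measurable lborel" using mD by simp
    show "?g n \<in> borel_measurable lborel" for n by measurable
    have "emeasure lborel (cball (0::'a) (R + norm b)) < \<infinity>"
      using emeasure_bounded_finite bounded_cball by blast
    then show "integrable lborel ?w"
      by (intro integrable_mult_right integrable_real_indicator) auto
    show "AE x in lborel. norm (?g n x) \<le> ?w x" for n
    proof (rule AE_I2)
      fix x
      let ?h = "inverse (real (Suc n))"
      have h: "0 < ?h" "?h \<le> 1" by (auto simp: field_simps)
      show "norm (?g n x) \<le> ?w x"
      proof (cases "norm x \<le> R + norm b")
        case True
        have "\<bar>F (?h *\<^sub>R b + x) - F x\<bar> \<le> L * (?h * norm b)"
          using L(2)[rule_format, of "?h *\<^sub>R b + x" x] by simp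
        then show ?thesis
          using True h by (simp add: abs_divide divide_le_eq mult_ac del: of_nat_Suc inverse_eq_divide)
      next
        case False
        have "norm (?h *\<^sub>R b) \<le> norm b"
          using h mult_right_mono[of ?h 1 "norm b"] by (simp del: of_nat_Suc)
        moreover have "norm x \<le> norm (?h *\<^sub>R b + x) + norm (?h *\<^sub>R b)"
          by (metis add_diff_cancel_left' norm_triangle_ineq4 add.commute)
        ultimately have "norm (?h *\<^sub>R b + x) > R" "norm x > R"
          using False norm_ge_zero[of b] by linarith+
        then have "F (?h *\<^sub>R b + x) = 0" "F x = 0"
          using R K(3) by force+
        then show ?thesis using False by simp
      qed
    qed
  qed (use lim in auto)
  then have "(LINT x|lborel. frechet_derivative F (at x) b) = 0"
    unfolding zero by (simp add: LIMSEQ_const_iff)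
  then show ?thesis
    using mD by (simp add: integral_completion)
qed

section \<open>Weak gradients\<close>

text \<open>Integration by parts: the product \<open>f x * \<phi> x\<close> is again a test
  function, so its derivative has integral 0.\<close>

lemma has_weak_gradient_grad:
  fixes f :: "'a::euclidean_space \<Rightarrow> real"
  assumes f: "f \<in> Cc_inf \<Omega>"
  shows "has_weak_gradient f (grad f)"
  unfolding has_weak_gradient_def
proof (intro conjI allI impI ballI)
  obtain K where K: "compact K" "K \<subseteq> \<Omega>" "\<forall>x. x \<notin> K \<longrightarrow> f x = 0" "\<forall>x. x \<notin> K \<longrightarrow> grad f x = 0"
     "\<forall>x h. x \<notin> K \<longrightarrow> frechet_derivative f (at x) h = 0"
    by (rule Cc_inf_supportE[OF f])
  fix C :: "'a set" assume C: "compact C"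
  then have [measurable]: "C \<in> sets lebesgue" by (simp add: borel_compact)
  have "integrable lebesgue f" "integrable lebesgue (grad f)"
    by (auto intro!: compact_support_integrable(2)[OF K(1)] Cc_inf_continuous[OF f] grad_continuous[OF f] simp: K)
  then show "f absolutely_integrable_on C" "grad f absolutely_integrable_on C"
    unfolding set_integrable_def
    using integrable_mult_indicator[of C lebesgue f] integrable_mult_indicator[of C lebesgue "grad f"] by auto
next
  obtain K where K: "compact K" "K \<subseteq> \<Omega>" "\<forall>x. x \<notin> K \<longrightarrow> f x = 0" "\<forall>x. x \<notin> K \<longrightarrow> grad f x = 0"
     "\<forall>x h. x \<notin> K \<longrightarrow> frechet_derivative f (at x) h = 0"
    by (rule Cc_inf_supportE[OF f])
  fix \<phi> :: "'a \<Rightarrow> real" and b :: 'a assume \<phi>: "\<phi> \<in> Cc_inf UNIV" and b: "b \<in> Basis"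
  have "frechet_derivative (\<lambda>x. f x * \<phi> x) (at x) = (\<lambda>h. f x * frechet_derivative \<phi> (at x) h + frechet_derivative f (at x) h * \<phi> x)" for x
    by (intro frechet_derivative_eqI has_derivative_mult) 
      (use f \<phi> Cc_inf_differentiable frechet_derivative_works in blast)+
  then have "0 = (LINT x|lebesgue. f x * frechet_derivative \<phi> (at x) b + frechet_derivative f (at x) b * \<phi> x)"
    using integral_derivative_Cc_inf[OF Cc_inf_mult[OF f \<phi>], of b] by simp
  also have "\<dots> = (LINT x|lebesgue. f x * frechet_derivative \<phi> (at x) b) + (LINT x|lebesgue. frechet_derivative f (at x) b * \<phi> x)"
    by (intro Bochner_Integration.integral_add compact_support_integrable(2)[OF K(1)])
      (auto intro!: continuous_intros Cc_inf_continuous[OF f] Cc_inf_continuous[OF \<phi>]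
        Cc_inf_derivative_continuous[OF f] Cc_inf_derivative_continuous[OF \<phi>] simp: K)
  finally show "(LINT x|lebesgue. f x * frechet_derivative \<phi> (at x) b) = - (LINT x|lebesgue. (grad f x \<bullet> b) * \<phi> x)"
    using Cc_inf_differentiable[OF f] by (simp add: grad_inner)
qed

text \<open>The positive and the negative part of \<open>g\<close> define measures that agree on
  boxes. Boxes are stable under intersection and generate the Borel sets, so the measures agree and
  hence so do their densities. Large boxes \<open>?Q\<close> come first because the uniqueness of
  densities needs finite integrals.\<close>

lemma integral_box_zero_imp_AE_zero:
  fixes g :: "'a::euclidean_space \<Rightarrow> real"
  assumes g[measurable]: "g \<in> borel_measurable borel"
    and int: "\<And>c d. integrable lborel (\<lambda>x. indicator (box c d) x * g x)"
    and zero: "\<And>c d. (LINT x|lborel. indicator (box c d) x * g x) = 0"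
  shows "AE x in lborel. g x = 0"
proof -
  have "AE x in lborel. x \<in> box (- (real n *\<^sub>R One)) (real n *\<^sub>R One) \<longrightarrow> g x = 0" for n
  proof -
    let ?Q = "box (- (real n *\<^sub>R One)) (real n *\<^sub>R One :: 'a)"
    let ?f = "\<lambda>x. indicator ?Q x * g x"
    have i: "integrable lborel ?f" by (rule int)
    have fin: "(\<integral>\<^sup>+x. ennreal (?f x) \<partial>lborel) \<noteq> \<infinity>"
      "(\<integral>\<^sup>+x. ennreal (- ?f x) \<partial>lborel) \<noteq> \<infinity>"
      using i unfolding real_integrable_def by auto
    \<comment> \<open>\<open>ennreal\<close> sends negative numbers to 0, so these are the densities
      of the positive and the negative part.\<close>
    have "density lborel (\<lambda>x. ennreal (?f x)) = density lborel (\<lambda>x. ennreal (- ?f x))"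
    proof (rule measure_eqI_generator_eq[where E="range (\<lambda>(a,b). box a b)" and \<Omega>=UNIV and A="\<lambda>n. box (- (real n *\<^sub>R One)) (real n *\<^sub>R One)"])
      show "Int_stable (range (\<lambda>(a, b::'a). box a b))"
        by (auto simp: Int_stable_def box_Int_box)
      show "emeasure (density lborel (\<lambda>x. ennreal (?f x))) X = emeasure (density lborel (\<lambda>x. ennreal (- ?f x))) X"
        if X: "X \<in> range (\<lambda>(a, b::'a). box a b)" for X
      proof -
        obtain a b where X: "X = box a b" using X by auto
        obtain c d where cd: "?Q \<inter> box a b = box c d"
          unfolding box_Int_box by blast
        let ?h = "\<lambda>x. indicator (box c d) x * g x"
        have ih: "integrable lborel ?h" by (rule int)
        have eq: "ennreal (?f x) * indicator X x = ennreal (?h x)" "ennreal (- ?f x) * indicator X x = ennreal (- ?h x)" for x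
          using cd X by (auto simp: indicator_def split: if_splits)
        have "(\<integral>\<^sup>+x. ennreal (?h x) \<partial>lborel) = (\<integral>\<^sup>+x. ennreal (- ?h x) \<partial>lborel)"
        proof -
          have nf: "(\<integral>\<^sup>+x. ennreal (?h x) \<partial>lborel) \<noteq> \<infinity>" "(\<integral>\<^sup>+x. ennreal (- ?h x) \<partial>lborel) \<noteq> \<infinity>"
            using ih unfolding real_integrable_def by auto
          have "enn2real (\<integral>\<^sup>+x. ennreal (?h x) \<partial>lborel) = enn2real (\<integral>\<^sup>+x. ennreal (- ?h x) \<partial>lborel)"
            using real_lebesgue_integral_def[OF ih] zero[of c d] by simp
          moreover have "a = b" if "enn2real a = enn2real b" "a \<noteq> \<infinity>" "b \<noteq> \<infinity>" for a b
            using that by (cases a; cases b) auto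
          ultimately show ?thesis using nf by blast
        qed
        then show ?thesis
          by (simp add: emeasure_density X eq[unfolded X])
      qed
      show "range (\<lambda>n. box (- (real n *\<^sub>R One)) (real n *\<^sub>R One)) \<subseteq> range (\<lambda>(a, b::'a). box a b)"
        by auto
      show "(\<Union>n. box (- (real n *\<^sub>R One)) (real n *\<^sub>R One)) = (UNIV::'a set)"
        by (rule UN_box_eq_UNIV)
      show "emeasure (density lborel (\<lambda>x. ennreal (?f x))) (box (- (real m *\<^sub>R One)) (real m *\<^sub>R One)) \<noteq> \<infinity>" for m
      proof -
        have "emeasure (density lborel (\<lambda>x. ennreal (?f x))) (box (- (real m *\<^sub>R One)) (real m *\<^sub>R One)) \<le> (\<integral>\<^sup>+x. ennreal (?f x) \<partial>lborel)"
          by (simp add: emeasure_density) (auto intro!: nn_integral_mono simp: indicator_def)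
        then show ?thesis using fin(1) by (auto simp: top_unique)
      qed
    qed (auto simp: borel_eq_box)
    then have "AE x in lborel. ennreal (?f x) = ennreal (- ?f x)"
      by (subst (asm) finite_density_unique) (use fin in auto)
    then show ?thesis
    proof eventually_elim
      case (elim x)
      then show ?case
        by (cases "g x \<ge> 0") (auto simp: ennreal_eq_0_iff ennreal_neg split: split_indicator_asm)
    qed
  qed
  then have "AE x in lborel. \<forall>n. x \<in> box (- (real n *\<^sub>R One)) (real n *\<^sub>R One) \<longrightarrow> g x = 0"
    unfolding AE_all_countable by blast
  then show ?thesis
  proof eventually_elim
    case (elim x)
    have "x \<in> (\<Union>n. box (- (real n *\<^sub>R One)) (real n *\<^sub>R One))"
      by (simp add: UN_box_eq_UNIV)
    with elim show ?case by auto
  qed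
qed

lemma locally_integrable_borel_measurable:
  fixes f :: "'a::euclidean_space \<Rightarrow> 'b::euclidean_space"
  assumes loc: "\<And>K. compact K \<Longrightarrow> f absolutely_integrable_on K"
  shows "f \<in> borel_measurable lebesgue"
proof -
  have "(\<lambda>x. indicator (cball 0 (real n)) x *\<^sub>R f x) \<in> borel_measurable lebesgue" for n
    using loc[of "cball 0 (real n)"] by (auto simp: set_integrable_def)
  moreover have "(\<lambda>n. indicator (cball 0 (real n)) x *\<^sub>R f x) \<longlonglongrightarrow> f x" for x
  proof (rule tendsto_eventually)
    show "\<forall>\<^sub>F n in sequentially. indicator (cball 0 (real n)) x *\<^sub>R f x = f x"
      using eventually_ge_at_top[of "nat \<lceil>norm x\<rceil>"]
      by eventually_elim (auto simp: indicator_def nat_le_iff ceiling_le_iff)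
  qed
  ultimately show ?thesis
    by (rule borel_measurable_LIMSEQ_metric)
qed

text \<open>Box bumps are admissible test functions and converge boundedly to indicators of boxes,
  so the integrals of \<open>f\<close> over all boxes vanish.\<close>

lemma fundamental_lemma_variations:
  fixes f :: "'a::euclidean_space \<Rightarrow> real"
  assumes loc: "\<And>K. compact K \<Longrightarrow> f absolutely_integrable_on K"
    and zero: "\<And>\<phi>. \<phi> \<in> Cc_inf UNIV \<Longrightarrow> (LINT x|lebesgue. f x * \<phi> x) = 0"
  shows "AE x in lebesgue. f x = 0"
proof -
  have [measurable]: "f \<in> borel_measurable lebesgue"
    by (rule locally_integrable_borel_measurable[OF loc])
  \<comment> \<open>The argument with boxes works on Borel sets, whereas \<open>f\<close> is only
    Lebesgue measurable; \<open>g\<close> is a Borel version of it.\<close>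
  then obtain g where g[measurable]: "g \<in> borel_measurable lborel" and fg: "AE x in lborel. f x = g x"
    using completion_ex_borel_measurable_real by blast
  have fg': "AE x in lebesgue. f x = g x"
    using fg AE_completion by blast
  have *: "integrable lborel (\<lambda>x. indicator (box c d) x * g x) \<and> (LINT x|lborel. indicator (box c d) x * g x) = 0" for c d
  proof -
    have [measurable]: "box c d \<in> sets lebesgue"
      by (rule fmeasurableD[OF lmeasurable_box])
    have i: "integrable lebesgue (\<lambda>x. indicator (cbox c d) x * f x)"
      using loc[of "cbox c d"] by (auto simp: set_integrable_def)
    have i2: "integrable lebesgue (\<lambda>x. indicator (box c d) x * f x)"
      using set_integrable_subset[OF loc[of "cbox c d"], of "box c d"] box_subset_cbox[of c d]
      by (simp add: set_integrable_def)
    have "(\<lambda>j. LINT x|lebesgue. f x * box_bump c d j x) \<longlonglongrightarrow> (LINT x|lebesgue. f x * indicator (box c d) x)"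
    proof (rule integral_dominated_convergence[where w="\<lambda>x. norm (indicator (cbox c d) x * f x)"])
      have "box_bump c d j \<in> borel_measurable borel" for j
        using Cc_inf_continuous[OF box_bump_in_Cc_inf[OF subset_UNIV]] borel_measurable_continuous_onI by blast
      then have "box_bump c d j \<in> borel_measurable lborel" for j
        by simp
      then have [measurable]: "box_bump c d j \<in> borel_measurable lebesgue" for j
        using measurable_completion by blast
      show "(\<lambda>x. f x * box_bump c d j x) \<in> borel_measurable lebesgue" for j
        by measurable
      show "AE x in lebesgue. norm (f x * box_bump c d j x) \<le> norm (indicator (cbox c d) x * f x)" for j
      proof (rule AE_I2)
        fix x
        have "norm (f x * box_bump c d j x) \<le> \<bar>f x\<bar> * 1"
          using box_bump_bounds[of c d j x] by (simp add: abs_mult mult_left_le)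
        moreover have "box_bump c d j x = 0" if "x \<notin> cbox c d"
        proof -
          from that obtain i where i: "i \<in> Basis" "x \<bullet> i < c \<bullet> i \<or> x \<bullet> i > d \<bullet> i"
            by (auto simp: mem_box not_le)
          then have "flat 0 (real j * (x \<bullet> i - c \<bullet> i)) * flat 0 (real j * (d \<bullet> i - x \<bullet> i)) = 0"
            by (auto simp: flat0 mult_le_0_iff)
          then show ?thesis
            unfolding box_bump_def using i(1) by (intro prod_zero) auto
        qed
        ultimately show "norm (f x * box_bump c d j x) \<le> norm (indicator (cbox c d) x * f x)"
          by (auto simp: indicator_def)
      qed
      show "(\<lambda>x. f x * indicator (box c d) x) \<in> borel_measurable lebesgue"
        using borel_measurable_integrable[OF i2] by (simp add: mult.commute)
      show "integrable lebesgue (\<lambda>x. norm (indicator (cbox c d) x * f x))"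
        using i by (rule integrable_norm)
      show "AE x in lebesgue. (\<lambda>j. f x * box_bump c d j x) \<longlonglongrightarrow> f x * indicator (box c d) x"
        by (intro AE_I2 tendsto_mult_left box_bump_tendsto)
    qed
    then have "(LINT x|lebesgue. f x * indicator (box c d) x) = 0"
      by (simp add: zero[OF box_bump_in_Cc_inf[OF subset_UNIV]] LIMSEQ_const_iff)
    moreover have "(LINT x|lebesgue. f x * indicator (box c d) x) = (LINT x|lebesgue. indicator (box c d) x * g x)"
      using fg' measurable_completion[OF g] by (intro integral_cong_AE) (auto simp: mult.commute)
    moreover have "integrable lebesgue (\<lambda>x. indicator (box c d) x * g x)"
      using fg' measurable_completion[OF g] by (intro integrable_cong_AE_imp[OF i2]) auto
    ultimately show ?thesis
      by (simp add: integral_completion integrable_completion)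
  qed
  have "AE x in lborel. g x = 0"
    by (rule integral_box_zero_imp_AE_zero) (use * g in auto)
  then have "AE x in lebesgue. g x = 0"
    using AE_completion by blast
  with fg' show ?thesis by eventually_elim auto
qed

section \<open>Uniqueness, linearity and stability of weak gradients\<close>

lemma continuous_borel_measurable_lebesgue:
  assumes "continuous_on UNIV f"
  shows "f \<in> borel_measurable lebesgue"
proof -
  have "f \<in> borel_measurable lborel"
    using borel_measurable_continuous_onI[OF assms] by simp
  then show ?thesis by (rule measurable_completion)
qed

lemmas Cc_inf_borel_measurable = continuous_borel_measurable_lebesgue[OF Cc_inf_continuous]
  and grad_borel_measurable = continuous_borel_measurable_lebesgue[OF grad_continuous]

lemma has_weak_gradientD:
  assumes "has_weak_gradient u G"
  shows "u \<in> borel_measurable lebesgue" "G \<in> borel_measurable lebesgue"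
  using assms by (auto simp: has_weak_gradient_def intro!: locally_integrable_borel_measurable)

lemma integrable_mult_compact_support:
  fixes f g :: "'a::euclidean_space \<Rightarrow> real"
  assumes f: "f absolutely_integrable_on K" and K: "compact K" and g: "continuous_on UNIV g" "\<And>x. x \<notin> K \<Longrightarrow> g x = 0"
  shows "integrable lebesgue (\<lambda>x. f x * g x)"
proof -
  obtain B where B: "B > 0" "\<forall>x. norm (g x) \<le> B"
    by (rule compact_support_bounded[OF K g])
  have [measurable]: "g \<in> borel_measurable lebesgue"
    by (rule continuous_borel_measurable_lebesgue[OF g(1)])
  have *: "integrable lebesgue (\<lambda>x. B * (indicator K x * f x))"
    using f by (simp add: set_integrable_def)
  have m: "(\<lambda>x. indicator K x * f x) \<in> borel_measurable lebesgue"
    using f by (auto simp: set_integrable_def)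
  have "integrable lebesgue (\<lambda>x. (indicator K x * f x) * g x)"
  proof (rule Bochner_Integration.integrable_bound[OF *])
    show "(\<lambda>x. indicat_real K x * f x * g x) \<in> borel_measurable lebesgue"
      using m by measurable
    show "AE x in lebesgue. norm (indicat_real K x * f x * g x) \<le> norm (B * (indicat_real K x * f x))"
    proof (rule AE_I2)
      fix x
      have "\<bar>indicator K x * f x\<bar> * \<bar>g x\<bar> \<le> \<bar>indicator K x * f x\<bar> * B"
        using B by (intro mult_left_mono) auto
      then show "norm (indicat_real K x * f x * g x) \<le> norm (B * (indicat_real K x * f x))"
        using B(1) by (simp add: abs_mult mult.commute mult.left_commute)
    qed
  qed
  moreover have "(indicator K x * f x) * g x = f x * g x" for x
    using g(2)[of x] by (cases "x \<in> K") auto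
  ultimately show ?thesis by simp
qed

lemma has_weak_gradient_integrable:
  assumes u: "has_weak_gradient u G" and \<phi>: "\<phi> \<in> Cc_inf UNIV"
  shows "integrable lebesgue (\<lambda>x. u x * frechet_derivative \<phi> (at x) b)"
    "integrable lebesgue (\<lambda>x. (G x \<bullet> b) * \<phi> x)"
proof -
  obtain K where K: "compact K" "K \<subseteq> UNIV" "\<forall>x. x \<notin> K \<longrightarrow> \<phi> x = 0" "\<forall>x. x \<notin> K \<longrightarrow> grad \<phi> x = 0"
     "\<forall>x h. x \<notin> K \<longrightarrow> frechet_derivative \<phi> (at x) h = 0"
    by (rule Cc_inf_supportE[OF \<phi>])
  have 1: "u absolutely_integrable_on K" and 2: "G absolutely_integrable_on K"
    using u K(1) by (auto simp: has_weak_gradient_def)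
  have "integrable lebesgue (\<lambda>x. (indicator K x *\<^sub>R G x) \<bullet> b)"
    using 2 unfolding set_integrable_def by (intro integrable_inner_left)
  then have 3: "(\<lambda>x. G x \<bullet> b) absolutely_integrable_on K"
    by (simp add: set_integrable_def)
  show "integrable lebesgue (\<lambda>x. u x * frechet_derivative \<phi> (at x) b)"
    using K(5) by (intro integrable_mult_compact_support[OF 1 K(1) Cc_inf_derivative_continuous[OF \<phi>]]) auto
  show "integrable lebesgue (\<lambda>x. (G x \<bullet> b) * \<phi> x)"
    using K(3) by (intro integrable_mult_compact_support[OF 3 K(1) Cc_inf_continuous[OF \<phi>]]) auto
qed

text \<open>Each coordinate of the difference is orthogonal to all test functions.\<close>

lemma has_weak_gradient_unique:
  fixes u :: "'a::euclidean_space \<Rightarrow> real"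
  assumes G: "has_weak_gradient u G" and G': "has_weak_gradient u G'"
  shows "AE x in lebesgue. G x = G' x"
proof -
  have *: "AE x in lebesgue. (G x - G' x) \<bullet> b = 0" if b: "b \<in> Basis" for b
  proof (rule fundamental_lemma_variations)
    fix K :: "'a set" assume "compact K"
    then have "G absolutely_integrable_on K" "G' absolutely_integrable_on K"
      using G G' by (auto simp: has_weak_gradient_def)
    then have "integrable lebesgue (\<lambda>x. (indicator K x *\<^sub>R G x - indicator K x *\<^sub>R G' x) \<bullet> b)"
      unfolding set_integrable_def by (intro integrable_inner_left Bochner_Integration.integrable_diff)
    then show "(\<lambda>x. (G x - G' x) \<bullet> b) absolutely_integrable_on K"
      by (simp add: set_integrable_def inner_diff_left algebra_simps)
  next
    fix \<phi> :: "'a \<Rightarrow> real" assume \<phi>: "\<phi> \<in> Cc_inf UNIV"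
    have "(LINT x|lebesgue. (G x \<bullet> b) * \<phi> x) = (LINT x|lebesgue. (G' x \<bullet> b) * \<phi> x)"
      using G G' b \<phi> unfolding has_weak_gradient_def by force
    then show "(LINT x|lebesgue. (G x - G' x) \<bullet> b * \<phi> x) = 0"
      using has_weak_gradient_integrable(2)[OF G \<phi>, of b] has_weak_gradient_integrable(2)[OF G' \<phi>, of b]
      by (simp add: inner_diff_left left_diff_distrib)
  qed
  have "AE x in lebesgue. \<forall>b\<in>Basis. (G x - G' x) \<bullet> b = 0"
    by (rule AE_finite_allI) (use * in auto)
  then show ?thesis
    by eventually_elim (simp add: euclidean_eq_iff[of "G _"] inner_diff_left)
qed

lemma weak_gradient_AE:
  assumes "has_weak_gradient u G"
  shows "AE x in lebesgue. weak_gradient u x = G x"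
  using has_weak_gradient_unique[OF _ assms] someI[of "has_weak_gradient u", OF assms]
  by (simp add: weak_gradient_def)

lemma has_weak_gradient_weak_gradient:
  "has_weak_gradient u G \<Longrightarrow> has_weak_gradient u (weak_gradient u)"
  using someI[of "has_weak_gradient u" G] by (simp add: weak_gradient_def)

lemma has_weak_gradient_add:
  assumes u: "has_weak_gradient u G" and v: "has_weak_gradient v G'"
  shows "has_weak_gradient (\<lambda>x. u x + v x) (\<lambda>x. G x + G' x)"
proof -
  have *: "(LINT x|lebesgue. (u x + v x) * frechet_derivative \<phi> (at x) b) = - (LINT x|lebesgue. ((G x + G' x) \<bullet> b) * \<phi> x)"
    if \<phi>: "\<phi> \<in> Cc_inf UNIV" and b: "b \<in> Basis" for \<phi> b
  proof -
    have "(LINT x|lebesgue. u x * frechet_derivative \<phi> (at x) b) = - (LINT x|lebesgue. (G x \<bullet> b) * \<phi> x)"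
      "(LINT x|lebesgue. v x * frechet_derivative \<phi> (at x) b) = - (LINT x|lebesgue. (G' x \<bullet> b) * \<phi> x)"
      using u v \<phi> b unfolding has_weak_gradient_def by blast+
    then show ?thesis
      using has_weak_gradient_integrable[OF u \<phi>, of b] has_weak_gradient_integrable[OF v \<phi>, of b]
      by (simp add: inner_add_left distrib_right)
  qed
  show ?thesis
    unfolding has_weak_gradient_def
  proof (intro conjI allI impI ballI)
    fix K :: "'a set" assume "compact K"
    with u v have "u absolutely_integrable_on K" "v absolutely_integrable_on K"
        "G absolutely_integrable_on K" "G' absolutely_integrable_on K"
      unfolding has_weak_gradient_def by blast+
    then show "(\<lambda>x. u x + v x) absolutely_integrable_on K" "(\<lambda>x. G x + G' x) absolutely_integrable_on K"
      using set_integral_add(1) by blast+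
  qed (rule *)
qed

lemma has_weak_gradient_cmult:
  assumes u: "has_weak_gradient u G"
  shows "has_weak_gradient (\<lambda>x. c * u x) (\<lambda>x. c *\<^sub>R G x)"
proof -
  have *: "(LINT x|lebesgue. (c * u x) * frechet_derivative \<phi> (at x) b) = - (LINT x|lebesgue. ((c *\<^sub>R G x) \<bullet> b) * \<phi> x)"
    if \<phi>: "\<phi> \<in> Cc_inf UNIV" and b: "b \<in> Basis" for \<phi> b
  proof -
    have "(LINT x|lebesgue. u x * frechet_derivative \<phi> (at x) b) = - (LINT x|lebesgue. (G x \<bullet> b) * \<phi> x)"
      using u \<phi> b unfolding has_weak_gradient_def by blast
    then show ?thesis
      using has_weak_gradient_integrable[OF u \<phi>, of b] by (simp add: mult.assoc)
  qed
  show ?thesis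
    unfolding has_weak_gradient_def
  proof (intro conjI allI impI ballI)
    fix K :: "'a set" assume "compact K"
    with u have "u absolutely_integrable_on K" "G absolutely_integrable_on K"
      unfolding has_weak_gradient_def by blast+
    then have i: "integrable lebesgue (\<lambda>x. indicator K x *\<^sub>R u x)" "integrable lebesgue (\<lambda>x. indicator K x *\<^sub>R G x)"
      unfolding set_integrable_def .
    show "(\<lambda>x. c * u x) absolutely_integrable_on K" "(\<lambda>x. c *\<^sub>R G x) absolutely_integrable_on K"
      using integrable_scaleR_right[of c, OF i(1)] integrable_scaleR_right[of c, OF i(2)]
      by (simp_all add: set_integrable_def mult.left_commute mult.commute)
  qed (rule *)
qed

lemma has_weak_gradient_diff:
  assumes "has_weak_gradient u G" "has_weak_gradient v G'"
  shows "has_weak_gradient (\<lambda>x. u x - v x) (\<lambda>x. G x - G' x)"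
  using has_weak_gradient_add[OF assms(1) has_weak_gradient_cmult[OF assms(2), of "-1"]] by simp

text \<open>A test function and its derivatives are bounded and live on one compact set, so local L1
  convergence lets both sides of the defining identity pass to the limit.\<close>

lemma has_weak_gradient_limit:
  fixes u :: "'a::euclidean_space \<Rightarrow> real"
  assumes un: "\<And>n. has_weak_gradient (U n) (\<GG> n)"
    and loc: "\<And>K. compact K \<Longrightarrow> u absolutely_integrable_on K" "\<And>K. compact K \<Longrightarrow> G absolutely_integrable_on K"
    and lim: "\<And>K. compact K \<Longrightarrow> (\<lambda>n. LINT x|lebesgue. indicator K x * \<bar>U n x - u x\<bar>) \<longlonglongrightarrow> 0"
      "\<And>K. compact K \<Longrightarrow> (\<lambda>n. LINT x|lebesgue. indicator K x * norm (\<GG> n x - G x)) \<longlonglongrightarrow> 0"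
  shows "has_weak_gradient u G"
proof -
  \<comment> \<open>Used twice: with \<open>g\<close> a partial derivative of the test function for
    the left side of the identity, and with \<open>g\<close> the test function itself for the right
    side.\<close>
  have key: "(\<lambda>n. LINT x|lebesgue. f n x * g x) \<longlonglongrightarrow> (LINT x|lebesgue. h x * g x)"
    if K: "compact K" and f: "\<And>n. f n absolutely_integrable_on K" and h: "h absolutely_integrable_on K"
      and g: "continuous_on UNIV g" "\<And>x. x \<notin> K \<Longrightarrow> g x = 0"
      and l: "(\<lambda>n. LINT x|lebesgue. indicator K x * \<bar>f n x - h x\<bar>) \<longlonglongrightarrow> 0"
    for f :: "nat \<Rightarrow> 'a \<Rightarrow> real" and g h :: "'a \<Rightarrow> real" and K
  proof -
    obtain B where B: "B > 0" "\<forall>x. norm (g x) \<le> B"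
      by (rule compact_support_bounded[OF K g])
    have i: "integrable lebesgue (\<lambda>x. f n x * g x)" "integrable lebesgue (\<lambda>x. h x * g x)" for n
      using integrable_mult_compact_support[OF f K g] integrable_mult_compact_support[OF h K g] by auto
    have "integrable lebesgue (\<lambda>x. \<bar>indicator K x *\<^sub>R f n x - indicator K x *\<^sub>R h x\<bar>)" for n
      using f h unfolding set_integrable_def by (intro integrable_abs Bochner_Integration.integrable_diff)
    moreover have "\<bar>indicator K x *\<^sub>R f n x - indicator K x *\<^sub>R h x\<bar> = indicator K x * \<bar>f n x - h x\<bar>" for n x
      by (simp add: indicator_def)
    ultimately have ii: "integrable lebesgue (\<lambda>x. indicator K x * \<bar>f n x - h x\<bar>)" for n
      by simp
    have "\<bar>(LINT x|lebesgue. f n x * g x) - (LINT x|lebesgue. h x * g x)\<bar> \<le> B * (LINT x|lebesgue. indicator K x * \<bar>f n x - h x\<bar>)" for n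
    proof -
      have "\<bar>(LINT x|lebesgue. f n x * g x) - (LINT x|lebesgue. h x * g x)\<bar> = \<bar>LINT x|lebesgue. f n x * g x - h x * g x\<bar>"
        using i by simp
      also have "\<dots> \<le> (LINT x|lebesgue. \<bar>f n x * g x - h x * g x\<bar>)"
        by (rule integral_abs_bound)
      also have "\<dots> \<le> (LINT x|lebesgue. B * (indicator K x * \<bar>f n x - h x\<bar>))"
      proof (intro integral_mono integrable_mult_right ii integrable_abs Bochner_Integration.integrable_diff i)
        fix x
        have "\<bar>f n x * g x - h x * g x\<bar> = \<bar>g x\<bar> * \<bar>f n x - h x\<bar>"
          by (simp add: abs_mult[symmetric] algebra_simps)
        then show "\<bar>f n x * g x - h x * g x\<bar> \<le> B * (indicator K x * \<bar>f n x - h x\<bar>)"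
          using B g(2)[of x] by (cases "x \<in> K") (auto intro: mult_right_mono)
      qed
      finally show ?thesis by simp
    qed
    moreover have "(\<lambda>n. B * (LINT x|lebesgue. indicator K x * \<bar>f n x - h x\<bar>)) \<longlonglongrightarrow> 0"
      using tendsto_mult_right_zero[OF l] by simp
    ultimately have "(\<lambda>n. (LINT x|lebesgue. f n x * g x) - (LINT x|lebesgue. h x * g x)) \<longlonglongrightarrow> 0"
      using Lim_null_comparison[OF always_eventually, of "\<lambda>n. (LINT x|lebesgue. f n x * g x) - (LINT x|lebesgue. h x * g x)"
         "\<lambda>n. B * (LINT x|lebesgue. indicator K x * \<bar>f n x - h x\<bar>)"] by simp
    then show ?thesis by (rule LIM_zero_cancel)
  qed
  show ?thesis
    unfolding has_weak_gradient_def
  proof (intro conjI allI impI ballI)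
    fix K :: "'a set" assume K: "compact K"
    show "u absolutely_integrable_on K" by (rule loc(1)[OF K])
    show "G absolutely_integrable_on K" by (rule loc(2)[OF K])
  next
    fix \<phi> :: "'a \<Rightarrow> real" and b :: 'a assume \<phi>: "\<phi> \<in> Cc_inf UNIV" and b: "b \<in> Basis"
    obtain K where K: "compact K" "K \<subseteq> UNIV" "\<forall>x. x \<notin> K \<longrightarrow> \<phi> x = 0" "\<forall>x. x \<notin> K \<longrightarrow> grad \<phi> x = 0"
       "\<forall>x h. x \<notin> K \<longrightarrow> frechet_derivative \<phi> (at x) h = 0"
      by (rule Cc_inf_supportE[OF \<phi>])
    have inn: "(\<lambda>x. H x \<bullet> b) absolutely_integrable_on K" if "H absolutely_integrable_on K" for H :: "'a \<Rightarrow> 'a"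
    proof -
      have "integrable lebesgue (\<lambda>x. (indicator K x *\<^sub>R H x) \<bullet> b)"
        using that unfolding set_integrable_def by (intro integrable_inner_left)
      then show ?thesis by (simp add: set_integrable_def)
    qed
    have aU: "U n absolutely_integrable_on K" and aG: "\<GG> n absolutely_integrable_on K" for n
      using un K(1) unfolding has_weak_gradient_def by blast+
    have 1: "(\<lambda>n. LINT x|lebesgue. U n x * frechet_derivative \<phi> (at x) b) \<longlonglongrightarrow> (LINT x|lebesgue. u x * frechet_derivative \<phi> (at x) b)"
      by (rule key[OF K(1) aU loc(1)[OF K(1)] Cc_inf_derivative_continuous[OF \<phi>] _ lim(1)[OF K(1)]]) (use K(5) in blast)
    have 2: "(\<lambda>n. LINT x|lebesgue. (\<GG> n x \<bullet> b) * \<phi> x) \<longlonglongrightarrow> (LINT x|lebesgue. (G x \<bullet> b) * \<phi> x)"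
    proof (rule key[OF K(1) inn[OF aG] inn[OF loc(2)[OF K(1)]] Cc_inf_continuous[OF \<phi>]])
      have "integrable lebesgue (\<lambda>x. norm (indicator K x *\<^sub>R \<GG> n x - indicator K x *\<^sub>R G x))" for n
        using aG loc(2)[OF K(1)] unfolding set_integrable_def by (intro integrable_norm Bochner_Integration.integrable_diff)
      moreover have "norm (indicator K x *\<^sub>R \<GG> n x - indicator K x *\<^sub>R G x) = indicator K x * norm (\<GG> n x - G x)" for n x
        by (simp add: indicator_def)
      ultimately have i1: "integrable lebesgue (\<lambda>x. indicator K x * norm (\<GG> n x - G x))" for n
        by simp
      have "(LINT x|lebesgue. indicator K x * \<bar>\<GG> n x \<bullet> b - G x \<bullet> b\<bar>) \<le> (LINT x|lebesgue. indicator K x * norm (\<GG> n x - G x))" for n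
      proof (rule integral_mono')
        fix x
        have "\<bar>\<GG> n x \<bullet> b - G x \<bullet> b\<bar> \<le> norm (\<GG> n x - G x)"
          using Basis_le_norm[OF b, of "\<GG> n x - G x"] by (simp add: inner_diff_left)
        then show "indicator K x * \<bar>\<GG> n x \<bullet> b - G x \<bullet> b\<bar> \<le> indicator K x * norm (\<GG> n x - G x)"
          by (simp add: indicator_def)
      qed (use i1 in auto)
      then show "(\<lambda>n. LINT x|lebesgue. indicator K x * \<bar>\<GG> n x \<bullet> b - G x \<bullet> b\<bar>) \<longlonglongrightarrow> 0"
        by (intro tendsto_sandwich[OF _ _ tendsto_const lim(2)[OF K(1)]])
          (auto intro!: always_eventually Bochner_Integration.integral_nonneg)
    qed (use K(3) in blast)
    have "(LINT x|lebesgue. U n x * frechet_derivative \<phi> (at x) b) = - (LINT x|lebesgue. (\<GG> n x \<bullet> b) * \<phi> x)" for n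
      using un \<phi> b unfolding has_weak_gradient_def by blast
    with 1 have "(\<lambda>n. - (LINT x|lebesgue. (\<GG> n x \<bullet> b) * \<phi> x)) \<longlonglongrightarrow> (LINT x|lebesgue. u x * frechet_derivative \<phi> (at x) b)"
      by simp
    with tendsto_minus[OF 2] show "(LINT x|lebesgue. u x * frechet_derivative \<phi> (at x) b) = - (LINT x|lebesgue. (G x \<bullet> b) * \<phi> x)"
      using LIMSEQ_unique by blast
  qed
qed

section \<open>Pointwise inequalities for powers\<close>

text \<open>The end point \<open>a = 0\<close> is allowed although the power need not be
  differentiable there: the mean value theorem asks only for continuity at the end points.\<close>

lemma powr_mvt:
  fixes a b r :: real
  assumes "0 \<le> a" "a < b" "r > 0"
  obtains z where "a < z" "z < b" "b powr r - a powr r = (b - a) * (r * z powr (r - 1))"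
proof -
  have "continuous_on {a..b} (\<lambda>x. x powr r)"
    using assms by (intro continuous_on_powr') (auto intro: continuous_intros)
  moreover have d: "((\<lambda>x. x powr r) has_real_derivative r * x powr (r - 1)) (at x)" if "a < x" for x
    using that assms by (intro has_real_derivative_powr) auto
  then have "(\<lambda>x. x powr r) differentiable (at x)" if "a < x" for x
    using that by (auto simp: real_differentiable_def)
  ultimately obtain l z where z: "a < z" "z < b" "DERIV (\<lambda>x. x powr r) z :> l" "b powr r - a powr r = (b - a) * l"
    using MVT[OF assms(2), of "\<lambda>x. x powr r"] by blast
  have "DERIV (\<lambda>x. x powr r) z :> r * z powr (r - 1)"
    using z(1) assms by (intro has_real_derivative_powr) auto
  then have "l = r * z powr (r - 1)"
    using z(3) DERIV_unique by blast
  with z that show ?thesis by blast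
qed

text \<open>The mean value theorem on the two halves of the interval, together with the strict
  growth of the derivative.\<close>

lemma powr_strict_convex:
  fixes s t r :: real
  assumes "0 \<le> s" "s < t" "r > 1"
  shows "((s + t) / 2) powr r < (s powr r + t powr r) / 2"
proof -
  let ?m = "(s + t) / 2"
  obtain z where z: "s < z" "z < ?m" "?m powr r - s powr r = (?m - s) * (r * z powr (r - 1))"
    using powr_mvt[of s ?m r] assms by auto
  obtain y where y: "?m < y" "y < t" "t powr r - ?m powr r = (t - ?m) * (r * y powr (r - 1))"
    using powr_mvt[of ?m t r] assms by auto
  have "z powr (r - 1) < y powr (r - 1)"
    using z y assms by (intro powr_less_mono2) auto
  then have "(t - s) / 2 * (r * z powr (r - 1)) < (t - s) / 2 * (r * y powr (r - 1))"
    using assms by (intro mult_strict_left_mono) auto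
  moreover have m: "?m - s = (t - s) / 2" "t - ?m = (t - s) / 2"
    by (simp_all add: field_simps)
  ultimately have "?m powr r - s powr r < t powr r - ?m powr r"
    unfolding z(3) y(3) by (simp only: m)
  then show ?thesis by simp
qed

lemma powr_midpoint_convex:
  fixes s t r :: real
  assumes "0 \<le> s" "0 \<le> t" "r > 1"
  shows "((s + t) / 2) powr r \<le> (s powr r + t powr r) / 2"
  using powr_strict_convex[of s t r] powr_strict_convex[of t s r] assms
  by (cases s t rule: linorder_cases) (auto simp: add.commute)

lemma norm_midpoint_powr:
  fixes x y :: "'b::real_normed_vector"
  assumes "r > 1"
  shows "norm ((1/2) *\<^sub>R (x + y)) powr r \<le> (norm x powr r + norm y powr r) / 2"
proof -
  have "norm ((1/2) *\<^sub>R (x + y)) \<le> (norm x + norm y) / 2"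
    using norm_triangle_ineq[of x y] by simp
  then have "norm ((1/2) *\<^sub>R (x + y)) powr r \<le> ((norm x + norm y) / 2) powr r"
    using assms by (intro powr_mono2) auto
  also have "\<dots> \<le> (norm x powr r + norm y powr r) / 2"
    using assms by (intro powr_midpoint_convex) auto
  finally show ?thesis .
qed

text \<open>Two different sources of strictness: for equal norms the parallelogram identity makes
  the midpoint strictly shorter, for different norms the scalar power is strictly convex.\<close>

lemma norm_midpoint_powr_strict:
  fixes x y :: "'b::real_inner"
  assumes "r > 1" "x \<noteq> y"
  shows "norm ((1/2) *\<^sub>R (x + y)) powr r < (norm x powr r + norm y powr r) / 2"
proof (cases "norm x = norm y")
  case True
  have "(norm (x + y))\<^sup>2 + (norm (x - y))\<^sup>2 = 2 * (norm x)\<^sup>2 + 2 * (norm y)\<^sup>2"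
    by (simp add: power2_norm_eq_inner inner_add_left inner_add_right inner_diff_left inner_diff_right inner_commute)
  moreover have "(norm (x - y))\<^sup>2 > 0"
    using assms by simp
  moreover have "(2 * norm x)\<^sup>2 = 2 * (norm x)\<^sup>2 + 2 * (norm y)\<^sup>2"
    using True by (simp add: power_mult_distrib)
  ultimately have "(norm (x + y))\<^sup>2 < (2 * norm x)\<^sup>2"
    by linarith
  then have "norm (x + y) < 2 * norm x"
    by (rule power2_less_imp_less) simp
  then have "norm ((1/2) *\<^sub>R (x + y)) < norm x" by simp
  then have "norm ((1/2) *\<^sub>R (x + y)) powr r < norm x powr r"
    using assms by (intro powr_less_mono2) auto
  then show ?thesis using True by simp
next
  case False
  have "norm ((1/2) *\<^sub>R (x + y)) \<le> (norm x + norm y) / 2"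
    using norm_triangle_ineq[of x y] by simp
  then have "norm ((1/2) *\<^sub>R (x + y)) powr r \<le> ((norm x + norm y) / 2) powr r"
    using assms by (intro powr_mono2) auto
  also have "\<dots> < (norm x powr r + norm y powr r) / 2"
    using False powr_strict_convex[of "norm x" "norm y" r] powr_strict_convex[of "norm y" "norm x" r] assms
    by (cases "norm x" "norm y" rule: linorder_cases) (auto simp: add.commute)
  finally show ?thesis .
qed

lemma add_powr_le:
  fixes s t r :: real
  assumes "0 \<le> s" "0 \<le> t" "r > 0"
  shows "(s + t) powr r \<le> 2 powr r * (s powr r + t powr r)"
proof -
  have "(s + t) powr r \<le> (2 * max s t) powr r"
    using assms by (intro powr_mono2) auto
  also have "\<dots> = 2 powr r * max s t powr r" by (simp add: powr_mult)
  also have "\<dots> \<le> 2 powr r * (s powr r + t powr r)"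
    by (intro mult_left_mono) (auto simp: max_def)
  finally show ?thesis .
qed

lemma norm_add_powr_le:
  fixes x y :: "'b::real_normed_vector"
  assumes "r > 0"
  shows "norm (x + y) powr r \<le> 2 powr r * (norm x powr r + norm y powr r)"
proof -
  have "norm (x + y) powr r \<le> (norm x + norm y) powr r"
    using assms by (intro powr_mono2 norm_triangle_ineq) auto
  also have "\<dots> \<le> 2 powr r * (norm x powr r + norm y powr r)"
    using assms by (intro add_powr_le) auto
  finally show ?thesis .
qed

lemma powr_diff_le:
  fixes s t r :: real
  assumes "0 \<le> s" "0 \<le> t" "r \<ge> 1"
  shows "\<bar>s powr r - t powr r\<bar> \<le> r * max s t powr (r - 1) * \<bar>s - t\<bar>"
proof -
  have *: "b powr r - a powr r \<le> r * b powr (r - 1) * (b - a) \<and> a powr r \<le> b powr r" if ab: "0 \<le> a" "a < b" for a b :: real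
  proof -
    obtain z where z: "a < z" "z < b" "b powr r - a powr r = (b - a) * (r * z powr (r - 1))"
      using powr_mvt[of a b r] ab assms by auto
    have "z powr (r - 1) \<le> b powr (r - 1)"
      using z ab assms by (intro powr_mono2) auto
    then have "(b - a) * (r * z powr (r - 1)) \<le> (b - a) * (r * b powr (r - 1))"
      using ab assms by (intro mult_left_mono) auto
    moreover have "a powr r \<le> b powr r" using ab assms by (intro powr_mono2) auto
    ultimately show ?thesis using z(3) by (simp add: mult_ac)
  qed
  show ?thesis
    using *[of s t] *[of t s] assms
    by (cases s t rule: linorder_cases) (auto simp: max_def)
qed

text \<open>The loss is a small multiple of one power plus a large multiple of the power of the
  difference. After integration this turns convergence in the r-norm into convergence of the
  integrals of the powers.\<close>

lemma norm_powr_diff_le: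
  assumes r: "r \<ge> 1" and \<eta>: "\<eta> > 0"
  obtains C where "C \<ge> 0" "\<forall>x y::'b::real_normed_vector. \<bar>norm x powr r - norm y powr r\<bar> \<le> \<eta> * norm x powr r + C * norm (x - y) powr r"
proof -
  \<comment> \<open>The threshold between two regimes: if \<open>norm (x - y)\<close> is at most
    \<open>\<tau> * norm x\<close>, the difference of the powers is below the \<eta>-term; otherwise
    \<open>norm x\<close> itself is controlled by \<open>norm (x - y)\<close>.\<close>
  define \<tau> where "\<tau> = min 1 (\<eta> / (r * 2 powr r))"
  have \<tau>: "0 < \<tau>" "\<tau> \<le> 1" "r * 2 powr r * \<tau> \<le> \<eta>"
    using r \<eta> by (auto simp: \<tau>_def min_def field_simps)
  define C where "C = r * (1 + 1 / \<tau>) powr (r - 1)"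
  have "\<bar>norm x powr r - norm y powr r\<bar> \<le> \<eta> * norm x powr r + C * norm (x - y) powr r" for x y :: 'b
  proof -
    define \<delta> where "\<delta> = norm (x - y)"
    have \<delta>0: "\<delta> \<ge> 0" by (simp add: \<delta>_def)
    have ya: "norm y \<le> norm x + \<delta>"
      unfolding \<delta>_def by (metis norm_minus_commute norm_triangle_sub)
    have ab: "\<bar>norm x - norm y\<bar> \<le> \<delta>"
      unfolding \<delta>_def by (rule norm_triangle_ineq3)
    have "\<bar>norm x powr r - norm y powr r\<bar> \<le> r * max (norm x) (norm y) powr (r - 1) * \<bar>norm x - norm y\<bar>"
      using r by (intro powr_diff_le) auto
    also have "\<dots> \<le> r * (norm x + \<delta>) powr (r - 1) * \<delta>"
      using r ya ab \<delta>0 by (intro mult_mono powr_mono2) (auto simp: le_max_iff_disj)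
    also have "\<dots> \<le> \<eta> * norm x powr r + C * \<delta> powr r"
    proof (cases "\<delta> \<le> \<tau> * norm x")
      case True
      have "\<tau> * norm x \<le> 1 * norm x" using \<tau> by (intro mult_right_mono) auto
      then have "norm x + \<delta> \<le> 2 * norm x" using True by simp
      then have "(norm x + \<delta>) powr (r - 1) \<le> (2 * norm x) powr (r - 1)"
        using r \<delta>0 by (intro powr_mono2) auto
      then have "r * (norm x + \<delta>) powr (r - 1) * \<delta> \<le> r * (2 * norm x) powr (r - 1) * (\<tau> * norm x)"
        using r True \<delta>0 by (intro mult_mono) auto
      also have "\<dots> = r * 2 powr (r - 1) * \<tau> * norm x powr r"
        using powr_mult_base[of "norm x" "r - 1"] by (simp add: powr_mult mult_ac)
      also have "\<dots> \<le> r * 2 powr r * \<tau> * norm x powr r"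
        using r \<tau> by (intro mult_right_mono mult_left_mono powr_mono) auto
      also have "\<dots> \<le> \<eta> * norm x powr r"
        using \<tau> by (intro mult_right_mono) auto
      finally show ?thesis using r by (simp add: C_def add_increasing2)
    next
      case False
      then have "norm x \<le> \<delta> / \<tau>" using \<tau> by (simp add: field_simps)
      then have "norm x + \<delta> \<le> (1 + 1 / \<tau>) * \<delta>" by (simp add: field_simps)
      then have "(norm x + \<delta>) powr (r - 1) \<le> ((1 + 1 / \<tau>) * \<delta>) powr (r - 1)"
        using r \<delta>0 by (intro powr_mono2) auto
      then have "r * (norm x + \<delta>) powr (r - 1) * \<delta> \<le> r * ((1 + 1 / \<tau>) * \<delta>) powr (r - 1) * \<delta>"
        using r \<delta>0 by (intro mult_right_mono mult_left_mono) auto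
      also have "\<dots> = C * \<delta> powr r"
        using powr_mult_base[OF \<delta>0, of "r - 1"] by (simp add: powr_mult mult_ac C_def)
      finally show ?thesis using \<eta> by (simp add: add_increasing)
    qed
    finally show ?thesis by (simp add: \<delta>_def)
  qed
  moreover have "C \<ge> 0" using r by (simp add: C_def)
  ultimately show ?thesis using that by blast
qed

text \<open>Uniform convexity of \<open>|x|\<^sup>r\<close>: by homogeneity it suffices to bound the convexity defect from
  below on a compact set, where strict convexity makes it positive. This treats
  \<open>r < 2\<close> and \<open>r \<ge> 2\<close> alike.\<close>

lemma norm_powr_uniform_convex:
  assumes r: "r > 1" and \<epsilon>: "\<epsilon> > 0"
  obtains C where "C \<ge> 0" "\<forall>x y::'b::euclidean_space. norm (x - y) powr r \<le>
    \<epsilon> * (norm x powr r + norm y powr r) + C * ((norm x powr r + norm y powr r) / 2 - norm ((1/2) *\<^sub>R (x + y)) powr r)"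
proof -
  let ?D = "\<lambda>z::'b\<times>'b. (norm (fst z) powr r + norm (snd z) powr r) / 2 - norm ((1/2) *\<^sub>R (fst z + snd z)) powr r"
  let ?S = "\<lambda>z::'b\<times>'b. norm (fst z) powr r + norm (snd z) powr r"
  let ?N = "\<lambda>z::'b\<times>'b. norm (fst z - snd z) powr r"
  \<comment> \<open>Normalized pairs that are at least \<epsilon> apart. Excluding a neighbourhood
    of the diagonal is essential, since the convexity defect vanishes there.\<close>
  define K where "K = {z. ?S z = 1} \<inter> {z. \<epsilon> \<le> ?N z}"
  have cpow: "continuous_on UNIV (\<lambda>z::'b\<times>'b. norm (f z) powr r)" if "continuous_on UNIV f" for f :: "'b\<times>'b \<Rightarrow> 'b"
    using that r by (intro continuous_on_powr' continuous_on_norm continuous_on_const) auto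
  have cS: "continuous_on UNIV ?S"
    by (intro continuous_on_add cpow continuous_on_fst continuous_on_snd continuous_on_id)
  have cN: "continuous_on UNIV ?N"
    by (intro cpow continuous_on_diff continuous_on_fst continuous_on_snd continuous_on_id)
  have cD: "continuous_on UNIV ?D"
    by (intro continuous_on_diff continuous_on_divide cS cpow continuous_on_scaleR continuous_on_add continuous_on_fst continuous_on_snd continuous_on_id continuous_on_const) auto
  have "closed K"
    unfolding K_def by (intro closed_Int closed_Collect_eq closed_Collect_le cS cN continuous_on_const)
  moreover have "bounded K"
  proof (rule boundedI)
    fix z assume "z \<in> K"
    then have S: "?S z = 1" by (simp add: K_def)
    have "norm (fst z) powr r \<le> 1 powr r" "norm (snd z) powr r \<le> 1 powr r"
      using S powr_ge_zero[of "norm (fst z)" r] powr_ge_zero[of "norm (snd z)" r] unfolding powr_one_eq_one by linarith+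
    then have "norm (fst z) \<le> 1" "norm (snd z) \<le> 1"
      using powr_less_mono2[of r 1 "norm (fst z)"] powr_less_mono2[of r 1 "norm (snd z)"] r
      by (auto simp: not_le[symmetric])
    then show "norm z \<le> 2"
      using norm_Pair_le[of "fst z" "snd z"] by simp
  qed
  ultimately have K: "compact K" by (simp add: compact_eq_bounded_closed)
  obtain \<delta> where \<delta>: "\<delta> > 0" "\<forall>z\<in>K. \<delta> \<le> ?D z"
  proof (cases "K = {}")
    case True
    then show ?thesis using that[of 1] by simp
  next
    case False
    obtain z where z: "z \<in> K" "\<forall>w\<in>K. ?D z \<le> ?D w"
      using continuous_attains_inf[OF K False continuous_on_subset[OF cD subset_UNIV]] by blast
    have "fst z \<noteq> snd z"
      using z(1) \<epsilon> by (auto simp: K_def)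
    then have "?D z > 0"
      using norm_midpoint_powr_strict[OF r, of "fst z" "snd z"] by simp
    then show ?thesis using that[of "?D z"] z(2) by blast
  qed
  \<comment> \<open>On \<open>K\<close> the defect is at least \<delta>, while the left-hand side
    never exceeds \<open>2 powr r\<close> on normalized pairs.\<close>
  define C where "C = 2 powr r / \<delta>"
  have C: "C \<ge> 0" using \<delta> by (simp add: C_def)
  have norm1: "?N z \<le> \<epsilon> + C * ?D z" if S: "?S z = 1" for z
  proof (cases "\<epsilon> \<le> ?N z")
    case True
    then have "\<delta> \<le> ?D z" using \<delta> S by (simp add: K_def)
    then have "C * \<delta> \<le> C * ?D z" using C by (rule mult_left_mono)
    moreover have "C * \<delta> = 2 powr r" using \<delta> by (simp add: C_def)
    moreover have "?N z \<le> 2 powr r * (?S z)"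
      using norm_add_powr_le[of r "fst z" "- snd z"] r by simp
    ultimately show ?thesis using S \<epsilon> by simp
  next
    case False
    moreover have "?D z \<ge> 0"
      using norm_midpoint_powr[OF r, of "fst z" "snd z"] by simp
    ultimately show ?thesis using C by (simp add: add_increasing2)
  qed
  have "norm (x - y) powr r \<le> \<epsilon> * (norm x powr r + norm y powr r) + C * ((norm x powr r + norm y powr r) / 2 - norm ((1/2) *\<^sub>R (x + y)) powr r)"
    for x y :: 'b
  proof (cases "norm x powr r + norm y powr r = 0")
    case True
    then have "norm x powr r = 0" "norm y powr r = 0"
      using powr_ge_zero[of "norm x" r] powr_ge_zero[of "norm y" r] by linarith+
    then show ?thesis by simp
  next
    case False
    define S where "S = norm x powr r + norm y powr r"
    have S: "S > 0"
      using False powr_ge_zero[of "norm x" r] powr_ge_zero[of "norm y" r] unfolding S_def by linarith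
    \<comment> \<open>The scaling that normalizes the pair: all terms are homogeneous of degree
      \<open>r\<close>, and \<open>c powr r = 1 / S\<close>.\<close>
    define c where "c = S powr (- (1 / r))"
    have c0: "c > 0" using S by (simp add: c_def)
    have "c powr r = S powr (- (1 / r) * r)"
      unfolding c_def by (rule powr_powr)
    also have "- (1 / r) * r = - 1" using r by simp
    finally have cr: "c powr r = 1 / S"
      using S by (simp add: powr_minus_divide)
    have sc: "norm (c *\<^sub>R v) powr r = norm v powr r / S" for v :: 'b
      using c0 cr by (simp add: powr_mult)
    have S1: "?S (c *\<^sub>R x, c *\<^sub>R y) = 1"
      unfolding fst_conv snd_conv sc using S by (simp add: add_divide_distrib[symmetric] S_def)
    have e1: "c *\<^sub>R x - c *\<^sub>R y = c *\<^sub>R (x - y)" "(1/2) *\<^sub>R (c *\<^sub>R x + c *\<^sub>R y) = c *\<^sub>R ((1/2) *\<^sub>R (x + y))"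
      by (simp_all add: algebra_simps)
    have "?N (c *\<^sub>R x, c *\<^sub>R y) \<le> \<epsilon> + C * ?D (c *\<^sub>R x, c *\<^sub>R y)"
      by (rule norm1[OF S1])
    then have "norm (x - y) powr r / S \<le> \<epsilon> + C * ((norm x powr r / S + norm y powr r / S) / 2 - norm ((1/2) *\<^sub>R (x + y)) powr r / S)"
      unfolding fst_conv snd_conv e1 sc .
    then have "S * (norm (x - y) powr r / S) \<le> S * (\<epsilon> + C * ((norm x powr r / S + norm y powr r / S) / 2 - norm ((1/2) *\<^sub>R (x + y)) powr r / S))"
      using S by (intro mult_left_mono) auto
    also have "\<dots> = \<epsilon> * S + C * ((norm x powr r + norm y powr r) / 2 - norm ((1/2) *\<^sub>R (x + y)) powr r)"
      using S by (simp add: field_simps)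
    finally show ?thesis using S by (simp add: S_def)
  qed
  with C that show ?thesis by blast
qed

text \<open>Provides a majorant of the difference quotients that does not depend on
  \<open>t\<close>, for dominated convergence in \<open>Ir_derivative\<close>.\<close>

lemma norm_powr_direction:
  fixes x y :: "'b::real_inner"
  assumes r: "r > 1" and t: "0 < t" "t \<le> 1"
  shows "\<bar>(norm (x + t *\<^sub>R y) powr r - norm x powr r) / t\<bar> \<le> r * 2 powr r * (norm x powr r + norm y powr r)"
proof -
  let ?m = "norm x + norm y"
  have n: "norm (t *\<^sub>R y) \<le> norm y"
    using t mult_right_mono[of t 1 "norm y"] by simp
  have m: "max (norm (x + t *\<^sub>R y)) (norm x) \<le> ?m"
    using n norm_triangle_ineq[of x "t *\<^sub>R y"] by auto
  have d: "\<bar>norm (x + t *\<^sub>R y) - norm x\<bar> \<le> t * norm y"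
    using norm_triangle_ineq3[of "x + t *\<^sub>R y" x] t by simp
  have "\<bar>norm (x + t *\<^sub>R y) powr r - norm x powr r\<bar> \<le> r * max (norm (x + t *\<^sub>R y)) (norm x) powr (r - 1) * \<bar>norm (x + t *\<^sub>R y) - norm x\<bar>"
    using r by (intro powr_diff_le) auto
  also have "\<dots> \<le> r * ?m powr (r - 1) * (t * ?m)"
  proof -
    have "t * norm y \<le> t * ?m" using t by (intro mult_left_mono) auto
    with d have "\<bar>norm (x + t *\<^sub>R y) - norm x\<bar> \<le> t * ?m" by linarith
    moreover have "max (norm (x + t *\<^sub>R y)) (norm x) powr (r - 1) \<le> ?m powr (r - 1)"
      using r m by (intro powr_mono2) (auto simp: le_max_iff_disj)
    ultimately show ?thesis
      using r by (intro mult_mono) auto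
  qed
  also have "\<dots> = t * (r * ?m powr r)"
    using powr_mult_base[of ?m "r - 1"] by (simp add: mult_ac)
  also have "\<dots> \<le> t * (r * (2 powr r * (norm x powr r + norm y powr r)))"
    using r t by (intro mult_left_mono add_powr_le) auto
  finally show ?thesis
    using t by (simp add: abs_divide divide_le_eq mult_ac)
qed

text \<open>Away from 0 the power is a smooth function of \<open>x \<bullet> x\<close>. At 0 the
  quotient has size \<open>\<bar>h\<bar> powr (r - 1)\<close>, which tends to 0 because
  \<open>r > 1\<close>; the formula agrees since \<open>0 powr (r - 2) = 0\<close>.\<close>

lemma norm_powr_has_derivative_along:
  fixes x y :: "'b::real_inner"
  assumes r: "r > 1"
  shows "((\<lambda>t. norm (x + t *\<^sub>R y) powr r) has_real_derivative r * (norm x powr (r - 2) * (x \<bullet> y))) (at 0)"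
proof (cases "x = 0")
  case True
  have "((\<lambda>h. \<bar>h\<bar> powr (r - 1) * norm y powr r) \<longlongrightarrow> \<bar>0\<bar> powr (r - 1) * norm y powr r) (at 0)"
    using r by (intro tendsto_intros tendsto_powr') auto
  then have 1: "((\<lambda>h. \<bar>h\<bar> powr (r - 1) * norm y powr r) \<longlongrightarrow> 0) (at 0)"
    by simp
  have "((\<lambda>h. (norm (h *\<^sub>R y) powr r) / h) \<longlongrightarrow> 0) (at 0)"
  proof (rule Lim_null_comparison[OF _ 1])
    have "norm (norm (h *\<^sub>R y) powr r / h) \<le> \<bar>h\<bar> powr (r - 1) * norm y powr r" for h
      by (cases "h = 0") (auto simp: powr_mult powr_diff)
    then show "\<forall>\<^sub>F h in at 0. norm (norm (h *\<^sub>R y) powr r / h) \<le> \<bar>h\<bar> powr (r - 1) * norm y powr r"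
      by simp
  qed
  then show ?thesis
    using True by (simp add: DERIV_def)
next
  case False
  have eq: "norm z powr r = (z \<bullet> z) powr (r / 2)" for z :: 'b
    unfolding norm_eq_sqrt_inner by (simp add: powr_half_sqrt[symmetric] powr_powr)
  have pos: "(x \<bullet> x) > 0" using False by simp
  have "((\<lambda>t. (x + t *\<^sub>R y) \<bullet> (x + t *\<^sub>R y)) has_real_derivative 2 * (x \<bullet> y)) (at 0)"
    unfolding inner_add_left inner_add_right inner_scaleR_left inner_scaleR_right
    by (auto intro!: derivative_eq_intros simp: inner_commute)
  moreover have "(x + 0 *\<^sub>R y) \<bullet> (x + 0 *\<^sub>R y) = x \<bullet> x" by simp
  then have "((\<lambda>u. u powr (r / 2)) has_real_derivative r / 2 * (x \<bullet> x) powr (r / 2 - 1)) (at ((x + 0 *\<^sub>R y) \<bullet> (x + 0 *\<^sub>R y)))"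
    using has_real_derivative_powr[OF pos, of "r / 2"] by (simp only:)
  ultimately have "((\<lambda>t. ((x + t *\<^sub>R y) \<bullet> (x + t *\<^sub>R y)) powr (r / 2)) has_real_derivative r / 2 * (x \<bullet> x) powr (r / 2 - 1) * (2 * (x \<bullet> y))) (at 0)"
    by (rule DERIV_chain2[where f = "\<lambda>u. u powr (r / 2)", rotated])
  moreover have "(x \<bullet> x) powr (r / 2 - 1) = norm x powr (r - 2)"
    unfolding norm_eq_sqrt_inner by (simp add: powr_half_sqrt[symmetric] powr_powr diff_divide_distrib)
  ultimately show ?thesis
    by (simp add: eq mult_ac)
qed

text \<open>Plays the role of Young's inequality: both norms are replaced by their maximum, which
  costs no constant and is enough for integrability.\<close>

lemma norm_powr_inner_le:
  fixes x y :: "'b::real_inner"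
  assumes r: "r > 1"
  shows "\<bar>norm x powr (r - 2) * (x \<bullet> y)\<bar> \<le> norm x powr r + norm y powr r"
proof -
  have "\<bar>norm x powr (r - 2) * (x \<bullet> y)\<bar> \<le> norm x powr (r - 2) * (norm x * norm y)"
    unfolding abs_mult by (intro mult_mono Cauchy_Schwarz_ineq2) auto
  also have "\<dots> = norm x powr (r - 1) * norm y"
    using powr_mult_base[of "norm x" "r - 2"] by (simp add: mult_ac)
  also have "\<dots> \<le> max (norm x) (norm y) powr (r - 1) * max (norm x) (norm y)"
    using r by (intro mult_mono powr_mono2) auto
  also have "\<dots> = max (norm x) (norm y) powr r"
    using powr_mult_base[of "max (norm x) (norm y)" "r - 1"] by (simp add: mult_ac le_max_iff_disj)
  also have "\<dots> \<le> norm x powr r + norm y powr r"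
    by (auto simp: max_def)
  finally show ?thesis .
qed

text \<open>Plays the role of Hoelder's inequality on sets of finite measure. Later choices of
  \<eta> balance the measure of the set against the integral of the power.\<close>

lemma le_add_powr:
  fixes t \<eta> r :: real
  assumes "t \<ge> 0" "\<eta> > 0" "r \<ge> 1"
  shows "t \<le> \<eta> + \<eta> powr (1 - r) * t powr r"
proof (cases "t \<le> \<eta>")
  case True
  then show ?thesis by (simp add: add_increasing2)
next
  case False
  then have "t powr (1 - r) \<le> \<eta> powr (1 - r)"
    using assms by (intro powr_mono2') auto
  then have "t powr (1 - r) * t powr r \<le> \<eta> powr (1 - r) * t powr r"
    by (intro mult_right_mono) auto
  moreover have "t powr (1 - r) * t powr r = t"
    using False assms by (simp add: powr_add[symmetric])
  ultimately show ?thesis using assms by simp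
qed

section \<open>Functions with integrable powers\<close>

definition Lr :: "'c measure \<Rightarrow> real \<Rightarrow> ('c \<Rightarrow> 'b::euclidean_space) \<Rightarrow> bool" where
  "Lr M r X \<longleftrightarrow> X \<in> borel_measurable M \<and> integrable M (\<lambda>z. norm (X z) powr r)"

text \<open>The r-th power of the usual norm: modulars then add up without roots. Instead of the
  triangle inequality there is the factor \<open>2 powr r\<close> in \<open>Lr_add\<close>.\<close>

definition Ir :: "'c measure \<Rightarrow> real \<Rightarrow> ('c \<Rightarrow> 'b::euclidean_space) \<Rightarrow> real" where
  "Ir M r X = (LINT z|M. norm (X z) powr r)"

lemma LrD: "Lr M r X \<Longrightarrow> X \<in> borel_measurable M" "Lr M r X \<Longrightarrow> integrable M (\<lambda>z. norm (X z) powr r)"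
  by (auto simp: Lr_def)

lemma Ir_nonneg: "0 \<le> Ir M r X"
  unfolding Ir_def by (rule Bochner_Integration.integral_nonneg) simp

lemma Lr_bound:
  assumes "Lr M r X" "Y \<in> borel_measurable M" "AE z in M. norm (Y z) \<le> norm (X z)" "r > 0"
  shows "Lr M r Y"
  unfolding Lr_def
proof
  show "integrable M (\<lambda>z. norm (Y z) powr r)"
  proof (rule Bochner_Integration.integrable_bound[OF LrD(2)[OF assms(1)]])
    show "(\<lambda>z. norm (Y z) powr r) \<in> borel_measurable M"
      using assms(2) by measurable
    show "AE z in M. norm (norm (Y z) powr r) \<le> norm (norm (X z) powr r)"
      using assms(3) by eventually_elim (use assms(4) in \<open>auto intro!: powr_mono2\<close>)
  qed
qed fact

lemma Ir_mono_AE: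
  assumes "Lr M r X" "Y \<in> borel_measurable M" "AE z in M. norm (Y z) \<le> norm (X z)" "r > 0"
  shows "Ir M r Y \<le> Ir M r X"
  unfolding Ir_def
  by (rule integral_mono_AE[OF LrD(2)[OF Lr_bound[OF assms]] LrD(2)[OF assms(1)]])
    (use assms(3) in eventually_elim, use assms(4) in \<open>auto intro!: powr_mono2\<close>)

lemma Lr_cong_AE:
  assumes "Lr M r X" "Y \<in> borel_measurable M" "AE z in M. Y z = X z" "r > 0"
  shows "Lr M r Y" "Ir M r Y = Ir M r X"
proof -
  have "AE z in M. norm (Y z) \<le> norm (X z)" "AE z in M. norm (X z) \<le> norm (Y z)"
    using assms(3) by auto
  then show "Lr M r Y" and "Ir M r Y = Ir M r X"
    using Lr_bound[OF assms(1,2)] Ir_mono_AE[OF assms(1,2)] Ir_mono_AE[of M r Y X] LrD(1)[OF assms(1)] assms(4)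
    by auto
qed

lemma Lr_scaleR:
  assumes "Lr M r X"
  shows "Lr M r (\<lambda>z. c *\<^sub>R X z)" "Ir M r (\<lambda>z. c *\<^sub>R X z) = \<bar>c\<bar> powr r * Ir M r X"
proof -
  have [measurable]: "X \<in> borel_measurable M" by (rule LrD(1)[OF assms])
  have e: "norm (c *\<^sub>R X z) powr r = \<bar>c\<bar> powr r * norm (X z) powr r" for z
    by (simp add: powr_mult)
  show "Lr M r (\<lambda>z. c *\<^sub>R X z)" "Ir M r (\<lambda>z. c *\<^sub>R X z) = \<bar>c\<bar> powr r * Ir M r X"
    unfolding Lr_def Ir_def e using LrD(2)[OF assms] by auto
qed

lemma Lr_add:
  assumes X: "Lr M r X" and Y: "Lr M r Y" and r: "r > 0"
  shows "Lr M r (\<lambda>z. X z + Y z)" "Ir M r (\<lambda>z. X z + Y z) \<le> 2 powr r * (Ir M r X + Ir M r Y)"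
proof -
  have [measurable]: "X \<in> borel_measurable M" "Y \<in> borel_measurable M"
    using X Y LrD by blast+
  have i: "integrable M (\<lambda>z. 2 powr r * (norm (X z) powr r + norm (Y z) powr r))"
    by (intro integrable_mult_right Bochner_Integration.integrable_add LrD(2) X Y)
  have le: "norm (X z + Y z) powr r \<le> 2 powr r * (norm (X z) powr r + norm (Y z) powr r)" for z
    using r by (rule norm_add_powr_le)
  have j: "integrable M (\<lambda>z. norm (X z + Y z) powr r)"
    by (rule Bochner_Integration.integrable_bound[OF i]) (use le in \<open>auto simp: abs_of_nonneg\<close>)
  then show "Lr M r (\<lambda>z. X z + Y z)" by (simp add: Lr_def)
  have "Ir M r (\<lambda>z. X z + Y z) \<le> (LINT z|M. 2 powr r * (norm (X z) powr r + norm (Y z) powr r))"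
    unfolding Ir_def by (rule integral_mono[OF j i le])
  also have "\<dots> = 2 powr r * (Ir M r X + Ir M r Y)"
    using LrD(2)[OF X] LrD(2)[OF Y] by (simp add: Ir_def)
  finally show "Ir M r (\<lambda>z. X z + Y z) \<le> 2 powr r * (Ir M r X + Ir M r Y)" .
qed

lemma Lr_diff:
  assumes X: "Lr M r X" and Y: "Lr M r Y" and r: "r > 0"
  shows "Lr M r (\<lambda>z. X z - Y z)" "Ir M r (\<lambda>z. X z - Y z) \<le> 2 powr r * (Ir M r X + Ir M r Y)"
  using Lr_add[OF X Lr_scaleR(1)[OF Y, of "-1"] r] Lr_scaleR(2)[OF Y, of "-1"] by simp_all

lemma Ir_diff_commute: "Ir M r (\<lambda>z. X z - Y z) = Ir M r (\<lambda>z. Y z - X z)"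
  by (simp add: Ir_def norm_minus_commute)

lemma Ir_zero_AE:
  assumes "Lr M r X" "Ir M r X = 0"
  shows "AE z in M. X z = 0"
  using integral_nonneg_eq_0_iff_AE[OF LrD(2)[OF assms(1)]] assms(2) by (simp add: Ir_def)

lemma Ir_tendsto:
  assumes X: "\<And>n. Lr M r (X n)" and Y: "Lr M r Y" and r: "r \<ge> 1"
    and lim: "(\<lambda>n. Ir M r (\<lambda>z. X n z - Y z)) \<longlonglongrightarrow> 0"
  shows "(\<lambda>n. Ir M r (X n)) \<longlonglongrightarrow> Ir M r Y"
proof (rule LIMSEQ_I)
  fix e :: real assume e: "e > 0"
  \<comment> \<open>Makes the first term of the pointwise inequality cost at most
    \<open>e / 2\<close> after integration; the summand 1 covers the case that
    \<open>Ir M r Y\<close> is 0.\<close>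
  let ?\<eta> = "e / (2 * (Ir M r Y + 1))"
  have I: "Ir M r Y + 1 > 0" using Ir_nonneg[of M r Y] by linarith
  then have \<eta>: "?\<eta> > 0" using e by simp
  obtain C where C: "C \<ge> 0" "\<forall>x y::'b. \<bar>norm x powr r - norm y powr r\<bar> \<le> ?\<eta> * norm x powr r + C * norm (x - y) powr r"
    by (rule norm_powr_diff_le[OF r \<eta>])
  have D: "Lr M r (\<lambda>z. X n z - Y z)" for n
    using Lr_diff(1)[OF X Y] r by simp
  have key: "\<bar>Ir M r (X n) - Ir M r Y\<bar> \<le> ?\<eta> * Ir M r Y + C * Ir M r (\<lambda>z. X n z - Y z)" for n
  proof -
    have "\<bar>Ir M r (X n) - Ir M r Y\<bar> = \<bar>LINT z|M. norm (X n z) powr r - norm (Y z) powr r\<bar>"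
      using LrD(2)[OF X] LrD(2)[OF Y] by (simp add: Ir_def)
    also have "\<dots> \<le> (LINT z|M. \<bar>norm (X n z) powr r - norm (Y z) powr r\<bar>)"
      by (rule integral_abs_bound)
    also have "\<dots> \<le> (LINT z|M. ?\<eta> * norm (Y z) powr r + C * norm (X n z - Y z) powr r)"
    proof (intro integral_mono integrable_abs Bochner_Integration.integrable_diff Bochner_Integration.integrable_add integrable_mult_right LrD(2) X Y D)
      fix z
      show "\<bar>norm (X n z) powr r - norm (Y z) powr r\<bar> \<le> ?\<eta> * norm (Y z) powr r + C * norm (X n z - Y z) powr r"
        using C(2)[rule_format, of "Y z" "X n z"] by (simp add: norm_minus_commute abs_minus_commute)
    qed
    also have "\<dots> = ?\<eta> * Ir M r Y + C * Ir M r (\<lambda>z. X n z - Y z)"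
      using LrD(2)[OF Y] LrD(2)[OF D] by (simp add: Ir_def)
    finally show ?thesis .
  qed
  have "(\<lambda>n. C * Ir M r (\<lambda>z. X n z - Y z)) \<longlonglongrightarrow> 0"
    using tendsto_mult_right_zero[OF lim] by simp
  then obtain N where N: "\<forall>n\<ge>N. norm (C * Ir M r (\<lambda>z. X n z - Y z) - 0) < e / 2"
    using LIMSEQ_D[of _ 0 "e / 2"] e by (meson half_gt_zero)
  have h: "?\<eta> * Ir M r Y \<le> e / 2"
    using I e by (simp add: field_simps)
  have c: "C * Ir M r (\<lambda>z. X n z - Y z) < e / 2" if "n \<ge> N" for n
    using N that by fastforce
  have "norm (Ir M r (X n) - Ir M r Y) < e" if n: "n \<ge> N" for n
    using key[of n] c[OF n] h unfolding real_norm_def by linarith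
  then show "\<exists>N. \<forall>n\<ge>N. norm (Ir M r (X n) - Ir M r Y) < e" by blast
qed

text \<open>Dominated convergence with majorants that vary but converge. This form is required
  because the approximating test functions are controlled only by their own differences and
  gradients.\<close>

lemma Ir_dominated:
  assumes X[measurable]: "\<And>n. X n \<in> borel_measurable M" and X0[measurable]: "X0 \<in> borel_measurable M"
    and Y: "\<And>n. Lr M r (Y n)" and Y0: "Lr M r Y0" and r: "r > 0"
    and XY: "\<And>n. AE z in M. norm (X n z) \<le> norm (Y n z)" and XY0: "AE z in M. norm (X0 z) \<le> norm (Y0 z)"
    and lim: "AE z in M. (\<lambda>n. X n z) \<longlonglongrightarrow> X0 z"
    and limY: "(\<lambda>n. Ir M r (\<lambda>z. Y n z - Y0 z)) \<longlonglongrightarrow> 0"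
  shows "(\<lambda>n. Ir M r (\<lambda>z. X n z - X0 z)) \<longlonglongrightarrow> 0"
proof -
  \<comment> \<open>The excess of the error over the error of the majorants. Unlike the error itself
    it lies below the fixed function \<open>2 * norm (Y0 z)\<close>, so ordinary dominated
    convergence applies to it.\<close>
  define Z where "Z n z = max 0 (norm (X n z - X0 z) - norm (Y n z - Y0 z))" for n z
  have mY[measurable]: "Y n \<in> borel_measurable M" "Y0 \<in> borel_measurable M" for n
    using Y Y0 LrD by blast+
  have mZ[measurable]: "Z n \<in> borel_measurable M" for n
    unfolding Z_def by measurable
  have Z0: "Z n z \<ge> 0" for n z by (simp add: Z_def)
  have Zb: "AE z in M. norm (Z n z) \<le> norm (2 *\<^sub>R Y0 z)" for n
    using XY[of n] XY0
  proof eventually_elim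
    case (elim z)
    have "norm (X n z - X0 z) \<le> norm (Y n z) + norm (Y0 z)"
      using norm_triangle_ineq4[of "X n z" "X0 z"] elim by linarith
    also have "norm (Y n z) \<le> norm (Y n z - Y0 z) + norm (Y0 z)"
      using norm_triangle_ineq[of "Y n z - Y0 z" "Y0 z"] by simp
    finally show ?case by (simp add: Z_def)
  qed
  have Lz: "Lr M r (Z n)" for n
    by (rule Lr_bound[OF Lr_scaleR(1)[OF Y0, of 2] mZ Zb r])
  have "(\<lambda>n. LINT z|M. norm (Z n z) powr r) \<longlonglongrightarrow> (LINT z|M. 0)"
  proof (rule integral_dominated_convergence[where w="\<lambda>z. norm (2 *\<^sub>R Y0 z) powr r"])
    show "(\<lambda>z. norm (Z n z) powr r) \<in> borel_measurable M" for n by measurable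
    show "integrable M (\<lambda>z. norm (2 *\<^sub>R Y0 z) powr r)"
      by (rule LrD(2)[OF Lr_scaleR(1)[OF Y0]])
    show "AE z in M. norm (norm (Z n z) powr r) \<le> norm (2 *\<^sub>R Y0 z) powr r" for n
      using Zb[of n] by eventually_elim (use r in \<open>auto intro!: powr_mono2\<close>)
    show "AE z in M. (\<lambda>n. norm (Z n z) powr r) \<longlonglongrightarrow> 0"
      using lim
    proof eventually_elim
      case (elim z)
      have 1: "(\<lambda>n. norm (X n z - X0 z)) \<longlonglongrightarrow> 0"
        using elim by (simp add: tendsto_norm_zero LIM_zero)
      have "(\<lambda>n. norm (Z n z)) \<longlonglongrightarrow> 0"
        by (rule tendsto_sandwich[OF _ _ tendsto_const 1]) (auto simp: Z_def)
      then have "(\<lambda>n. norm (Z n z) powr r) \<longlonglongrightarrow> 0 powr r"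
        using r by (intro tendsto_powr' tendsto_const) auto
      then show ?case by simp
    qed
  qed auto
  then have IZ: "(\<lambda>n. Ir M r (Z n)) \<longlonglongrightarrow> 0"
    by (simp add: Ir_def)
  define W where "W n z = Z n z + norm (Y n z - Y0 z)" for n z
  have LY: "Lr M r (\<lambda>z. norm (Y n z - Y0 z))" for n
    by (rule Lr_bound[OF Lr_diff(1)[OF Y Y0 r]]) (use r in auto)
  have IY: "Ir M r (\<lambda>z. norm (Y n z - Y0 z)) = Ir M r (\<lambda>z. Y n z - Y0 z)" for n
    by (simp add: Ir_def)
  have up: "Ir M r (\<lambda>z. X n z - X0 z) \<le> 2 powr r * (Ir M r (Z n) + Ir M r (\<lambda>z. Y n z - Y0 z))" for n
  proof -
    have "Ir M r (\<lambda>z. X n z - X0 z) \<le> Ir M r (W n)"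
    proof (rule Ir_mono_AE[OF _ _ _ r])
      show "Lr M r (W n)" unfolding W_def by (rule Lr_add(1)[OF Lz LY r])
      show "AE z in M. norm (X n z - X0 z) \<le> norm (W n z)"
        by (rule AE_I2) (auto simp: W_def Z_def)
    qed measurable
    also have "\<dots> \<le> 2 powr r * (Ir M r (Z n) + Ir M r (\<lambda>z. Y n z - Y0 z))"
      using Lr_add(2)[OF Lz LY r, of n n] unfolding W_def IY .
    finally show ?thesis .
  qed
  have "(\<lambda>n. 2 powr r * (Ir M r (Z n) + Ir M r (\<lambda>z. Y n z - Y0 z))) \<longlonglongrightarrow> 2 powr r * (0 + 0)"
    by (intro tendsto_mult_left tendsto_add IZ limY)
  then have l: "(\<lambda>n. 2 powr r * (Ir M r (Z n) + Ir M r (\<lambda>z. Y n z - Y0 z))) \<longlonglongrightarrow> 0" by simp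
  show ?thesis
    by (rule tendsto_sandwich[OF _ _ tendsto_const l]) (simp_all add: Ir_nonneg up)
qed

text \<open>Integrates the pointwise inequality. The threshold \<open>d\<close> depends only on the
  bound \<open>B\<close> and on \<open>e\<close>, so it serves all pairs of a bounded sequence at
  once.\<close>

lemma Ir_uniform_convex:
  assumes r: "r > 1" and e: "e > 0"
  obtains d where "d > 0" "\<forall>X Y :: 'c \<Rightarrow> 'b::euclidean_space. Lr M r X \<longrightarrow> Lr M r Y \<longrightarrow> Ir M r X \<le> B \<longrightarrow> Ir M r Y \<le> B \<longrightarrow>
     (Ir M r X + Ir M r Y) / 2 - Ir M r (\<lambda>z. (1/2) *\<^sub>R (X z + Y z)) < d \<longrightarrow> Ir M r (\<lambda>z. X z - Y z) < e"
proof -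
  define B' where "B' = max B 1"
  have B': "B' > 0" "B \<le> B'" by (auto simp: B'_def)
  \<comment> \<open>Two functions bounded by \<open>B'\<close> then contribute at most
    \<open>e / 2\<close> to the first term; \<open>d\<close> is fitted to the other half.\<close>
  define \<epsilon> where "\<epsilon> = e / (4 * B')"
  have \<epsilon>: "\<epsilon> > 0" using e B' by (simp add: \<epsilon>_def)
  obtain C where C: "C \<ge> 0" "\<forall>x y::'b. norm (x - y) powr r \<le>
    \<epsilon> * (norm x powr r + norm y powr r) + C * ((norm x powr r + norm y powr r) / 2 - norm ((1/2) *\<^sub>R (x + y)) powr r)"
    by (rule norm_powr_uniform_convex[OF r \<epsilon>])
  define d where "d = e / (2 * (C + 1))"
  have d: "d > 0" using e C by (simp add: d_def)
  have "Ir M r (\<lambda>z. X z - Y z) < e"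
    if X: "Lr M r X" and Y: "Lr M r Y" and b: "Ir M r X \<le> B" "Ir M r Y \<le> B"
      and def: "(Ir M r X + Ir M r Y) / 2 - Ir M r (\<lambda>z. (1/2) *\<^sub>R (X z + Y z)) < d" for X Y :: "'c \<Rightarrow> 'b"
  proof -
    have r0: "r > 0" using r by simp
    have M: "Lr M r (\<lambda>z. (1/2) *\<^sub>R (X z + Y z))"
      by (rule Lr_scaleR(1)[OF Lr_add(1)[OF X Y r0]])
    note i = LrD(2)[OF X] LrD(2)[OF Y] LrD(2)[OF M] LrD(2)[OF Lr_diff(1)[OF X Y r0]]
    have "Ir M r (\<lambda>z. X z - Y z) \<le> (LINT z|M. \<epsilon> * (norm (X z) powr r + norm (Y z) powr r) + C * ((norm (X z) powr r + norm (Y z) powr r) / 2 - norm ((1/2) *\<^sub>R (X z + Y z)) powr r))"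
      unfolding Ir_def
      by (intro integral_mono Bochner_Integration.integrable_add Bochner_Integration.integrable_diff integrable_mult_right integrable_divide_zero i)
        (use C(2) i in auto)
    also have "\<dots> = (LINT z|M. \<epsilon> * (norm (X z) powr r + norm (Y z) powr r)) + (LINT z|M. C * ((norm (X z) powr r + norm (Y z) powr r) / 2 - norm ((1/2) *\<^sub>R (X z + Y z)) powr r))"
      by (intro Bochner_Integration.integral_add Bochner_Integration.integrable_add Bochner_Integration.integrable_diff integrable_mult_right integrable_divide_zero i)
    also have "(LINT z|M. \<epsilon> * (norm (X z) powr r + norm (Y z) powr r)) = \<epsilon> * (Ir M r X + Ir M r Y)"
      unfolding Ir_def by (subst Bochner_Integration.integral_add[symmetric, OF i(1) i(2)]) simp
    also have "(LINT z|M. C * ((norm (X z) powr r + norm (Y z) powr r) / 2 - norm ((1/2) *\<^sub>R (X z + Y z)) powr r)) =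
       C * ((Ir M r X + Ir M r Y) / 2 - Ir M r (\<lambda>z. (1/2) *\<^sub>R (X z + Y z)))"
    proof -
      have "integrable M (\<lambda>z. (norm (X z) powr r + norm (Y z) powr r) / 2)"
        using i by (intro integrable_divide_zero Bochner_Integration.integrable_add) auto
      from Bochner_Integration.integral_diff[OF this i(3)] show ?thesis
        unfolding Ir_def by (simp add: i(1,2) del: norm_scaleR)
    qed
    finally have "Ir M r (\<lambda>z. X z - Y z) \<le> \<epsilon> * (Ir M r X + Ir M r Y) + C * ((Ir M r X + Ir M r Y) / 2 - Ir M r (\<lambda>z. (1/2) *\<^sub>R (X z + Y z)))" .
    also have "\<epsilon> * (Ir M r X + Ir M r Y) \<le> \<epsilon> * (B' + B')"
      using b B' \<epsilon> by (intro mult_left_mono) auto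
    also have "\<epsilon> * (B' + B') = e / 2" using B' by (simp add: \<epsilon>_def)
    also have "C * ((Ir M r X + Ir M r Y) / 2 - Ir M r (\<lambda>z. (1/2) *\<^sub>R (X z + Y z))) \<le> C * d"
      using def C by (intro mult_left_mono) auto
    also have "C * d < e / 2" using C e by (simp add: d_def field_simps)
    finally show ?thesis by simp
  qed
  with d that show ?thesis by blast
qed

lemma Ir_midpoint_le:
  assumes X: "Lr M r X" and Y: "Lr M r Y" and r: "r > 1"
  shows "Ir M r (\<lambda>z. (1/2) *\<^sub>R (X z + Y z)) \<le> (Ir M r X + Ir M r Y) / 2"
proof -
  have r0: "r > 0" using r by simp
  note i = LrD(2)[OF X] LrD(2)[OF Y] LrD(2)[OF Lr_scaleR(1)[OF Lr_add(1)[OF X Y r0], of "1/2"]]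
  have j: "integrable M (\<lambda>z. (norm (X z) powr r + norm (Y z) powr r) / 2)"
    using i by (intro integrable_divide_zero Bochner_Integration.integrable_add) auto
  have "Ir M r (\<lambda>z. (1/2) *\<^sub>R (X z + Y z)) \<le> (LINT z|M. (norm (X z) powr r + norm (Y z) powr r) / 2)"
    unfolding Ir_def by (rule integral_mono[OF i(3) j norm_midpoint_powr[OF r]])
  also have "\<dots> = (Ir M r X + Ir M r Y) / 2"
    by (simp add: Ir_def i(1,2))
  finally show ?thesis .
qed

text \<open>One r-th of the derivative of \<open>Ir M r\<close> at \<open>X\<close> in direction
  \<open>Y\<close>. Summed over the three measures it becomes the left-hand side of the weak
  formulation.\<close>

definition Dr :: "'c measure \<Rightarrow> real \<Rightarrow> ('c \<Rightarrow> 'b::euclidean_space) \<Rightarrow> ('c \<Rightarrow> 'b) \<Rightarrow> real" where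
  "Dr M r X Y = (LINT z|M. norm (X z) powr (r - 2) * (X z \<bullet> Y z))"

lemma Dr_integrable:
  assumes X: "Lr M r X" and Y: "Lr M r Y" and r: "r > 1"
  shows "integrable M (\<lambda>z. norm (X z) powr (r - 2) * (X z \<bullet> Y z))"
proof (rule Bochner_Integration.integrable_bound)
  have [measurable]: "X \<in> borel_measurable M" "Y \<in> borel_measurable M"
    using X Y LrD by blast+
  show "integrable M (\<lambda>z. norm (X z) powr r + norm (Y z) powr r)"
    by (intro Bochner_Integration.integrable_add LrD(2) X Y)
  show "(\<lambda>z. norm (X z) powr (r - 2) * (X z \<bullet> Y z)) \<in> borel_measurable M"
    by measurable
  show "AE z in M. norm (norm (X z) powr (r - 2) * (X z \<bullet> Y z)) \<le> norm (norm (X z) powr r + norm (Y z) powr r)"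
    by (rule AE_I2) (use norm_powr_inner_le[OF r] in auto)
qed

text \<open>The steps \<open>1 / (n + 1)\<close> suffice: minimality only compares with
  \<open>u + t v\<close> for small positive \<open>t\<close>, and the opposite direction is obtained
  from \<open>-v\<close>.\<close>

lemma Ir_derivative:
  assumes X: "Lr M r X" and Y: "Lr M r Y" and r: "r > 1"
  shows "(\<lambda>n. (Ir M r (\<lambda>z. X z + inverse (real (Suc n)) *\<^sub>R Y z) - Ir M r X) / inverse (real (Suc n))) \<longlonglongrightarrow> r * Dr M r X Y"
proof -
  have r0: "r > 0" using r by simp
  have [measurable]: "X \<in> borel_measurable M" "Y \<in> borel_measurable M"
    using X Y LrD by blast+
  let ?t = "\<lambda>n. inverse (real (Suc n))"
  have t: "0 < ?t n" "?t n \<le> 1" for n by (auto simp: field_simps)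
  let ?q = "\<lambda>n z. (norm (X z + ?t n *\<^sub>R Y z) powr r - norm (X z) powr r) / ?t n"
  have i: "integrable M (\<lambda>z. norm (X z + ?t n *\<^sub>R Y z) powr r)" for n
    by (rule LrD(2)[OF Lr_add(1)[OF X Lr_scaleR(1)[OF Y] r0]])
  have "(\<lambda>n. LINT z|M. ?q n z) \<longlonglongrightarrow> (LINT z|M. r * (norm (X z) powr (r - 2) * (X z \<bullet> Y z)))"
  proof (rule integral_dominated_convergence[where w="\<lambda>z. r * 2 powr r * (norm (X z) powr r + norm (Y z) powr r)"])
    show "(\<lambda>z. r * (norm (X z) powr (r - 2) * (X z \<bullet> Y z))) \<in> borel_measurable M" by measurable
    show "?q n \<in> borel_measurable M" for n by measurable
    show "integrable M (\<lambda>z. r * 2 powr r * (norm (X z) powr r + norm (Y z) powr r))"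
      by (intro integrable_mult_right Bochner_Integration.integrable_add LrD(2) X Y)
    show "AE z in M. norm (?q n z) \<le> r * 2 powr r * (norm (X z) powr r + norm (Y z) powr r)" for n
      by (rule AE_I2) (use norm_powr_direction[OF r t(1)[of n] t(2)[of n]] in \<open>simp only: real_norm_def\<close>)
    show "AE z in M. (\<lambda>n. ?q n z) \<longlonglongrightarrow> r * (norm (X z) powr (r - 2) * (X z \<bullet> Y z))"
    proof (rule AE_I2)
      fix z
      have "((\<lambda>h. (norm (X z + (0 + h) *\<^sub>R Y z) powr r - norm (X z + 0 *\<^sub>R Y z) powr r) / h) \<longlongrightarrow> r * (norm (X z) powr (r - 2) * (X z \<bullet> Y z))) (at 0)"
        using norm_powr_has_derivative_along[OF r] unfolding DERIV_def .
      then have l: "((\<lambda>h. (norm (X z + h *\<^sub>R Y z) powr r - norm (X z) powr r) / h) \<longlongrightarrow> r * (norm (X z) powr (r - 2) * (X z \<bullet> Y z))) (at 0)"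
        by simp
      have "filterlim ?t (at 0) sequentially"
        unfolding filterlim_at using LIMSEQ_inverse_real_of_nat by (auto simp del: of_nat_Suc)
      from filterlim_compose[OF l this] show "(\<lambda>n. ?q n z) \<longlonglongrightarrow> r * (norm (X z) powr (r - 2) * (X z \<bullet> Y z))" .
    qed
  qed
  moreover have "(LINT z|M. ?q n z) = (Ir M r (\<lambda>z. X z + ?t n *\<^sub>R Y z) - Ir M r X) / ?t n" for n
    unfolding Ir_def integral_divide_zero
    by (subst Bochner_Integration.integral_diff[OF i LrD(2)[OF X]]) (rule refl)
  ultimately show ?thesis
    by (simp only: Dr_def integral_mult_right_zero)
qed

lemma Dr_minus: "Dr M r X (\<lambda>z. - Y z) = - Dr M r X Y"
  by (simp add: Dr_def)

lemma Lr_imp_integrable: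
  assumes X: "Lr M r X" and A: "A \<in> sets M" "emeasure M A < \<infinity>" and r: "r \<ge> 1"
  shows "integrable M (\<lambda>z. indicator A z *\<^sub>R X z)"
    and "\<eta> > 0 \<Longrightarrow> (LINT z|M. indicator A z * norm (X z)) \<le> \<eta> * measure M A + \<eta> powr (1 - r) * Ir M r X"
proof -
  have [measurable]: "X \<in> borel_measurable M" using X LrD by blast
  have ind: "integrable M (indicat_real A)"
    using A by (intro integrable_real_indicator)
  have i: "integrable M (\<lambda>z. \<eta> * indicator A z + \<eta> powr (1 - r) * norm (X z) powr r)" for \<eta>
    by (intro Bochner_Integration.integrable_add integrable_mult_right ind LrD(2)[OF X])
  have le: "indicator A z * norm (X z) \<le> \<eta> * indicator A z + \<eta> powr (1 - r) * norm (X z) powr r" if "\<eta> > 0" for \<eta> z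
    using le_add_powr[of "norm (X z)" \<eta> r] that r by (auto simp: indicator_def)
  show j: "integrable M (\<lambda>z. indicator A z *\<^sub>R X z)"
  proof (rule Bochner_Integration.integrable_bound[OF i[of 1]])
    show "AE z in M. norm (indicat_real A z *\<^sub>R X z) \<le> norm (1 * indicat_real A z + 1 powr (1 - r) * norm (X z) powr r)"
      by (rule AE_I2) (use le[of 1] in \<open>auto simp: abs_of_nonneg\<close>)
  qed (use A in measurable)
  assume \<eta>: "\<eta> > 0"
  have "(LINT z|M. indicator A z * norm (X z)) \<le> (LINT z|M. \<eta> * indicator A z + \<eta> powr (1 - r) * norm (X z) powr r)"
  proof (rule integral_mono[OF _ i le[OF \<eta>]])
    show "integrable M (\<lambda>z. indicat_real A z * norm (X z))"
      using integrable_norm[OF j] by simp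
  qed
  also have "\<dots> = \<eta> * measure M A + \<eta> powr (1 - r) * Ir M r X"
    using ind LrD(2)[OF X] A by (simp add: Ir_def)
  finally show "(LINT z|M. indicator A z * norm (X z)) \<le> \<eta> * measure M A + \<eta> powr (1 - r) * Ir M r X" .
qed

lemma Ir_tendsto_imp_L1:
  assumes X: "\<And>n. Lr M r (X n)" and A: "A \<in> sets M" "emeasure M A < \<infinity>" and r: "r \<ge> 1"
    and lim: "(\<lambda>n. Ir M r (X n)) \<longlonglongrightarrow> 0"
  shows "(\<lambda>n. LINT z|M. indicator A z * norm (X n z)) \<longlonglongrightarrow> 0"
proof (rule LIMSEQ_I)
  fix e :: real assume e: "e > 0"
  define \<eta> where "\<eta> = e / (2 * (measure M A + 1))"
  have mA: "measure M A + 1 > 0" by (simp add: add_nonneg_pos)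
  then have \<eta>: "\<eta> > 0" "\<eta> * measure M A \<le> e / 2" using e by (auto simp: \<eta>_def field_simps)
  have "(\<lambda>n. \<eta> powr (1 - r) * Ir M r (X n)) \<longlonglongrightarrow> 0"
    using tendsto_mult_right_zero[OF lim] by simp
  then obtain N where N: "\<forall>n\<ge>N. norm (\<eta> powr (1 - r) * Ir M r (X n) - 0) < e / 2"
    using LIMSEQ_D[of _ 0 "e / 2"] e by (meson half_gt_zero)
  have "norm ((LINT z|M. indicator A z * norm (X n z)) - 0) < e" if "n \<ge> N" for n
  proof -
    have "0 \<le> (LINT z|M. indicator A z * norm (X n z))"
      by (rule Bochner_Integration.integral_nonneg) simp
    moreover have "(LINT z|M. indicator A z * norm (X n z)) \<le> \<eta> * measure M A + \<eta> powr (1 - r) * Ir M r (X n)"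
      by (rule Lr_imp_integrable(2)[OF X A r \<eta>(1)])
    moreover have "\<eta> powr (1 - r) * Ir M r (X n) < e / 2"
      using N that by fastforce
    ultimately show ?thesis using \<eta>(2) by simp
  qed
  then show "\<exists>N. \<forall>n\<ge>N. norm ((LINT z|M. indicator A z * norm (X n z)) - 0) < e" by blast
qed

section \<open>The Gagliardo measure\<close>

lemma sigma_finite_lebesgue: "sigma_finite_measure (lebesgue :: 'a::euclidean_space measure)"
proof
  have "emeasure lebesgue (cball (0::'a) (real n)) \<noteq> \<infinity>" for n
    using emeasure_bounded_finite[OF bounded_cball, of "0::'a" "real n"] by simp
  moreover have "(\<Union>n. cball (0::'a) (real n)) = UNIV"
    using real_arch_simple by (auto simp: dist_norm)
  ultimately show "\<exists>A::'a set set. countable A \<and> A \<subseteq> sets lebesgue \<and> \<Union> A = space lebesgue \<and> (\<forall>a\<in>A. emeasure lebesgue a \<noteq> \<infinity>)"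
    by (intro exI[of _ "range (\<lambda>n. cball (0::'a) (real n))"]) auto
qed

interpretation lebesgue: sigma_finite_measure "lebesgue :: 'a::euclidean_space measure"
  by (rule sigma_finite_lebesgue)

interpretation leb2: pair_sigma_finite "lebesgue :: 'a::euclidean_space measure" "lebesgue :: 'a measure"
  by unfold_locales

text \<open>The product of the completed measures rather than the completion of the product: Fubini
  then yields exactly the iterated \<open>lebesgue\<close> integrals of the definitions.\<close>

abbreviation leb2 :: "('a::euclidean_space \<times> 'a) measure" where
  "leb2 \<equiv> lebesgue \<Otimes>\<^sub>M lebesgue"

lemma id_borel_measurable_lebesgue: "(\<lambda>x::'a::euclidean_space. x) \<in> borel_measurable lebesgue"
  by (rule continuous_borel_measurable_lebesgue) (rule continuous_on_id)

lemma fst_leb2_measurable: "fst \<in> borel_measurable (leb2 :: ('a::euclidean_space \<times> 'a) measure)"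
  by (rule measurable_compose[OF measurable_fst id_borel_measurable_lebesgue])

lemma snd_leb2_measurable: "snd \<in> borel_measurable (leb2 :: ('a::euclidean_space \<times> 'a) measure)"
  by (rule measurable_compose[OF measurable_snd id_borel_measurable_lebesgue])

text \<open>For \<open>\<sigma> = N + s p\<close> the Gagliardo seminorm of \<open>u\<close> becomes the \<open>p\<close>-norm of \<open>dl u\<close> with respect
  to the measure \<open>gag \<sigma>\<close>.\<close>

definition kern :: "real \<Rightarrow> 'a::euclidean_space \<times> 'a \<Rightarrow> real" where
  "kern \<sigma> z = 1 / norm (fst z - snd z) powr \<sigma>"

definition gag :: "real \<Rightarrow> ('a::euclidean_space \<times> 'a) measure" where
  "gag \<sigma> = density leb2 (\<lambda>z. ennreal (kern \<sigma> z))"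

definition dl :: "('a::euclidean_space \<Rightarrow> real) \<Rightarrow> 'a \<times> 'a \<Rightarrow> real" where
  "dl u z = u (fst z) - u (snd z)"

lemma kern_nonneg: "0 \<le> kern \<sigma> z"
  by (simp add: kern_def)

lemma norm_diff_leb2_measurable [measurable]:
  "(\<lambda>z::'a::euclidean_space \<times> 'a. norm (fst z - snd z)) \<in> borel_measurable leb2"
  using borel_measurable_diff[OF fst_leb2_measurable snd_leb2_measurable] by measurable

lemma kern_measurable [measurable]: "kern \<sigma> \<in> borel_measurable leb2"
  unfolding kern_def by measurable

lemma sets_gag [measurable_cong, simp]: "sets (gag \<sigma>) = sets leb2"
  by (simp add: gag_def)

lemma space_gag [simp]: "space (gag \<sigma>) = UNIV"
  by (simp add: gag_def space_pair_measure)

lemma borel_measurable_gag_iff: "f \<in> borel_measurable (gag \<sigma>) \<longleftrightarrow> f \<in> borel_measurable leb2"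
  by (simp add: gag_def)

lemma dl_measurable_leb2:
  assumes "u \<in> borel_measurable lebesgue"
  shows "dl u \<in> borel_measurable leb2"
  unfolding dl_def
  using measurable_compose[OF measurable_fst assms] measurable_compose[OF measurable_snd assms]
  by (intro borel_measurable_diff)

lemma dl_measurable:
  assumes "u \<in> borel_measurable lebesgue"
  shows "dl u \<in> borel_measurable (gag \<sigma>)"
  using dl_measurable_leb2[OF assms] by (simp add: borel_measurable_gag_iff)

lemma nn_integral_gag:
  fixes f :: "'a::euclidean_space \<times> 'a \<Rightarrow> real"
  assumes [measurable]: "f \<in> borel_measurable leb2" and f: "\<And>z. 0 \<le> f z"
  shows "(\<integral>\<^sup>+z. ennreal (f z) \<partial>gag \<sigma>) =
    (\<integral>\<^sup>+x. (\<integral>\<^sup>+y. ennreal (f (x, y) / norm (x - y) powr \<sigma>) \<partial>lebesgue) \<partial>lebesgue)"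
proof -
  have "(\<integral>\<^sup>+z. ennreal (f z) \<partial>gag \<sigma>) = (\<integral>\<^sup>+z. ennreal (kern \<sigma> z) * ennreal (f z) \<partial>leb2)"
    unfolding gag_def by (rule nn_integral_density) measurable
  also have "\<dots> = (\<integral>\<^sup>+x. (\<integral>\<^sup>+y. ennreal (kern \<sigma> (x, y)) * ennreal (f (x, y)) \<partial>lebesgue) \<partial>lebesgue)"
    by (rule lebesgue.nn_integral_fst[symmetric]) measurable
  also have "\<dots> = (\<integral>\<^sup>+x. (\<integral>\<^sup>+y. ennreal (f (x, y) / norm (x - y) powr \<sigma>) \<partial>lebesgue) \<partial>lebesgue)"
    using f by (simp add: kern_def ennreal_mult[symmetric])
  finally show ?thesis .
qed

lemma integral_gag:
  fixes f :: "'a::euclidean_space \<times> 'a \<Rightarrow> real"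
  assumes f: "integrable (gag \<sigma>) f"
  shows "(LINT z|gag \<sigma>. f z) = (LINT x|lebesgue. (LINT y|lebesgue. f (x, y) / norm (x - y) powr \<sigma>))"
proof -
  have m: "f \<in> borel_measurable leb2"
    using f borel_measurable_gag_iff by blast
  have "integrable leb2 (\<lambda>z. kern \<sigma> z *\<^sub>R f z)"
    using f m unfolding gag_def by (subst (asm) integrable_density) (auto simp: kern_nonneg)
  then have "(LINT x|lebesgue. (LINT y|lebesgue. kern \<sigma> (x, y) *\<^sub>R f (x, y))) = (LINT z|leb2. kern \<sigma> z *\<^sub>R f z)"
    by (rule leb2.integral_fst')
  moreover have "(LINT z|gag \<sigma>. f z) = (LINT z|leb2. kern \<sigma> z *\<^sub>R f z)"
    unfolding gag_def using m by (intro integral_density) (auto simp: kern_nonneg)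
  ultimately show ?thesis
    by (simp add: kern_def)
qed

text \<open>A null set of points gives two null strips in the product. This is how pointwise
  convergence of \<open>u\<close> reaches \<open>dl u\<close>.\<close>

lemma AE_gag:
  assumes "AE x in lebesgue. P x"
  shows "AE z in gag \<sigma>. P (fst z) \<and> P (snd z)"
proof -
  obtain N where N: "N \<in> null_sets lebesgue" "{x. \<not> P x} \<subseteq> N"
    using assms by (auto simp: eventually_ae_filter)
  have 1: "N \<times> UNIV \<in> null_sets leb2" "UNIV \<times> N \<in> null_sets leb2"
    using lebesgue.times_in_null_sets1[OF N(1), of UNIV] lebesgue.times_in_null_sets2[OF _ N(1), of UNIV lebesgue] by auto
  have "AE z in leb2. P (fst z) \<and> P (snd z)"
    by (rule AE_I'[OF null_sets.Un[OF 1]]) (use N(2) in \<open>auto simp: mem_Times_iff\<close>)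
  then show ?thesis
    unfolding gag_def by (subst AE_density) auto
qed

lemma emeasure_lebesgue_cball:
  fixes x :: "'a::euclidean_space"
  assumes "r \<ge> 0"
  shows "emeasure lebesgue (cball x r) = ennreal (unit_ball_vol (real DIM('a)) * r ^ DIM('a))"
  using emeasure_cball[OF assms, of x] by simp

text \<open>The part of the Gagliardo seminorm with \<open>x\<close> in \<open>E\<close> and \<open>y\<close> outside \<open>E\<close> alone controls the
  \<open>p\<close>-norm: a ball of twice the measure of \<open>E\<close> around \<open>x\<close> has half of its measure outside \<open>E\<close>.\<close>

definition gain_const :: "'a::euclidean_space itself \<Rightarrow> real \<Rightarrow> real \<Rightarrow> real" where
  "gain_const _ s p = (2 / unit_ball_vol (real DIM('a))) powr (1 + s * p / real DIM('a))"

lemma gain_const_pos: "gain_const TYPE('a::euclidean_space) s p > 0"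
proof -
  have "2 / unit_ball_vol (real DIM('a)) > 0"
    by (intro divide_pos_pos unit_ball_vol_pos) auto
  then show ?thesis unfolding gain_const_def powr_gt_zero by linarith
qed

lemma gagliardo_poincare_nn:
  fixes u :: "'a::euclidean_space \<Rightarrow> real"
  assumes u: "u \<in> borel_measurable lebesgue" and E: "E \<in> sets lebesgue" "emeasure lebesgue E \<le> ennreal m" "m > 0"
    and 0: "\<And>x. x \<notin> E \<Longrightarrow> u x = 0" and sp: "s > 0" "p > 0"
  shows "(\<integral>\<^sup>+x. ennreal (\<bar>u x\<bar> powr p) \<partial>lebesgue) \<le>
     ennreal (gain_const TYPE('a) s p * m powr (s * p / real DIM('a))) *
     (\<integral>\<^sup>+z. ennreal (\<bar>dl u z\<bar> powr p) \<partial>gag (real DIM('a) + s * p))"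
proof -
  let ?N = "real DIM('a)"
  let ?\<sigma> = "?N + s * p"
  define \<omega> where "\<omega> = unit_ball_vol ?N"
  have \<omega>: "\<omega> > 0" by (simp add: \<omega>_def)
  \<comment> \<open>Solves \<open>\<omega> * R ^ N = 2 * m\<close> for the dimension
    \<open>N\<close>.\<close>
  define R where "R = (2 * m / \<omega>) powr (1 / ?N)"
  have N0: "?N > 0" by simp
  have R: "R > 0" using \<omega> E(3) by (simp add: R_def)
  have RN: "R ^ DIM('a) = 2 * m / \<omega>"
  proof -
    have "R ^ DIM('a) = R powr ?N" using R by (simp add: powr_realpow)
    also have "\<dots> = 2 * m / \<omega>" using \<omega> E(3) by (simp add: R_def powr_powr)
    finally show ?thesis .
  qed
  \<comment> \<open>One factor \<open>m\<close> cancels against the measure found outside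
    \<open>E\<close>. The remaining power \<open>m powr (s * p / N)\<close> is the gain on small
    sets that later drives the Stampacchia iteration.\<close>
  have R\<sigma>: "R powr ?\<sigma> = m * (gain_const TYPE('a) s p * m powr (s * p / ?N))"
  proof -
    have "R powr ?\<sigma> = (2 * m / \<omega>) powr (1 + s * p / ?N)"
      using N0 by (simp add: R_def powr_powr add_divide_distrib)
    also have "\<dots> = (2 / \<omega> * m) powr (1 + s * p / ?N)" by simp
    also have "\<dots> = (2 / \<omega>) powr (1 + s * p / ?N) * m powr (1 + s * p / ?N)"
      by (rule powr_mult)
    also have "m powr (1 + s * p / ?N) = m * m powr (s * p / ?N)"
      using E(3) by (simp add: powr_add)
    finally show ?thesis by (simp add: gain_const_def \<omega>_def)
  qed
  have vol: "ennreal m \<le> emeasure lebesgue (cball x R - E)" for x :: 'a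
  proof -
    have c: "emeasure lebesgue (cball x R) = ennreal (2 * m)"
      using emeasure_lebesgue_cball[of R x] R RN \<omega> unfolding \<omega>_def[symmetric] by simp
    have "ennreal (2 * m) \<le> emeasure lebesgue (cball x R - E) + emeasure lebesgue E"
      unfolding c[of, symmetric]
      by (rule order_trans[OF emeasure_mono emeasure_subadditive]) (use E in auto)
    also have "\<dots> \<le> emeasure lebesgue (cball x R - E) + ennreal m"
      using E(2) by (intro add_left_mono)
    also have "ennreal (2 * m) = ennreal m + ennreal m"
      using ennreal_plus[of m m] E(3) by simp
    finally have "ennreal m + ennreal m \<le> emeasure lebesgue (cball x R - E) + ennreal m" .
    then have "ennreal m + ennreal m \<le> ennreal m + emeasure lebesgue (cball x R - E)"
      by (simp only: add.commute)
    then show ?thesis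
      by (simp add: ennreal_add_left_cancel_le)
  qed
  have inner: "ennreal (\<bar>u x\<bar> powr p * (m / R powr ?\<sigma>)) \<le> (\<integral>\<^sup>+y. ennreal (\<bar>u x - u y\<bar> powr p / norm (x - y) powr ?\<sigma>) \<partial>lebesgue)" for x
  proof (cases "x \<in> E")
    case False
    then show ?thesis using 0 by simp
  next
    case True
    have "ennreal (\<bar>u x\<bar> powr p * (m / R powr ?\<sigma>)) = ennreal (\<bar>u x\<bar> powr p / R powr ?\<sigma>) * ennreal m"
      using E(3) by (simp add: ennreal_mult[symmetric] mult_ac)
    also have "\<dots> \<le> ennreal (\<bar>u x\<bar> powr p / R powr ?\<sigma>) * emeasure lebesgue (cball x R - E)"
      by (intro mult_left_mono vol) simp
    also have "\<dots> = (\<integral>\<^sup>+y. ennreal (\<bar>u x\<bar> powr p / R powr ?\<sigma>) * indicator (cball x R - E) y \<partial>lebesgue)"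
      using E(1) by (intro nn_integral_cmult_indicator[symmetric]) auto
    also have "\<dots> \<le> (\<integral>\<^sup>+y. ennreal (\<bar>u x - u y\<bar> powr p / norm (x - y) powr ?\<sigma>) \<partial>lebesgue)"
    proof (rule nn_integral_mono)
      fix y
      show "ennreal (\<bar>u x\<bar> powr p / R powr ?\<sigma>) * indicator (cball x R - E) y \<le> ennreal (\<bar>u x - u y\<bar> powr p / norm (x - y) powr ?\<sigma>)"
      proof (cases "y \<in> cball x R - E")
        case y: True
        \<comment> \<open>On the diagonal the quotient is a division by 0, hence 0, and the
          comparison would fail.\<close>
        then have "x \<noteq> y" using True by auto
        moreover have "norm (x - y) \<le> R" using y by (simp add: dist_norm)
        ultimately have "norm (x - y) powr ?\<sigma> \<le> R powr ?\<sigma>" "norm (x - y) powr ?\<sigma> > 0"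
          using sp by (auto intro!: powr_mono2)
        then have "\<bar>u x\<bar> powr p / R powr ?\<sigma> \<le> \<bar>u x\<bar> powr p / norm (x - y) powr ?\<sigma>"
          using R by (intro divide_left_mono mult_pos_pos) auto
        moreover have "u y = 0" using y 0 by auto
        ultimately show ?thesis using y by (simp add: ennreal_leI)
      qed simp
    qed
    finally show ?thesis .
  qed
  have mm: "m / R powr ?\<sigma> > 0" using E(3) R by simp
  let ?S = "\<integral>\<^sup>+z. ennreal (\<bar>dl u z\<bar> powr p) \<partial>gag ?\<sigma>"
  have S: "?S = (\<integral>\<^sup>+x. (\<integral>\<^sup>+y. ennreal (\<bar>u x - u y\<bar> powr p / norm (x - y) powr ?\<sigma>) \<partial>lebesgue) \<partial>lebesgue)"
  proof -
    have "(\<lambda>z. \<bar>dl u z\<bar> powr p) \<in> borel_measurable leb2"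
      using dl_measurable_leb2[OF u] by measurable
    then show ?thesis by (subst nn_integral_gag) (simp_all add: dl_def)
  qed
  have "(\<integral>\<^sup>+x. ennreal (\<bar>u x\<bar> powr p) \<partial>lebesgue) = (\<integral>\<^sup>+x. ennreal (R powr ?\<sigma> / m) * ennreal (\<bar>u x\<bar> powr p * (m / R powr ?\<sigma>)) \<partial>lebesgue)"
    using E(3) R by (intro nn_integral_cong) (simp add: ennreal_mult[symmetric])
  also have "\<dots> = ennreal (R powr ?\<sigma> / m) * (\<integral>\<^sup>+x. ennreal (\<bar>u x\<bar> powr p * (m / R powr ?\<sigma>)) \<partial>lebesgue)"
  proof (rule nn_integral_cmult)
    note u[measurable]
    show "(\<lambda>x. ennreal (\<bar>u x\<bar> powr p * (m / R powr ?\<sigma>))) \<in> borel_measurable lebesgue" by measurable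
  qed
  also have "\<dots> \<le> ennreal (R powr ?\<sigma> / m) * ?S"
    unfolding S by (intro mult_left_mono nn_integral_mono inner) simp
  also have "R powr ?\<sigma> / m = gain_const TYPE('a) s p * m powr (s * p / ?N)"
    using R\<sigma> E(3) by simp
  finally show ?thesis .
qed

lemma gagliardo_poincare:
  fixes u :: "'a::euclidean_space \<Rightarrow> real"
  assumes u: "u \<in> borel_measurable lebesgue" and E: "E \<in> sets lebesgue" "emeasure lebesgue E \<le> ennreal m" "m > 0"
    and 0: "\<And>x. x \<notin> E \<Longrightarrow> u x = 0" and sp: "s > 0" "p > 0"
    and L: "Lr (gag (real DIM('a) + s * p)) p (dl u)"
  shows "Lr lebesgue p u"
    "Ir lebesgue p u \<le> gain_const TYPE('a) s p * m powr (s * p / real DIM('a)) * Ir (gag (real DIM('a) + s * p)) p (dl u)"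
proof -
  let ?C = "gain_const TYPE('a) s p * m powr (s * p / real DIM('a))"
  let ?I = "Ir (gag (real DIM('a) + s * p)) p (dl u)"
  have "(\<integral>\<^sup>+z. ennreal (\<bar>dl u z\<bar> powr p) \<partial>gag (real DIM('a) + s * p)) = ennreal ?I"
    unfolding Ir_def using LrD(2)[OF L] by (subst nn_integral_eq_integral) auto
  then have le: "(\<integral>\<^sup>+x. ennreal (\<bar>u x\<bar> powr p) \<partial>lebesgue) \<le> ennreal (?C * ?I)"
    using gagliardo_poincare_nn[OF u E 0 sp] gain_const_pos[where 'a='a, of s p] Ir_nonneg[of "gag (real DIM('a) + s * p)" p "dl u"]
    by (simp add: ennreal_mult)
  have i: "integrable lebesgue (\<lambda>x. \<bar>u x\<bar> powr p)"
  proof (rule integrableI_bounded)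
    show "(\<lambda>x. \<bar>u x\<bar> powr p) \<in> borel_measurable lebesgue" using u by measurable
    show "(\<integral>\<^sup>+x. ennreal (norm (\<bar>u x\<bar> powr p)) \<partial>lebesgue) < \<infinity>"
      using le_less_trans[OF le ennreal_less_top] by simp
  qed
  then show "Lr lebesgue p u" using u by (simp add: Lr_def)
  have "ennreal (Ir lebesgue p u) \<le> ennreal (?C * ?I)"
    using le i unfolding Ir_def by (subst (asm) nn_integral_eq_integral) auto
  then show "Ir lebesgue p u \<le> ?C * ?I"
    using gain_const_pos[where 'a='a, of s p] Ir_nonneg[of "gag (real DIM('a) + s * p)" p "dl u"]
    by (subst (asm) ennreal_le_iff) auto
qed

section \<open>Finiteness of the Gagliardo seminorm of a test function\<close>

lemma ennreal_le_suminf: "f j \<le> suminf f" for f :: "nat \<Rightarrow> ennreal"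
  using sum_le_suminf[of f "{j}"] by simp

text \<open>Takes the place of polar coordinates: a radial kernel is bounded by a constant
  \<open>c j\<close> on each dyadic shell, and each shell is contained in a ball of known
  volume.\<close>

lemma nn_integral_dyadic_bound:
  fixes x :: "'a::euclidean_space" and c \<rho> :: "nat \<Rightarrow> real" and h :: "'a \<Rightarrow> real"
  assumes c: "\<And>j. c j \<ge> 0" and \<rho>: "\<And>j. \<rho> j \<ge> 0"
    and h: "\<And>y. h y > 0 \<Longrightarrow> \<exists>j. h y \<le> c j \<and> norm (x - y) \<le> \<rho> j"
    and sum: "summable (\<lambda>j. c j * (unit_ball_vol (real DIM('a)) * \<rho> j ^ DIM('a)))"
  shows "(\<integral>\<^sup>+y. ennreal (h y) \<partial>lebesgue) \<le> ennreal (\<Sum>j. c j * (unit_ball_vol (real DIM('a)) * \<rho> j ^ DIM('a)))"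
proof -
  have "ennreal (h y) \<le> (\<Sum>j. ennreal (c j) * indicator (cball x (\<rho> j)) y)" for y
  proof (cases "h y > 0")
    case True
    then obtain j where j: "h y \<le> c j" "norm (x - y) \<le> \<rho> j" using h by blast
    then have "ennreal (h y) \<le> ennreal (c j) * indicator (cball x (\<rho> j)) y"
      by (simp add: dist_norm ennreal_leI)
    also have "\<dots> \<le> (\<Sum>j. ennreal (c j) * indicator (cball x (\<rho> j)) y)"
      by (rule ennreal_le_suminf)
    finally show ?thesis .
  qed (simp add: ennreal_neg not_less)
  then have "(\<integral>\<^sup>+y. ennreal (h y) \<partial>lebesgue) \<le> (\<integral>\<^sup>+y. (\<Sum>j. ennreal (c j) * indicator (cball x (\<rho> j)) y) \<partial>lebesgue)"
    by (rule nn_integral_mono)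
  also have "\<dots> = (\<Sum>j. \<integral>\<^sup>+y. ennreal (c j) * indicator (cball x (\<rho> j)) y \<partial>lebesgue)"
    by (rule nn_integral_suminf, intro borel_measurable_times_ennreal borel_measurable_const borel_measurable_indicator) simp
  also have "\<dots> = (\<Sum>j. ennreal (c j * (unit_ball_vol (real DIM('a)) * \<rho> j ^ DIM('a))))"
  proof (rule suminf_cong)
    fix j
    have "(\<integral>\<^sup>+y. ennreal (c j) * indicator (cball x (\<rho> j)) y \<partial>lebesgue) = ennreal (c j) * emeasure lebesgue (cball x (\<rho> j))"
      by (rule nn_integral_cmult_indicator) auto
    then show "(\<integral>\<^sup>+y. ennreal (c j) * indicator (cball x (\<rho> j)) y \<partial>lebesgue) = ennreal (c j * (unit_ball_vol (real DIM('a)) * \<rho> j ^ DIM('a)))"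
      using emeasure_lebesgue_cball[OF \<rho>[of j], of x] c \<rho> by (simp add: ennreal_mult)
  qed
  also have "\<dots> = ennreal (\<Sum>j. c j * (unit_ball_vol (real DIM('a)) * \<rho> j ^ DIM('a)))"
    by (rule suminf_ennreal2[OF _ sum]) (use c \<rho> in auto)
  finally show ?thesis .
qed

text \<open>Near the diagonal the linear bound leaves the exponent \<open>p - s * p\<close>,
  positive because \<open>s < 1\<close>; far away the constant bound leaves the decay
  \<open>s * p\<close>, positive because \<open>s > 0\<close>. Both series over dyadic shells are
  geometric.\<close>

lemma kernel_nn_integral_bounded:
  assumes s: "0 < s" "s < 1" and p: "p > 0" and L: "L \<ge> 0" and B: "B \<ge> 0"
  obtains H where "\<forall>x::'a::euclidean_space. (\<integral>\<^sup>+y. ennreal (min (L * norm (x - y)) B powr p / norm (x - y) powr (real DIM('a) + s * p)) \<partial>lebesgue) \<le> ennreal H"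
proof -
  let ?N = "real DIM('a)"
  let ?\<sigma> = "?N + s * p"
  let ?\<omega> = "unit_ball_vol ?N"
  let ?h = "\<lambda>x y::'a. min (L * norm (x - y)) B powr p / norm (x - y) powr ?\<sigma>"
  define \<beta> where "\<beta> = p - s * p"
  have \<beta>: "\<beta> > 0" using s p by (simp add: \<beta>_def)
  \<comment> \<open>\<open>c1 j\<close> bounds the kernel on the shell with distances between
    \<open>2 powr (- (j + 1))\<close> and \<open>2 powr (- j)\<close>, \<open>c2 j\<close> on the
    shell between \<open>2 powr j\<close> and \<open>2 powr (j + 1)\<close>.\<close>
  define c1 \<rho>1 where "c1 = (\<lambda>j::nat. L powr p * ((2 powr (- \<beta>)) ^ j * (2 powr (real j + 1)) powr ?N))"
    and "\<rho>1 = (\<lambda>j::nat. (1 / 2 :: real) ^ j)"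
  define c2 \<rho>2 where "c2 = (\<lambda>j::nat. B powr p * (2 powr (- ?\<sigma>)) ^ j)" and "\<rho>2 = (\<lambda>j::nat. (2 :: real) ^ Suc j)"
  have pw: "a ^ DIM('a) = a powr ?N" if "a > 0" for a :: real
    using that by (simp add: powr_realpow)
  have e1: "c1 j * (?\<omega> * \<rho>1 j ^ DIM('a)) = (L powr p * ?\<omega> * 2 powr ?N) * (2 powr (- \<beta>)) ^ j" for j
  proof -
    have "(2 powr (real j + 1)) powr ?N * \<rho>1 j ^ DIM('a) = 2 powr ?N"
    proof -
      have "\<rho>1 j = 2 powr (- real j)"
        by (simp add: \<rho>1_def powr_minus powr_realpow power_one_over inverse_eq_divide)
      then have "\<rho>1 j ^ DIM('a) = (2 powr (- real j)) powr ?N" by (simp add: pw)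
      then show ?thesis
        by (simp add: powr_powr powr_add[symmetric] algebra_simps)
    qed
    then show ?thesis by (simp add: c1_def mult_ac)
  qed
  have e2: "c2 j * (?\<omega> * \<rho>2 j ^ DIM('a)) = (B powr p * ?\<omega> * 2 powr ?N) * (2 powr (- (s * p))) ^ j" for j
  proof -
    have "(2 powr (- ?\<sigma>)) ^ j * \<rho>2 j ^ DIM('a) = 2 powr ?N * (2 powr (- (s * p))) ^ j"
    proof -
      have "\<rho>2 j = 2 powr (real j + 1)"
        by (simp add: \<rho>2_def powr_add powr_realpow)
      then have "\<rho>2 j ^ DIM('a) = 2 powr ((real j + 1) * ?N)" by (simp add: pw powr_powr)
      moreover have "(2 powr a) ^ j = 2 powr (a * real j)" for a :: real
        by (simp add: powr_realpow[symmetric] powr_powr)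
      ultimately show ?thesis
        by (simp add: powr_add[symmetric] algebra_simps)
    qed
    then show ?thesis by (simp add: c2_def mult_ac)
  qed
  have lt1: "(2::real) powr (- t) < 1" if "t > 0" for t
    using powr_less_cancel_iff[of 2 "- t" 0] that by simp
  have s1: "summable (\<lambda>j. c1 j * (?\<omega> * \<rho>1 j ^ DIM('a)))"
    unfolding e1 using \<beta> by (intro summable_mult summable_geometric) (simp add: lt1)
  have s2: "summable (\<lambda>j. c2 j * (?\<omega> * \<rho>2 j ^ DIM('a)))"
    unfolding e2 using s p by (intro summable_mult summable_geometric) (simp add: lt1)
  let ?H = "(\<Sum>j. c1 j * (?\<omega> * \<rho>1 j ^ DIM('a))) + (\<Sum>j. c2 j * (?\<omega> * \<rho>2 j ^ DIM('a)))"
  have "(\<integral>\<^sup>+y. ennreal (?h x y) \<partial>lebesgue) \<le> ennreal ?H" for x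
  proof -
    define h1 where "h1 y = (if norm (x - y) \<le> 1 then ?h x y else 0)" for y
    define h2 where "h2 y = (if norm (x - y) \<le> 1 then 0 else ?h x y)" for y
    have i1: "(\<integral>\<^sup>+y. ennreal (h1 y) \<partial>lebesgue) \<le> ennreal (\<Sum>j. c1 j * (?\<omega> * \<rho>1 j ^ DIM('a)))"
    proof (rule nn_integral_dyadic_bound[OF _ _ _ s1])
      show "c1 j \<ge> 0" for j using L by (simp add: c1_def)
      show "\<rho>1 j \<ge> 0" for j by (simp add: \<rho>1_def)
      fix y assume hy: "h1 y > 0"
      define t where "t = norm (x - y)"
      have t1: "t \<le> 1" using hy by (auto simp: h1_def t_def split: if_splits)
      \<comment> \<open>For \<open>x = y\<close> the quotient is 0 by convention, which the
        positivity of \<open>h1 y\<close> excludes.\<close>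
      have t0: "t > 0"
      proof (rule ccontr)
        assume "\<not> t > 0"
        then have "x = y" by (simp add: t_def)
        with hy show False by (simp add: h1_def)
      qed
      define j where "j = nat \<lfloor>- log 2 t\<rfloor>"
      have "0 \<le> - log 2 t" using t0 t1 by simp
      then have j: "real j \<le> - log 2 t" "- log 2 t < real j + 1"
        unfolding j_def by linarith+
      have tu: "t \<le> 2 powr (- real j)" using j t0 by (simp add: log_le_iff[symmetric] le_powr_iff)
      have tl: "2 powr (- (real j + 1)) \<le> t" using j t0 by (simp add: powr_le_iff)
      have "h1 y = min (L * t) B powr p / t powr ?\<sigma>"
        using t1 by (simp add: h1_def t_def)
      also have "\<dots> \<le> (L * t) powr p / t powr ?\<sigma>"
        using L B p t0 by (intro divide_right_mono powr_mono2) auto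
      also have "\<dots> = L powr p * (t powr \<beta> * (1 / t powr ?N))"
        using t0 by (simp add: powr_mult \<beta>_def powr_diff powr_add)
      also have "\<dots> \<le> L powr p * ((2 powr (- real j)) powr \<beta> * (1 / (2 powr (- (real j + 1))) powr ?N))"
        using tu tl t0 \<beta> by (intro mult_left_mono mult_mono divide_left_mono powr_mono2) auto
      also have "\<dots> = c1 j"
      proof -
        have "(2 powr (- real j)) powr \<beta> = (2 powr (- \<beta>)) ^ j"
          by (simp add: powr_powr powr_realpow[symmetric] mult.commute)
        moreover have "1 / (2 powr (- (real j + 1))) powr ?N = (2 powr (real j + 1)) powr ?N"
        proof -
          have "(2 powr (- (real j + 1))) powr ?N = 2 powr (- ((real j + 1) * ?N))"
            by (simp only: powr_powr mult_minus_left)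
          then show ?thesis by (simp add: powr_minus_divide powr_powr)
        qed
        ultimately show ?thesis by (simp only: c1_def)
      qed
      finally have "h1 y \<le> c1 j" .
      moreover have "norm (x - y) \<le> \<rho>1 j"
        using tu by (simp add: \<rho>1_def t_def powr_minus_divide powr_realpow power_one_over)
      ultimately show "\<exists>j. h1 y \<le> c1 j \<and> norm (x - y) \<le> \<rho>1 j" by blast
    qed
    have i2: "(\<integral>\<^sup>+y. ennreal (h2 y) \<partial>lebesgue) \<le> ennreal (\<Sum>j. c2 j * (?\<omega> * \<rho>2 j ^ DIM('a)))"
    proof (rule nn_integral_dyadic_bound[OF _ _ _ s2])
      show "c2 j \<ge> 0" for j by (simp add: c2_def)
      show "\<rho>2 j \<ge> 0" for j by (simp add: \<rho>2_def)
      fix y assume hy: "h2 y > 0"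
      define t where "t = norm (x - y)"
      have t1: "t > 1" using hy by (auto simp: h2_def t_def split: if_splits)
      define j where "j = nat \<lfloor>log 2 t\<rfloor>"
      have "0 \<le> log 2 t" using t1 by simp
      then have j: "real j \<le> log 2 t" "log 2 t < real j + 1"
        unfolding j_def by linarith+
      have tl: "2 powr (real j) \<le> t" using j t1 by (simp add: powr_le_iff)
      have tu: "t \<le> 2 powr (real j + 1)" using j t1 by (simp add: le_powr_iff)
      have "h2 y = min (L * t) B powr p / t powr ?\<sigma>"
        using t1 by (simp add: h2_def t_def)
      also have "\<dots> \<le> B powr p / (2 powr real j) powr ?\<sigma>"
        using L B p s t1 tl by (intro frac_le powr_mono2) auto
      also have "\<dots> = c2 j"
      proof -
        have "(2 powr (- b)) ^ j = 1 / (2 powr real j) powr b" for b :: real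
        proof -
          have "(2 powr (- b)) ^ j = (2 powr (- b)) powr real j"
            by (rule powr_realpow[symmetric]) simp
          also have "\<dots> = 2 powr (- (real j * b))"
            by (simp only: powr_powr mult_minus_left mult.commute)
          also have "\<dots> = 1 / (2 powr real j) powr b"
            by (simp only: powr_powr powr_minus_divide)
          finally show ?thesis .
        qed
        note g = this[of ?\<sigma>]
        show ?thesis unfolding c2_def g by (simp only: times_divide_eq_right mult_1_right)
      qed
      finally have "h2 y \<le> c2 j" .
      moreover have "norm (x - y) \<le> \<rho>2 j"
        using tu by (simp add: \<rho>2_def t_def powr_add powr_realpow)
      ultimately show "\<exists>j. h2 y \<le> c2 j \<and> norm (x - y) \<le> \<rho>2 j" by blast
    qed
    have [measurable]: "(\<lambda>y. norm (x - y)) \<in> borel_measurable lebesgue"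
      by (rule continuous_borel_measurable_lebesgue) (intro continuous_intros)
    have m: "h1 \<in> borel_measurable lebesgue" "h2 \<in> borel_measurable lebesgue"
      unfolding h1_def h2_def by measurable
    have "(\<integral>\<^sup>+y. ennreal (?h x y) \<partial>lebesgue) = (\<integral>\<^sup>+y. ennreal (h1 y) + ennreal (h2 y) \<partial>lebesgue)"
      by (intro nn_integral_cong) (auto simp: h1_def h2_def)
    also have "\<dots> = (\<integral>\<^sup>+y. ennreal (h1 y) \<partial>lebesgue) + (\<integral>\<^sup>+y. ennreal (h2 y) \<partial>lebesgue)"
      using m by (intro nn_integral_add) auto
    also have "\<dots> \<le> ennreal (\<Sum>j. c1 j * (?\<omega> * \<rho>1 j ^ DIM('a))) + ennreal (\<Sum>j. c2 j * (?\<omega> * \<rho>2 j ^ DIM('a)))"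
      by (rule add_mono[OF i1 i2])
    also have "\<dots> = ennreal ?H"
    proof (rule ennreal_plus[symmetric])
      show "0 \<le> (\<Sum>j. c1 j * (?\<omega> * \<rho>1 j ^ DIM('a)))"
        by (rule suminf_nonneg[OF s1]) (auto simp: c1_def \<rho>1_def)
      show "0 \<le> (\<Sum>j. c2 j * (?\<omega> * \<rho>2 j ^ DIM('a)))"
        by (rule suminf_nonneg[OF s2]) (auto simp: c2_def \<rho>2_def)
    qed
    finally show ?thesis .
  qed
  then show ?thesis using that by blast
qed

text \<open>The difference vanishes unless one of the two points lies in the support
  \<open>K\<close>. Integrating the other point first gives at most the kernel bound, so the total
  is at most twice that bound times the measure of \<open>K\<close>.\<close>

lemma Cc_inf_dl_Lr:
  fixes \<phi> :: "'a::euclidean_space \<Rightarrow> real"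
  assumes \<phi>: "\<phi> \<in> Cc_inf \<Omega>" and s: "0 < s" "s < 1" and p: "p > 0"
  shows "Lr (gag (real DIM('a) + s * p)) p (dl \<phi>)"
proof -
  let ?\<sigma> = "real DIM('a) + s * p"
  obtain K where K: "compact K" "K \<subseteq> \<Omega>" "\<forall>x. x \<notin> K \<longrightarrow> \<phi> x = 0" "\<forall>x. x \<notin> K \<longrightarrow> grad \<phi> x = 0"
     "\<forall>x h. x \<notin> K \<longrightarrow> frechet_derivative \<phi> (at x) h = 0"
    by (rule Cc_inf_supportE[OF \<phi>])
  obtain B0 where B0: "B0 > 0" "\<forall>x. norm (\<phi> x) \<le> B0"
    by (rule compact_support_bounded[OF K(1) Cc_inf_continuous[OF \<phi>] K(3)[rule_format]])
  obtain L where L: "L > 0" "\<forall>x y. \<bar>\<phi> x - \<phi> y\<bar> \<le> L * norm (x - y)" "\<forall>x. norm (grad \<phi> x) \<le> L"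
    by (rule Cc_inf_lipschitz[OF \<phi>])
  define B where "B = 2 * B0"
  define h where "h z = min (L * norm (fst z - snd z)) B powr p / norm (fst z - snd z) powr ?\<sigma>" for z :: "'a \<times> 'a"
  have L0: "L \<ge> 0" and Bn: "B \<ge> 0" using L(1) B0(1) by (auto simp: B_def)
  obtain H where H: "\<forall>x::'a. (\<integral>\<^sup>+y. ennreal (min (L * norm (x - y)) B powr p / norm (x - y) powr ?\<sigma>) \<partial>lebesgue) \<le> ennreal H"
    by (rule kernel_nn_integral_bounded[OF s p L0 Bn])
  have [measurable]: "\<phi> \<in> borel_measurable lebesgue" by (rule Cc_inf_borel_measurable[OF \<phi>])
  have mdl: "dl \<phi> \<in> borel_measurable leb2" by (rule dl_measurable_leb2) measurable
  have mh[measurable]: "h \<in> borel_measurable leb2"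
    unfolding h_def by measurable
  have KS[measurable]: "K \<in> sets lebesgue" using K(1) by (simp add: borel_compact)
  have eK: "emeasure lebesgue K < \<infinity>"
    using emeasure_bounded_finite[OF compact_imp_bounded[OF K(1)]] K(1) by (simp add: borel_compact)
  have pt: "ennreal (\<bar>dl \<phi> z\<bar> powr p / norm (fst z - snd z) powr ?\<sigma>) \<le> ennreal (h z) * indicator K (fst z) + ennreal (h z) * indicator K (snd z)" for z
  proof -
    have b: "\<bar>dl \<phi> z\<bar> \<le> min (L * norm (fst z - snd z)) B"
      using L(2)[rule_format, of "fst z" "snd z"] B0(2)[rule_format, of "fst z"] B0(2)[rule_format, of "snd z"]
      by (simp add: dl_def B_def)
    have "\<bar>dl \<phi> z\<bar> powr p / norm (fst z - snd z) powr ?\<sigma> \<le> h z"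
      unfolding h_def using b p by (intro divide_right_mono powr_mono2) auto
    then have *: "ennreal (\<bar>dl \<phi> z\<bar> powr p / norm (fst z - snd z) powr ?\<sigma>) \<le> ennreal (h z)"
      by (rule ennreal_leI)
    show ?thesis
    proof (cases "fst z \<in> K")
      case True
      then show ?thesis using * by (simp add: add_increasing2)
    next
      case 1: False
      show ?thesis
      proof (cases "snd z \<in> K")
        case True
        then show ?thesis using * by (simp add: add_increasing)
      next
        case False
        then show ?thesis using 1 K(3) by (simp add: dl_def)
      qed
    qed
  qed
  have m1: "(\<lambda>z. ennreal (h z) * indicator K (fst z)) \<in> borel_measurable leb2"
    by (intro borel_measurable_times_ennreal measurable_compose[OF mh measurable_ennreal]
        measurable_compose[OF measurable_fst borel_measurable_indicator[OF KS]])
  have m2: "(\<lambda>z. ennreal (h z) * indicator K (snd z)) \<in> borel_measurable leb2"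
    by (intro borel_measurable_times_ennreal measurable_compose[OF mh measurable_ennreal]
        measurable_compose[OF measurable_snd borel_measurable_indicator[OF KS]])
  have I1: "(\<integral>\<^sup>+z. ennreal (h z) * indicator K (fst z) \<partial>leb2) \<le> ennreal H * emeasure lebesgue K"
  proof -
    have "(\<integral>\<^sup>+z. ennreal (h z) * indicator K (fst z) \<partial>leb2) = (\<integral>\<^sup>+x. (\<integral>\<^sup>+y. ennreal (h (x, y)) * indicator K x \<partial>lebesgue) \<partial>lebesgue)"
      by (subst lebesgue.nn_integral_fst[OF m1, symmetric]) simp
    also have "\<dots> = (\<integral>\<^sup>+x. (\<integral>\<^sup>+y. ennreal (h (x, y)) \<partial>lebesgue) * indicator K x \<partial>lebesgue)"
      by (intro nn_integral_cong nn_integral_multc) measurable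
    also have "\<dots> \<le> (\<integral>\<^sup>+x. ennreal H * indicator K x \<partial>lebesgue)"
      by (intro nn_integral_mono mult_right_mono) (use H in \<open>auto simp: h_def\<close>)
    also have "\<dots> = ennreal H * emeasure lebesgue K"
      by (rule nn_integral_cmult_indicator) measurable
    finally show ?thesis .
  qed
  have I2: "(\<integral>\<^sup>+z. ennreal (h z) * indicator K (snd z) \<partial>leb2) \<le> ennreal H * emeasure lebesgue K"
  proof -
    have "(\<integral>\<^sup>+z. ennreal (h z) * indicator K (snd z) \<partial>leb2) = (\<integral>\<^sup>+y. (\<integral>\<^sup>+x. ennreal (h (x, y)) * indicator K y \<partial>lebesgue) \<partial>lebesgue)"
      by (subst leb2.nn_integral_snd[OF m2, symmetric]) simp
    also have "\<dots> = (\<integral>\<^sup>+y. (\<integral>\<^sup>+x. ennreal (h (x, y)) \<partial>lebesgue) * indicator K y \<partial>lebesgue)"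
      by (intro nn_integral_cong nn_integral_multc) measurable
    also have "\<dots> \<le> (\<integral>\<^sup>+x. ennreal H * indicator K x \<partial>lebesgue)"
      by (intro nn_integral_mono mult_right_mono) (use H in \<open>auto simp: h_def norm_minus_commute\<close>)
    also have "\<dots> = ennreal H * emeasure lebesgue K"
      by (rule nn_integral_cmult_indicator) measurable
    finally show ?thesis .
  qed
  have "(\<integral>\<^sup>+z. ennreal (\<bar>dl \<phi> z\<bar> powr p) \<partial>gag ?\<sigma>) = (\<integral>\<^sup>+z. ennreal (kern ?\<sigma> z) * ennreal (\<bar>dl \<phi> z\<bar> powr p) \<partial>leb2)"
    unfolding gag_def using mdl by (intro nn_integral_density) measurable
  also have "\<dots> = (\<integral>\<^sup>+z. ennreal (\<bar>dl \<phi> z\<bar> powr p / norm (fst z - snd z) powr ?\<sigma>) \<partial>leb2)"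
    by (simp add: kern_def ennreal_mult[symmetric])
  also have "\<dots> \<le> (\<integral>\<^sup>+z. ennreal (h z) * indicator K (fst z) + ennreal (h z) * indicator K (snd z) \<partial>leb2)"
    by (intro nn_integral_mono pt)
  also have "\<dots> = (\<integral>\<^sup>+z. ennreal (h z) * indicator K (fst z) \<partial>leb2) + (\<integral>\<^sup>+z. ennreal (h z) * indicator K (snd z) \<partial>leb2)"
    by (rule nn_integral_add[OF m1 m2])
  also have "\<dots> \<le> ennreal H * emeasure lebesgue K + ennreal H * emeasure lebesgue K"
    by (rule add_mono[OF I1 I2])
  also have "\<dots> < \<infinity>"
    using eK by (simp add: ennreal_mult_less_top)
  finally have fin: "(\<integral>\<^sup>+z. ennreal (\<bar>dl \<phi> z\<bar> powr p) \<partial>gag ?\<sigma>) < \<infinity>" .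
  have mg: "dl \<phi> \<in> borel_measurable (gag ?\<sigma>)" using mdl by (simp add: borel_measurable_gag_iff)
  show ?thesis
    unfolding Lr_def
  proof
    show "integrable (gag ?\<sigma>) (\<lambda>z. norm (dl \<phi> z) powr p)"
    proof (rule integrableI_bounded)
      show "(\<lambda>z. norm (dl \<phi> z) powr p) \<in> borel_measurable (gag ?\<sigma>)"
        using mg by measurable
      show "(\<integral>\<^sup>+z. ennreal (norm (norm (dl \<phi> z) powr p)) \<partial>gag ?\<sigma>) < \<infinity>"
        using fin by simp
    qed
  qed (rule mg)
qed

section \<open>Limits of functions with integrable powers\<close>

text \<open>The bound is asked only from \<open>k0\<close> on, because a Cauchy condition controls
  only the tail of a sequence.\<close>

lemma Lr_Fatou:
  assumes Y: "\<And>k::nat. Lr M r (Y k)" and Y0: "Y0 \<in> borel_measurable M" and r: "r > 0"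
    and lim: "AE z in M. (\<lambda>k. Y k z) \<longlonglongrightarrow> Y0 z" and c: "\<And>k. k \<ge> k0 \<Longrightarrow> Ir M r (Y k) \<le> c"
  shows "Lr M r Y0" "Ir M r Y0 \<le> c"
proof -
  have [measurable]: "Y k \<in> borel_measurable M" for k using Y LrD by blast
  note Y0[measurable]
  have c0: "c \<ge> 0" using c[of k0] Ir_nonneg[of M r "Y k0"] by linarith
  have nn: "(\<integral>\<^sup>+z. ennreal (norm (Y k z) powr r) \<partial>M) = ennreal (Ir M r (Y k))" for k
    unfolding Ir_def by (rule nn_integral_eq_integral[OF LrD(2)[OF Y]]) simp
  have "(\<integral>\<^sup>+z. ennreal (norm (Y0 z) powr r) \<partial>M) = (\<integral>\<^sup>+z. liminf (\<lambda>k. ennreal (norm (Y k z) powr r)) \<partial>M)"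
  proof (rule nn_integral_cong_AE)
    show "AE z in M. ennreal (norm (Y0 z) powr r) = liminf (\<lambda>k. ennreal (norm (Y k z) powr r))"
      using lim
    proof eventually_elim
      case (elim z)
      have "(\<lambda>k. norm (Y k z) powr r) \<longlonglongrightarrow> norm (Y0 z) powr r"
        using r elim by (intro tendsto_powr' tendsto_norm tendsto_const) auto
      then have "(\<lambda>k. ennreal (norm (Y k z) powr r)) \<longlonglongrightarrow> ennreal (norm (Y0 z) powr r)"
        by (rule tendsto_ennrealI)
      from lim_imp_Liminf[OF _ this] show ?case by simp
    qed
  qed
  also have "\<dots> \<le> liminf (\<lambda>k. \<integral>\<^sup>+z. ennreal (norm (Y k z) powr r) \<partial>M)"
    by (rule nn_integral_liminf) measurable
  also have "\<dots> \<le> ennreal c"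
  proof -
    have "\<forall>\<^sub>F k in sequentially. (\<integral>\<^sup>+z. ennreal (norm (Y k z) powr r) \<partial>M) \<le> ennreal c"
      unfolding nn using eventually_ge_at_top[of k0] by eventually_elim (auto intro: ennreal_leI c)
    then have "liminf (\<lambda>k. \<integral>\<^sup>+z. ennreal (norm (Y k z) powr r) \<partial>M) \<le> liminf (\<lambda>k::nat. ennreal c)"
      by (rule Liminf_mono)
    then show ?thesis by (simp add: Liminf_const)
  qed
  finally have le: "(\<integral>\<^sup>+z. ennreal (norm (Y0 z) powr r) \<partial>M) \<le> ennreal c" .
  have i: "integrable M (\<lambda>z. norm (Y0 z) powr r)"
  proof (rule integrableI_bounded)
    show "(\<integral>\<^sup>+z. ennreal (norm (norm (Y0 z) powr r)) \<partial>M) < \<infinity>"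
      using le_less_trans[OF le ennreal_less_top] by simp
  qed measurable
  then show "Lr M r Y0" using Y0 by (simp add: Lr_def)
  have "ennreal (Ir M r Y0) \<le> ennreal c"
    using le nn_integral_eq_integral[OF i] by (simp add: Ir_def)
  then show "Ir M r Y0 \<le> c" using c0 by (simp add: ennreal_le_iff)
qed

lemma summable_differences_convergent:
  fixes y :: "nat \<Rightarrow> 'b::banach"
  assumes "summable (\<lambda>k. norm (y (Suc k) - y k))"
  shows "convergent y"
proof -
  have "summable (\<lambda>k. y (Suc k) - y k)"
    using assms by (rule summable_norm_cancel)
  then have "(\<lambda>n. \<Sum>k<n. y (Suc k) - y k) \<longlonglongrightarrow> (\<Sum>k. y (Suc k) - y k)"
    by (rule summable_LIMSEQ)
  then have "(\<lambda>n. (y n - y 0) + y 0) \<longlonglongrightarrow> (\<Sum>k. y (Suc k) - y k) + y 0"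
    unfolding sum_lessThan_telescope by (rule tendsto_add[OF _ tendsto_const])
  then show ?thesis by (auto simp: convergent_def)
qed

text \<open>The Riesz-Fischer argument: along a subsequence whose increments have L1 norm below
  \<open>(1 / 2) ^ k\<close>, the increments are summable almost everywhere.\<close>

lemma L1_Cauchy_AE_convergent_subseq:
  fixes X :: "nat \<Rightarrow> 'c \<Rightarrow> 'b::euclidean_space"
  assumes X: "\<And>n. integrable M (X n)"
    and C: "\<And>e. e > 0 \<Longrightarrow> \<exists>N. \<forall>m\<ge>N. \<forall>n\<ge>N. (LINT z|M. norm (X m z - X n z)) < e"
  obtains r :: "nat \<Rightarrow> nat" where "strict_mono r" "AE z in M. convergent (\<lambda>k. X (r k) z)"
proof -
  have [measurable]: "X n \<in> borel_measurable M" for n using X by auto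
  obtain N where N: "\<And>k m n. m \<ge> N k \<Longrightarrow> n \<ge> N k \<Longrightarrow> (LINT z|M. norm (X m z - X n z)) < (1 / 2) ^ k"
    using C[of "(1 / 2) ^ k" for k] by (metis zero_less_power half_gt_zero zero_less_one)
  \<comment> \<open>Summing the \<open>N i\<close> makes \<open>r k\<close> dominate
    \<open>N k\<close>, and the summand \<open>k\<close> makes \<open>r\<close> strictly
    increasing.\<close>
  define r where "r k = (\<Sum>i\<le>k. N i) + k" for k
  have r: "strict_mono r"
    by (rule strict_monoI_Suc) (simp add: r_def)
  have rN: "N k \<le> r k" for k
  proof -
    have "N k \<le> (\<Sum>i\<le>k. N i)" by (rule member_le_sum) auto
    then show ?thesis by (simp add: r_def)
  qed
  have small: "(LINT z|M. norm (X (r (Suc k)) z - X (r k) z)) < (1 / 2) ^ k" for k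
  proof (rule N)
    show "N k \<le> r k" by (rule rN)
    show "N k \<le> r (Suc k)" using rN[of k] strict_monoD[OF r, of k "Suc k"] by simp
  qed
  have i: "integrable M (\<lambda>z. norm (X (r (Suc k)) z - X (r k) z))" for k
    by (intro integrable_norm Bochner_Integration.integrable_diff X)
  have "(\<integral>\<^sup>+z. (\<Sum>k. ennreal (norm (X (r (Suc k)) z - X (r k) z))) \<partial>M) = (\<Sum>k. \<integral>\<^sup>+z. ennreal (norm (X (r (Suc k)) z - X (r k) z)) \<partial>M)"
    by (rule nn_integral_suminf) measurable
  also have "\<dots> \<le> (\<Sum>k. ennreal ((1 / 2) ^ k))"
  proof (rule suminf_le)
    fix k
    have "(\<integral>\<^sup>+z. ennreal (norm (X (r (Suc k)) z - X (r k) z)) \<partial>M) = ennreal (LINT z|M. norm (X (r (Suc k)) z - X (r k) z))"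
      by (rule nn_integral_eq_integral[OF i]) simp
    also have "\<dots> \<le> ennreal ((1 / 2) ^ k)"
      using small[of k] by (intro ennreal_leI) simp
    finally show "(\<integral>\<^sup>+z. ennreal (norm (X (r (Suc k)) z - X (r k) z)) \<partial>M) \<le> ennreal ((1 / 2) ^ k)" .
  qed auto
  also have "\<dots> = ennreal (\<Sum>k. (1 / 2) ^ k)"
    by (rule suminf_ennreal2) (auto intro: summable_geometric)
  finally have "(\<integral>\<^sup>+z. (\<Sum>k. ennreal (norm (X (r (Suc k)) z - X (r k) z))) \<partial>M) \<le> ennreal (\<Sum>k. (1 / 2) ^ k)" .
  then have "(\<integral>\<^sup>+z. (\<Sum>k. ennreal (norm (X (r (Suc k)) z - X (r k) z))) \<partial>M) \<noteq> \<infinity>"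
    by (simp add: top_unique) (metis ennreal_neq_top top.extremum_unique)
  then have "AE z in M. (\<Sum>k. ennreal (norm (X (r (Suc k)) z - X (r k) z))) \<noteq> \<infinity>"
    by (intro nn_integral_noteq_infinite) measurable
  then have "AE z in M. convergent (\<lambda>k. X (r k) z)"
  proof eventually_elim
    case (elim z)
    then have "summable (\<lambda>k. norm (X (r (Suc k)) z - X (r k) z))"
      by (intro summable_suminf_not_top) auto
    then show ?case by (rule summable_differences_convergent)
  qed
  with r that show ?thesis by blast
qed

section \<open>The space \<open>W\<close>\<close>

locale double_phase =
  fixes \<Omega> :: "'a::euclidean_space set" and s p q :: real and a :: "'a \<Rightarrow> real" and A :: real
  assumes open_\<Omega>: "open \<Omega>" and bounded_\<Omega>: "bounded \<Omega>" and \<Omega>_ne: "\<Omega> \<noteq> {}"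
    and s01: "0 < s" "s < 1" and p1: "1 < p" and pq: "p < q"
    and a_nonneg: "\<And>x. 0 \<le> a x" and a_meas: "a \<in> borel_measurable lebesgue" and a_le: "\<And>x. a x \<le> A"
begin

text \<open>The kernel and the weight \<open>a\<close> are absorbed into measures. The three terms
  of the modular become \<open>Ir\<close> for three measures and share one theory.\<close>

abbreviation GM :: "('a \<times> 'a) measure" where "GM \<equiv> gag (real DIM('a) + s * p)"
abbreviation AM :: "'a measure" where "AM \<equiv> density lebesgue (\<lambda>x. ennreal (a x))"

lemma p0: "p > 0" and q0: "q > 0" and q1: "q > 1"
  using p1 pq by auto

text \<open>\<open>xi\<close> is the modular \<open>\<xi>\<close>, with the gradient as a separate argument: all estimates are then free of
  the choice in \<^const>\<open>weak_gradient\<close>.\<close>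

definition fin :: "('a \<Rightarrow> real) \<Rightarrow> ('a \<Rightarrow> 'a) \<Rightarrow> bool" where
  "fin u G \<longleftrightarrow> u \<in> borel_measurable lebesgue \<and> Lr GM p (dl u) \<and> Lr lebesgue p G \<and> Lr AM q G"

definition xi :: "('a \<Rightarrow> real) \<Rightarrow> ('a \<Rightarrow> 'a) \<Rightarrow> real" where
  "xi u G = Ir GM p (dl u) + Ir lebesgue p G + Ir AM q G"

lemma xi_nonneg: "0 \<le> xi u G"
  by (simp add: xi_def Ir_nonneg)

lemma xi_parts: "Ir GM p (dl u) \<le> xi u G" "Ir lebesgue p G \<le> xi u G" "Ir AM q G \<le> xi u G"
  using Ir_nonneg[of GM p "dl u"] Ir_nonneg[of lebesgue p G] Ir_nonneg[of AM q G] by (auto simp: xi_def)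

lemma finD:
  assumes "fin u G"
  shows "u \<in> borel_measurable lebesgue" "Lr GM p (dl u)" "Lr lebesgue p G" "Lr AM q G"
  using assms by (auto simp: fin_def)

lemma AE_AM: "AE x in lebesgue. P x \<Longrightarrow> AE x in AM. P x"
  using a_meas by (subst AE_density) auto

lemma dl_add: "dl (\<lambda>x. u x + v x) = (\<lambda>z. dl u z + dl v z)"
  and dl_diff: "dl (\<lambda>x. u x - v x) = (\<lambda>z. dl u z - dl v z)"
  and dl_cmult: "dl (\<lambda>x. c * u x) = (\<lambda>z. c *\<^sub>R dl u z)"
  by (auto simp: dl_def algebra_simps)

lemma two_powr_pq: "2 powr p \<le> 2 powr q"
  using pq by simp

lemma fin_add:
  assumes u: "fin u G" and v: "fin v H"
  shows "fin (\<lambda>x. u x + v x) (\<lambda>x. G x + H x)" "xi (\<lambda>x. u x + v x) (\<lambda>x. G x + H x) \<le> 2 powr q * (xi u G + xi v H)"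
proof -
  note U = finD[OF u] and V = finD[OF v]
  show "fin (\<lambda>x. u x + v x) (\<lambda>x. G x + H x)"
    unfolding fin_def dl_add using Lr_add(1)[OF U(2) V(2) p0] Lr_add(1)[OF U(3) V(3) p0] Lr_add(1)[OF U(4) V(4) q0] U(1) V(1)
    by simp
  have m: "2 powr p * x \<le> 2 powr q * x" if "x \<ge> 0" for x
    using two_powr_pq that by (rule mult_right_mono)
  have "Ir GM p (dl (\<lambda>x. u x + v x)) \<le> 2 powr q * (Ir GM p (dl u) + Ir GM p (dl v))"
    unfolding dl_add using Lr_add(2)[OF U(2) V(2) p0] m[of "Ir GM p (dl u) + Ir GM p (dl v)"] Ir_nonneg[of GM p "dl u"] Ir_nonneg[of GM p "dl v"]
    by linarith
  moreover have "Ir lebesgue p (\<lambda>x. G x + H x) \<le> 2 powr q * (Ir lebesgue p G + Ir lebesgue p H)"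
    using Lr_add(2)[OF U(3) V(3) p0] m[of "Ir lebesgue p G + Ir lebesgue p H"] Ir_nonneg[of lebesgue p G] Ir_nonneg[of lebesgue p H]
    by linarith
  moreover have "Ir AM q (\<lambda>x. G x + H x) \<le> 2 powr q * (Ir AM q G + Ir AM q H)"
    by (rule Lr_add(2)[OF U(4) V(4) q0])
  ultimately show "xi (\<lambda>x. u x + v x) (\<lambda>x. G x + H x) \<le> 2 powr q * (xi u G + xi v H)"
    by (simp add: xi_def algebra_simps)
qed

lemma fin_cmult:
  assumes u: "fin u G"
  shows "fin (\<lambda>x. c * u x) (\<lambda>x. c *\<^sub>R G x)"
    "xi (\<lambda>x. c * u x) (\<lambda>x. c *\<^sub>R G x) = \<bar>c\<bar> powr p * (Ir GM p (dl u) + Ir lebesgue p G) + \<bar>c\<bar> powr q * Ir AM q G"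
proof -
  note U = finD[OF u]
  show "fin (\<lambda>x. c * u x) (\<lambda>x. c *\<^sub>R G x)"
    unfolding fin_def dl_cmult using Lr_scaleR(1)[OF U(2)] Lr_scaleR(1)[OF U(3)] Lr_scaleR(1)[OF U(4)] U(1)
    by simp
  show "xi (\<lambda>x. c * u x) (\<lambda>x. c *\<^sub>R G x) = \<bar>c\<bar> powr p * (Ir GM p (dl u) + Ir lebesgue p G) + \<bar>c\<bar> powr q * Ir AM q G"
    unfolding xi_def dl_cmult Lr_scaleR(2)[OF U(2)] Lr_scaleR(2)[OF U(3)] Lr_scaleR(2)[OF U(4)] by (simp add: algebra_simps)
qed

text \<open>The modular mixes the homogeneities \<open>p\<close> and \<open>q\<close>: the smaller
  exponent decides for contractions, the larger one for dilations. This is what links the modular to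
  the Luxemburg norm.\<close>

lemma xi_cmult_le:
  assumes u: "fin u G"
  shows "xi (\<lambda>x. c * u x) (\<lambda>x. c *\<^sub>R G x) \<le> (\<bar>c\<bar> powr p + \<bar>c\<bar> powr q) * xi u G"
    "\<bar>c\<bar> \<le> 1 \<Longrightarrow> xi (\<lambda>x. c * u x) (\<lambda>x. c *\<^sub>R G x) \<le> \<bar>c\<bar> powr p * xi u G"
    "\<bar>c\<bar> \<ge> 1 \<Longrightarrow> xi (\<lambda>x. c * u x) (\<lambda>x. c *\<^sub>R G x) \<le> \<bar>c\<bar> powr q * xi u G"
proof -
  have n: "0 \<le> Ir GM p (dl u) + Ir lebesgue p G" "0 \<le> Ir AM q G"
    by (simp_all add: Ir_nonneg)
  show "xi (\<lambda>x. c * u x) (\<lambda>x. c *\<^sub>R G x) \<le> (\<bar>c\<bar> powr p + \<bar>c\<bar> powr q) * xi u G"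
    unfolding fin_cmult(2)[OF u] xi_def using n by (simp add: distrib_right distrib_left add_increasing Ir_nonneg)
  show "xi (\<lambda>x. c * u x) (\<lambda>x. c *\<^sub>R G x) \<le> \<bar>c\<bar> powr p * xi u G" if c: "\<bar>c\<bar> \<le> 1"
  proof -
    have "\<bar>c\<bar> powr q \<le> \<bar>c\<bar> powr p" using c pq by (intro powr_mono') auto
    from mult_right_mono[OF this n(2)] show ?thesis
      unfolding fin_cmult(2)[OF u] xi_def by (simp add: distrib_left)
  qed
  show "xi (\<lambda>x. c * u x) (\<lambda>x. c *\<^sub>R G x) \<le> \<bar>c\<bar> powr q * xi u G" if c: "\<bar>c\<bar> \<ge> 1"
  proof -
    have "\<bar>c\<bar> powr p \<le> \<bar>c\<bar> powr q" using c pq by (intro powr_mono) auto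
    from mult_right_mono[OF this n(1)] show ?thesis
      unfolding fin_cmult(2)[OF u] xi_def by (simp add: distrib_left)
  qed
qed

lemma fin_diff:
  assumes u: "fin u G" and v: "fin v H"
  shows "fin (\<lambda>x. u x - v x) (\<lambda>x. G x - H x)" "xi (\<lambda>x. u x - v x) (\<lambda>x. G x - H x) \<le> 2 powr q * (xi u G + xi v H)"
  using fin_add[OF u fin_cmult(1)[OF v, of "-1"]] fin_cmult(2)[OF v, of "-1"] by (simp_all add: xi_def)

lemma xi_diff_commute: "xi (\<lambda>x. u x - v x) (\<lambda>x. G x - H x) = xi (\<lambda>x. v x - u x) (\<lambda>x. H x - G x)"
  unfolding xi_def dl_diff by (simp add: Ir_diff_commute[of _ _ "dl u"] Ir_diff_commute[of _ _ G])

lemma fin_Cc_inf: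
  assumes \<phi>: "\<phi> \<in> Cc_inf \<Omega>'"
  shows "fin \<phi> (grad \<phi>)"
proof -
  obtain K where K: "compact K" "K \<subseteq> \<Omega>'" "\<forall>x. x \<notin> K \<longrightarrow> \<phi> x = 0" "\<forall>x. x \<notin> K \<longrightarrow> grad \<phi> x = 0"
     "\<forall>x h. x \<notin> K \<longrightarrow> frechet_derivative \<phi> (at x) h = 0"
    by (rule Cc_inf_supportE[OF \<phi>])
  have i: "integrable lebesgue (\<lambda>x. norm (grad \<phi> x) powr r)" if r: "r > 0" for r
  proof (rule compact_support_integrable(2)[OF K(1)])
    show "continuous_on UNIV (\<lambda>x. norm (grad \<phi> x) powr r)"
      using r by (intro continuous_on_powr' continuous_on_norm grad_continuous[OF \<phi>] continuous_on_const) auto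
    show "norm (grad \<phi> x) powr r = 0" if "x \<notin> K" for x using that K(4) by simp
  qed
  have m: "grad \<phi> \<in> borel_measurable lebesgue" by (rule grad_borel_measurable[OF \<phi>])
  have "integrable AM (\<lambda>x. norm (grad \<phi> x) powr q)"
  proof -
    have mq: "(\<lambda>x. norm (grad \<phi> x) powr q) \<in> borel_measurable lebesgue" using m by measurable
    have "integrable lebesgue (\<lambda>x. a x *\<^sub>R (norm (grad \<phi> x) powr q))"
    proof (rule Bochner_Integration.integrable_bound[OF integrable_mult_right[OF i[OF q0], of A]])
      show "(\<lambda>x. a x *\<^sub>R (norm (grad \<phi> x) powr q)) \<in> borel_measurable lebesgue"
        using mq a_meas by measurable
      show "AE x in lebesgue. norm (a x *\<^sub>R (norm (grad \<phi> x) powr q)) \<le> norm (A * norm (grad \<phi> x) powr q)"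
      proof (rule AE_I2)
        fix x
        have "A \<ge> 0" using a_nonneg[of x] a_le[of x] by linarith
        then show "norm (a x *\<^sub>R (norm (grad \<phi> x) powr q)) \<le> norm (A * norm (grad \<phi> x) powr q)"
          using a_nonneg[of x] a_le[of x] by (simp add: abs_mult mult_right_mono)
      qed
    qed
    then show ?thesis
      using mq a_meas by (subst integrable_density) (auto simp: a_nonneg)
  qed
  then show ?thesis
    unfolding fin_def Lr_def using i[OF p0] m Cc_inf_borel_measurable[OF \<phi>] Cc_inf_dl_Lr[OF \<phi> s01 p0, unfolded Lr_def] by simp
qed

subsection \<open>Modular and norm\<close>

lemma nn_integral_norm_powr:
  assumes "Lr M r X"
  shows "(\<integral>\<^sup>+z. ennreal (norm (X z) powr r) \<partial>M) = ennreal (Ir M r X)"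
  unfolding Ir_def by (rule nn_integral_eq_integral[OF LrD(2)[OF assms]]) simp

lemma Lr_iff_nn_integral:
  fixes X :: "'c \<Rightarrow> 'b::euclidean_space"
  shows "Lr M r X \<longleftrightarrow> X \<in> borel_measurable M \<and> (\<integral>\<^sup>+z. ennreal (norm (X z) powr r) \<partial>M) < \<infinity>"
proof
  assume "Lr M r X"
  then show "X \<in> borel_measurable M \<and> (\<integral>\<^sup>+z. ennreal (norm (X z) powr r) \<partial>M) < \<infinity>"
    using nn_integral_norm_powr[of M r X] by (simp add: Lr_def)
next
  assume X: "X \<in> borel_measurable M \<and> (\<integral>\<^sup>+z. ennreal (norm (X z) powr r) \<partial>M) < \<infinity>"
  then have [measurable]: "X \<in> borel_measurable M" by simp
  have "integrable M (\<lambda>z. norm (X z) powr r)"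
    by (rule integrableI_bounded) (use X in \<open>simp_all\<close>)
  with X show "Lr M r X" by (simp add: Lr_def)
qed

text \<open>Kept in \<open>ennreal\<close>, so that finiteness of the modular can be split into
  finiteness of the three terms.\<close>

lemma modular_W_eq_nn:
  assumes G: "has_weak_gradient u G"
  shows "modular_W s p q a u = (\<integral>\<^sup>+z. ennreal (norm (dl u z) powr p) \<partial>GM) +
     ((\<integral>\<^sup>+x. ennreal (norm (G x) powr p) \<partial>lebesgue) + (\<integral>\<^sup>+x. ennreal (norm (G x) powr q) \<partial>AM))"
proof -
  have u[measurable]: "u \<in> borel_measurable lebesgue" and mG[measurable]: "G \<in> borel_measurable lebesgue"
    using has_weak_gradientD[OF G] by auto
  note a_meas[measurable]
  have mdl: "(\<lambda>z. norm (dl u z) powr p) \<in> borel_measurable leb2"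
    using dl_measurable_leb2[OF u] by measurable
  have 1: "(\<integral>\<^sup>+x. (\<integral>\<^sup>+y. ennreal (\<bar>u x - u y\<bar> powr p / norm (x - y) powr (real DIM('a) + s * p)) \<partial>lebesgue) \<partial>lebesgue) =
    (\<integral>\<^sup>+z. ennreal (norm (dl u z) powr p) \<partial>GM)"
    by (subst nn_integral_gag[OF mdl]) (simp_all add: dl_def)
  have "(\<integral>\<^sup>+x. ennreal (norm (weak_gradient u x) powr p + a x * norm (weak_gradient u x) powr q) \<partial>lebesgue) =
     (\<integral>\<^sup>+x. ennreal (norm (G x) powr p) + ennreal (a x) * ennreal (norm (G x) powr q) \<partial>lebesgue)"
    using weak_gradient_AE[OF G] by (intro nn_integral_cong_AE) (auto simp: a_nonneg ennreal_mult)
  also have "\<dots> = (\<integral>\<^sup>+x. ennreal (norm (G x) powr p) \<partial>lebesgue) + (\<integral>\<^sup>+x. ennreal (a x) * ennreal (norm (G x) powr q) \<partial>lebesgue)"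
    by (rule nn_integral_add) measurable
  also have "(\<integral>\<^sup>+x. ennreal (a x) * ennreal (norm (G x) powr q) \<partial>lebesgue) = (\<integral>\<^sup>+x. ennreal (norm (G x) powr q) \<partial>AM)"
    by (rule nn_integral_density[symmetric]) measurable
  finally show ?thesis
    unfolding modular_W_def 1 by simp
qed

lemma modular_W_eq:
  assumes "has_weak_gradient u G" "fin u G"
  shows "modular_W s p q a u = ennreal (xi u G)"
  unfolding modular_W_eq_nn[OF assms(1)] xi_def
  using nn_integral_norm_powr[OF finD(2)[OF assms(2)]] nn_integral_norm_powr[OF finD(3)[OF assms(2)]]
    nn_integral_norm_powr[OF finD(4)[OF assms(2)]]
  by (simp add: Ir_nonneg add.assoc)

lemma modular_W_fin:
  assumes G: "has_weak_gradient u G" and m: "modular_W s p q a u < \<infinity>"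
  shows "fin u G"
proof -
  have "u \<in> borel_measurable lebesgue" "G \<in> borel_measurable lebesgue"
    using has_weak_gradientD[OF G] by auto
  with m dl_measurable[of u] show ?thesis
    unfolding modular_W_eq_nn[OF G] fin_def Lr_iff_nn_integral by (auto simp: ennreal_add_eq_top less_top)
qed

text \<open>Scaling back from \<open>u / t'\<close> multiplies the modular by at most
  \<open>t' powr p\<close>, hence by at most \<open>t'\<close>. Together with
  \<open>norm_W_le\<close> this makes convergence in the norm and in the modular the same, after
  which only \<open>xi\<close> is used.\<close>

lemma norm_W_less_imp:
  assumes G: "has_weak_gradient u G" and t: "norm_W s p q a u < ennreal t" "t \<le> 1"
  shows "fin u G" "xi u G \<le> t"
proof -
  obtain t' where t': "t' > 0" "ennreal t' < ennreal t" "modular_W s p q a (\<lambda>x. u x / t') \<le> 1"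
    using t(1) unfolding norm_W_def Inf_less_iff by auto
  have tt: "t' < t" using t' by (auto simp: ennreal_less_iff)
  let ?v = "\<lambda>x. inverse t' * u x" and ?H = "\<lambda>x. inverse t' *\<^sub>R G x"
  have v: "has_weak_gradient ?v ?H" by (rule has_weak_gradient_cmult[OF G])
  have mv: "modular_W s p q a ?v \<le> 1"
    using t'(3) by (simp add: divide_inverse mult.commute)
  have fv: "fin ?v ?H"
    by (rule modular_W_fin[OF v]) (use mv in \<open>simp add: le_less_trans\<close>)
  have x1: "xi ?v ?H \<le> 1"
    using mv unfolding modular_W_eq[OF v fv] by simp
  have e: "(\<lambda>x. t' * ?v x) = u" "(\<lambda>x. t' *\<^sub>R ?H x) = G"
    using t'(1) by auto
  show "fin u G" using fin_cmult(1)[OF fv, of t'] unfolding e .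
  have "xi u G \<le> \<bar>t'\<bar> powr p * xi ?v ?H"
    using xi_cmult_le(2)[OF fv, of t'] tt t t'(1) unfolding e by simp
  also have "\<dots> \<le> \<bar>t'\<bar> powr p * 1"
    using x1 by (intro mult_left_mono) auto
  also have "\<dots> \<le> t' powr 1"
    using powr_mono'[of 1 p t'] t'(1) tt t(2) p1 by simp
  finally show "xi u G \<le> t" using t'(1) tt by simp
qed

lemma norm_W_le:
  assumes G: "has_weak_gradient u G" and f: "fin u G" and t: "0 < t" "t \<le> 1" and x: "xi u G \<le> t powr q"
  shows "norm_W s p q a u \<le> ennreal t"
proof -
  let ?v = "\<lambda>x. inverse t * u x" and ?H = "\<lambda>x. inverse t *\<^sub>R G x"
  have v: "has_weak_gradient ?v ?H" by (rule has_weak_gradient_cmult[OF G])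
  have fv: "fin ?v ?H" by (rule fin_cmult(1)[OF f])
  have "xi ?v ?H \<le> \<bar>inverse t\<bar> powr q * xi u G"
    using t by (intro xi_cmult_le(3)[OF f]) (simp add: one_le_inverse)
  also have "\<dots> \<le> \<bar>inverse t\<bar> powr q * t powr q"
    using x by (intro mult_left_mono) auto
  also have "\<dots> = 1" using t by (simp add: powr_mult[symmetric])
  finally have "modular_W s p q a ?v \<le> 1"
    unfolding modular_W_eq[OF v fv] by simp
  then have "modular_W s p q a (\<lambda>x. u x / t) \<le> 1"
    by (simp add: divide_inverse mult.commute)
  then show ?thesis
    unfolding norm_W_def using t by (intro Inf_lower) auto
qed

text \<open>\<open>space_W\<close> with an explicit gradient and with convergence of the modular
  instead of the norm; \<open>space_W_imp_inW\<close> and \<open>inW_imp_space_W\<close> justify the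
  exchange.\<close>

definition inW :: "('a \<Rightarrow> real) \<Rightarrow> ('a \<Rightarrow> 'a) \<Rightarrow> bool" where
  "inW u G \<longleftrightarrow> has_weak_gradient u G \<and> (\<forall>x. x \<notin> \<Omega> \<longrightarrow> u x = 0) \<and> fin u G \<and>
    (\<exists>\<phi>. (\<forall>n. \<phi> n \<in> Cc_inf \<Omega>) \<and> (\<lambda>n. xi (\<lambda>x. u x - \<phi> n x) (\<lambda>x. G x - grad (\<phi> n) x)) \<longlonglongrightarrow> 0)"

lemma inWD:
  assumes "inW u G"
  shows "has_weak_gradient u G" "\<And>x. x \<notin> \<Omega> \<Longrightarrow> u x = 0" "fin u G"
  using assms by (auto simp: inW_def)

lemma inW_approx:
  assumes "inW u G" "e > 0"
  obtains \<phi> where "\<phi> \<in> Cc_inf \<Omega>" "xi (\<lambda>x. u x - \<phi> x) (\<lambda>x. G x - grad \<phi> x) < e"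
proof -
  obtain \<phi> where \<phi>: "\<forall>n. \<phi> n \<in> Cc_inf \<Omega>" "(\<lambda>n. xi (\<lambda>x. u x - \<phi> n x) (\<lambda>x. G x - grad (\<phi> n) x)) \<longlonglongrightarrow> 0"
    using assms(1) by (auto simp: inW_def)
  from LIMSEQ_D[OF \<phi>(2) assms(2)] obtain N where "norm (xi (\<lambda>x. u x - \<phi> N x) (\<lambda>x. G x - grad (\<phi> N) x) - 0) < e"
    by blast
  then show ?thesis
    using that[of "\<phi> N"] \<phi>(1) by simp
qed

lemma space_W_imp_inW:
  assumes u: "u \<in> space_W \<Omega> s p q a" and G: "has_weak_gradient u G"
  shows "inW u G"
proof -
  obtain \<phi> where \<phi>: "\<forall>n. \<phi> n \<in> Cc_inf \<Omega>" and l: "(\<lambda>n. norm_W s p q a (\<lambda>x. u x - \<phi> n x)) \<longlonglongrightarrow> 0"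
    and z: "\<forall>x. x \<notin> \<Omega> \<longrightarrow> u x = 0"
    using u unfolding space_W_def by blast
  have wg: "has_weak_gradient (\<lambda>x. u x - \<phi> n x) (\<lambda>x. G x - grad (\<phi> n) x)" for n
    using has_weak_gradient_diff[OF G has_weak_gradient_grad] \<phi> by blast
  have ev: "\<forall>\<^sub>F n in sequentially. norm_W s p q a (\<lambda>x. u x - \<phi> n x) < ennreal t" if "t > 0" for t
    using order_tendstoD(2)[OF l, of "ennreal t"] that by simp
  \<comment> \<open>One test function at distance less than 1 already shows that \<open>u\<close>
    has a finite modular, which \<open>space_W\<close> does not state.\<close>
  obtain n0 where "norm_W s p q a (\<lambda>x. u x - \<phi> n0 x) < ennreal 1"
    using eventually_happens[OF ev[of 1]] by auto
  from norm_W_less_imp(1)[OF wg this] have "fin (\<lambda>x. u x - \<phi> n0 x) (\<lambda>x. G x - grad (\<phi> n0) x)" by simp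
  from fin_add(1)[OF this fin_Cc_inf[OF \<phi>[rule_format, of n0]]] have f: "fin u G" by simp
  have "(\<lambda>n. xi (\<lambda>x. u x - \<phi> n x) (\<lambda>x. G x - grad (\<phi> n) x)) \<longlonglongrightarrow> 0"
  proof (rule order_tendstoI)
    fix e :: real assume "e < 0"
    then show "\<forall>\<^sub>F n in sequentially. e < xi (\<lambda>x. u x - \<phi> n x) (\<lambda>x. G x - grad (\<phi> n) x)"
      by (auto intro!: always_eventually less_le_trans[OF _ xi_nonneg])
  next
    fix e :: real assume e: "0 < e"
    define t where "t = min (e / 2) 1"
    have t: "0 < t" "t \<le> 1" "t < e" using e by (auto simp: t_def)
    from ev[OF t(1)] show "\<forall>\<^sub>F n in sequentially. xi (\<lambda>x. u x - \<phi> n x) (\<lambda>x. G x - grad (\<phi> n) x) < e"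
    proof eventually_elim
      case (elim n)
      from norm_W_less_imp(2)[OF wg elim t(2)] t(3) show ?case by linarith
    qed
  qed
  with G z f \<phi> show ?thesis unfolding inW_def by blast
qed

lemma inW_imp_space_W:
  assumes u: "inW u G"
  shows "u \<in> space_W \<Omega> s p q a"
proof -
  obtain \<phi> where \<phi>: "\<forall>n. \<phi> n \<in> Cc_inf \<Omega>" and l: "(\<lambda>n. xi (\<lambda>x. u x - \<phi> n x) (\<lambda>x. G x - grad (\<phi> n) x)) \<longlonglongrightarrow> 0"
    using u unfolding inW_def by blast
  note U = inWD[OF u]
  have wg: "has_weak_gradient (\<lambda>x. u x - \<phi> n x) (\<lambda>x. G x - grad (\<phi> n) x)" for n
    using has_weak_gradient_diff[OF U(1) has_weak_gradient_grad] \<phi> by blast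
  have f: "fin (\<lambda>x. u x - \<phi> n x) (\<lambda>x. G x - grad (\<phi> n) x)" for n
    using fin_diff(1)[OF U(3) fin_Cc_inf] \<phi> by blast
  have "(\<lambda>n. norm_W s p q a (\<lambda>x. u x - \<phi> n x)) \<longlonglongrightarrow> 0"
  proof (rule order_tendstoI)
    fix e :: ennreal assume "e < 0"
    then show "\<forall>\<^sub>F n in sequentially. e < norm_W s p q a (\<lambda>x. u x - \<phi> n x)" by simp
  next
    fix e :: ennreal assume e: "0 < e"
    obtain t where t: "0 < t" "t \<le> 1" "ennreal t < e"
    proof (cases e)
      case (real r)
      show ?thesis
        using that[of "min (r / 2) 1"] e real by (auto simp: ennreal_less_iff min_def)
    qed (use that[of 1] in auto)
    have "t powr q > 0" using t by simp
    from order_tendstoD(2)[OF l this] show "\<forall>\<^sub>F n in sequentially. norm_W s p q a (\<lambda>x. u x - \<phi> n x) < e"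
    proof eventually_elim
      case (elim n)
      from norm_W_le[OF wg f t(1,2) less_imp_le[OF elim]] t(3) show ?case by (rule le_less_trans)
    qed
  qed
  then show ?thesis
    using U(1,2) \<phi> unfolding space_W_def by blast
qed

lemma inW_weak_gradient:
  assumes "u \<in> space_W \<Omega> s p q a"
  shows "inW u (weak_gradient u)"
proof -
  obtain G where "has_weak_gradient u G" using assms by (auto simp: space_W_def)
  then show ?thesis
    using space_W_imp_inW[OF assms] has_weak_gradient_weak_gradient by blast
qed

end

text \<open>Treating \<open>u\<close> and its gradient as one function into a product space yields a
  single almost everywhere convergent subsequence for both.\<close>

lemma integrable_Pair:
  fixes f :: "'c \<Rightarrow> 'b::euclidean_space" and g :: "'c \<Rightarrow> 'd::euclidean_space"
  assumes "integrable M f" "integrable M g"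
  shows "integrable M (\<lambda>x. (f x, g x))"
proof -
  have "bounded_linear (\<lambda>x::'b. (x, 0::'d))" "bounded_linear (\<lambda>y::'d. (0::'b, y))"
    by (intro bounded_linear_Pair bounded_linear_ident bounded_linear_zero)+
  then have "integrable M (\<lambda>x. (f x, 0::'d) + (0::'b, g x))"
    using assms by (intro Bochner_Integration.integrable_add integrable_bounded_linear[of "\<lambda>x::'b. (x, 0::'d)"]
        integrable_bounded_linear[of "\<lambda>y::'d. (0::'b, y)"])
  then show ?thesis by simp
qed

context double_phase
begin

subsection \<open>Algebra and the Poincare inequality\<close>

lemma inW_Cc_inf: "\<phi> \<in> Cc_inf \<Omega> \<Longrightarrow> inW \<phi> (grad \<phi>)"
proof -
  assume \<phi>: "\<phi> \<in> Cc_inf \<Omega>"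
  obtain K where K: "compact K" "K \<subseteq> \<Omega>" "\<forall>x. x \<notin> K \<longrightarrow> \<phi> x = 0" "\<forall>x. x \<notin> K \<longrightarrow> grad \<phi> x = 0"
     "\<forall>x h. x \<notin> K \<longrightarrow> frechet_derivative \<phi> (at x) h = 0"
    by (rule Cc_inf_supportE[OF \<phi>])
  have "xi (\<lambda>x. \<phi> x - \<phi> x) (\<lambda>x. grad \<phi> x - grad \<phi> x) = 0"
    by (simp add: xi_def dl_def Ir_def)
  then have "\<exists>\<phi>'. (\<forall>n::nat. \<phi>' n \<in> Cc_inf \<Omega>) \<and> (\<lambda>n. xi (\<lambda>x. \<phi> x - \<phi>' n x) (\<lambda>x. grad \<phi> x - grad (\<phi>' n) x)) \<longlonglongrightarrow> 0"
    using \<phi> by (intro exI[of _ "\<lambda>_. \<phi>"]) simp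
  with K(2,3) has_weak_gradient_grad[OF \<phi>] fin_Cc_inf[OF \<phi>] show ?thesis
    unfolding inW_def by blast
qed

lemma inW_add:
  assumes u: "inW u G" and v: "inW v H"
  shows "inW (\<lambda>x. u x + v x) (\<lambda>x. G x + H x)"
proof -
  note U = inWD[OF u] and V = inWD[OF v]
  obtain \<phi> where \<phi>: "\<forall>n. \<phi> n \<in> Cc_inf \<Omega>" "(\<lambda>n. xi (\<lambda>x. u x - \<phi> n x) (\<lambda>x. G x - grad (\<phi> n) x)) \<longlonglongrightarrow> 0"
    using u unfolding inW_def by blast
  obtain \<psi> where \<psi>: "\<forall>n. \<psi> n \<in> Cc_inf \<Omega>" "(\<lambda>n. xi (\<lambda>x. v x - \<psi> n x) (\<lambda>x. H x - grad (\<psi> n) x)) \<longlonglongrightarrow> 0"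
    using v unfolding inW_def by blast
  have fU: "fin (\<lambda>x. u x - \<phi> n x) (\<lambda>x. G x - grad (\<phi> n) x)" and fV: "fin (\<lambda>x. v x - \<psi> n x) (\<lambda>x. H x - grad (\<psi> n) x)" for n
    using fin_diff(1)[OF U(3) fin_Cc_inf[OF \<phi>(1)[rule_format]]] fin_diff(1)[OF V(3) fin_Cc_inf[OF \<psi>(1)[rule_format]]] by auto
  have le: "xi (\<lambda>x. (u x + v x) - (\<phi> n x + \<psi> n x)) (\<lambda>x. (G x + H x) - grad (\<lambda>x. \<phi> n x + \<psi> n x) x) \<le>
     2 powr q * (xi (\<lambda>x. u x - \<phi> n x) (\<lambda>x. G x - grad (\<phi> n) x) + xi (\<lambda>x. v x - \<psi> n x) (\<lambda>x. H x - grad (\<psi> n) x))" for n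
    using fin_add(2)[OF fU fV, of n n] by (simp add: grad_add[OF \<phi>(1)[rule_format] \<psi>(1)[rule_format]] algebra_simps)
  have "(\<lambda>n. 2 powr q * (xi (\<lambda>x. u x - \<phi> n x) (\<lambda>x. G x - grad (\<phi> n) x) + xi (\<lambda>x. v x - \<psi> n x) (\<lambda>x. H x - grad (\<psi> n) x))) \<longlonglongrightarrow> 2 powr q * (0 + 0)"
    by (intro tendsto_mult_left tendsto_add \<phi> \<psi>)
  then have l: "(\<lambda>n. 2 powr q * (xi (\<lambda>x. u x - \<phi> n x) (\<lambda>x. G x - grad (\<phi> n) x) + xi (\<lambda>x. v x - \<psi> n x) (\<lambda>x. H x - grad (\<psi> n) x))) \<longlonglongrightarrow> 0" by simp
  have "(\<lambda>n. xi (\<lambda>x. (u x + v x) - (\<phi> n x + \<psi> n x)) (\<lambda>x. (G x + H x) - grad (\<lambda>x. \<phi> n x + \<psi> n x) x)) \<longlonglongrightarrow> 0"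
    by (rule tendsto_sandwich[OF _ _ tendsto_const l]) (simp_all add: xi_nonneg le)
  moreover have "\<forall>n. (\<lambda>x. \<phi> n x + \<psi> n x) \<in> Cc_inf \<Omega>"
    using Cc_inf_add \<phi>(1) \<psi>(1) by blast
  ultimately have "\<exists>\<phi>'. (\<forall>n::nat. \<phi>' n \<in> Cc_inf \<Omega>) \<and> (\<lambda>n. xi (\<lambda>x. (u x + v x) - \<phi>' n x) (\<lambda>x. (G x + H x) - grad (\<phi>' n) x)) \<longlonglongrightarrow> 0"
    by (intro exI[of _ "\<lambda>n x. \<phi> n x + \<psi> n x"] conjI)
  with has_weak_gradient_add[OF U(1) V(1)] fin_add(1)[OF U(3) V(3)] U(2) V(2) show ?thesis
    unfolding inW_def by simp
qed

lemma inW_cmult: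
  assumes u: "inW u G"
  shows "inW (\<lambda>x. c * u x) (\<lambda>x. c *\<^sub>R G x)"
proof -
  note U = inWD[OF u]
  obtain \<phi> where \<phi>: "\<forall>n. \<phi> n \<in> Cc_inf \<Omega>" "(\<lambda>n. xi (\<lambda>x. u x - \<phi> n x) (\<lambda>x. G x - grad (\<phi> n) x)) \<longlonglongrightarrow> 0"
    using u unfolding inW_def by blast
  have fU: "fin (\<lambda>x. u x - \<phi> n x) (\<lambda>x. G x - grad (\<phi> n) x)" for n
    using fin_diff(1)[OF U(3) fin_Cc_inf[OF \<phi>(1)[rule_format]]] by auto
  have le: "xi (\<lambda>x. c * u x - c * \<phi> n x) (\<lambda>x. c *\<^sub>R G x - grad (\<lambda>x. c * \<phi> n x) x) \<le>
     (\<bar>c\<bar> powr p + \<bar>c\<bar> powr q) * xi (\<lambda>x. u x - \<phi> n x) (\<lambda>x. G x - grad (\<phi> n) x)" for n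
    using xi_cmult_le(1)[OF fU, of c n] by (simp add: grad_cmult[OF \<phi>(1)[rule_format]] right_diff_distrib scaleR_right_diff_distrib)
  have l: "(\<lambda>n. (\<bar>c\<bar> powr p + \<bar>c\<bar> powr q) * xi (\<lambda>x. u x - \<phi> n x) (\<lambda>x. G x - grad (\<phi> n) x)) \<longlonglongrightarrow> 0"
    using tendsto_mult_right_zero[OF \<phi>(2)] by simp
  have "(\<lambda>n. xi (\<lambda>x. c * u x - c * \<phi> n x) (\<lambda>x. c *\<^sub>R G x - grad (\<lambda>x. c * \<phi> n x) x)) \<longlonglongrightarrow> 0"
    by (rule tendsto_sandwich[OF _ _ tendsto_const l]) (simp_all add: xi_nonneg le)
  moreover have "\<forall>n. (\<lambda>x. c * \<phi> n x) \<in> Cc_inf \<Omega>"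
    using Cc_inf_cmult \<phi>(1) by blast
  ultimately have "\<exists>\<phi>'. (\<forall>n::nat. \<phi>' n \<in> Cc_inf \<Omega>) \<and> (\<lambda>n. xi (\<lambda>x. c * u x - \<phi>' n x) (\<lambda>x. c *\<^sub>R G x - grad (\<phi>' n) x)) \<longlonglongrightarrow> 0"
    by (intro exI[of _ "\<lambda>n x. c * \<phi> n x"] conjI)
  with has_weak_gradient_cmult[OF U(1)] fin_cmult(1)[OF U(3)] U(2) show ?thesis
    unfolding inW_def by simp
qed

lemma inW_diff:
  assumes u: "inW u G" and v: "inW v H"
  shows "inW (\<lambda>x. u x - v x) (\<lambda>x. G x - H x)"
  using inW_add[OF u inW_cmult[OF v, of "-1"]] by simp

lemma inW_minus:
  assumes u: "inW u G"
  shows "inW (\<lambda>x. - u x) (\<lambda>x. - G x)"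
  using inW_cmult[OF u, of "-1"] by simp

section \<open>Poincare inequality, L1 bounds and completeness of W\<close>

definition vol :: real where "vol = measure lebesgue \<Omega>"

lemma \<Omega>_sets: "\<Omega> \<in> sets lebesgue"
  using open_\<Omega> by (simp add: borel_open)

lemma \<Omega>_finite: "emeasure lebesgue \<Omega> < \<infinity>"
  using emeasure_bounded_finite[OF bounded_\<Omega>] \<Omega>_sets open_\<Omega> by (simp add: borel_open)

lemma emeasure_\<Omega>: "emeasure lebesgue \<Omega> = ennreal vol"
  unfolding vol_def using \<Omega>_finite by (intro emeasure_eq_ennreal_measure) auto

lemma vol_pos: "vol > 0"
proof -
  obtain x e where "e > 0" "cball x e \<subseteq> \<Omega>"
    using open_\<Omega> \<Omega>_ne by (meson all_not_in_conv open_contains_cball)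
  then have "emeasure lebesgue (cball x e) \<le> ennreal vol"
    unfolding emeasure_\<Omega>[symmetric] by (intro emeasure_mono \<Omega>_sets)
  moreover have "emeasure lebesgue (cball x e) > 0"
  proof -
    have "unit_ball_vol (real DIM('a)) * e ^ DIM('a) > 0"
      using \<open>e > 0\<close> by (intro mult_pos_pos unit_ball_vol_pos) auto
    then show ?thesis
      using emeasure_lebesgue_cball[of e x] \<open>e > 0\<close> by simp
  qed
  ultimately have "ennreal vol > 0" by (rule less_le_trans[rotated])
  then show ?thesis by simp
qed

definition CP :: real where
  "CP = gain_const TYPE('a) s p * vol powr (s * p / real DIM('a))"

lemma CP_pos: "CP > 0"
  unfolding CP_def by (intro mult_pos_pos gain_const_pos) (use vol_pos in auto)

lemma poincare:
  assumes u: "fin u G" "\<And>x. x \<notin> \<Omega> \<Longrightarrow> u x = 0"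
  shows "Lr lebesgue p u" "Ir lebesgue p u \<le> CP * Ir GM p (dl u)"
proof -
  have e: "emeasure lebesgue \<Omega> \<le> ennreal vol" by (simp add: emeasure_\<Omega>)
  note * = gagliardo_poincare[OF finD(1)[OF u(1)] \<Omega>_sets e vol_pos u(2) s01(1) p0 finD(2)[OF u(1)]]
  show "Lr lebesgue p u" by (rule *(1))
  show "Ir lebesgue p u \<le> CP * Ir GM p (dl u)" unfolding CP_def by (rule *(2))
qed

lemma L1_of_Lr:
  fixes X :: "'a \<Rightarrow> 'b::euclidean_space"
  assumes X: "Lr lebesgue p X" and z: "AE x in lebesgue. x \<notin> \<Omega> \<longrightarrow> X x = 0"
  shows "integrable lebesgue X"
    "\<eta> > 0 \<Longrightarrow> (LINT x|lebesgue. norm (X x)) \<le> \<eta> * vol + \<eta> powr (1 - p) * Ir lebesgue p X"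
proof -
  have p1': "p \<ge> 1" using p1 by simp
  have [measurable]: "X \<in> borel_measurable lebesgue" using X LrD by blast
  have i: "integrable lebesgue (\<lambda>x. indicator \<Omega> x *\<^sub>R X x)"
    by (rule Lr_imp_integrable(1)[OF X \<Omega>_sets \<Omega>_finite p1'])
  have e: "AE x in lebesgue. indicator \<Omega> x *\<^sub>R X x = X x"
    using z by eventually_elim (auto simp: indicator_def)
  show j: "integrable lebesgue X"
    by (rule integrable_cong_AE_imp[OF i]) (use e in \<open>auto elim: AE_mp\<close>)
  assume \<eta>: "\<eta> > 0"
  have "(LINT x|lebesgue. norm (X x)) = (LINT x|lebesgue. indicator \<Omega> x * norm (X x))"
  proof (rule integral_cong_AE)
    show "(\<lambda>x. indicat_real \<Omega> x * norm (X x)) \<in> borel_measurable lebesgue"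
      using \<Omega>_sets by measurable
    show "AE x in lebesgue. norm (X x) = indicat_real \<Omega> x * norm (X x)"
      using z by eventually_elim (auto simp: indicator_def)
  qed measurable
  also have "\<dots> \<le> \<eta> * vol + \<eta> powr (1 - p) * Ir lebesgue p X"
    unfolding vol_def by (rule Lr_imp_integrable(2)[OF X \<Omega>_sets \<Omega>_finite p1' \<eta>])
  finally show "(LINT x|lebesgue. norm (X x)) \<le> \<eta> * vol + \<eta> powr (1 - p) * Ir lebesgue p X" .
qed

text \<open>The gradients of the approximating test functions vanish outside
  \<open>\<Omega>\<close>, so there \<open>G\<close> is no larger than the approximation error. The
  boundary of \<open>\<Omega>\<close> is included, without any information on its measure.\<close>

lemma inW_grad_AE_zero:
  assumes u: "inW u G"
  shows "AE x in lebesgue. x \<notin> \<Omega> \<longrightarrow> G x = 0"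
proof -
  obtain \<phi> where \<phi>: "\<forall>n. \<phi> n \<in> Cc_inf \<Omega>" "(\<lambda>n. xi (\<lambda>x. u x - \<phi> n x) (\<lambda>x. G x - grad (\<phi> n) x)) \<longlonglongrightarrow> 0"
    using u unfolding inW_def by blast
  note U = inWD[OF u] finD[OF inWD(3)[OF u]]
  let ?G = "\<lambda>x. indicator (- \<Omega>) x *\<^sub>R G x"
  have mG: "G \<in> borel_measurable lebesgue" using U(6) LrD by blast
  have m: "?G \<in> borel_measurable lebesgue"
    using mG \<Omega>_sets by (intro borel_measurable_scaleR borel_measurable_indicator) (auto simp: Compl_in_sets_lebesgue)
  have L: "Lr lebesgue p ?G"
    by (rule Lr_bound[OF U(6) m _ p0]) (auto simp: indicator_def)
  have "Ir lebesgue p ?G \<le> xi (\<lambda>x. u x - \<phi> n x) (\<lambda>x. G x - grad (\<phi> n) x)" for n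
  proof -
    have \<phi>n: "\<phi> n \<in> Cc_inf \<Omega>" using \<phi>(1) by blast
    obtain K where K: "compact K" "K \<subseteq> \<Omega>" "\<forall>x. x \<notin> K \<longrightarrow> \<phi> n x = 0" "\<forall>x. x \<notin> K \<longrightarrow> grad (\<phi> n) x = 0"
       "\<forall>x h. x \<notin> K \<longrightarrow> frechet_derivative (\<phi> n) (at x) h = 0"
      by (rule Cc_inf_supportE[OF \<phi>n])
    have "Ir lebesgue p ?G \<le> Ir lebesgue p (\<lambda>x. G x - grad (\<phi> n) x)"
    proof (rule Ir_mono_AE[OF finD(3)[OF fin_diff(1)[OF U(3) fin_Cc_inf[OF \<phi>n]]] m _ p0], rule AE_I2)
      fix x
      show "norm (?G x) \<le> norm (G x - grad (\<phi> n) x)"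
        using K(2,4) by (cases "x \<in> \<Omega>") auto
    qed
    also have "\<dots> \<le> xi (\<lambda>x. u x - \<phi> n x) (\<lambda>x. G x - grad (\<phi> n) x)" by (rule xi_parts(2))
    finally show ?thesis .
  qed
  then have "Ir lebesgue p ?G \<le> 0"
    using LIMSEQ_le_const[OF \<phi>(2)] by blast
  then have "Ir lebesgue p ?G = 0"
    using Ir_nonneg[of lebesgue p ?G] by linarith
  from Ir_zero_AE[OF L this] show ?thesis
    by eventually_elim (auto simp: indicator_def)
qed

lemma inW_L1:
  assumes u: "inW u G"
  shows "integrable lebesgue u" "integrable lebesgue G"
    "\<eta> > 0 \<Longrightarrow> (LINT x|lebesgue. \<bar>u x\<bar>) \<le> \<eta> * vol + \<eta> powr (1 - p) * (CP * Ir GM p (dl u))"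
    "\<eta> > 0 \<Longrightarrow> (LINT x|lebesgue. norm (G x)) \<le> \<eta> * vol + \<eta> powr (1 - p) * Ir lebesgue p G"
proof -
  note U = inWD[OF u]
  note P = poincare[OF U(3) U(2)]
  have z: "AE x in lebesgue. x \<notin> \<Omega> \<longrightarrow> u x = 0" using U(2) by simp
  show "integrable lebesgue u" by (rule L1_of_Lr(1)[OF P(1) z])
  show "integrable lebesgue G" by (rule L1_of_Lr(1)[OF finD(3)[OF U(3)] inW_grad_AE_zero[OF u]])
  assume \<eta>: "\<eta> > 0"
  have "\<eta> powr (1 - p) * Ir lebesgue p u \<le> \<eta> powr (1 - p) * (CP * Ir GM p (dl u))"
    by (rule mult_left_mono[OF P(2) powr_ge_zero])
  then show "(LINT x|lebesgue. \<bar>u x\<bar>) \<le> \<eta> * vol + \<eta> powr (1 - p) * (CP * Ir GM p (dl u))"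
    using L1_of_Lr(2)[OF P(1) z \<eta>] by simp
  show "(LINT x|lebesgue. norm (G x)) \<le> \<eta> * vol + \<eta> powr (1 - p) * Ir lebesgue p G"
    by (rule L1_of_Lr(2)[OF finD(3)[OF U(3)] inW_grad_AE_zero[OF u] \<eta>])
qed

lemma inW_L1_small:
  assumes e: "e > 0"
  obtains d where "d > 0" "\<forall>u G. inW u G \<longrightarrow> xi u G < d \<longrightarrow>
    (LINT x|lebesgue. \<bar>u x\<bar>) + (LINT x|lebesgue. norm (G x)) < e"
proof -
  \<comment> \<open>Each of the two integrals spends \<open>e / 4\<close> on the measure of
    \<open>\<Omega>\<close>; \<open>d\<close> bounds the remaining modular part by
    \<open>e / 2\<close>.\<close>
  define \<eta> where "\<eta> = e / (4 * vol)"
  have \<eta>: "\<eta> > 0" "\<eta> * vol = e / 4" using e vol_pos by (auto simp: \<eta>_def)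
  define c where "c = \<eta> powr (1 - p) * (CP + 1)"
  have c: "c > 0" using \<eta> CP_pos by (simp add: c_def)
  define d where "d = e / (2 * c)"
  have d: "d > 0" "c * d = e / 2" using c e by (auto simp: d_def)
  have "(LINT x|lebesgue. \<bar>u x\<bar>) + (LINT x|lebesgue. norm (G x)) < e" if u: "inW u G" and x: "xi u G < d" for u G
  proof -
    have "\<eta> powr (1 - p) * (CP * Ir GM p (dl u)) \<le> \<eta> powr (1 - p) * (CP * xi u G)"
      using xi_parts(1)[of u G] CP_pos by (intro mult_left_mono) auto
    moreover have "\<eta> powr (1 - p) * Ir lebesgue p G \<le> \<eta> powr (1 - p) * xi u G"
      using xi_parts(2)[where u=u and G=G] by (intro mult_left_mono) auto
    moreover have "\<eta> powr (1 - p) * (CP * xi u G) + \<eta> powr (1 - p) * xi u G = c * xi u G"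
      by (simp add: c_def algebra_simps)
    moreover have "c * xi u G < c * d"
      using x c by (rule mult_strict_left_mono)
    ultimately show ?thesis
      using inW_L1(3,4)[OF u \<eta>(1)] \<eta>(2) d(2) by linarith
  qed
  with d(1) that show ?thesis by blast
qed

text \<open>W is closed. The Poincare inequality gives local L1 convergence, under which weak
  gradients survive, and choosing for each \<open>U n\<close> a test function within
  \<open>1 / (n + 1)\<close> gives approximants of the limit.\<close>

lemma inW_limit:
  assumes U: "\<And>n::nat. inW (U n) (H n)" and z: "\<And>x. x \<notin> \<Omega> \<Longrightarrow> u x = 0" and f: "fin u G"
    and lim: "(\<lambda>n. xi (\<lambda>x. U n x - u x) (\<lambda>x. H n x - G x)) \<longlonglongrightarrow> 0"
  shows "inW u G"
proof -
  have p1': "p \<ge> 1" using p1 by simp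
  note UD = inWD[OF U]
  have fd: "fin (\<lambda>x. U n x - u x) (\<lambda>x. H n x - G x)" for n
    by (rule fin_diff(1)[OF UD(3) f])
  have zd: "U n x - u x = 0" if "x \<notin> \<Omega>" for n x
    using that z UD(2) by simp
  note Pd = poincare[OF fd zd]
  have l1: "(\<lambda>n. Ir lebesgue p (\<lambda>x. U n x - u x)) \<longlonglongrightarrow> 0"
  proof (rule tendsto_sandwich[OF _ _ tendsto_const])
    show "(\<lambda>n. CP * xi (\<lambda>x. U n x - u x) (\<lambda>x. H n x - G x)) \<longlonglongrightarrow> 0"
      using tendsto_mult_right_zero[OF lim] by simp
    have "Ir lebesgue p (\<lambda>x. U n x - u x) \<le> CP * xi (\<lambda>x. U n x - u x) (\<lambda>x. H n x - G x)" for n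
      using Pd(2)[of n] mult_left_mono[OF xi_parts(1)[of "\<lambda>x. U n x - u x" "\<lambda>x. H n x - G x"], of CP] CP_pos by linarith
    then show "\<forall>\<^sub>F n in sequentially. Ir lebesgue p (\<lambda>x. U n x - u x) \<le> CP * xi (\<lambda>x. U n x - u x) (\<lambda>x. H n x - G x)"
      by simp
  qed (simp add: Ir_nonneg)
  have l2: "(\<lambda>n. Ir lebesgue p (\<lambda>x. H n x - G x)) \<longlonglongrightarrow> 0"
    by (rule tendsto_sandwich[OF _ _ tendsto_const lim]) (simp_all add: Ir_nonneg xi_parts(2))
  have wg: "has_weak_gradient u G"
  proof (rule has_weak_gradient_limit[OF UD(1)])
    fix K :: "'a set" assume K: "compact K"
    have Ks: "K \<in> sets lebesgue" using K by (simp add: borel_compact)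
    have Kf: "emeasure lebesgue K < \<infinity>"
      using emeasure_bounded_finite[OF compact_imp_bounded[OF K]] K by (simp add: borel_compact)
    show "u absolutely_integrable_on K" "G absolutely_integrable_on K"
      unfolding set_integrable_def
      by (rule Lr_imp_integrable(1)[OF poincare(1)[OF f z] Ks Kf p1']) (simp, rule Lr_imp_integrable(1)[OF finD(3)[OF f] Ks Kf p1'])
    show "(\<lambda>n. LINT x|lebesgue. indicat_real K x * \<bar>U n x - u x\<bar>) \<longlonglongrightarrow> 0"
      using Ir_tendsto_imp_L1[OF Pd(1) Ks Kf p1' l1] by simp
    show "(\<lambda>n. LINT x|lebesgue. indicat_real K x * norm (H n x - G x)) \<longlonglongrightarrow> 0"
      using Ir_tendsto_imp_L1[OF finD(3)[OF fd] Ks Kf p1' l2] by simp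
  qed
  have "\<exists>\<phi>. \<phi> \<in> Cc_inf \<Omega> \<and> xi (\<lambda>x. U n x - \<phi> x) (\<lambda>x. H n x - grad \<phi> x) < inverse (real (Suc n))" for n
    by (rule inW_approx[OF U, of "inverse (real (Suc n))" n]) auto
  then obtain \<phi> where \<phi>: "\<And>n. \<phi> n \<in> Cc_inf \<Omega>"
    "\<And>n. xi (\<lambda>x. U n x - \<phi> n x) (\<lambda>x. H n x - grad (\<phi> n) x) < inverse (real (Suc n))"
    by metis
  have "(\<lambda>n. xi (\<lambda>x. u x - \<phi> n x) (\<lambda>x. G x - grad (\<phi> n) x)) \<longlonglongrightarrow> 0"
  proof (rule tendsto_sandwich[OF _ _ tendsto_const])
    have "(\<lambda>n. 2 powr q * (xi (\<lambda>x. U n x - u x) (\<lambda>x. H n x - G x) + inverse (real (Suc n)))) \<longlonglongrightarrow> 2 powr q * (0 + 0)"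
      by (intro tendsto_mult_left tendsto_add lim LIMSEQ_inverse_real_of_nat)
    then show "(\<lambda>n. 2 powr q * (xi (\<lambda>x. U n x - u x) (\<lambda>x. H n x - G x) + inverse (real (Suc n)))) \<longlonglongrightarrow> 0" by simp
    have "xi (\<lambda>x. u x - \<phi> n x) (\<lambda>x. G x - grad (\<phi> n) x) \<le> 2 powr q * (xi (\<lambda>x. U n x - u x) (\<lambda>x. H n x - G x) + inverse (real (Suc n)))" for n
    proof -
      have "xi (\<lambda>x. (u x - U n x) + (U n x - \<phi> n x)) (\<lambda>x. (G x - H n x) + (H n x - grad (\<phi> n) x)) \<le>
        2 powr q * (xi (\<lambda>x. u x - U n x) (\<lambda>x. G x - H n x) + xi (\<lambda>x. U n x - \<phi> n x) (\<lambda>x. H n x - grad (\<phi> n) x))"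
        by (rule fin_add(2)[OF fin_diff(1)[OF f UD(3)] fin_diff(1)[OF UD(3) fin_Cc_inf[OF \<phi>(1)]]])
      also have "\<dots> \<le> 2 powr q * (xi (\<lambda>x. U n x - u x) (\<lambda>x. H n x - G x) + inverse (real (Suc n)))"
        using \<phi>(2)[of n] by (intro mult_left_mono add_mono) (auto simp: xi_diff_commute[of u])
      finally show ?thesis by simp
    qed
    then show "\<forall>\<^sub>F n in sequentially. xi (\<lambda>x. u x - \<phi> n x) (\<lambda>x. G x - grad (\<phi> n) x) \<le> 2 powr q * (xi (\<lambda>x. U n x - u x) (\<lambda>x. H n x - G x) + inverse (real (Suc n)))"
      by simp
  qed (simp add: xi_nonneg)
  with wg z f \<phi>(1) show ?thesis unfolding inW_def by blast
qed

lemma inW_AE_subseq: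
  assumes U: "\<And>n::nat. inW (U n) (H n)" and u: "inW u G"
    and lim: "(\<lambda>n. xi (\<lambda>x. U n x - u x) (\<lambda>x. H n x - G x)) \<longlonglongrightarrow> 0"
  obtains r :: "nat \<Rightarrow> nat" where "strict_mono r" "AE x in lebesgue. (\<lambda>n. U (r n) x) \<longlonglongrightarrow> u x \<and> (\<lambda>n. H (r n) x) \<longlonglongrightarrow> G x"
proof -
  let ?X = "\<lambda>n x. (U n x - u x, H n x - G x)"
  have d: "inW (\<lambda>x. U n x - u x) (\<lambda>x. H n x - G x)" for n by (rule inW_diff[OF U u])
  note i = inW_L1(1,2)[OF d]
  have iX: "integrable lebesgue (?X n)" for n
    by (rule integrable_Pair[OF i])
  have "(\<lambda>n. LINT x|lebesgue. norm (?X n x)) \<longlonglongrightarrow> 0"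
  proof (rule LIMSEQ_I)
    fix e :: real assume "e > 0"
    then obtain \<delta> where \<delta>: "\<delta> > 0" "\<forall>u G. inW u G \<longrightarrow> xi u G < \<delta> \<longrightarrow>
      (LINT x|lebesgue. \<bar>u x\<bar>) + (LINT x|lebesgue. norm (G x)) < e"
      by (rule inW_L1_small)
    from LIMSEQ_D[OF lim \<delta>(1)] obtain N where N: "\<forall>n\<ge>N. norm (xi (\<lambda>x. U n x - u x) (\<lambda>x. H n x - G x) - 0) < \<delta>"
      by blast
    have "norm ((LINT x|lebesgue. norm (?X n x)) - 0) < e" if n: "n \<ge> N" for n
    proof -
      have x: "xi (\<lambda>x. U n x - u x) (\<lambda>x. H n x - G x) < \<delta>" using N n by force
      have "(LINT x|lebesgue. norm (?X n x)) \<le> (LINT x|lebesgue. \<bar>U n x - u x\<bar> + norm (H n x - G x))"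
      proof (rule integral_mono)
        show "integrable lebesgue (\<lambda>x. norm (?X n x))" by (rule integrable_norm[OF iX])
        show "integrable lebesgue (\<lambda>x. \<bar>U n x - u x\<bar> + norm (H n x - G x))"
          by (intro Bochner_Integration.integrable_add integrable_abs integrable_norm i)
        show "norm (?X n x) \<le> \<bar>U n x - u x\<bar> + norm (H n x - G x)" for x
          using norm_Pair_le[of "U n x - u x" "H n x - G x"] by simp
      qed
      also have "\<dots> = (LINT x|lebesgue. \<bar>U n x - u x\<bar>) + (LINT x|lebesgue. norm (H n x - G x))"
        by (intro Bochner_Integration.integral_add integrable_abs integrable_norm i)
      also have "\<dots> < e" using \<delta>(2) d[of n] x by blast
      finally have "(LINT x|lebesgue. norm (?X n x)) < e" .
      moreover have "0 \<le> (LINT x|lebesgue. norm (?X n x))" by simp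
      ultimately show ?thesis by simp
    qed
    then show "\<exists>N. \<forall>n\<ge>N. norm ((LINT x|lebesgue. norm (?X n x)) - 0) < e" by blast
  qed
  from tendsto_L1_AE_subseq[OF iX this] obtain r where r: "strict_mono r" "AE x in lebesgue. (\<lambda>n. ?X (r n) x) \<longlonglongrightarrow> 0"
    by blast
  have "AE x in lebesgue. (\<lambda>n. U (r n) x) \<longlonglongrightarrow> u x \<and> (\<lambda>n. H (r n) x) \<longlonglongrightarrow> G x"
    using r(2)
  proof eventually_elim
    case (elim x)
    have "(\<lambda>n. U (r n) x - u x) \<longlonglongrightarrow> 0" "(\<lambda>n. H (r n) x - G x) \<longlonglongrightarrow> 0"
      using tendsto_fst[OF elim] tendsto_snd[OF elim] by simp_all
    then show ?case by (simp add: LIM_zero_iff)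
  qed
  with r(1) that show ?thesis by blast
qed

text \<open>The limit is found almost everywhere along a subsequence that converges in L1. Fatou's
  lemma, with \<open>n\<close> fixed and \<open>k\<close> tending to infinity in the differences to
  \<open>U (r k)\<close>, then converts the Cauchy condition into convergence of the
  modular.\<close>

lemma inW_complete:
  assumes U: "\<And>n::nat. inW (U n) (H n)"
    and C: "\<And>e. e > 0 \<Longrightarrow> \<exists>N. \<forall>m\<ge>N. \<forall>n\<ge>N. xi (\<lambda>x. U m x - U n x) (\<lambda>x. H m x - H n x) < e"
  obtains u G where "inW u G" "(\<lambda>n. xi (\<lambda>x. U n x - u x) (\<lambda>x. H n x - G x)) \<longlonglongrightarrow> 0"
proof -
  let ?X = "\<lambda>n x. (U n x, H n x)"
  note UD = inWD[OF U]
  have iX: "integrable lebesgue (?X n)" for n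
    by (rule integrable_Pair[OF inW_L1(1,2)[OF U]])
  have CX: "\<exists>N. \<forall>m\<ge>N. \<forall>n\<ge>N. (LINT z|lebesgue. norm (?X m z - ?X n z)) < e" if e: "e > 0" for e
  proof -
    obtain \<delta> where \<delta>: "\<delta> > 0" "\<forall>u G. inW u G \<longrightarrow> xi u G < \<delta> \<longrightarrow>
      (LINT x|lebesgue. \<bar>u x\<bar>) + (LINT x|lebesgue. norm (G x)) < e"
      by (rule inW_L1_small[OF e])
    obtain N where N: "\<forall>m\<ge>N. \<forall>n\<ge>N. xi (\<lambda>x. U m x - U n x) (\<lambda>x. H m x - H n x) < \<delta>"
      using C[OF \<delta>(1)] by blast
    have "(LINT z|lebesgue. norm (?X m z - ?X n z)) < e" if mn: "m \<ge> N" "n \<ge> N" for m n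
    proof -
      have d: "inW (\<lambda>x. U m x - U n x) (\<lambda>x. H m x - H n x)" by (rule inW_diff[OF U U])
      note i = inW_L1(1,2)[OF d]
      have x: "xi (\<lambda>x. U m x - U n x) (\<lambda>x. H m x - H n x) < \<delta>" using N mn by blast
      have "(LINT x|lebesgue. norm (?X m x - ?X n x)) \<le> (LINT x|lebesgue. \<bar>U m x - U n x\<bar> + norm (H m x - H n x))"
      proof (rule integral_mono)
        show "integrable lebesgue (\<lambda>x. norm (?X m x - ?X n x))"
          by (intro integrable_norm Bochner_Integration.integrable_diff iX)
        show "integrable lebesgue (\<lambda>x. \<bar>U m x - U n x\<bar> + norm (H m x - H n x))"
          by (intro Bochner_Integration.integrable_add integrable_abs integrable_norm i)
        show "norm (?X m x - ?X n x) \<le> \<bar>U m x - U n x\<bar> + norm (H m x - H n x)" for x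
          using norm_Pair_le[of "U m x - U n x" "H m x - H n x"] by simp
      qed
      also have "\<dots> = (LINT x|lebesgue. \<bar>U m x - U n x\<bar>) + (LINT x|lebesgue. norm (H m x - H n x))"
        by (intro Bochner_Integration.integral_add integrable_abs integrable_norm i)
      also have "\<dots> < e" using \<delta>(2) d x by blast
      finally show ?thesis .
    qed
    then show ?thesis by blast
  qed
  obtain r where r: "strict_mono r" and cv: "AE x in lebesgue. convergent (\<lambda>k. ?X (r k) x)"
    by (rule L1_Cauchy_AE_convergent_subseq[OF iX CX])
  define X0 where "X0 x = lim (\<lambda>k. ?X (r k) x)" for x
  have mX: "?X n \<in> borel_measurable lebesgue" for n using iX by auto
  have mX0: "X0 \<in> borel_measurable lebesgue"
    unfolding X0_def by (rule borel_measurable_lim_metric) (rule mX)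
  \<comment> \<open>Membership in W demands the value 0 everywhere outside \<open>\<Omega>\<close>,
    while the limit is determined only almost everywhere.\<close>
  define u where "u x = (if x \<in> \<Omega> then fst (X0 x) else 0)" for x
  define G where "G x = snd (X0 x)" for x
  have mf: "(\<lambda>x. fst (X0 x)) \<in> borel_measurable lebesgue" and mG: "G \<in> borel_measurable lebesgue"
    unfolding G_def[abs_def] using mX0 by (auto intro!: measurable_compose[OF mX0] borel_measurable_continuous_onI continuous_intros)
  have mu: "u \<in> borel_measurable lebesgue"
  proof -
    have "(\<lambda>x. indicator \<Omega> x * fst (X0 x)) \<in> borel_measurable lebesgue"
      by (intro borel_measurable_times borel_measurable_indicator \<Omega>_sets mf)
    moreover have "(\<lambda>x. indicator \<Omega> x * fst (X0 x)) = u" by (auto simp: u_def)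
    ultimately show ?thesis by simp
  qed
  have zu: "u x = 0" if "x \<notin> \<Omega>" for x using that by (simp add: u_def)
  have AEl: "AE x in lebesgue. (\<lambda>k. U (r k) x) \<longlonglongrightarrow> u x \<and> (\<lambda>k. H (r k) x) \<longlonglongrightarrow> G x"
    using cv
  proof eventually_elim
    case (elim x)
    then have l: "(\<lambda>k. ?X (r k) x) \<longlonglongrightarrow> X0 x"
      unfolding X0_def by (simp add: convergent_LIMSEQ_iff)
    have "(\<lambda>k. U (r k) x) \<longlonglongrightarrow> fst (X0 x)" "(\<lambda>k. H (r k) x) \<longlonglongrightarrow> G x"
      using tendsto_fst[OF l] tendsto_snd[OF l] by (simp_all add: G_def)
    moreover have "(\<lambda>k. U (r k) x) \<longlonglongrightarrow> 0" if "x \<notin> \<Omega>"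
      using UD(2)[OF that] by simp
    ultimately show ?case by (cases "x \<in> \<Omega>") (auto simp: u_def)
  qed
  \<comment> \<open>Fatou's lemma bounds each of the three terms by \<open>e\<close> separately,
    hence the factor 3.\<close>
  have key: "fin (\<lambda>x. U n x - u x) (\<lambda>x. H n x - G x) \<and> xi (\<lambda>x. U n x - u x) (\<lambda>x. H n x - G x) \<le> 3 * e"
    if N: "\<forall>m\<ge>N. \<forall>n\<ge>N. xi (\<lambda>x. U m x - U n x) (\<lambda>x. H m x - H n x) < e" and n: "n \<ge> N" for n N e
  proof -
    have x: "xi (\<lambda>x. U n x - U (r k) x) (\<lambda>x. H n x - H (r k) x) \<le> e" if "k \<ge> N" for k
      using N n that seq_suble[OF r, of k] by (meson le_trans less_imp_le)
    have fk: "fin (\<lambda>x. U n x - U (r k) x) (\<lambda>x. H n x - H (r k) x)" for k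
      by (rule fin_diff(1)[OF UD(3) UD(3)])
    have m1: "(\<lambda>x. U n x - u x) \<in> borel_measurable lebesgue"
      using finD(1)[OF UD(3)] mu by (intro borel_measurable_diff)
    have m2: "(\<lambda>x. H n x - G x) \<in> borel_measurable lebesgue"
      using LrD(1)[OF finD(3)[OF UD(3)]] mG by (intro borel_measurable_diff)
    have a1: "AE z in GM. (\<lambda>k. dl (\<lambda>x. U n x - U (r k) x) z) \<longlonglongrightarrow> dl (\<lambda>x. U n x - u x) z"
      using AE_gag[OF AEl]
    proof eventually_elim
      case (elim z)
      then show ?case unfolding dl_def by (intro tendsto_diff tendsto_const) auto
    qed
    have a2: "AE x in lebesgue. (\<lambda>k. H n x - H (r k) x) \<longlonglongrightarrow> H n x - G x"
      using AEl by eventually_elim (intro tendsto_diff tendsto_const, auto)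
    have k1: "Ir GM p (dl (\<lambda>x. U n x - U (r k) x)) \<le> e" "Ir lebesgue p (\<lambda>x. H n x - H (r k) x) \<le> e"
       "Ir AM q (\<lambda>x. H n x - H (r k) x) \<le> e" if "k \<ge> N" for k
      using x[OF that] xi_parts[where u="\<lambda>x. U n x - U (r k) x" and G="\<lambda>x. H n x - H (r k) x"] by (auto intro: order_trans)
    note F1 = Lr_Fatou[where ?k0.0=N, OF finD(2)[OF fk] dl_measurable[OF m1] p0 a1 k1(1)]
    note F2 = Lr_Fatou[where ?k0.0=N, OF finD(3)[OF fk] m2 p0 a2 k1(2)]
    have m2': "(\<lambda>x. H n x - G x) \<in> borel_measurable AM" using m2 by simp
    note F3 = Lr_Fatou[where ?k0.0=N, OF finD(4)[OF fk] m2' q0 AE_AM[OF a2] k1(3)]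
    show ?thesis
      unfolding fin_def xi_def
      using F1 F2 F3 m1 by simp
  qed
  obtain N0 where N0: "\<forall>m\<ge>N0. \<forall>n\<ge>N0. xi (\<lambda>x. U m x - U n x) (\<lambda>x. H m x - H n x) < 1"
    using C[of 1] by auto
  have fu: "fin u G"
    using fin_diff(1)[OF UD(3) conjunct1[OF key[OF N0 order_refl]], of N0] by simp
  have lim: "(\<lambda>n. xi (\<lambda>x. U n x - u x) (\<lambda>x. H n x - G x)) \<longlonglongrightarrow> 0"
  proof (rule LIMSEQ_I)
    fix e :: real assume "e > 0"
    then have e: "e / 4 > 0" by simp
    from C[OF e] obtain N where N: "\<forall>m\<ge>N. \<forall>n\<ge>N. xi (\<lambda>x. U m x - U n x) (\<lambda>x. H m x - H n x) < e / 4" by blast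
    have "norm (xi (\<lambda>x. U n x - u x) (\<lambda>x. H n x - G x) - 0) < e" if "n \<ge> N" for n
      using conjunct2[OF key[OF N that]] e xi_nonneg[of "\<lambda>x. U n x - u x" "\<lambda>x. H n x - G x"] unfolding real_norm_def by linarith
    then show "\<exists>N. \<forall>n\<ge>N. norm (xi (\<lambda>x. U n x - u x) (\<lambda>x. H n x - G x) - 0) < e" by blast
  qed
  show ?thesis by (rule that[OF inW_limit[OF U zu fu lim] lim])
qed

end

section \<open>Truncations\<close>

lemma lipschitz_of_derivative_bound:
  fixes T :: "real \<Rightarrow> real"
  assumes "\<And>r. (T has_real_derivative T' r) (at r)" "\<And>r. \<bar>T' r\<bar> \<le> 1"
  shows "\<bar>T x - T y\<bar> \<le> \<bar>x - y\<bar>"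
proof -
  have "norm (T x - T y) \<le> 1 * norm (x - y)"
    by (rule field_differentiable_bound[of UNIV T T']) (use assms in auto)
  then show ?thesis by simp
qed

text \<open>A smooth substitute for the positive part: \<open>r * exp (- (1 / r))\<close> for
  positive \<open>r\<close>.\<close>

definition flat_ramp :: "real \<Rightarrow> real" where "flat_ramp r = r * flat 0 r"
definition flat_ramp' :: "real \<Rightarrow> real" where "flat_ramp' r = flat 0 r + r * flat 1 r"

lemma flat_ramp_DERIV: "(flat_ramp has_real_derivative flat_ramp' r) (at r)"
  unfolding flat_ramp_def[abs_def] flat_ramp'_def
  by (auto intro!: derivative_eq_intros flat_has_derivative[of 0, simplified])

text \<open>For positive \<open>r\<close> the slope is \<open>(1 + y) * exp (- y)\<close> with
  \<open>y = 1 / r\<close>, and \<open>1 + y \<le> exp y\<close>. The bound 1 makes compositions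
  with the ramp nonexpansive.\<close>

lemma flat_ramp'_bounds: "0 \<le> flat_ramp' r" "flat_ramp' r \<le> 1"
proof -
  have *: "flat_ramp' r = (if r \<le> 0 then 0 else (1 + 1 / r) * exp (- (1 / r)))"
    unfolding flat_ramp'_def flat0 flat1 by (simp add: power2_eq_square algebra_simps)
  then show "0 \<le> flat_ramp' r" by simp
  have "(1 + 1 / r) * exp (- (1 / r)) \<le> exp (1 / r) * exp (- (1 / r))"
    by (intro mult_right_mono exp_ge_add_one_self) auto
  also have "\<dots> = 1" by (simp add: exp_minus)
  finally show "flat_ramp' r \<le> 1" using * by simp
qed

lemma flat_ramp'_isCont: "isCont flat_ramp' r"
  unfolding flat_ramp'_def
  by (intro isCont_add isCont_mult DERIV_isCont[OF DERIV_ident] DERIV_isCont[OF flat_has_derivative])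

text \<open>Rescaling by \<open>Suc j\<close> brings the ramp closer to the positive part of
  \<open>r - t\<close> and leaves the bound on the slope unchanged; \<open>Suc\<close> avoids a
  division by 0.\<close>

definition ramp_approx :: "nat \<Rightarrow> real \<Rightarrow> real \<Rightarrow> real" where
  "ramp_approx j t r = flat_ramp (real (Suc j) * (r - t)) / real (Suc j)"

definition ramp_approx' :: "nat \<Rightarrow> real \<Rightarrow> real \<Rightarrow> real" where
  "ramp_approx' j t r = flat_ramp' (real (Suc j) * (r - t))"

lemma ramp_approx_DERIV: "(ramp_approx j t has_real_derivative ramp_approx' j t r) (at r)"
proof -
  have "((\<lambda>r. real (Suc j) * (r - t)) has_real_derivative real (Suc j)) (at r)"
    by (auto intro!: derivative_eq_intros)
  from DERIV_chain2[OF flat_ramp_DERIV this]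
  have "((\<lambda>r. flat_ramp (real (Suc j) * (r - t)) / real (Suc j)) has_real_derivative
     flat_ramp' (real (Suc j) * (r - t)) * real (Suc j) / real (Suc j)) (at r)"
    by (rule DERIV_cdivide)
  then show ?thesis
    unfolding ramp_approx_def[abs_def] ramp_approx'_def by (simp del: of_nat_Suc)
qed

lemma ramp_approx'_bound: "\<bar>ramp_approx' j t r\<bar> \<le> 1"
  using flat_ramp'_bounds[of "real (Suc j) * (r - t)"] by (simp add: ramp_approx'_def)

lemma ramp_approx'_isCont: "isCont (ramp_approx' j t) r"
  unfolding ramp_approx'_def
  by (rule isCont_o2[OF _ flat_ramp'_isCont]) (intro continuous_intros)

lemma ramp_approx_0: "t \<ge> 0 \<Longrightarrow> ramp_approx j t 0 = 0"
  by (simp add: ramp_approx_def flat_ramp_def flat0 mult_le_0_iff)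

lemma ramp_approx_tendsto: "(\<lambda>j. ramp_approx j t r) \<longlonglongrightarrow> max (r - t) 0"
proof (cases "r > t")
  case True
  have "(\<lambda>j. (r - t) * flat 0 (real (Suc j) * (r - t))) \<longlonglongrightarrow> (r - t) * 1"
    using True by (intro tendsto_mult_left LIMSEQ_Suc[OF flat0_tendsto]) simp
  then show ?thesis
    using True by (simp add: ramp_approx_def flat_ramp_def del: of_nat_Suc)
next
  case False
  then have "real (Suc j) * (r - t) \<le> 0" for j by (simp add: mult_le_0_iff)
  then have "ramp_approx j t r = 0" for j
    by (simp add: ramp_approx_def flat_ramp_def flat0 del: of_nat_Suc)
  then show ?thesis using False by simp
qed

lemma ramp_approx'_tendsto: "(\<lambda>j. ramp_approx' j t r) \<longlonglongrightarrow> (if r > t then 1 else 0)"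
proof (cases "r > t")
  case True
  let ?y = "\<lambda>j. real (Suc j) * (r - t)"
  have y: "?y j > 0" for j using True by (intro mult_pos_pos) auto
  have 1: "(\<lambda>j. flat 0 (?y j)) \<longlonglongrightarrow> 1"
    using True by (intro LIMSEQ_Suc[OF flat0_tendsto]) simp
  have 2: "(\<lambda>j. flat 0 (?y j) * (inverse (real (Suc j)) * inverse (r - t))) \<longlonglongrightarrow> 1 * (0 * inverse (r - t))"
    by (intro tendsto_mult 1 LIMSEQ_inverse_real_of_nat tendsto_const)
  have "?y j * flat 1 (?y j) = flat 0 (?y j) * (inverse (real (Suc j)) * inverse (r - t))" for j
  proof -
    have "?y j * flat 1 (?y j) = flat 0 (?y j) * inverse (?y j)"
    proof -
      have "c * flat 1 c = flat 0 c * inverse c" if "c > 0" for c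
        unfolding flat0 flat1 using that by (simp add: power2_eq_square field_simps)
      from this[OF y[of j]] show ?thesis .
    qed
    then show ?thesis by (simp only: inverse_mult_distrib)
  qed
  then have "(\<lambda>j. flat 0 (?y j) + ?y j * flat 1 (?y j)) \<longlonglongrightarrow> 1 + 1 * (0 * inverse (r - t))"
    by (simp only:) (rule tendsto_add[OF 1 2])
  then show ?thesis
    using True unfolding ramp_approx'_def flat_ramp'_def by simp
next
  case False
  then have "real (Suc j) * (r - t) \<le> 0" for j by (simp add: mult_le_0_iff)
  then have "ramp_approx' j t r = 0" for j
    by (simp add: ramp_approx'_def flat_ramp'_def flat_def del: of_nat_Suc)
  then show ?thesis using False by simp
qed

lemma ramp_approx_Cc_inf:
  assumes \<phi>: "\<phi> \<in> Cc_inf \<Omega>" and t: "t \<ge> 0"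
  shows "(\<lambda>x. ramp_approx j t (\<phi> x)) \<in> Cc_inf \<Omega>"
proof -
  obtain K where K: "compact K" "K \<subseteq> \<Omega>" "\<forall>x. x \<notin> K \<longrightarrow> \<phi> x = 0" "\<forall>x. x \<notin> K \<longrightarrow> grad \<phi> x = 0"
     "\<forall>x h. x \<notin> K \<longrightarrow> frechet_derivative \<phi> (at x) h = 0"
    by (rule Cc_inf_supportE[OF \<phi>])
  show ?thesis
  proof (rule Cc_infI[OF _ _ K(1,2)])
    fix n
    let ?c = "real (Suc j)"
    have 1: "Ck_on n UNIV (\<lambda>x. ?c * (\<phi> x + - t))"
      by (rule Ck_on_mult[OF Ck_on_const Ck_on_add[OF Cc_inf_CkD[OF \<phi>] Ck_on_const]])
    have "Ck_on n UNIV (\<lambda>x. (inverse ?c) * ((?c * (\<phi> x + - t)) * flat 0 (?c * (\<phi> x + - t))))"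
      by (rule Ck_on_mult[OF Ck_on_const Ck_on_mult[OF 1 Ck_on_flat[OF 1]]])
    then show "Ck_on n UNIV (\<lambda>x. ramp_approx j t (\<phi> x))"
      unfolding ramp_approx_def flat_ramp_def by (simp add: divide_inverse mult_ac del: of_nat_Suc)
  next
    fix x assume "ramp_approx j t (\<phi> x) \<noteq> 0"
    then show "x \<in> K" using K(3) ramp_approx_0[OF t] by metis
  qed
qed

context double_phase
begin

text \<open>Slope at most 1 means that composing with \<open>T\<close> enlarges neither differences
  nor gradients. The differences and gradients of the approximants themselves are therefore
  convergent majorants for \<open>Ir_dominated\<close>.\<close>

lemma inW_compose_smooth:
  assumes T: "\<And>r. (T has_real_derivative T' r) (at r)" "\<And>r. \<bar>T' r\<bar> \<le> 1" "\<And>r. isCont T' r" "T 0 = 0"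
    and Tc: "\<And>\<phi>. \<phi> \<in> Cc_inf \<Omega> \<Longrightarrow> (\<lambda>x. T (\<phi> x)) \<in> Cc_inf \<Omega>"
    and u: "inW u G"
  shows "inW (\<lambda>x. T (u x)) (\<lambda>x. T' (u x) *\<^sub>R G x)"
proof -
  note U = inWD[OF u] finD[OF inWD(3)[OF u]]
  have mG: "G \<in> borel_measurable lebesgue" by (rule LrD(1)[OF U(6)])
  have cT: "continuous_on UNIV T" using T(1) DERIV_isCont continuous_at_imp_continuous_on by blast
  have cT': "continuous_on UNIV T'" using T(3) continuous_at_imp_continuous_on by blast
  note lip = lipschitz_of_derivative_bound[OF T(1,2)]
  have meas: "(\<lambda>x. T (v x)) \<in> borel_measurable lebesgue" "(\<lambda>x. T' (v x)) \<in> borel_measurable lebesgue"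
    if "v \<in> borel_measurable lebesgue" for v :: "'a \<Rightarrow> real"
    using measurable_compose[OF that borel_measurable_continuous_onI[OF cT]]
      measurable_compose[OF that borel_measurable_continuous_onI[OF cT']] by auto
  have dlT: "\<bar>dl (\<lambda>x. T (v x)) z\<bar> \<le> \<bar>dl v z\<bar>" for v :: "'a \<Rightarrow> real" and z
    unfolding dl_def by (rule lip)
  have gT: "norm (T' r *\<^sub>R g) \<le> norm g" for r and g :: 'a
    using T(2)[of r] by (simp add: mult_left_le_one_le)
  have f: "fin (\<lambda>x. T (u x)) (\<lambda>x. T' (u x) *\<^sub>R G x)"
    unfolding fin_def
  proof (intro conjI)
    show "(\<lambda>x. T (u x)) \<in> borel_measurable lebesgue" by (rule meas(1)[OF U(4)])
    show "Lr GM p (dl (\<lambda>x. T (u x)))"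
      by (rule Lr_bound[OF U(5) dl_measurable[OF meas(1)[OF U(4)]] _ p0]) (simp add: dlT)
    have m: "(\<lambda>x. T' (u x) *\<^sub>R G x) \<in> borel_measurable lebesgue"
      by (intro borel_measurable_scaleR meas(2) U(4) mG)
    show "Lr lebesgue p (\<lambda>x. T' (u x) *\<^sub>R G x)"
      by (rule Lr_bound[OF U(6) m _ p0]) (use gT in auto)
    have m': "(\<lambda>x. T' (u x) *\<^sub>R G x) \<in> borel_measurable AM" using m by simp
    show "Lr AM q (\<lambda>x. T' (u x) *\<^sub>R G x)"
      by (rule Lr_bound[OF U(7) m' _ q0]) (use gT in auto)
  qed
  obtain \<phi> where \<phi>: "\<forall>n. \<phi> n \<in> Cc_inf \<Omega>" "(\<lambda>n. xi (\<lambda>x. u x - \<phi> n x) (\<lambda>x. G x - grad (\<phi> n) x)) \<longlonglongrightarrow> 0"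
    using u unfolding inW_def by blast
  have lim: "(\<lambda>n. xi (\<lambda>x. \<phi> n x - u x) (\<lambda>x. grad (\<phi> n) x - G x)) \<longlonglongrightarrow> 0"
    using \<phi>(2) unfolding xi_diff_commute[of u] .
  \<comment> \<open>The subsequence supplies pointwise convergence; modular convergence is
    inherited, so nothing is lost by passing to it.\<close>
  obtain r where r: "strict_mono r" "AE x in lebesgue. (\<lambda>n. \<phi> (r n) x) \<longlonglongrightarrow> u x \<and> (\<lambda>n. grad (\<phi> (r n)) x) \<longlonglongrightarrow> G x"
    by (rule inW_AE_subseq[OF inW_Cc_inf[OF \<phi>(1)[rule_format]] u lim])
  let ?v = "\<lambda>n. \<phi> (r n)"
  have v: "?v n \<in> Cc_inf \<Omega>" for n using \<phi>(1) by blast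
  note V = finD[OF fin_Cc_inf[OF v]]
  have limv: "(\<lambda>n. xi (\<lambda>x. ?v n x - u x) (\<lambda>x. grad (?v n) x - G x)) \<longlonglongrightarrow> 0"
    using LIMSEQ_subseq_LIMSEQ[OF lim r(1)] by (simp add: o_def)
  have lim_parts: "(\<lambda>n. Ir GM p (\<lambda>z. dl (?v n) z - dl u z)) \<longlonglongrightarrow> 0"
    "(\<lambda>n. Ir lebesgue p (\<lambda>x. grad (?v n) x - G x)) \<longlonglongrightarrow> 0"
    "(\<lambda>n. Ir AM q (\<lambda>x. grad (?v n) x - G x)) \<longlonglongrightarrow> 0"
    using xi_parts[where u="\<lambda>x. ?v n x - u x" and G="\<lambda>x. grad (?v n) x - G x" for n]
    unfolding dl_diff[symmetric]
    by (rule_tac [!] tendsto_sandwich[OF _ _ tendsto_const limv]) (simp_all add: Ir_nonneg)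
  have W: "inW (\<lambda>x. T (?v n x)) (\<lambda>x. T' (?v n x) *\<^sub>R grad (?v n) x)" for n
  proof -
    have "grad (\<lambda>x. T (?v n x)) = (\<lambda>x. T' (?v n x) *\<^sub>R grad (?v n) x)"
      using grad_compose[OF v T(1)] by blast
    then show ?thesis using inW_Cc_inf[OF Tc[OF v], of n] by simp
  qed
  have 1: "(\<lambda>n. Ir GM p (\<lambda>z. dl (\<lambda>x. T (?v n x)) z - dl (\<lambda>x. T (u x)) z)) \<longlonglongrightarrow> 0"
  proof (rule Ir_dominated[OF dl_measurable[OF meas(1)[OF V(1)]] dl_measurable[OF meas(1)[OF U(4)]] V(2) U(5) p0 _ _ _ lim_parts(1)])
    show "AE z in GM. norm (dl (\<lambda>x. T (?v n x)) z) \<le> norm (dl (?v n) z)" for n by (simp add: dlT)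
    show "AE z in GM. norm (dl (\<lambda>x. T (u x)) z) \<le> norm (dl u z)" by (simp add: dlT)
    show "AE z in GM. (\<lambda>n. dl (\<lambda>x. T (?v n x)) z) \<longlonglongrightarrow> dl (\<lambda>x. T (u x)) z"
      using AE_gag[OF r(2)]
    proof eventually_elim
      case (elim z)
      then show ?case
        unfolding dl_def by (intro tendsto_diff isCont_tendsto_compose[OF DERIV_isCont[OF T(1)]]) auto
    qed
  qed
  have c2: "AE x in lebesgue. (\<lambda>n. T' (?v n x) *\<^sub>R grad (?v n) x) \<longlonglongrightarrow> T' (u x) *\<^sub>R G x"
    using r(2) by eventually_elim (intro tendsto_scaleR isCont_tendsto_compose[OF T(3)], auto)
  have mv: "(\<lambda>x. T' (?v n x) *\<^sub>R grad (?v n) x) \<in> borel_measurable lebesgue" for n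
    by (intro borel_measurable_scaleR meas(2) V(1) LrD(1)[OF V(3)])
  have mu: "(\<lambda>x. T' (u x) *\<^sub>R G x) \<in> borel_measurable lebesgue"
    by (intro borel_measurable_scaleR meas(2) U(4) mG)
  have 2: "(\<lambda>n. Ir lebesgue p (\<lambda>x. T' (?v n x) *\<^sub>R grad (?v n) x - T' (u x) *\<^sub>R G x)) \<longlonglongrightarrow> 0"
    by (rule Ir_dominated[OF mv mu V(3) U(6) p0 AE_I2 AE_I2 c2 lim_parts(2)]) (rule gT)+
  have mv': "(\<lambda>x. T' (?v n x) *\<^sub>R grad (?v n) x) \<in> borel_measurable AM" for n using mv by simp
  have mu': "(\<lambda>x. T' (u x) *\<^sub>R G x) \<in> borel_measurable AM" using mu by simp
  have 3: "(\<lambda>n. Ir AM q (\<lambda>x. T' (?v n x) *\<^sub>R grad (?v n) x - T' (u x) *\<^sub>R G x)) \<longlonglongrightarrow> 0"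
    by (rule Ir_dominated[OF mv' mu' V(4) U(7) q0 AE_I2 AE_I2 AE_AM[OF c2] lim_parts(3)]) (rule gT)+
  have "(\<lambda>n. xi (\<lambda>x. T (?v n x) - T (u x)) (\<lambda>x. T' (?v n x) *\<^sub>R grad (?v n) x - T' (u x) *\<^sub>R G x)) \<longlonglongrightarrow> 0 + 0 + 0"
    unfolding xi_def dl_diff by (intro tendsto_add 1 2 3)
  then show ?thesis
    using U(2) T(4) f by (intro inW_limit[OF W]) auto
qed

text \<open>The smooth ramps are applied to \<open>u\<close> itself rather than to its approximations: on the level set
  \<open>u = t\<close>, where the approximations are not controlled, all of them have slope \<open>0\<close>.\<close>

lemma inW_pos_part:
  assumes u: "inW u G" and t: "t \<ge> 0"
  shows "inW (\<lambda>x. max (u x - t) 0) (\<lambda>x. if u x > t then G x else 0)"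
proof -
  note U = inWD[OF u] finD[OF inWD(3)[OF u]]
  have mG: "G \<in> borel_measurable lebesgue" by (rule LrD(1)[OF U(6)])
  note U(4)[measurable] mG[measurable]
  have W: "inW (\<lambda>x. ramp_approx j t (u x)) (\<lambda>x. ramp_approx' j t (u x) *\<^sub>R G x)" for j
    by (rule inW_compose_smooth[OF ramp_approx_DERIV ramp_approx'_bound ramp_approx'_isCont ramp_approx_0[OF t] ramp_approx_Cc_inf[OF _ t] u])
  note V = finD[OF inWD(3)[OF W]]
  have m1: "(\<lambda>x. max (u x - t) 0) \<in> borel_measurable lebesgue"
    by (intro borel_measurable_max borel_measurable_diff U(4) borel_measurable_const)
  have m2: "(\<lambda>x. if u x > t then G x else 0) \<in> borel_measurable lebesgue" by measurable
  have m2': "(\<lambda>x. if u x > t then G x else 0) \<in> borel_measurable AM" using m2 by simp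
  have b1: "\<bar>dl (\<lambda>x. max (u x - t) 0) z\<bar> \<le> \<bar>dl u z\<bar>" for z
    unfolding dl_def by (auto simp: max_def)
  have b2: "norm (if u x > t then G x else 0) \<le> norm (G x)" for x by simp
  have b3: "\<bar>dl (\<lambda>x. ramp_approx j t (u x)) z\<bar> \<le> \<bar>dl u z\<bar>" for j z
    unfolding dl_def by (rule lipschitz_of_derivative_bound[OF ramp_approx_DERIV ramp_approx'_bound])
  have b4: "norm (ramp_approx' j t (u x) *\<^sub>R G x) \<le> norm (G x)" for j x
    using ramp_approx'_bound[of j t "u x"] by (simp add: mult_left_le_one_le)
  have f: "fin (\<lambda>x. max (u x - t) 0) (\<lambda>x. if u x > t then G x else 0)"
    unfolding fin_def
    using m1 Lr_bound[OF U(5) dl_measurable[OF m1] _ p0] Lr_bound[OF U(6) m2 _ p0] Lr_bound[OF U(7) m2' _ q0] b1 b2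
    by simp
  \<comment> \<open>Here the majorants \<open>dl u\<close> and \<open>G\<close> are the same for all
    \<open>j\<close>, so their convergence is trivial.\<close>
  have c0: "(\<lambda>n::nat. Ir M r (\<lambda>x. Y x - Y x)) \<longlonglongrightarrow> 0" for M :: "'c measure" and r and Y :: "'c \<Rightarrow> 'd::euclidean_space"
    by (simp add: Ir_def)
  have 1: "(\<lambda>j. Ir GM p (\<lambda>z. dl (\<lambda>x. ramp_approx j t (u x)) z - dl (\<lambda>x. max (u x - t) 0) z)) \<longlonglongrightarrow> 0"
  proof (rule Ir_dominated[OF LrD(1)[OF V(2)] dl_measurable[OF m1] U(5) U(5) p0 _ _ _ c0])
    show "AE z in GM. (\<lambda>j. dl (\<lambda>x. ramp_approx j t (u x)) z) \<longlonglongrightarrow> dl (\<lambda>x. max (u x - t) 0) z"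
      unfolding dl_def by (intro AE_I2 tendsto_diff ramp_approx_tendsto)
  qed (simp_all add: b1 b3)
  have cv: "(\<lambda>j. ramp_approx' j t (u x) *\<^sub>R G x) \<longlonglongrightarrow> (if u x > t then G x else 0)" for x
  proof -
    have "(\<lambda>j. ramp_approx' j t (u x) *\<^sub>R G x) \<longlonglongrightarrow> (if u x > t then 1 else 0) *\<^sub>R G x"
      by (intro tendsto_scaleR ramp_approx'_tendsto tendsto_const)
    then show ?thesis by (simp split: if_splits)
  qed
  have 2: "(\<lambda>j. Ir lebesgue p (\<lambda>x. ramp_approx' j t (u x) *\<^sub>R G x - (if u x > t then G x else 0))) \<longlonglongrightarrow> 0"
    by (rule Ir_dominated[OF LrD(1)[OF V(3)] m2 U(6) U(6) p0 AE_I2[OF b4] AE_I2[OF b2] AE_I2[OF cv] c0])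
  have 3: "(\<lambda>j. Ir AM q (\<lambda>x. ramp_approx' j t (u x) *\<^sub>R G x - (if u x > t then G x else 0))) \<longlonglongrightarrow> 0"
    by (rule Ir_dominated[OF LrD(1)[OF V(4)] m2' U(7) U(7) q0 AE_I2[OF b4] AE_I2[OF b2] AE_I2[OF cv] c0])
  have "(\<lambda>j. xi (\<lambda>x. ramp_approx j t (u x) - max (u x - t) 0) (\<lambda>x. ramp_approx' j t (u x) *\<^sub>R G x - (if u x > t then G x else 0))) \<longlonglongrightarrow> 0 + 0 + 0"
    unfolding xi_def dl_diff by (intro tendsto_add 1 2 3)
  then show ?thesis
    using U(2) t f by (intro inW_limit[OF W]) auto
qed

text \<open>The maximum is \<open>u\<close> plus the positive part of \<open>v - u\<close>, the
  minimum is \<open>v\<close> minus it. With the tie \<open>v = u\<close> decided the same way in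
  both, the two gradients are at every point a rearrangement of \<open>G x\<close> and
  \<open>H x\<close>.\<close>

lemma inW_max_min:
  assumes u: "inW u G" and v: "inW v H"
  shows "inW (\<lambda>x. max (u x) (v x)) (\<lambda>x. if v x > u x then H x else G x)"
    "inW (\<lambda>x. min (u x) (v x)) (\<lambda>x. if v x > u x then G x else H x)"
proof -
  have 1: "inW (\<lambda>x. max (v x - u x - 0) 0) (\<lambda>x. if v x - u x > 0 then H x - G x else 0)"
    by (rule inW_pos_part[OF inW_diff[OF v u]]) simp
  have e: "(\<lambda>x. u x + max (v x - u x - 0) 0) = (\<lambda>x. max (u x) (v x))"
    "(\<lambda>x. G x + (if v x - u x > 0 then H x - G x else 0)) = (\<lambda>x. if v x > u x then H x else G x)"
    "(\<lambda>x. v x - max (v x - u x - 0) 0) = (\<lambda>x. min (u x) (v x))"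
    "(\<lambda>x. H x - (if v x - u x > 0 then H x - G x else 0)) = (\<lambda>x. if v x > u x then G x else H x)"
    by (auto simp: max_def min_def)
  show "inW (\<lambda>x. max (u x) (v x)) (\<lambda>x. if v x > u x then H x else G x)"
    using inW_add[OF u 1] unfolding e .
  show "inW (\<lambda>x. min (u x) (v x)) (\<lambda>x. if v x > u x then G x else H x)"
    using inW_diff[OF v 1] unfolding e .
qed

end

section \<open>Submodularity of powers of differences\<close>

text \<open>The tangent inequality of a convex function. Cauchy-Schwarz reduces it to the norms,
  where the mean value theorem applies; the case \<open>x = 0\<close> is covered because
  \<open>0 powr (r - 2) = 0\<close>.\<close>

lemma norm_powr_tangent:
  fixes x y :: "'b::real_inner"
  assumes r: "r > 1"
  shows "r * (norm x powr (r - 2) * (x \<bullet> (y - x))) \<le> norm y powr r - norm x powr r"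
proof -
  have n: "r * norm x powr (r - 1) * (norm y - norm x) \<le> norm y powr r - norm x powr r"
  proof (cases "norm x" "norm y" rule: linorder_cases)
    case less
    obtain z where z: "norm x < z" "z < norm y" "norm y powr r - norm x powr r = (norm y - norm x) * (r * z powr (r - 1))"
      using powr_mvt[of "norm x" "norm y" r] less r by auto
    have "norm x powr (r - 1) \<le> z powr (r - 1)" using z r by (intro powr_mono2) auto
    then have "(norm y - norm x) * (r * norm x powr (r - 1)) \<le> (norm y - norm x) * (r * z powr (r - 1))"
      using less r by (intro mult_left_mono) auto
    then show ?thesis using z(3) by (simp add: mult_ac)
  next
    case greater
    obtain z where z: "norm y < z" "z < norm x" "norm x powr r - norm y powr r = (norm x - norm y) * (r * z powr (r - 1))"
      using powr_mvt[of "norm y" "norm x" r] greater r by auto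
    have zp: "z > 0" using z(1) norm_ge_zero[of y] by linarith
    have "z powr (r - 1) \<le> norm x powr (r - 1)" using z zp r by (intro powr_mono2) auto
    then have "(norm x - norm y) * (r * z powr (r - 1)) \<le> (norm x - norm y) * (r * norm x powr (r - 1))"
      using greater r by (intro mult_left_mono) auto
    then have "norm x powr r - norm y powr r \<le> (norm x - norm y) * (r * norm x powr (r - 1))"
      using z(3) by simp
    then show ?thesis by (simp add: algebra_simps)
  qed simp
  have "norm x powr (r - 2) * (x \<bullet> (y - x)) \<le> norm x powr (r - 1) * (norm y - norm x)"
  proof -
    have "x \<bullet> (y - x) = x \<bullet> y - norm x * norm x"
      by (simp add: inner_diff_right power2_norm_eq_inner[symmetric] power2_eq_square)
    also have "\<dots> \<le> norm x * norm y - norm x * norm x"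
      using norm_cauchy_schwarz[of x y] by simp
    finally have "norm x powr (r - 2) * (x \<bullet> (y - x)) \<le> norm x powr (r - 2) * (norm x * norm y - norm x * norm x)"
      by (intro mult_left_mono) auto
    also have "\<dots> = (norm x * norm x powr (r - 2)) * (norm y - norm x)"
      by (simp add: algebra_simps)
    also have "norm x * norm x powr (r - 2) = norm x powr (r - 1)"
      using powr_mult_base[of "norm x" "r - 2"] by simp
    finally show ?thesis .
  qed
  then have "r * (norm x powr (r - 2) * (x \<bullet> (y - x))) \<le> r * (norm x powr (r - 1) * (norm y - norm x))"
    using r by (intro mult_left_mono) auto
  with n show ?thesis by (simp add: mult_ac)
qed

text \<open>Karamata's inequality for two points: add the tangent inequalities at \<open>c\<close>
  and \<open>d\<close> and use that the slope \<psi> is monotone.\<close>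

lemma powr_majorization:
  fixes a b c d r :: real
  assumes r: "r > 1" and sum: "c + d = a + b" and cd: "b \<le> c" "c \<le> a" "b \<le> d" "d \<le> a"
  shows "\<bar>c\<bar> powr r + \<bar>d\<bar> powr r \<le> \<bar>a\<bar> powr r + \<bar>b\<bar> powr r"
proof -
  define \<psi> where "\<psi> x = r * (\<bar>x\<bar> powr (r - 2) * x)" for x :: real
  have t: "\<psi> x * (y - x) \<le> \<bar>y\<bar> powr r - \<bar>x\<bar> powr r" for x y
    using norm_powr_tangent[OF r, of x y] by (simp add: \<psi>_def mult_ac)
  have key: "\<bar>c\<bar> powr r + \<bar>d\<bar> powr r \<le> \<bar>a\<bar> powr r + \<bar>b\<bar> powr r"
    if s: "c + d = a + b" "c \<le> a" "d \<le> c" for c d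
  proof -
    have "(\<psi> c - \<psi> d) * (c - d) \<ge> 0"
      using t[of c d] t[of d c] by (simp add: algebra_simps)
    then have "\<psi> c \<ge> \<psi> d \<or> c = d"
      using s(3) by (auto simp: zero_le_mult_iff)
    then have "(\<psi> c - \<psi> d) * (a - c) \<ge> 0"
      using s(2) by auto
    \<comment> \<open>Since the sums agree, \<open>b - d\<close> is the negative of
      \<open>a - c\<close>, and the two tangent terms combine into a product of numbers of equal
      sign.\<close>
    moreover have "\<psi> c * (a - c) + \<psi> d * (b - d) = (\<psi> c - \<psi> d) * (a - c)"
    proof -
      have "b - d = - (a - c)" using s(1) by simp
      then show ?thesis by (simp only: left_diff_distrib)
    qed
    ultimately show ?thesis
      using t[of c a] t[of d b] by linarith
  qed
  show ?thesis
  proof (cases "d \<le> c")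
    case True
    then show ?thesis using key[of c d] sum cd by simp
  next
    case False
    then show ?thesis using key[of d c] sum cd by simp
  qed
qed

text \<open>If both points order \<open>u\<close> and \<open>v\<close> alike, the two sides agree.
  Otherwise the differences on the left have the same sum as those on the right and lie between
  them, so majorization applies.\<close>

lemma lattice_powr:
  fixes u u' v v' r :: real
  assumes r: "r > 1"
  shows "\<bar>max u v - max u' v'\<bar> powr r + \<bar>min u v - min u' v'\<bar> powr r \<le> \<bar>u - u'\<bar> powr r + \<bar>v - v'\<bar> powr r"
proof -
  have m: "\<bar>max u v - max u' v'\<bar> powr r + \<bar>min u v - min u' v'\<bar> powr r \<le> \<bar>u - u'\<bar> powr r + \<bar>v - v'\<bar> powr r"
    if "u \<ge> v" "u' < v'" for u v u' v' :: real
    using powr_majorization[OF r, of "u - v'" "v - u'" "u - u'" "v - v'"] that by simp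
  show ?thesis
  proof (cases "u \<ge> v")
    case 1: True
    show ?thesis
    proof (cases "u' \<ge> v'")
      case True
      with 1 show ?thesis by (simp add: max_absorb1 min_absorb2)
    qed (use 1 m[of v u u' v'] in simp)
  next
    case 1: False
    show ?thesis
    proof (cases "u' < v'")
      case True
      with 1 show ?thesis by (simp add: max_absorb2 min_absorb1)
    next
      case False
      then show ?thesis
        using 1 m[of u v v' u'] by (cases "u' = v'") (simp_all add: max.commute min.commute add.commute)
    qed
  qed
qed

section \<open>Minimization with a bounded increasing nonlinearity\<close>

text \<open>\<open>F x\<close> is a convex primitive of the right-hand side \<open>f x\<close>; the
  subgradient inequality expresses the monotonicity of \<open>f x\<close>. Measurability is asked
  for superpositions, the only form in which it is used.\<close>

locale variational = double_phase +
  fixes f F :: "'a::euclidean_space \<Rightarrow> real \<Rightarrow> real" and \<epsilon> :: real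
  assumes f_meas: "\<And>u. u \<in> borel_measurable lebesgue \<Longrightarrow> (\<lambda>x. f x (u x)) \<in> borel_measurable lebesgue"
    and F_meas: "\<And>u. u \<in> borel_measurable lebesgue \<Longrightarrow> (\<lambda>x. F x (u x)) \<in> borel_measurable lebesgue"
    and f_nonneg: "\<And>x t. 0 \<le> f x t" and f_le: "\<And>x t. f x t \<le> \<epsilon>"
    and F_subgradient: "\<And>x t t'. f x t * (t' - t) \<le> F x t' - F x t"
    and F_0: "\<And>x. F x 0 = 0"
begin

lemma \<epsilon>_nonneg: "\<epsilon> \<ge> 0"
  using f_nonneg[of undefined 0] f_le[of undefined 0] by linarith

lemma F_lipschitz: "\<bar>F x t - F x t'\<bar> \<le> \<epsilon> * \<bar>t - t'\<bar>"
proof -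
  have *: "F x t - F x t' \<le> \<epsilon> * \<bar>t - t'\<bar>" for t t'
  proof -
    have "F x t - F x t' \<le> f x t * (t - t')"
      using F_subgradient[of x t t'] by (simp add: algebra_simps)
    also have "\<dots> \<le> \<bar>f x t\<bar> * \<bar>t - t'\<bar>"
      by (metis abs_ge_self abs_mult)
    also have "\<dots> \<le> \<epsilon> * \<bar>t - t'\<bar>"
      using f_nonneg f_le by (intro mult_right_mono) (auto simp: abs_of_nonneg)
    finally show ?thesis .
  qed
  show ?thesis using *[of t t'] *[of t' t] by (simp add: abs_le_iff abs_minus_commute)
qed

definition Phi :: "('a \<Rightarrow> real) \<Rightarrow> real" where
  "Phi u = (LINT x|lebesgue. F x (u x))"

definition AA :: "('a \<Rightarrow> real) \<Rightarrow> ('a \<Rightarrow> 'a) \<Rightarrow> real" where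
  "AA u G = Ir GM p (dl u) / p + Ir lebesgue p G / p + Ir AM q G / q"

definition JJ :: "('a \<Rightarrow> real) \<Rightarrow> ('a \<Rightarrow> 'a) \<Rightarrow> real" where
  "JJ u G = AA u G - Phi u"

lemma F_integrable:
  assumes "integrable lebesgue u"
  shows "integrable lebesgue (\<lambda>x. F x (u x))"
proof (rule Bochner_Integration.integrable_bound[OF integrable_mult_right[OF integrable_abs[OF assms], of \<epsilon>]])
  show "(\<lambda>x. F x (u x)) \<in> borel_measurable lebesgue" using assms by (intro F_meas) auto
  show "AE x in lebesgue. norm (F x (u x)) \<le> norm (\<epsilon> * \<bar>u x\<bar>)"
    using F_lipschitz[of _ _ 0] \<epsilon>_nonneg by (intro AE_I2) (simp add: F_0 abs_mult)
qed

lemma Phi_lipschitz: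
  assumes u: "integrable lebesgue u" and v: "integrable lebesgue v"
  shows "\<bar>Phi u - Phi v\<bar> \<le> \<epsilon> * (LINT x|lebesgue. \<bar>u x - v x\<bar>)"
proof -
  have "\<bar>Phi u - Phi v\<bar> = \<bar>LINT x|lebesgue. F x (u x) - F x (v x)\<bar>"
    unfolding Phi_def by (simp add: Bochner_Integration.integral_diff[OF F_integrable[OF u] F_integrable[OF v]])
  also have "\<dots> \<le> (LINT x|lebesgue. \<bar>F x (u x) - F x (v x)\<bar>)"
    by (rule integral_abs_bound)
  also have "\<dots> \<le> (LINT x|lebesgue. \<epsilon> * \<bar>u x - v x\<bar>)"
    by (intro integral_mono integrable_abs integrable_mult_right Bochner_Integration.integrable_diff F_integrable u v F_lipschitz)
  finally show ?thesis by simp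
qed

lemma Phi_zero: "Phi (\<lambda>x. 0) = 0"
  by (simp add: Phi_def F_0)

lemma AA_bounds:
  "xi u G / q \<le> AA u G" "AA u G \<le> xi u G"
proof -
  have "x / q \<le> x / p" if "x \<ge> 0" for x using that p0 pq by (intro divide_left_mono) auto
  from this[OF Ir_nonneg[of GM p "dl u"]] this[OF Ir_nonneg[of lebesgue p G]]
  show "xi u G / q \<le> AA u G" by (simp add: AA_def xi_def add_divide_distrib)
  have d: "x / y \<le> x" if "x \<ge> 0" "y > 1" for x y :: real
    using that mult_left_mono[of 1 y x] by (simp add: divide_le_eq)
  show "AA u G \<le> xi u G"
    unfolding AA_def xi_def
    by (intro add_mono d Ir_nonneg p1 q1)
qed

text \<open>What remains after the modular part of \<open>Phi\<close> has been absorbed into half of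
  the coercivity constant \<open>1 / q\<close>.\<close>

definition C0 :: real where
  "C0 = \<epsilon> * ((2 * q * \<epsilon> * CP + 1) powr (1 / (p - 1)) * vol)"

lemma Phi_le:
  assumes u: "inW u G"
  shows "\<bar>Phi u\<bar> \<le> xi u G / (2 * q) + C0"
proof -
  let ?b = "2 * q * \<epsilon> * CP + 1"
  \<comment> \<open>Chosen so that \<open>\<eta> powr (1 - p) = 1 / ?b\<close>, which leaves a
    coefficient of at most \<open>1 / (2 * q)\<close> in front of the modular. The summand 1 keeps
    \<open>?b\<close> positive when \<epsilon> is 0.\<close>
  define \<eta> where "\<eta> = ?b powr (1 / (p - 1))"
  have b: "?b \<ge> 1" using q0 \<epsilon>_nonneg CP_pos by simp
  then have \<eta>: "\<eta> > 0" unfolding \<eta>_def powr_gt_zero by linarith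
  have "1 / (p - 1) * (1 - p) = - 1" using p1 by (simp add: field_simps)
  then have \<eta>p: "\<eta> powr (1 - p) = 1 / ?b"
  proof -
    have "?b > 0" using b by linarith
    then show "1 / (p - 1) * (1 - p) = - 1 \<Longrightarrow> ?thesis"
      unfolding \<eta>_def powr_powr by (simp add: powr_minus_divide)
  qed
  note L = inW_L1(1)[OF u]
  have "\<bar>Phi u\<bar> \<le> \<epsilon> * (LINT x|lebesgue. \<bar>u x\<bar>)"
    using Phi_lipschitz[OF L, of "\<lambda>x. 0"] by (simp add: Phi_zero)
  also have "\<dots> \<le> \<epsilon> * (\<eta> * vol + \<eta> powr (1 - p) * (CP * xi u G))"
  proof (rule mult_left_mono[OF _ \<epsilon>_nonneg])
    have "\<eta> powr (1 - p) * (CP * Ir GM p (dl u)) \<le> \<eta> powr (1 - p) * (CP * xi u G)"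
      using xi_parts(1)[of u G] CP_pos by (intro mult_left_mono) auto
    then show "(LINT x|lebesgue. \<bar>u x\<bar>) \<le> \<eta> * vol + \<eta> powr (1 - p) * (CP * xi u G)"
      using inW_L1(3)[OF u \<eta>] by linarith
  qed
  also have "\<dots> = (\<epsilon> * CP / ?b) * xi u G + C0"
    unfolding \<eta>p C0_def \<eta>_def[symmetric] by (simp add: algebra_simps)
  also have "\<epsilon> * CP / ?b \<le> 1 / (2 * q)"
    using b q0 by (simp add: field_simps)
  then have "(\<epsilon> * CP / ?b) * xi u G + C0 \<le> 1 / (2 * q) * xi u G + C0"
    by (intro add_right_mono mult_right_mono xi_nonneg)
  finally show ?thesis by simp
qed

lemma JJ_coercive:
  assumes u: "inW u G"
  shows "xi u G \<le> 2 * q * (JJ u G + C0)"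
proof -
  have "xi u G / q - (xi u G / (2 * q) + C0) \<le> JJ u G"
    using AA_bounds(1)[of u G] Phi_le[OF u] unfolding JJ_def by linarith
  then have "xi u G / (2 * q) \<le> JJ u G + C0"
    using q0 by (simp add: field_simps)
  then show ?thesis using q0 by (simp add: field_simps)
qed

section \<open>Submodularity and suprema of minimizing sequences\<close>

lemma Ir_pair_le:
  fixes X Y Z W :: "'c \<Rightarrow> 'b::euclidean_space"
  assumes L: "Lr M r X" "Lr M r Y" "Lr M r Z" "Lr M r W"
    and le: "\<And>z. norm (X z) powr r + norm (Y z) powr r \<le> norm (Z z) powr r + norm (W z) powr r"
  shows "Ir M r X + Ir M r Y \<le> Ir M r Z + Ir M r W"
proof -
  note i = LrD(2)[OF L(1)] LrD(2)[OF L(2)] LrD(2)[OF L(3)] LrD(2)[OF L(4)]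
  have "Ir M r X + Ir M r Y = (LINT z|M. norm (X z) powr r + norm (Y z) powr r)"
    unfolding Ir_def by (rule Bochner_Integration.integral_add[OF i(1,2), symmetric])
  also have "\<dots> \<le> (LINT z|M. norm (Z z) powr r + norm (W z) powr r)"
    by (intro integral_mono Bochner_Integration.integrable_add i le)
  also have "\<dots> = Ir M r Z + Ir M r W"
    unfolding Ir_def by (rule Bochner_Integration.integral_add[OF i(3,4)])
  finally show ?thesis .
qed

text \<open>Only the Gagliardo term can become strictly smaller, by \<open>lattice_powr\<close>. The
  gradient terms and \<open>Phi\<close> merely exchange their values where
  \<open>v x > u x\<close>.\<close>

lemma JJ_submodular:
  assumes u: "inW u G" and v: "inW v H"
  shows "JJ (\<lambda>x. max (u x) (v x)) (\<lambda>x. if v x > u x then H x else G x) +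
    JJ (\<lambda>x. min (u x) (v x)) (\<lambda>x. if v x > u x then G x else H x) \<le> JJ u G + JJ v H"
proof -
  note W = inW_max_min[OF u v]
  note fs = finD[OF inWD(3)[OF W(1)]] finD[OF inWD(3)[OF W(2)]] finD[OF inWD(3)[OF u]] finD[OF inWD(3)[OF v]]
  have 1: "Ir GM p (dl (\<lambda>x. max (u x) (v x))) + Ir GM p (dl (\<lambda>x. min (u x) (v x))) \<le> Ir GM p (dl u) + Ir GM p (dl v)"
    by (rule Ir_pair_le[OF fs(2) fs(6) fs(10) fs(14)]) (use lattice_powr[OF p1] in \<open>simp add: dl_def\<close>)
  have 2: "Ir lebesgue p (\<lambda>x. if v x > u x then H x else G x) + Ir lebesgue p (\<lambda>x. if v x > u x then G x else H x) \<le> Ir lebesgue p G + Ir lebesgue p H"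
    by (rule Ir_pair_le[OF fs(3) fs(7) fs(11) fs(15)]) simp
  have 3: "Ir AM q (\<lambda>x. if v x > u x then H x else G x) + Ir AM q (\<lambda>x. if v x > u x then G x else H x) \<le> Ir AM q G + Ir AM q H"
    by (rule Ir_pair_le[OF fs(4) fs(8) fs(12) fs(16)]) simp
  have "Phi (\<lambda>x. max (u x) (v x)) + Phi (\<lambda>x. min (u x) (v x)) = (LINT x|lebesgue. F x (max (u x) (v x)) + F x (min (u x) (v x)))"
    unfolding Phi_def
    by (rule Bochner_Integration.integral_add[symmetric, OF F_integrable[OF inW_L1(1)[OF W(1)]] F_integrable[OF inW_L1(1)[OF W(2)]]])
  also have "\<dots> = (LINT x|lebesgue. F x (u x) + F x (v x))"
    by (rule Bochner_Integration.integral_cong) (auto simp: max_def min_def)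
  also have "\<dots> = Phi u + Phi v"
    unfolding Phi_def by (rule Bochner_Integration.integral_add[OF F_integrable[OF inW_L1(1)[OF u]] F_integrable[OF inW_L1(1)[OF v]]])
  finally have 4: "Phi (\<lambda>x. max (u x) (v x)) + Phi (\<lambda>x. min (u x) (v x)) = Phi u + Phi v" .
  have "AA (\<lambda>x. max (u x) (v x)) (\<lambda>x. if v x > u x then H x else G x) +
     AA (\<lambda>x. min (u x) (v x)) (\<lambda>x. if v x > u x then G x else H x) \<le> AA u G + AA v H"
    using divide_right_mono[OF 1 less_imp_le[OF p0]] divide_right_mono[OF 2 less_imp_le[OF p0]] divide_right_mono[OF 3 less_imp_le[OF q0]]
    unfolding AA_def add_divide_distrib by linarith
  with 4 show ?thesis unfolding JJ_def by linarith
qed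

text \<open>The supremum of \<open>U m, ..., U (m + j)\<close> with its gradient. The suprema are
  kept finite, since only these are known to lie in W.\<close>

fun supseq :: "(nat \<Rightarrow> 'a \<Rightarrow> real) \<Rightarrow> (nat \<Rightarrow> 'a \<Rightarrow> 'a) \<Rightarrow> nat \<Rightarrow> nat \<Rightarrow> ('a \<Rightarrow> real) \<times> ('a \<Rightarrow> 'a)" where
  "supseq U H m 0 = (U m, H m)"
| "supseq U H m (Suc j) = (\<lambda>x. max (fst (supseq U H m j) x) (U (m + Suc j) x),
     \<lambda>x. if U (m + Suc j) x > fst (supseq U H m j) x then H (m + Suc j) x else snd (supseq U H m j) x)"

lemma supseq_upper: "m \<le> i \<Longrightarrow> i \<le> m + j \<Longrightarrow> U i x \<le> fst (supseq U H m j) x"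
proof (induction j)
  case (Suc j)
  show ?case
  proof (cases "i = m + Suc j")
    case False
    then have "U i x \<le> fst (supseq U H m j) x" using Suc by simp
    then show ?thesis by simp
  qed simp
qed simp

lemma supseq_least: "(\<And>i. m \<le> i \<Longrightarrow> i \<le> m + j \<Longrightarrow> U i x \<le> c) \<Longrightarrow> fst (supseq U H m j) x \<le> c"
  by (induction j) auto

lemma supseq_mono:
  assumes "m \<le> m'" "m' + j' \<le> m + j"
  shows "fst (supseq U H m' j') x \<le> fst (supseq U H m j) x"
  by (rule supseq_least, rule supseq_upper) (use assms in auto)

text \<open>The minimum with the old supremum has energy at least \<open>m0\<close>, so by
  submodularity a further function raises the energy of the supremum by at most its own excess over
  \<open>m0\<close>. The excesses form a geometric series.\<close>

lemma supseq_JJ: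
  assumes U: "\<And>n. inW (U n) (H n)" and J: "\<And>n. JJ (U n) (H n) \<le> m0 + (1 / 2) ^ n"
    and m0: "\<And>u G. inW u G \<Longrightarrow> m0 \<le> JJ u G"
  shows "inW (fst (supseq U H m j)) (snd (supseq U H m j)) \<and>
    JJ (fst (supseq U H m j)) (snd (supseq U H m j)) \<le> m0 + 2 * (1 / 2) ^ m - (1 / 2) ^ (m + j)"
proof (induction j)
  case 0
  show ?case using U[of m] J[of m] by simp
next
  case (Suc j)
  let ?u = "fst (supseq U H m j)" and ?G = "snd (supseq U H m j)"
  have W: "inW ?u ?G" using Suc by simp
  have "JJ (fst (supseq U H m (Suc j))) (snd (supseq U H m (Suc j))) \<le> JJ ?u ?G + JJ (U (m + Suc j)) (H (m + Suc j)) - m0"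
    using JJ_submodular[OF W U, of "m + Suc j"] m0[OF inW_max_min(2)[OF W U[of "m + Suc j"]]] by simp
  also have "\<dots> \<le> (m0 + 2 * (1 / 2) ^ m - (1 / 2) ^ (m + j)) + (1 / 2) ^ (m + Suc j)"
    using Suc J[of "m + Suc j"] by simp
  also have "\<dots> = m0 + 2 * (1 / 2) ^ m - (1 / 2) ^ (m + Suc j)" by simp
  finally have "JJ (fst (supseq U H m (Suc j))) (snd (supseq U H m (Suc j))) \<le> m0 + 2 * (1 / 2) ^ m - (1 / 2) ^ (m + Suc j)" .
  moreover have "inW (fst (supseq U H m (Suc j))) (snd (supseq U H m (Suc j)))"
    using inW_max_min(1)[OF W U[of "m + Suc j"]] by simp
  ultimately show ?case by blast
qed

text \<open>Suprema of a fast minimizing sequence are still minimizing by submodularity, and by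
  monotonicity their distances in \<open>L\<^sup>1\<close> are differences of integrals. This replaces the
  compact embedding of \<open>W\<close> into \<open>L\<^sup>1\<close>.\<close>

lemma minimizing_L1_Cauchy:
  assumes U: "\<And>n. inW (U n) (H n)" and J: "\<And>n. JJ (U n) (H n) \<le> m0 + (1 / 2) ^ n"
    and m0: "\<And>u G. inW u G \<Longrightarrow> m0 \<le> JJ u G"
  obtains V K where "\<forall>n::nat. inW (V n) (K n)" "\<forall>n. JJ (V n) (K n) \<le> m0 + 2 * (1 / 2) ^ n"
    "\<forall>e>0. \<exists>N. \<forall>m\<ge>N. \<forall>n\<ge>N. (LINT x|lebesgue. \<bar>V m x - V n x\<bar>) < e"
proof -
  note S = supseq_JJ[OF U J m0]
  let ?v = "\<lambda>m j. fst (supseq U H m j)"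
  have vi: "integrable lebesgue (?v m j)" for m j
    using inW_L1(1) S by blast
  define a' where "a' m j = (LINT x|lebesgue. ?v m j x)" for m j
  have dist: "(LINT x|lebesgue. \<bar>?v m j x - ?v m' j' x\<bar>) = a' m j - a' m' j'" if "m \<le> m'" "m' + j' \<le> m + j" for m j m' j'
  proof -
    have "(LINT x|lebesgue. \<bar>?v m j x - ?v m' j' x\<bar>) = (LINT x|lebesgue. ?v m j x - ?v m' j' x)"
      using supseq_mono[OF that] by (intro Bochner_Integration.integral_cong) auto
    also have "\<dots> = a' m j - a' m' j'"
      unfolding a'_def by (rule Bochner_Integration.integral_diff[OF vi vi])
    finally show ?thesis .
  qed
  \<comment> \<open>The L1 bound \<open>inW_L1\<close> with \<eta> equal to 1; all suprema have
    energy at most \<open>m0 + 2\<close>, and coercivity bounds their modulars.\<close>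
  define B where "B = 1 * vol + 1 * (CP * (2 * q * (m0 + 2 + C0)))"
  have aB: "\<bar>a' m j\<bar> \<le> B" for m j
  proof -
    have W: "inW (?v m j) (snd (supseq U H m j))" using S by blast
    have "JJ (?v m j) (snd (supseq U H m j)) \<le> m0 + 2 * (1 / 2) ^ m - (1 / 2) ^ (m + j)"
      using S by blast
    also have "\<dots> \<le> m0 + 2"
    proof -
      have "(1 / 2 :: real) ^ m \<le> 1" by (rule power_le_one) auto
      moreover have "(0::real) \<le> (1 / 2) ^ (m + j)" by simp
      ultimately show ?thesis by linarith
    qed
    finally have "xi (?v m j) (snd (supseq U H m j)) \<le> 2 * q * (m0 + 2 + C0)"
      using JJ_coercive[OF W] q0 by (smt (verit) mult_left_mono)
    then have "Ir GM p (dl (?v m j)) \<le> 2 * q * (m0 + 2 + C0)"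
      using xi_parts(1)[of "?v m j" "snd (supseq U H m j)"] by linarith
    then have "CP * Ir GM p (dl (?v m j)) \<le> CP * (2 * q * (m0 + 2 + C0))"
      using CP_pos by (intro mult_left_mono) auto
    then have "(LINT x|lebesgue. \<bar>?v m j x\<bar>) \<le> B"
      using inW_L1(3)[OF W, of 1] by (simp add: B_def)
    then show ?thesis
      unfolding a'_def using integral_abs_bound[of lebesgue "?v m j"] by linarith
  qed
  \<comment> \<open>Stands for the integral of the supremum of all \<open>U i\<close> with
    \<open>i \<ge> m\<close>, without forming that function.\<close>
  define A' where "A' m = (SUP j. a' m j)" for m
  have bdd: "bdd_above (range (a' m))" for m
    using aB by (intro bdd_aboveI[of _ B]) (auto simp: abs_le_iff)
  have aA: "a' m j \<le> A' m" for m j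
    unfolding A'_def by (rule cSUP_upper[OF UNIV_I bdd])
  have "\<exists>j. a' m j > A' m - (1 / 2) ^ m" for m
  proof -
    have "A' m - (1 / 2) ^ m < A' m" by simp
    then show ?thesis unfolding A'_def using less_cSUP_iff[OF _ bdd] by auto
  qed
  then obtain j where j: "\<And>m. a' m (j m) > A' m - (1 / 2) ^ m" by metis
  have A'dec: "A' m' \<le> A' m" if "m \<le> m'" for m m'
    unfolding A'_def[of m']
  proof (rule cSUP_least)
    fix i
    have "0 \<le> (LINT x|lebesgue. \<bar>?v m (m' + i) x - ?v m' i x\<bar>)" by simp
    then have "a' m' i \<le> a' m (m' + i)"
      using dist[OF that, of i "m' + i"] by simp
    also have "\<dots> \<le> A' m" by (rule aA)
    finally show "a' m' i \<le> A' m" .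
  qed simp
  have "decseq A'" using A'dec by (simp add: decseq_def)
  moreover have "A' m \<ge> - B" for m
    using aA[of m 0] aB[of m 0] by linarith
  ultimately obtain L where L: "A' \<longlonglongrightarrow> L"
    using decseq_convergent[of A' "- B"] by blast
  have d1: "(LINT x|lebesgue. \<bar>?v m (j m) x - ?v m' (j m') x\<bar>) \<le> 2 * (1 / 2) ^ m + (A' m - A' m')" if mm: "m \<le> m'" for m m'
  proof -
    \<comment> \<open>Long enough that the supremum of \<open>U m, ..., U (m + i)\<close> dominates
      both functions to be compared; each distance to it is then a difference of integrals.\<close>
    define i where "i = m' + j m' + j m"
    have e1: "(LINT x|lebesgue. \<bar>?v m i x - ?v m (j m) x\<bar>) = a' m i - a' m (j m)"
      by (rule dist) (auto simp: i_def)
    have e2: "(LINT x|lebesgue. \<bar>?v m i x - ?v m' (j m') x\<bar>) = a' m i - a' m' (j m')"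
      by (rule dist) (use mm in \<open>auto simp: i_def\<close>)
    have i1: "integrable lebesgue (\<lambda>x. \<bar>?v m i x - ?v m (j m) x\<bar>)" "integrable lebesgue (\<lambda>x. \<bar>?v m i x - ?v m' (j m') x\<bar>)"
       "integrable lebesgue (\<lambda>x. \<bar>?v m (j m) x - ?v m' (j m') x\<bar>)"
      by (intro integrable_abs Bochner_Integration.integrable_diff vi)+
    have "(LINT x|lebesgue. \<bar>?v m (j m) x - ?v m' (j m') x\<bar>) \<le> (LINT x|lebesgue. \<bar>?v m i x - ?v m (j m) x\<bar> + \<bar>?v m i x - ?v m' (j m') x\<bar>)"
      by (intro integral_mono i1 Bochner_Integration.integrable_add) linarith
    also have "\<dots> = (a' m i - a' m (j m)) + (a' m i - a' m' (j m'))"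
      unfolding e1[symmetric] e2[symmetric] by (rule Bochner_Integration.integral_add[OF i1(1,2)])
    also have "\<dots> \<le> (1 / 2) ^ m + (A' m - A' m' + (1 / 2) ^ m')"
      using aA[of m i] j[of m] j[of m'] by linarith
    also have "(1 / 2 :: real) ^ m' \<le> (1 / 2) ^ m"
      using mm by (intro power_decreasing) auto
    finally show ?thesis by simp
  qed
  have cauchy: "\<exists>N. \<forall>m\<ge>N. \<forall>n\<ge>N. (LINT x|lebesgue. \<bar>?v m (j m) x - ?v n (j n) x\<bar>) < e" if e: "e > 0" for e
  proof -
    have e4: "e / 4 > 0" using e by simp
    obtain N1 where N1: "\<forall>n\<ge>N1. norm (A' n - L) < e / 4"
      using LIMSEQ_D[OF L e4] by blast
    have "(\<lambda>n. (1 / 2 :: real) ^ n) \<longlonglongrightarrow> 0" by (rule LIMSEQ_realpow_zero) auto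
    from LIMSEQ_D[OF this e4] obtain N2 where N2: "\<forall>n\<ge>N2. norm ((1 / 2 :: real) ^ n - 0) < e / 4" by blast
    have main: "(LINT x|lebesgue. \<bar>?v m (j m) x - ?v n (j n) x\<bar>) < e" if "m \<ge> max N1 N2" "m \<le> n" for m n
    proof -
      have "\<bar>A' m - L\<bar> < e / 4" "\<bar>A' n - L\<bar> < e / 4" "(1 / 2 :: real) ^ m < e / 4"
        using N1 N2 that by auto
      then show ?thesis using d1[OF that(2)] by linarith
    qed
    have "(LINT x|lebesgue. \<bar>?v m (j m) x - ?v n (j n) x\<bar>) < e" if "m \<ge> max N1 N2" "n \<ge> max N1 N2" for m n
    proof (cases "m \<le> n")
      case True
      then show ?thesis using main that by blast
    next
      case False
      then have "(LINT x|lebesgue. \<bar>?v n (j n) x - ?v m (j m) x\<bar>) < e" using main that by simp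
      then show ?thesis by (simp add: abs_minus_commute)
    qed
    then show ?thesis by blast
  qed
  show ?thesis
  proof (rule that[of "\<lambda>n. ?v n (j n)" "\<lambda>n. snd (supseq U H n (j n))"])
    show "\<forall>n. inW (?v n (j n)) (snd (supseq U H n (j n)))" using S by blast
    show "\<forall>n. JJ (?v n (j n)) (snd (supseq U H n (j n))) \<le> m0 + 2 * (1 / 2) ^ n"
    proof
      fix n
      have "JJ (?v n (j n)) (snd (supseq U H n (j n))) \<le> m0 + 2 * (1 / 2) ^ n - (1 / 2) ^ (n + j n)" using S by blast
      moreover have "(0::real) \<le> (1 / 2) ^ (n + j n)" by simp
      ultimately show "JJ (?v n (j n)) (snd (supseq U H n (j n))) \<le> m0 + 2 * (1 / 2) ^ n" by linarith
    qed
    show "\<forall>e>0. \<exists>N. \<forall>m\<ge>N. \<forall>n\<ge>N. (LINT x|lebesgue. \<bar>?v m (j m) x - ?v n (j n) x\<bar>) < e"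
      using cauchy by blast
  qed
qed

text \<open>The midpoint has energy at least \<open>m0\<close>. Hence the convexity defect of
  \<open>AA\<close> is at most the average excess of the two energies plus the change of
  \<open>Phi\<close>, and the latter is small in terms of the L1 distance.\<close>

lemma L1_Cauchy_minimizing_imp_Cauchy:
  assumes V: "\<forall>n::nat. inW (V n) (K n)" and J: "\<forall>n. JJ (V n) (K n) \<le> m0 + 2 * (1 / 2) ^ n"
    and m0: "\<And>u G. inW u G \<Longrightarrow> m0 \<le> JJ u G"
    and C: "\<forall>e>0. \<exists>N. \<forall>m\<ge>N. \<forall>n\<ge>N. (LINT x|lebesgue. \<bar>V m x - V n x\<bar>) < e"
    and e: "e > 0"
  shows "\<exists>N. \<forall>m\<ge>N. \<forall>n\<ge>N. xi (\<lambda>x. V m x - V n x) (\<lambda>x. K m x - K n x) < e"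
proof -
  define B where "B = 2 * q * (m0 + 2 + C0)"
  have xB: "xi (V n) (K n) \<le> B" for n
  proof -
    have "JJ (V n) (K n) \<le> m0 + 2"
      using J[rule_format, of n] power_le_one[of "1/2::real" n] by simp
    then have "2 * q * (JJ (V n) (K n) + C0) \<le> B"
      unfolding B_def using q0 by (intro mult_left_mono) auto
    then show ?thesis using JJ_coercive[OF V[rule_format], of n] by linarith
  qed
  have e3: "e / 3 > 0" using e by simp
  obtain d1 where d1: "d1 > 0" "\<forall>X Y :: 'a \<times> 'a \<Rightarrow> real. Lr GM p X \<longrightarrow> Lr GM p Y \<longrightarrow> Ir GM p X \<le> B \<longrightarrow> Ir GM p Y \<le> B \<longrightarrow>
     (Ir GM p X + Ir GM p Y) / 2 - Ir GM p (\<lambda>z. (1/2) *\<^sub>R (X z + Y z)) < d1 \<longrightarrow> Ir GM p (\<lambda>z. X z - Y z) < e / 3"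
    by (rule Ir_uniform_convex[OF p1 e3])
  obtain d2 where d2: "d2 > 0" "\<forall>X Y :: 'a \<Rightarrow> 'a. Lr lebesgue p X \<longrightarrow> Lr lebesgue p Y \<longrightarrow> Ir lebesgue p X \<le> B \<longrightarrow> Ir lebesgue p Y \<le> B \<longrightarrow>
     (Ir lebesgue p X + Ir lebesgue p Y) / 2 - Ir lebesgue p (\<lambda>z. (1/2) *\<^sub>R (X z + Y z)) < d2 \<longrightarrow> Ir lebesgue p (\<lambda>z. X z - Y z) < e / 3"
    by (rule Ir_uniform_convex[OF p1 e3])
  obtain d3 where d3: "d3 > 0" "\<forall>X Y :: 'a \<Rightarrow> 'a. Lr AM q X \<longrightarrow> Lr AM q Y \<longrightarrow> Ir AM q X \<le> B \<longrightarrow> Ir AM q Y \<le> B \<longrightarrow>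
     (Ir AM q X + Ir AM q Y) / 2 - Ir AM q (\<lambda>z. (1/2) *\<^sub>R (X z + Y z)) < d3 \<longrightarrow> Ir AM q (\<lambda>z. X z - Y z) < e / 3"
    by (rule Ir_uniform_convex[OF q1 e3])
  \<comment> \<open>A total defect below \<open>d\<close> puts each of the three nonnegative defects
    below its own threshold, after the weights \<open>1 / p\<close> and \<open>1 / q\<close> are
    undone.\<close>
  define d where "d = min (d1 / p) (min (d2 / p) (d3 / q))"
  have d: "d > 0" "d \<le> d1 / p" "d \<le> d2 / p" "d \<le> d3 / q"
    using d1(1) d2(1) d3(1) p0 q0 by (auto simp: d_def)
  have d4: "d / 4 > 0" using d by simp
  have de: "d / (2 * (\<epsilon> + 1)) > 0" using d \<epsilon>_nonneg by simp
  \<comment> \<open>The summand 1 in the denominator keeps this tolerance meaningful for every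
    \<epsilon>; it yields \<open>\<epsilon> * \<Delta> \<le> d / 2\<close> below.\<close>
  obtain N1 where N1: "\<forall>m\<ge>N1. \<forall>n\<ge>N1. (LINT x|lebesgue. \<bar>V m x - V n x\<bar>) < d / (2 * (\<epsilon> + 1))"
    using C de by blast
  have "(\<lambda>n. (1 / 2 :: real) ^ n) \<longlonglongrightarrow> 0" by (rule LIMSEQ_realpow_zero) auto
  from LIMSEQ_D[OF this d4] obtain N2 where N2: "\<forall>n\<ge>N2. norm ((1 / 2 :: real) ^ n - 0) < d / 4" by blast
  have "xi (\<lambda>x. V m x - V n x) (\<lambda>x. K m x - K n x) < e" if mn: "m \<ge> max N1 N2" "n \<ge> max N1 N2" for m n
  proof -
    have Wm: "inW (V m) (K m)" and Wn: "inW (V n) (K n)" using V by auto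
    note fm = finD[OF inWD(3)[OF Wm]] and fn = finD[OF inWD(3)[OF Wn]]
    let ?u = "\<lambda>x. (1/2) * (V m x + V n x)" and ?G = "\<lambda>x. (1/2) *\<^sub>R (K m x + K n x)"
    have W: "inW ?u ?G" by (rule inW_cmult[OF inW_add[OF Wm Wn]])
    have dlu: "dl ?u = (\<lambda>z. (1/2) *\<^sub>R (dl (V m) z + dl (V n) z))"
      by (auto simp: dl_def algebra_simps)
    define D1 where "D1 = (Ir GM p (dl (V m)) + Ir GM p (dl (V n))) / 2 - Ir GM p (\<lambda>z. (1/2) *\<^sub>R (dl (V m) z + dl (V n) z))"
    define D2 where "D2 = (Ir lebesgue p (K m) + Ir lebesgue p (K n)) / 2 - Ir lebesgue p (\<lambda>z. (1/2) *\<^sub>R (K m z + K n z))"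
    define D3 where "D3 = (Ir AM q (K m) + Ir AM q (K n)) / 2 - Ir AM q (\<lambda>z. (1/2) *\<^sub>R (K m z + K n z))"
    have D: "D1 \<ge> 0" "D2 \<ge> 0" "D3 \<ge> 0"
      using Ir_midpoint_le[OF fm(2) fn(2) p1] Ir_midpoint_le[OF fm(3) fn(3) p1] Ir_midpoint_le[OF fm(4) fn(4) q1]
      by (simp_all add: D1_def D2_def D3_def)
    have AAd: "(AA (V m) (K m) + AA (V n) (K n)) / 2 - AA ?u ?G = D1 / p + D2 / p + D3 / q"
      unfolding AA_def dlu D1_def D2_def D3_def using p0 q0 by (simp add: field_simps)
    note i = inW_L1(1)[OF Wm] inW_L1(1)[OF Wn] inW_L1(1)[OF W]
    define \<Delta> where "\<Delta> = (LINT x|lebesgue. \<bar>V m x - V n x\<bar>)"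
    have \<Delta>: "\<epsilon> * \<Delta> \<le> d / 2"
    proof -
      have "\<Delta> < d / (2 * (\<epsilon> + 1))" using N1 mn by (simp add: \<Delta>_def)
      then have "\<epsilon> * \<Delta> \<le> \<epsilon> * (d / (2 * (\<epsilon> + 1)))" using \<epsilon>_nonneg by (intro mult_left_mono) auto
      also have "\<dots> = (d / 2) * (\<epsilon> / (\<epsilon> + 1))" using \<epsilon>_nonneg by (simp add: field_simps)
      also have "\<dots> \<le> (d / 2) * 1"
        using \<epsilon>_nonneg d by (intro mult_left_mono) (auto simp: divide_le_eq)
      finally show ?thesis by simp
    qed
    have P1: "\<bar>Phi (V m) - Phi ?u\<bar> \<le> \<epsilon> * (\<Delta> / 2)"
    proof -
      have "(\<lambda>x. \<bar>V m x - ?u x\<bar>) = (\<lambda>x. \<bar>V m x - V n x\<bar> / 2)" by (auto simp: abs_if field_simps)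
      then show ?thesis using Phi_lipschitz[OF i(1) i(3)] by (simp add: \<Delta>_def)
    qed
    have P2: "\<bar>Phi (V n) - Phi ?u\<bar> \<le> \<epsilon> * (\<Delta> / 2)"
    proof -
      have "(\<lambda>x. \<bar>V n x - ?u x\<bar>) = (\<lambda>x. \<bar>V m x - V n x\<bar> / 2)" by (auto simp: abs_if field_simps)
      then show ?thesis using Phi_lipschitz[OF i(2) i(3)] by (simp add: \<Delta>_def)
    qed
    have pw: "(1 / 2 :: real) ^ m < d / 4" "(1 / 2 :: real) ^ n < d / 4"
      using N2 mn by auto
    have Jm: "AA (V m) (K m) - Phi (V m) \<le> m0 + 2 * (1 / 2) ^ m" and Jn: "AA (V n) (K n) - Phi (V n) \<le> m0 + 2 * (1 / 2) ^ n"
      and Ju: "m0 \<le> AA ?u ?G - Phi ?u"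
      using J m0[OF W] by (auto simp: JJ_def)
    have tot: "D1 / p + D2 / p + D3 / q < d"
    proof -
      have "D1 / p + D2 / p + D3 / q \<le> (1 / 2) ^ m + (1 / 2) ^ n + (\<bar>Phi (V m) - Phi ?u\<bar> + \<bar>Phi (V n) - Phi ?u\<bar>) / 2"
      proof -
        have "(Am + An) / 2 - Au \<le> x + y + (am + an) / 2"
          if "Am - pm \<le> m0 + 2 * x" "An - pn \<le> m0 + 2 * y" "m0 \<le> Au - pu" "pm - pu \<le> am" "pn - pu \<le> an"
          for Am An Au x y am an pm pn pu :: real
          using that by (simp add: field_simps)
        from this[OF Jm Jn Ju abs_ge_self abs_ge_self] show ?thesis
          unfolding AAd[symmetric] .
      qed
      moreover have "(\<bar>Phi (V m) - Phi ?u\<bar> + \<bar>Phi (V n) - Phi ?u\<bar>) / 2 \<le> d / 4"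
        using P1 P2 \<Delta> by simp
      ultimately show ?thesis using pw d(1) by linarith
    qed
    have q1': "D1 / p \<ge> 0" "D2 / p \<ge> 0" "D3 / q \<ge> 0" using D p0 q0 by simp_all
    have "D1 / p < d1 / p" "D2 / p < d2 / p" "D3 / q < d3 / q"
      using tot q1' d by linarith+
    then have dd: "D1 < d1" "D2 < d2" "D3 < d3"
      using p0 q0 by (simp_all add: divide_less_cancel)
    have b: "Ir GM p (dl (V m)) \<le> B" "Ir GM p (dl (V n)) \<le> B" "Ir lebesgue p (K m) \<le> B" "Ir lebesgue p (K n) \<le> B"
      "Ir AM q (K m) \<le> B" "Ir AM q (K n) \<le> B"
      using xB[of m] xB[of n] xi_parts[where u="V m" and G="K m"] xi_parts[where u="V n" and G="K n"] by linarith+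
    have "Ir GM p (\<lambda>z. dl (V m) z - dl (V n) z) < e / 3"
      using d1(2) fm(2) fn(2) b dd(1) unfolding D1_def by blast
    moreover have "Ir lebesgue p (\<lambda>z. K m z - K n z) < e / 3"
      using d2(2) fm(3) fn(3) b dd(2) unfolding D2_def by blast
    moreover have "Ir AM q (\<lambda>z. K m z - K n z) < e / 3"
      using d3(2) fm(4) fn(4) b dd(3) unfolding D3_def by blast
    ultimately show ?thesis unfolding xi_def dl_diff by linarith
  qed
  then show ?thesis by blast
qed

section \<open>Existence of a minimizer\<close>

theorem minimizer_exists:
  obtains u G where "inW u G" "\<forall>v H. inW v H \<longrightarrow> JJ u G \<le> JJ v H"
proof -
  define S where "S = {JJ u G |u G. inW u G}"
  define m0 where "m0 = Inf S"
  have ne: "S \<noteq> {}"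
  proof -
    have "(\<lambda>x. 0) \<in> Cc_inf \<Omega>"
      by (rule Cc_infI[of _ "{}"]) (auto intro: Ck_on_const)
    from inW_Cc_inf[OF this] show ?thesis by (auto simp: S_def)
  qed
  have bd: "bdd_below S"
  proof (rule bdd_belowI[of _ "- C0"])
    fix y assume "y \<in> S"
    then obtain u G where u: "inW u G" "y = JJ u G" by (auto simp: S_def)
    have "0 \<le> 2 * q * (JJ u G + C0)"
      using JJ_coercive[OF u(1)] xi_nonneg[of u G] by linarith
    then show "- C0 \<le> y" using q0 u(2) by (simp add: zero_le_mult_iff)
  qed
  have m0: "m0 \<le> JJ u G" if "inW u G" for u G
    unfolding m0_def by (rule cInf_lower[OF _ bd]) (use that in \<open>auto simp: S_def\<close>)
  \<comment> \<open>A geometric rate is demanded because the suprema accumulate all later excesses,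
    which must be summable.\<close>
  have "\<exists>u G. inW u G \<and> JJ u G \<le> m0 + (1 / 2) ^ n" for n :: nat
  proof -
    have "Inf S < m0 + (1 / 2) ^ n" by (simp add: m0_def)
    then obtain y where "y \<in> S" "y < m0 + (1 / 2) ^ n"
      using cInf_less_iff[OF ne bd] by blast
    then show ?thesis by (force simp: S_def)
  qed
  then obtain U H where UH: "\<And>n::nat. inW (U n) (H n)" "\<And>n. JJ (U n) (H n) \<le> m0 + (1 / 2) ^ n"
    by metis
  obtain V K where V: "\<forall>n::nat. inW (V n) (K n)" "\<forall>n. JJ (V n) (K n) \<le> m0 + 2 * (1 / 2) ^ n"
    "\<forall>e>0. \<exists>N. \<forall>m\<ge>N. \<forall>n\<ge>N. (LINT x|lebesgue. \<bar>V m x - V n x\<bar>) < e"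
    by (rule minimizing_L1_Cauchy[OF UH m0])
  note Cau = L1_Cauchy_minimizing_imp_Cauchy[OF V(1,2) m0 V(3)]
  obtain u G where u: "inW u G" "(\<lambda>n. xi (\<lambda>x. V n x - u x) (\<lambda>x. K n x - G x)) \<longlonglongrightarrow> 0"
    by (rule inW_complete[OF V(1)[rule_format] Cau])
  note fV = finD[OF inWD(3)[OF V(1)[rule_format]]] and fu = finD[OF inWD(3)[OF u(1)]]
  have parts: "(\<lambda>n. Ir GM p (\<lambda>z. dl (V n) z - dl u z)) \<longlonglongrightarrow> 0"
    "(\<lambda>n. Ir lebesgue p (\<lambda>x. K n x - G x)) \<longlonglongrightarrow> 0"
    "(\<lambda>n. Ir AM q (\<lambda>x. K n x - G x)) \<longlonglongrightarrow> 0"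
    using xi_parts[where u="\<lambda>x. V n x - u x" and G="\<lambda>x. K n x - G x" for n]
    unfolding dl_diff[symmetric]
    by (rule_tac [!] tendsto_sandwich[OF _ _ tendsto_const u(2)]) (simp_all add: Ir_nonneg)
  have AAl: "(\<lambda>n. AA (V n) (K n)) \<longlonglongrightarrow> AA u G"
    unfolding AA_def
    by (intro tendsto_add tendsto_divide tendsto_const Ir_tendsto[OF fV(2) fu(2) _ parts(1)] Ir_tendsto[OF fV(3) fu(3) _ parts(2)]
        Ir_tendsto[OF fV(4) fu(4) _ parts(3)]) (use p1 q1 in auto)
  have Phil: "(\<lambda>n. Phi (V n)) \<longlonglongrightarrow> Phi u"
  proof (rule LIMSEQ_I)
    fix e :: real assume e: "e > 0"
    then have e': "e / (\<epsilon> + 1) > 0" using \<epsilon>_nonneg by simp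
    obtain \<delta> where \<delta>: "\<delta> > 0" "\<forall>u G. inW u G \<longrightarrow> xi u G < \<delta> \<longrightarrow>
      (LINT x|lebesgue. \<bar>u x\<bar>) + (LINT x|lebesgue. norm (G x)) < e / (\<epsilon> + 1)"
      by (rule inW_L1_small[OF e'])
    from LIMSEQ_D[OF u(2) \<delta>(1)] obtain N where N: "\<forall>n\<ge>N. norm (xi (\<lambda>x. V n x - u x) (\<lambda>x. K n x - G x) - 0) < \<delta>" by blast
    have "norm (Phi (V n) - Phi u) < e" if n: "n \<ge> N" for n
    proof -
      have "xi (\<lambda>x. V n x - u x) (\<lambda>x. K n x - G x) < \<delta>" using N n by force
      then have "(LINT x|lebesgue. \<bar>V n x - u x\<bar>) + (LINT x|lebesgue. norm (K n x - G x)) < e / (\<epsilon> + 1)"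
        using \<delta>(2) inW_diff[OF V(1)[rule_format] u(1)] by blast
      moreover have "0 \<le> (LINT x|lebesgue. norm (K n x - G x))" by simp
      ultimately have l: "(LINT x|lebesgue. \<bar>V n x - u x\<bar>) < e / (\<epsilon> + 1)" by linarith
      have "\<bar>Phi (V n) - Phi u\<bar> \<le> \<epsilon> * (LINT x|lebesgue. \<bar>V n x - u x\<bar>)"
        by (rule Phi_lipschitz[OF inW_L1(1)[OF V(1)[rule_format]] inW_L1(1)[OF u(1)]])
      also have "\<dots> \<le> \<epsilon> * (e / (\<epsilon> + 1))" using l \<epsilon>_nonneg by (intro mult_left_mono) auto
      also have "\<dots> < e" using \<epsilon>_nonneg e by (simp add: field_simps)
      finally show ?thesis by simp
    qed
    then show "\<exists>N. \<forall>n\<ge>N. norm (Phi (V n) - Phi u) < e" by blast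
  qed
  have Jl: "(\<lambda>n. JJ (V n) (K n)) \<longlonglongrightarrow> JJ u G"
    unfolding JJ_def by (intro tendsto_diff AAl Phil)
  have "(\<lambda>n. m0 + 2 * (1 / 2) ^ n) \<longlonglongrightarrow> m0 + 2 * 0"
    by (intro tendsto_add tendsto_mult tendsto_const LIMSEQ_realpow_zero) auto
  then have "JJ u G \<le> m0"
    using LIMSEQ_le[OF Jl] V(2) by force
  then have "\<forall>v H. inW v H \<longrightarrow> JJ u G \<le> JJ v H"
    using m0 by force
  with u(1) that show ?thesis by blast
qed

end

section \<open>Euler-Lagrange equation and bounds\<close>

text \<open>At the levels \<open>t j\<close>, which approach the final height with gaps halving each
  time, \<phi> decays geometrically. The extra power \<beta> is what makes the recursion
  close.\<close>

lemma stampacchia_iteration: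
  fixes \<phi> :: "real \<Rightarrow> real"
  assumes nn: "\<And>t. 0 \<le> \<phi> t" and mono: "\<And>t h. t \<le> h \<Longrightarrow> \<phi> h \<le> \<phi> t"
    and dec: "\<And>t h. 0 \<le> t \<Longrightarrow> t < h \<Longrightarrow> (h - t) * \<phi> h \<le> K * \<phi> t powr (1 + \<beta>)"
    and V: "\<phi> 0 \<le> V" "V > 0" and K: "K > 0" and \<beta>: "\<beta> > 0"
  shows "\<phi> (K * V powr \<beta> * 2 powr (1 + 1 / \<beta>)) = 0"
proof -
  define M where "M = K * V powr \<beta> * 2 powr (1 + 1 / \<beta>)"
  \<comment> \<open>Solves \<open>\<rho> powr \<beta> = 1 / 2\<close>: the gain from the extra power
    then offsets the halving of the gaps between the levels.\<close>
  define \<rho> where "\<rho> = 2 powr (- (1 / \<beta>))"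
  have M: "M > 0" using K V by (simp add: M_def)
  have \<rho>: "0 < \<rho>" "\<rho> < 1"
    using \<beta> powr_less_cancel_iff[of 2 "- (1 / \<beta>)" 0] by (auto simp: \<rho>_def)
  have \<rho>\<beta>: "\<rho> powr \<beta> = 1 / 2"
  proof -
    have "\<rho> powr \<beta> = 2 powr (- (1 / \<beta>) * \<beta>)" unfolding \<rho>_def by (rule powr_powr)
    also have "- (1 / \<beta>) * \<beta> = - 1" using \<beta> by simp
    finally show ?thesis by (simp add: powr_minus_divide)
  qed
  define t where "t j = M * (1 - (1 / 2) ^ j)" for j :: nat
  have t0: "0 \<le> t j" for j
    unfolding t_def using M power_le_one[of "1/2::real" j] by simp
  have tS: "t (Suc j) - t j = M * (1 / 2) ^ Suc j" for j
    unfolding t_def by (simp add: algebra_simps)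
  have claim: "\<phi> (t j) \<le> V * \<rho> ^ j" for j
  proof (induction j)
    case 0
    show ?case using V by (simp add: t_def)
  next
    case (Suc j)
    have d: "t (Suc j) - t j > 0" unfolding tS using M by simp
    have "(t (Suc j) - t j) * \<phi> (t (Suc j)) \<le> K * \<phi> (t j) powr (1 + \<beta>)"
      by (rule dec[OF t0]) (use d in simp)
    also have "\<dots> \<le> K * (V * \<rho> ^ j) powr (1 + \<beta>)"
      using K \<beta> Suc nn by (intro mult_left_mono powr_mono2) auto
    also have "(V * \<rho> ^ j) powr (1 + \<beta>) = (V * \<rho> ^ j) * (V powr \<beta> * (1 / 2) ^ j)"
    proof -
      have "(V * \<rho> ^ j) powr (1 + \<beta>) = (V * \<rho> ^ j) * (V * \<rho> ^ j) powr \<beta>"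
        using V \<rho> powr_mult_base[of "V * \<rho> ^ j" \<beta>] by simp
      also have "(V * \<rho> ^ j) powr \<beta> = V powr \<beta> * (\<rho> ^ j) powr \<beta>" by (rule powr_mult)
      also have "(\<rho> ^ j) powr \<beta> = (\<rho> powr \<beta>) ^ j"
        using \<rho> by (simp add: powr_realpow[symmetric] powr_powr mult.commute)
      finally show ?thesis unfolding \<rho>\<beta> .
    qed
    also have "K * ((V * \<rho> ^ j) * (V powr \<beta> * (1 / 2) ^ j)) = (M * (1 / 2) ^ Suc j) * (V * \<rho> ^ Suc j)"
    proof -
      \<comment> \<open>The last factor of \<open>M\<close> is chosen for this: it pays for one more
        factor \<rho> and one more halving of the gap.\<close>
      have "2 powr (1 + 1 / \<beta>) * \<rho> = 2"
        unfolding \<rho>_def powr_add[symmetric] by simp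
      then have "M * \<rho> = 2 * (K * V powr \<beta>)" unfolding M_def by (simp add: mult_ac)
      then have "(M * (1 / 2) ^ Suc j) * (V * \<rho> ^ Suc j) = (2 * (K * V powr \<beta>)) * ((1 / 2) ^ Suc j * (V * \<rho> ^ j))"
        by (simp only: power_Suc) (simp add: mult_ac)
      then show ?thesis by (simp only: power_Suc) (simp add: mult_ac)
    qed
    finally have "(M * (1 / 2) ^ Suc j) * \<phi> (t (Suc j)) \<le> (M * (1 / 2) ^ Suc j) * (V * \<rho> ^ Suc j)"
      unfolding tS .
    then show ?case by (rule mult_left_le_imp_le) (use M in simp)
  qed
  have "\<phi> M \<le> V * \<rho> ^ j" for j
  proof -
    have "t j \<le> M" unfolding t_def using M by (simp add: mult_left_le)
    then show ?thesis using mono claim order_trans by blast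
  qed
  moreover have "(\<lambda>j. V * \<rho> ^ j) \<longlonglongrightarrow> 0"
    using tendsto_mult_right_zero[OF LIMSEQ_realpow_zero[of \<rho>]] \<rho> by simp
  ultimately have "\<phi> M \<le> 0" using LIMSEQ_le_const by blast
  then show ?thesis using nn[of M] by (simp add: M_def)
qed

context double_phase
begin

text \<open>The constant of the \<open>L\<^sup>\<infinity>\<close> bound; it does not depend on the nonlinearity.\<close>

definition stam_exp :: real where "stam_exp = s * p / real DIM('a) / (p - 1)"

definition stam :: real where
  "stam = 2 * (2 * gain_const TYPE('a) s p) powr (1 / (p - 1)) * vol powr stam_exp * 2 powr (1 + 1 / stam_exp)"

lemma stam_exp_pos: "stam_exp > 0"
  unfolding stam_exp_def using s01 p1 by simp

lemma stam_pos: "stam > 0"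
  unfolding stam_def using gain_const_pos[where 'a='a, of s p] vol_pos by simp

end

context variational
begin

text \<open>The first variation of \<open>AA\<close>; \<open>weak_form_eq\<close> identifies it with
  the left-hand side of the weak formulation.\<close>

definition DD :: "('a \<Rightarrow> real) \<Rightarrow> ('a \<Rightarrow> 'a) \<Rightarrow> ('a \<Rightarrow> real) \<Rightarrow> ('a \<Rightarrow> 'a) \<Rightarrow> real" where
  "DD u G v H = Dr GM p (dl u) (dl v) + Dr lebesgue p G H + Dr AM q G H"

lemma dl_minus: "dl (\<lambda>x. - v x) = (\<lambda>z. - dl v z)"
  by (auto simp: dl_def)

lemma DD_minus: "DD u G (\<lambda>x. - v x) (\<lambda>x. - H x) = - DD u G v H"
  unfolding DD_def dl_minus by (simp add: Dr_minus)

lemma DD_minus_left: "DD (\<lambda>x. - u x) (\<lambda>x. - G x) v H = - DD u G v H"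
  unfolding DD_def dl_minus by (simp add: Dr_def)

lemma f_mult_integrable:
  assumes u: "integrable lebesgue u" and v: "integrable lebesgue v"
  shows "integrable lebesgue (\<lambda>x. f x (u x) * v x)"
proof (rule Bochner_Integration.integrable_bound[OF integrable_mult_right[OF integrable_abs[OF v], of \<epsilon>]])
  show "(\<lambda>x. f x (u x) * v x) \<in> borel_measurable lebesgue"
    using u v by (intro borel_measurable_times f_meas) auto
  show "AE x in lebesgue. norm (f x (u x) * v x) \<le> norm (\<epsilon> * \<bar>v x\<bar>)"
    using f_nonneg f_le \<epsilon>_nonneg by (intro AE_I2) (simp add: abs_mult abs_of_nonneg mult_right_mono)
qed

text \<open>Since \<open>F\<close> enters \<open>JJ\<close> with a minus sign, its subgradient inequality suffices; no derivative
  of \<open>Phi\<close> is needed.\<close>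

lemma euler_lagrange_le:
  assumes u: "inW u G" and min: "\<forall>v H. inW v H \<longrightarrow> JJ u G \<le> JJ v H" and v: "inW v H"
  shows "(LINT x|lebesgue. f x (u x) * v x) \<le> DD u G v H"
proof -
  let ?t = "\<lambda>n. inverse (real (Suc n))"
  note fu = finD[OF inWD(3)[OF u]] and fv = finD[OF inWD(3)[OF v]]
  have W: "inW (\<lambda>x. u x + ?t n * v x) (\<lambda>x. G x + ?t n *\<^sub>R H x)" for n
    by (rule inW_add[OF u inW_cmult[OF v]])
  have dlW: "dl (\<lambda>x. u x + ?t n * v x) = (\<lambda>z. dl u z + ?t n *\<^sub>R dl v z)" for n
    by (auto simp: dl_def algebra_simps)
  let ?Q = "\<lambda>n. (Ir GM p (\<lambda>z. dl u z + ?t n *\<^sub>R dl v z) - Ir GM p (dl u)) / ?t n / p +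
     (Ir lebesgue p (\<lambda>x. G x + ?t n *\<^sub>R H x) - Ir lebesgue p G) / ?t n / p +
     (Ir AM q (\<lambda>x. G x + ?t n *\<^sub>R H x) - Ir AM q G) / ?t n / q"
  have "?Q \<longlonglongrightarrow> p * Dr GM p (dl u) (dl v) / p + p * Dr lebesgue p G H / p + q * Dr AM q G H / q"
    by (intro tendsto_add tendsto_divide tendsto_const Ir_derivative[OF fu(2) fv(2) p1] Ir_derivative[OF fu(3) fv(3) p1]
        Ir_derivative[OF fu(4) fv(4) q1]) (use p0 q0 in auto)
  then have lim: "?Q \<longlonglongrightarrow> DD u G v H"
    unfolding DD_def using p0 q0 by simp
  note iu = inW_L1(1)[OF u] and iv = inW_L1(1)[OF v]
  have "(LINT x|lebesgue. f x (u x) * v x) \<le> ?Q n" for n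
  proof -
    have t: "?t n > 0" by simp
    have q: "?Q n = (AA (\<lambda>x. u x + ?t n * v x) (\<lambda>x. G x + ?t n *\<^sub>R H x) - AA u G) / ?t n"
      unfolding AA_def dlW by (simp add: diff_divide_distrib add_divide_distrib divide_divide_eq_left mult.commute del: of_nat_Suc)
    have "?t n * (LINT x|lebesgue. f x (u x) * v x) = (LINT x|lebesgue. ?t n * (f x (u x) * v x))"
      by simp
    also have "\<dots> \<le> (LINT x|lebesgue. F x (u x + ?t n * v x) - F x (u x))"
    proof (intro integral_mono integrable_mult_right Bochner_Integration.integrable_diff F_integrable f_mult_integrable iu iv inW_L1(1)[OF W])
      fix x
      show "?t n * (f x (u x) * v x) \<le> F x (u x + ?t n * v x) - F x (u x)"
        using F_subgradient[of x "u x" "u x + ?t n * v x"] by (simp add: mult_ac del: of_nat_Suc)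
    qed
    also have "\<dots> = Phi (\<lambda>x. u x + ?t n * v x) - Phi u"
      unfolding Phi_def by (rule Bochner_Integration.integral_diff[OF F_integrable[OF inW_L1(1)[OF W]] F_integrable[OF iu]])
    also have "\<dots> \<le> AA (\<lambda>x. u x + ?t n * v x) (\<lambda>x. G x + ?t n *\<^sub>R H x) - AA u G"
      using min W[of n] unfolding JJ_def by fastforce
    finally show ?thesis
      unfolding q using t by (simp add: pos_le_divide_eq mult.commute del: of_nat_Suc)
  qed
  then show ?thesis
    using LIMSEQ_le_const[OF lim] by blast
qed

text \<open>Both sides are odd in \<open>v\<close>, so the inequality for \<open>v\<close> and for
  \<open>-v\<close> gives equality.\<close>

lemma euler_lagrange:
  assumes u: "inW u G" and min: "\<forall>v H. inW v H \<longrightarrow> JJ u G \<le> JJ v H" and v: "inW v H"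
  shows "DD u G v H = (LINT x|lebesgue. f x (u x) * v x)"
  using euler_lagrange_le[OF u min v] euler_lagrange_le[OF u min inW_minus[OF v]]
  by (simp add: DD_minus)

section \<open>Sign and upper bound of the minimizer\<close>

lemma powr_le_of_same_sign:
  fixes x y :: real
  assumes "0 \<le> x * y" "\<bar>y\<bar> \<le> \<bar>x\<bar>" "r > 1"
  shows "\<bar>y\<bar> powr r \<le> \<bar>x\<bar> powr (r - 2) * (x * y)"
proof -
  have "\<bar>y\<bar> powr r = \<bar>y\<bar> powr (r - 1) * \<bar>y\<bar>"
    using powr_mult_base[of "\<bar>y\<bar>" "r - 1"] by (simp add: mult.commute)
  also have "\<dots> \<le> \<bar>x\<bar> powr (r - 1) * \<bar>y\<bar>"
    using assms by (intro mult_right_mono powr_mono2) auto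
  also have "\<dots> = \<bar>x\<bar> powr (r - 2) * (\<bar>x\<bar> * \<bar>y\<bar>)"
    using powr_mult_base[of "\<bar>x\<bar>" "r - 2"] by (simp add: mult_ac)
  also have "\<bar>x\<bar> * \<bar>y\<bar> = x * y" using assms(1) by (simp add: abs_mult[symmetric])
  finally show ?thesis .
qed

text \<open>The difference of the positive parts has the sign of \<open>dl u\<close> and is no
  larger in modulus, so pairing it with \<open>dl u\<close> dominates its own p-th power. The two
  gradient terms are nonnegative and are dropped.\<close>

lemma DD_pos_part:
  assumes u: "inW u G" and t: "t \<ge> 0"
  shows "Ir GM p (dl (\<lambda>x. max (u x - t) 0)) \<le> DD u G (\<lambda>x. max (u x - t) 0) (\<lambda>x. if u x > t then G x else 0)"
proof -
  let ?v = "\<lambda>x. max (u x - t) 0" and ?H = "\<lambda>x. if u x > t then G x else 0"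
  have W: "inW ?v ?H" by (rule inW_pos_part[OF u t])
  note fu = finD[OF inWD(3)[OF u]] and fv = finD[OF inWD(3)[OF W]]
  have "Ir GM p (dl ?v) \<le> Dr GM p (dl u) (dl ?v)"
    unfolding Ir_def Dr_def
  proof (rule integral_mono[OF LrD(2)[OF fv(2)] Dr_integrable[OF fu(2) fv(2) p1]])
    fix z
    have "0 \<le> dl u z * dl ?v z"
      unfolding dl_def by (auto simp: max_def zero_le_mult_iff)
    moreover have "\<bar>dl ?v z\<bar> \<le> \<bar>dl u z\<bar>"
      unfolding dl_def by (auto simp: max_def)
    ultimately show "norm (dl ?v z) powr p \<le> norm (dl u z) powr (p - 2) * (dl u z \<bullet> dl ?v z)"
      using powr_le_of_same_sign[OF _ _ p1] by simp
  qed
  moreover have "0 \<le> Dr lebesgue p G ?H" "0 \<le> Dr AM q G ?H"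
    unfolding Dr_def by (intro Bochner_Integration.integral_nonneg mult_nonneg_nonneg; simp)+
  ultimately show ?thesis unfolding DD_def by linarith
qed

text \<open>Testing with the negative part, that is, the positive part of \<open>-u\<close>: since
  \<open>f\<close> is nonnegative, its Gagliardo energy must vanish, and the Poincare inequality
  then makes the negative part 0.\<close>

lemma minimizer_nonneg:
  assumes u: "inW u G" and min: "\<forall>v H. inW v H \<longrightarrow> JJ u G \<le> JJ v H"
  shows "AE x in lebesgue. 0 \<le> u x"
proof -
  let ?v = "\<lambda>x. max (- u x - 0) 0" and ?H = "\<lambda>x. if - u x > 0 then - G x else 0"
  have W: "inW ?v ?H" by (rule inW_pos_part[OF inW_minus[OF u]]) simp
  have "Ir GM p (dl ?v) \<le> DD (\<lambda>x. - u x) (\<lambda>x. - G x) ?v ?H"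
    by (rule DD_pos_part[OF inW_minus[OF u]]) simp
  also have "\<dots> = - (LINT x|lebesgue. f x (u x) * ?v x)"
    unfolding DD_minus_left euler_lagrange[OF u min W] ..
  also have "\<dots> \<le> 0"
    using f_nonneg by (simp add: Bochner_Integration.integral_nonneg)
  finally have z: "Ir GM p (dl ?v) = 0" using Ir_nonneg[of GM p "dl ?v"] by linarith
  have P: "Lr lebesgue p ?v" "Ir lebesgue p ?v \<le> CP * Ir GM p (dl ?v)"
    using poincare[OF inWD(3)[OF W] inWD(2)[OF W]] by simp_all
  then have "Ir lebesgue p ?v \<le> 0" using z by simp
  then have "Ir lebesgue p ?v = 0" using Ir_nonneg[of lebesgue p ?v] by linarith
  from Ir_zero_AE[OF P(1) this] show ?thesis
    by eventually_elim (auto simp: max_def split: if_splits)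
qed

text \<open>Testing with the positive part of \<open>u - t\<close> bounds its Gagliardo energy by
  \<epsilon> times its integral. The gain estimate on the superlevel set returns a multiple of the
  same integral; half of the integral is absorbed, and what remains is the decay required for the
  iteration.\<close>

lemma minimizer_bounded:
  assumes u: "inW u G" and min: "\<forall>v H. inW v H \<longrightarrow> JJ u G \<le> JJ v H" and \<epsilon>: "\<epsilon> > 0"
  shows "AE x in lebesgue. u x \<le> stam * \<epsilon> powr (1 / (p - 1))"
proof -
  let ?g = "gain_const TYPE('a) s p"
  let ?\<gamma> = "s * p / real DIM('a)"
  have g: "?g > 0" by (rule gain_const_pos)
  note U = inWD[OF u]
  have [measurable]: "u \<in> borel_measurable lebesgue" by (rule finD(1)[OF U(3)])
  define E where "E t = {x \<in> space lebesgue. u x > t}" for t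
  have E[measurable]: "E t \<in> sets lebesgue" for t unfolding E_def by measurable
  have E\<Omega>: "E t \<subseteq> \<Omega>" if "t \<ge> 0" for t using U(2) that by (force simp: E_def)
  \<comment> \<open>The iteration lemma works with all real levels, but superlevel sets are known to
    lie in \<open>\<Omega>\<close> only for nonnegative ones.\<close>
  define \<phi> where "\<phi> t = measure lebesgue (E (max t 0))" for t
  have Efin: "emeasure lebesgue (E t) < \<infinity>" if "t \<ge> 0" for t
    using emeasure_mono[OF E\<Omega>[OF that] \<Omega>_sets] \<Omega>_finite by (rule le_less_trans)
  have Elm: "E t \<in> lmeasurable" if "t \<ge> 0" for t using Efin[OF that] by (simp add: fmeasurable_def)
  have Em: "emeasure lebesgue (E t) = ennreal (\<phi> t)" if "t \<ge> 0" for t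
    using Efin[OF that] that by (simp add: \<phi>_def emeasure_eq_ennreal_measure less_top)
  define K where "K = 2 * (2 * ?g * \<epsilon>) powr (1 / (p - 1))"
  have K: "K > 0" using g \<epsilon> by (simp add: K_def)
  have dec: "(h - t) * \<phi> h \<le> K * \<phi> t powr (1 + stam_exp)" if th: "0 \<le> t" "t < h" for t h
  proof -
    let ?v = "\<lambda>x. max (u x - t) 0"
    have W: "inW ?v (\<lambda>x. if u x > t then G x else 0)" by (rule inW_pos_part[OF u th(1)])
    note fv = finD[OF inWD(3)[OF W]] and iv = inW_L1(1)[OF W]
    have zero: "?v x = 0" if "x \<notin> E t" for x using that by (simp add: E_def)
    have eh: "(h - t) * \<phi> h \<le> (LINT x|lebesgue. ?v x)"
    proof -
      have "E h \<in> lmeasurable" by (rule Elm) (use th in simp)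
      then have ie: "integrable lebesgue (indicat_real (E h))" by (simp add: fmeasurable_def)
      have "(h - t) * \<phi> h = (LINT x|lebesgue. (h - t) * indicator (E h) x)"
        using th by (simp add: \<phi>_def)
      also have "\<dots> \<le> (LINT x|lebesgue. ?v x)"
        using th by (intro integral_mono integrable_mult_right ie iv) (auto simp: indicator_def E_def)
      finally show ?thesis .
    qed
    \<comment> \<open>A superlevel set of measure 0 is treated apart, because the gain estimate
      needs a positive \<open>m\<close>.\<close>
    show ?thesis
    proof (cases "\<phi> t = 0")
      case True
      have "\<phi> h \<le> \<phi> t"
        unfolding \<phi>_def using th by (intro measure_mono_fmeasurable Elm E) (auto simp: E_def)
      then show ?thesis using True th by (simp add: mult_nonneg_nonpos)
    next
      case False
      then have m: "\<phi> t > 0" by (simp add: \<phi>_def zero_less_measure_iff[symmetric])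
      have "Ir GM p (dl ?v) \<le> (LINT x|lebesgue. f x (u x) * ?v x)"
        using DD_pos_part[OF u th(1)] unfolding euler_lagrange[OF u min W] .
      also have "\<dots> \<le> (LINT x|lebesgue. \<epsilon> * ?v x)"
        using f_le by (intro integral_mono f_mult_integrable inW_L1(1)[OF u] iv integrable_mult_right mult_right_mono) auto
      finally have S: "Ir GM p (dl ?v) \<le> \<epsilon> * (LINT x|lebesgue. ?v x)" by simp
      note P = gagliardo_poincare[OF fv(1) E eq_refl[OF Em[OF th(1)]] m zero s01(1) p0 fv(2)]
      \<comment> \<open>The factor 2 is what turns the bound on the modular term into exactly half
        of the integral of \<open>?v\<close>, once
        \<open>\<eta> powr (1 - p) = 1 / c\<close>.\<close>
      define c where "c = 2 * ?g * \<epsilon> * \<phi> t powr ?\<gamma>"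
      have c: "c > 0" using g \<epsilon> m by (simp add: c_def)
      define \<eta> where "\<eta> = c powr (1 / (p - 1))"
      have \<eta>: "\<eta> > 0" using c by (simp add: \<eta>_def)
      have \<eta>p: "\<eta> powr (1 - p) = 1 / c"
      proof -
        have "\<eta> powr (1 - p) = c powr (1 / (p - 1) * (1 - p))" unfolding \<eta>_def by (rule powr_powr)
        also have "1 / (p - 1) * (1 - p) = - 1" using p1 by (simp add: field_simps)
        finally show ?thesis using c by (simp add: powr_minus_divide)
      qed
      have "(LINT x|lebesgue. ?v x) = (LINT x|lebesgue. indicator (E t) x * norm (?v x))"
        using zero by (intro Bochner_Integration.integral_cong) (auto simp: indicator_def)
      also have "\<dots> \<le> \<eta> * measure lebesgue (E t) + \<eta> powr (1 - p) * Ir lebesgue p ?v"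
        by (rule Lr_imp_integrable(2)[OF P(1) E Efin[OF th(1)] less_imp_le[OF p1] \<eta>])
      also have "measure lebesgue (E t) = \<phi> t" using th by (simp add: \<phi>_def)
      also have "\<eta> powr (1 - p) * Ir lebesgue p ?v \<le> \<eta> powr (1 - p) * (?g * \<phi> t powr ?\<gamma> * (\<epsilon> * (LINT x|lebesgue. ?v x)))"
        using P(2) S g by (intro mult_left_mono[OF order_trans[OF P(2)]] mult_left_mono) auto
      also have "\<dots> = (LINT x|lebesgue. ?v x) / 2"
      proof -
        have e: "?g * \<phi> t powr ?\<gamma> * (\<epsilon> * (LINT x|lebesgue. ?v x)) = c * ((LINT x|lebesgue. ?v x) / 2)"
          by (simp add: c_def)
        show ?thesis unfolding \<eta>p e using c by simp
      qed
      finally have "(LINT x|lebesgue. ?v x) \<le> 2 * (\<eta> * \<phi> t)" by simp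
      also have "2 * (\<eta> * \<phi> t) = K * \<phi> t powr (1 + stam_exp)"
      proof -
        have "\<eta> = (2 * ?g * \<epsilon>) powr (1 / (p - 1)) * (\<phi> t powr ?\<gamma>) powr (1 / (p - 1))"
          unfolding \<eta>_def c_def by (rule powr_mult)
        also have "(\<phi> t powr ?\<gamma>) powr (1 / (p - 1)) = \<phi> t powr stam_exp"
          by (simp add: powr_powr stam_exp_def)
        finally have e: "\<eta> = (2 * ?g * \<epsilon>) powr (1 / (p - 1)) * \<phi> t powr stam_exp" .
        show ?thesis
          unfolding e K_def using powr_mult_base[of "\<phi> t" stam_exp] m by (simp add: mult_ac)
      qed
      finally show ?thesis using eh by linarith
    qed
  qed
  have V: "\<phi> 0 \<le> vol"
    unfolding \<phi>_def vol_def using \<Omega>_finite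
    by (intro measure_mono_fmeasurable E E\<Omega>) (auto simp: fmeasurable_def \<Omega>_sets)
  have mono: "\<phi> h \<le> \<phi> t" if "t \<le> h" for t h
    unfolding \<phi>_def using that by (intro measure_mono_fmeasurable Elm E) (auto simp: E_def)
  have "\<phi> (K * vol powr stam_exp * 2 powr (1 + 1 / stam_exp)) = 0"
    by (rule stampacchia_iteration[OF _ mono dec V vol_pos K stam_exp_pos]) (simp add: \<phi>_def)
  \<comment> \<open>Splitting the power of \<epsilon> off the height produced by the iteration
    leaves \<open>stam\<close>.\<close>
  moreover have "K * vol powr stam_exp * 2 powr (1 + 1 / stam_exp) = stam * \<epsilon> powr (1 / (p - 1))"
    unfolding K_def stam_def powr_mult[of "2 * ?g" \<epsilon>] by (simp add: mult_ac)
  ultimately have z: "\<phi> (stam * \<epsilon> powr (1 / (p - 1))) = 0" by simp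
  have M0: "stam * \<epsilon> powr (1 / (p - 1)) \<ge> 0" using stam_pos by simp
  have "emeasure lebesgue (E (stam * \<epsilon> powr (1 / (p - 1)))) = 0"
    unfolding Em[OF M0] z by simp
  then have "E (stam * \<epsilon> powr (1 / (p - 1))) \<in> null_sets lebesgue" using E by (simp add: null_sets_def)
  then show ?thesis
    by (rule AE_I') (auto simp: E_def)
qed

end

section \<open>Weak formulation and energy\<close>

context variational
begin

lemma AM_integral:
  fixes g :: "'a \<Rightarrow> real"
  assumes "integrable AM g"
  shows "integrable lebesgue (\<lambda>x. a x * g x)" "(LINT x|AM. g x) = (LINT x|lebesgue. a x * g x)"
proof -
  have m: "g \<in> borel_measurable lebesgue" using borel_measurable_integrable[OF assms] by simp
  show "integrable lebesgue (\<lambda>x. a x * g x)"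
    using assms integrable_density[OF m a_meas] a_nonneg by simp
  show "(LINT x|AM. g x) = (LINT x|lebesgue. a x * g x)"
    using integral_density[OF m a_meas] a_nonneg by simp
qed

lemma set_integral_\<Omega>_eq:
  fixes g h :: "'a \<Rightarrow> real"
  assumes "g \<in> borel_measurable lebesgue" "h \<in> borel_measurable lebesgue"
    "AE x in lebesgue. (x \<in> \<Omega> \<longrightarrow> g x = h x) \<and> (x \<notin> \<Omega> \<longrightarrow> h x = 0)"
  shows "(LINT x:\<Omega>|lebesgue. g x) = (LINT x|lebesgue. h x)"
  unfolding set_lebesgue_integral_def
proof (rule integral_cong_AE)
  show "(\<lambda>x. indicat_real \<Omega> x *\<^sub>R g x) \<in> borel_measurable lebesgue"
    by (intro borel_measurable_scaleR borel_measurable_indicator \<Omega>_sets assms(1))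
  show "AE x in lebesgue. indicat_real \<Omega> x *\<^sub>R g x = h x"
    using assms(3) by eventually_elim (auto simp: indicator_def)
qed (rule assms(2))

text \<open>Fubini for the Gagliardo part, where integrability comes from
  \<open>Dr_integrable\<close>. For the gradient part the integral extends from
  \<open>\<Omega>\<close> to the whole space because the gradient of \<open>u\<close> vanishes
  outside.\<close>

lemma weak_form_eq:
  assumes u: "u \<in> space_W \<Omega> s p q a" and v: "v \<in> space_W \<Omega> s p q a"
  shows "(LINT x|lebesgue. (LINT y|lebesgue.
           \<bar>u x - u y\<bar> powr (p - 2) * (u x - u y) * (v x - v y) /
           norm (x - y) powr (real DIM('a) + p * s))) +
        (LINT x:\<Omega>|lebesgue.
           (norm (weak_gradient u x) powr (p - 2) *\<^sub>R weak_gradient u x +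
            (a x * norm (weak_gradient u x) powr (q - 2)) *\<^sub>R weak_gradient u x)
           \<bullet> weak_gradient v x) = DD u (weak_gradient u) v (weak_gradient v)"
proof -
  let ?G = "weak_gradient u" and ?H = "weak_gradient v"
  have Wu: "inW u ?G" and Wv: "inW v ?H" using u v by (auto intro: inW_weak_gradient)
  note fu = finD[OF inWD(3)[OF Wu]] and fv = finD[OF inWD(3)[OF Wv]]
  note [measurable] = LrD(1)[OF fu(3)] LrD(1)[OF fv(3)] a_meas
  have 1: "Dr GM p (dl u) (dl v) = (LINT x|lebesgue. (LINT y|lebesgue.
           \<bar>u x - u y\<bar> powr (p - 2) * (u x - u y) * (v x - v y) /
           norm (x - y) powr (real DIM('a) + p * s)))"
    unfolding Dr_def integral_gag[OF Dr_integrable[OF fu(2) fv(2) p1]]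
    by (simp add: dl_def mult.assoc mult.commute[of p s])
  note i1 = Dr_integrable[OF fu(3) fv(3) p1] and i2 = AM_integral[OF Dr_integrable[OF fu(4) fv(4) q1]]
  have "(LINT x:\<Omega>|lebesgue. (norm (?G x) powr (p - 2) *\<^sub>R ?G x + (a x * norm (?G x) powr (q - 2)) *\<^sub>R ?G x) \<bullet> ?H x)
    = (LINT x|lebesgue. norm (?G x) powr (p - 2) * (?G x \<bullet> ?H x) + a x * (norm (?G x) powr (q - 2) * (?G x \<bullet> ?H x)))"
  proof (rule set_integral_\<Omega>_eq)
    show "AE x in lebesgue. (x \<in> \<Omega> \<longrightarrow> (norm (?G x) powr (p - 2) *\<^sub>R ?G x + (a x * norm (?G x) powr (q - 2)) *\<^sub>R ?G x) \<bullet> ?H x =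
      norm (?G x) powr (p - 2) * (?G x \<bullet> ?H x) + a x * (norm (?G x) powr (q - 2) * (?G x \<bullet> ?H x))) \<and>
      (x \<notin> \<Omega> \<longrightarrow> norm (?G x) powr (p - 2) * (?G x \<bullet> ?H x) + a x * (norm (?G x) powr (q - 2) * (?G x \<bullet> ?H x)) = 0)"
      using inW_grad_AE_zero[OF Wu] by eventually_elim (simp add: inner_add_left)
  qed measurable
  also have "\<dots> = Dr lebesgue p ?G ?H + Dr AM q ?G ?H"
    unfolding Dr_def i2(2) by (rule Bochner_Integration.integral_add[OF i1 i2(1)])
  finally show ?thesis
    unfolding DD_def 1 by simp
qed

lemma energy_part_eq:
  assumes u: "u \<in> space_W \<Omega> s p q a"
  shows "1 / p * (LINT x|lebesgue. (LINT y|lebesgue.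
        \<bar>u x - u y\<bar> powr p / norm (x - y) powr (real DIM('a) + s * p))) +
     (LINT x:\<Omega>|lebesgue.
        norm (weak_gradient u x) powr p / p + a x * (norm (weak_gradient u x) powr q / q)) = AA u (weak_gradient u)"
proof -
  let ?G = "weak_gradient u"
  have Wu: "inW u ?G" using u by (rule inW_weak_gradient)
  note fu = finD[OF inWD(3)[OF Wu]]
  note [measurable] = LrD(1)[OF fu(3)] a_meas
  have 1: "Ir GM p (dl u) = (LINT x|lebesgue. (LINT y|lebesgue.
        \<bar>u x - u y\<bar> powr p / norm (x - y) powr (real DIM('a) + s * p)))"
    unfolding Ir_def integral_gag[OF LrD(2)[OF fu(2)]] by (simp add: dl_def)
  note i1 = LrD(2)[OF fu(3)] and i2 = AM_integral[OF LrD(2)[OF fu(4)]]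
  have "(LINT x:\<Omega>|lebesgue. norm (?G x) powr p / p + a x * (norm (?G x) powr q / q)) =
    (LINT x|lebesgue. norm (?G x) powr p / p + a x * norm (?G x) powr q / q)"
  proof (rule set_integral_\<Omega>_eq)
    show "AE x in lebesgue. (x \<in> \<Omega> \<longrightarrow> norm (?G x) powr p / p + a x * (norm (?G x) powr q / q) = norm (?G x) powr p / p + a x * norm (?G x) powr q / q) \<and>
       (x \<notin> \<Omega> \<longrightarrow> norm (?G x) powr p / p + a x * norm (?G x) powr q / q = 0)"
      using inW_grad_AE_zero[OF Wu] by eventually_elim simp
  qed measurable
  also have "\<dots> = (LINT x|lebesgue. norm (?G x) powr p / p) + (LINT x|lebesgue. a x * norm (?G x) powr q / q)"
    by (intro Bochner_Integration.integral_add integrable_divide_zero i1 i2(1))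
  also have "\<dots> = Ir lebesgue p ?G / p + Ir AM q ?G / q"
    unfolding Ir_def i2(2) by simp
  finally show ?thesis unfolding AA_def 1 by simp
qed

text \<open>The minimizer comes with some gradient of its own, whereas the solution and its energy
  are defined through \<open>weak_gradient u\<close>.\<close>

lemma JJ_cong_gradient:
  assumes "inW u G" "inW u G'"
  shows "JJ u G = JJ u G'"
proof -
  have e: "AE x in lebesgue. G' x = G x"
    by (rule has_weak_gradient_unique[OF inWD(1)[OF assms(2)] inWD(1)[OF assms(1)]])
  note f = finD[OF inWD(3)[OF assms(1)]] and f' = finD[OF inWD(3)[OF assms(2)]]
  show ?thesis
    unfolding JJ_def AA_def
    using Lr_cong_AE(2)[OF f(3) LrD(1)[OF f'(3)] e p0] Lr_cong_AE(2)[OF f(4) LrD(1)[OF f'(4)] AE_AM[OF e] q0] by simp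
qed

end

section \<open>The truncated nonlinearity\<close>

definition clip :: "real \<Rightarrow> real \<Rightarrow> real" where "clip M t = min (max t 0) M"

text \<open>The truncation of \<open>\<bar>t\<bar> powr (r - 2) * t\<close>: unchanged between 0 and
  \<open>M\<close>, zero below and constant above, hence bounded and nondecreasing.\<close>

definition clip_pow :: "real \<Rightarrow> real \<Rightarrow> real \<Rightarrow> real" where
  "clip_pow r M t = clip M t powr (r - 1)"

text \<open>The primitive of \<^const>\<open>clip_pow\<close> vanishing at \<open>0\<close>.\<close>

definition clip_prim :: "real \<Rightarrow> real \<Rightarrow> real \<Rightarrow> real" where
  "clip_prim r M t = clip M t powr r / r + M powr (r - 1) * max (t - M) 0"

lemma clip_bounds: "M > 0 \<Longrightarrow> 0 \<le> clip M t" "clip M t \<le> M"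
  by (auto simp: clip_def)

lemma clip_pow_bounds:
  assumes "M > 0" "r > 1"
  shows "0 \<le> clip_pow r M t" "clip_pow r M t \<le> M powr (r - 1)"
  using assms clip_bounds[of M t] by (auto simp: clip_pow_def intro!: powr_mono2)

text \<open>The step from \<open>t\<close> to \<open>t'\<close> is split into the step between the
  clipped values, where the tangent inequality of the power applies, and the change of the parts
  outside the interval from 0 to \<open>M\<close>.\<close>

lemma clip_prim_subgradient:
  assumes M: "M > 0" and r: "r > 1"
  shows "clip_pow r M t * (t' - t) \<le> clip_prim r M t' - clip_prim r M t"
proof -
  define x y where "x = clip M t" and "y = clip M t'"
  have xy: "0 \<le> x" "x \<le> M" "0 \<le> y" "y \<le> M"
    using clip_bounds(1)[OF M] clip_bounds(2) by (auto simp: x_def y_def)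
  have "r * (x powr (r - 2) * (x * (y - x))) \<le> y powr r - x powr r"
    using norm_powr_tangent[OF r, of x y] xy by simp
  moreover have "x powr (r - 2) * (x * (y - x)) = x powr (r - 1) * (y - x)"
    using powr_mult_base[of x "r - 2"] xy by (simp add: mult_ac)
  ultimately have "r * (x powr (r - 1) * (y - x)) \<le> y powr r - x powr r" by simp
  then have 1: "x powr (r - 1) * (y - x) \<le> y powr r / r - x powr r / r"
    using r by (simp add: field_simps)
  have le: "x powr (r - 1) \<le> M powr (r - 1)" using xy r by (intro powr_mono2) auto
  \<comment> \<open>Where \<open>t\<close> exceeds \<open>M\<close> the slope at \<open>x\<close> is
    already the maximal one (\<open>z1\<close>); where \<open>t\<close> is negative the slope is 0
    (\<open>z2\<close>). The remaining parts of \<open>t'\<close> are estimated by sign and by the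
    maximal slope.\<close>
  have 2: "x powr (r - 1) * ((t' - y) - (t - x)) \<le> M powr (r - 1) * (max (t' - M) 0 - max (t - M) 0)"
  proof -
    have e': "t' - y = max (t' - M) 0 - max (- t') 0" using M by (auto simp: y_def clip_def)
    have e: "t - x = max (t - M) 0 - max (- t) 0" using M by (auto simp: x_def clip_def)
    have z1: "x powr (r - 1) * max (t - M) 0 = M powr (r - 1) * max (t - M) 0"
      using M by (cases "t \<le> M") (auto simp: x_def clip_def)
    have z2: "x powr (r - 1) * max (- t) 0 = 0"
      using M by (cases "t \<ge> 0") (auto simp: x_def clip_def)
    have "x powr (r - 1) * ((t' - y) - (t - x)) = x powr (r - 1) * max (t' - M) 0 - x powr (r - 1) * max (- t') 0 -
      (x powr (r - 1) * max (t - M) 0 - x powr (r - 1) * max (- t) 0)"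
      unfolding e e' by (simp add: right_diff_distrib)
    also have "\<dots> \<le> M powr (r - 1) * max (t' - M) 0 - 0 - (M powr (r - 1) * max (t - M) 0 - 0)"
      unfolding z1 z2 using le by (intro diff_mono mult_right_mono mult_nonneg_nonneg order_refl) auto
    finally show ?thesis by (simp add: right_diff_distrib)
  qed
  have "clip_pow r M t * (t' - t) = x powr (r - 1) * (y - x) + x powr (r - 1) * ((t' - y) - (t - x))"
    by (simp add: clip_pow_def x_def algebra_simps)
  also have "\<dots> \<le> (y powr r / r - x powr r / r) + M powr (r - 1) * (max (t' - M) 0 - max (t - M) 0)"
    by (rule add_mono[OF 1 2])
  also have "\<dots> = clip_prim r M t' - clip_prim r M t"
    by (simp add: clip_prim_def x_def y_def algebra_simps)
  finally show ?thesis .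
qed

lemma clip_pow_eq:
  assumes "0 \<le> t" "t \<le> M"
  shows "clip_pow r M t = \<bar>t\<bar> powr (r - 2) * t"
  using assms powr_mult_base[of t "r - 2"] by (simp add: clip_pow_def clip_def mult.commute)

lemma clip_prim_eq:
  assumes "0 \<le> t" "t \<le> M"
  shows "clip_prim r M t = \<bar>t\<bar> powr r / r"
  using assms by (simp add: clip_prim_def clip_def)

lemma clip_prim_nonneg: "M > 0 \<Longrightarrow> r > 1 \<Longrightarrow> 0 \<le> clip_prim r M t"
  by (simp add: clip_prim_def)

lemma clip_measurable:
  assumes "u \<in> borel_measurable M'"
  shows "(\<lambda>x. clip_pow r M (u x)) \<in> borel_measurable M'" "(\<lambda>x. clip_prim r M (u x)) \<in> borel_measurable M'"
  using assms unfolding clip_pow_def clip_prim_def clip_def by measurable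

section \<open>Existence\<close>

context double_phase
begin

lemma truncated_variational:
  assumes w: "w \<in> borel_measurable lebesgue" "\<And>x. 0 \<le> w x" "\<And>x. w x \<le> C"
    and k: "k > 1" and P: "P > 1" and M: "M > 0" and lam: "lam > 0"
    and \<epsilon>: "lam * C * M powr (k - 1) + M powr (P - 1) \<le> \<epsilon>"
  shows "variational \<Omega> s p q a A (\<lambda>x t. lam * w x * clip_pow k M t + clip_pow P M t)
     (\<lambda>x t. lam * w x * clip_prim k M t + clip_prim P M t) \<epsilon>"
proof unfold_locales
  fix u :: "'a \<Rightarrow> real" assume u: "u \<in> borel_measurable lebesgue"
  show "(\<lambda>x. lam * w x * clip_pow k M (u x) + clip_pow P M (u x)) \<in> borel_measurable lebesgue"
    "(\<lambda>x. lam * w x * clip_prim k M (u x) + clip_prim P M (u x)) \<in> borel_measurable lebesgue"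
    by (intro borel_measurable_add borel_measurable_times borel_measurable_const w(1) clip_measurable[OF u])+
next
  fix x t t'
  have lw: "0 \<le> lam * w x" using lam w(2) by simp
  show "0 \<le> lam * w x * clip_pow k M t + clip_pow P M t"
    using lw clip_pow_bounds(1)[OF M k] clip_pow_bounds(1)[OF M P] by simp
  have "lam * w x * clip_pow k M t + clip_pow P M t \<le> lam * C * M powr (k - 1) + M powr (P - 1)"
  proof -
    have "0 \<le> C" using w(2)[of x] w(3)[of x] by linarith
    then have "0 \<le> lam * C" using lam by simp
    then show ?thesis
      using lam w(2,3) clip_pow_bounds[OF M k, of t] clip_pow_bounds[OF M P, of t]
      by (intro add_mono mult_mono) auto
  qed
  with \<epsilon> show "lam * w x * clip_pow k M t + clip_pow P M t \<le> \<epsilon>" by simp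
  have "lam * w x * (clip_pow k M t * (t' - t)) \<le> lam * w x * (clip_prim k M t' - clip_prim k M t)"
    by (rule mult_left_mono[OF clip_prim_subgradient[OF M k] lw])
  then show "(lam * w x * clip_pow k M t + clip_pow P M t) * (t' - t) \<le>
     lam * w x * clip_prim k M t' + clip_prim P M t' - (lam * w x * clip_prim k M t + clip_prim P M t)"
    using clip_prim_subgradient[OF M P, of t t'] by (simp add: algebra_simps)
next
  show "lam * w x * clip_prim k M 0 + clip_prim P M 0 = 0" for x
    using M by (simp add: clip_prim_def clip_def)
qed

lemma exists_test_function:
  obtains \<phi> where "\<phi> \<in> Cc_inf \<Omega>" "\<forall>x. 0 \<le> \<phi> x \<and> \<phi> x \<le> 1" "emeasure lebesgue {x. \<phi> x > 0} > 0"
proof -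
  obtain z where "z \<in> \<Omega>" using \<Omega>_ne by blast
  then obtain c d where cd: "z \<in> box c d" "cbox c d \<subseteq> \<Omega>"
    using open_contains_cbox[of \<Omega> z] open_\<Omega> by (metis open_contains_cbox)
  have pos: "box_bump c d 1 x > 0" if "x \<in> box c d" for x
    unfolding box_bump_def using that by (intro prod_pos mult_pos_pos) (auto simp: mem_box flat0)
  have "0 < emeasure lebesgue (box c d)"
  proof -
    have "box c d \<noteq> {}" using cd(1) by auto
    then have "\<And>b. b \<in> Basis \<Longrightarrow> c \<bullet> b < d \<bullet> b" by (auto simp: box_ne_empty)
    then have "0 < (\<Prod>b\<in>Basis. (d - c) \<bullet> b)" by (intro prod_pos) (simp add: inner_diff_left)
    then show ?thesis
      using \<open>\<And>b. b \<in> Basis \<Longrightarrow> c \<bullet> b < d \<bullet> b\<close> by (simp add: emeasure_lborel_box less_imp_le)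
  qed
  also have "\<dots> \<le> emeasure lebesgue {x. box_bump c d 1 x > 0}"
  proof (rule emeasure_mono)
    show "box c d \<subseteq> {x. box_bump c d 1 x > 0}" using pos by blast
    have [measurable]: "box_bump c d 1 \<in> borel_measurable lebesgue"
      by (rule Cc_inf_borel_measurable[OF box_bump_in_Cc_inf[OF cd(2)]])
    have "{x \<in> space lebesgue. box_bump c d 1 x > 0} \<in> sets lebesgue" by measurable
    then show "{x. box_bump c d 1 x > 0} \<in> sets lebesgue" by simp
  qed
  finally show ?thesis
    using that[OF box_bump_in_Cc_inf[OF cd(2)]] box_bump_bounds by blast
qed

text \<open>Along small multiples of a test function the leading part is of order
  \<open>t powr p\<close>, while \<open>Phi\<close> is at least a positive multiple of
  \<open>t powr k\<close>, and \<open>k < p\<close>.\<close>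

lemma exists_negative_energy:
  assumes w: "w \<in> borel_measurable lebesgue" "\<And>x. 0 \<le> w x" "\<And>x. w x \<le> C"
    and wpos: "AE x in lebesgue. x \<in> \<Omega> \<longrightarrow> 0 < w x"
    and k: "1 < k" "k < p" and P: "P > 1" and M: "M > 0" and lam: "lam > 0"
    and V: "variational \<Omega> s p q a A (\<lambda>x t. lam * w x * clip_pow k M t + clip_pow P M t)
     (\<lambda>x t. lam * w x * clip_prim k M t + clip_prim P M t) \<epsilon>"
  shows "\<exists>u G. inW u G \<and> variational.JJ s p q a (\<lambda>x t. lam * w x * clip_prim k M t + clip_prim P M t) u G < 0"
proof -
  interpret V: variational \<Omega> s p q a A "\<lambda>x t. lam * w x * clip_pow k M t + clip_pow P M t"
     "\<lambda>x t. lam * w x * clip_prim k M t + clip_prim P M t" \<epsilon> by (rule V)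
  obtain \<phi> where \<phi>: "\<phi> \<in> Cc_inf \<Omega>" "\<forall>x. 0 \<le> \<phi> x \<and> \<phi> x \<le> 1" "emeasure lebesgue {x. \<phi> x > 0} > 0"
    by (rule exists_test_function)
  have W\<phi>: "inW \<phi> (grad \<phi>)" by (rule inW_Cc_inf[OF \<phi>(1)])
  have m\<phi>[measurable]: "\<phi> \<in> borel_measurable lebesgue" by (rule Cc_inf_borel_measurable[OF \<phi>(1)])
  note w(1)[measurable]
  \<comment> \<open>The test function takes values between 0 and 1 and \<open>k > 1\<close>, so its
    power \<open>k\<close> lies below the function itself.\<close>
  have i\<phi>: "integrable lebesgue (\<lambda>x. w x * \<phi> x powr k)"
  proof (rule Bochner_Integration.integrable_bound[OF integrable_mult_right[OF inW_L1(1)[OF W\<phi>], of C]])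
    show "(\<lambda>x. w x * \<phi> x powr k) \<in> borel_measurable lebesgue" by measurable
    show "AE x in lebesgue. norm (w x * \<phi> x powr k) \<le> norm (C * \<phi> x)"
    proof (rule AE_I2)
      fix x
      have b: "0 \<le> \<phi> x" "\<phi> x \<le> 1" using \<phi>(2) by auto
      have "\<phi> x powr k \<le> \<phi> x powr 1" using b k by (intro powr_mono') auto
      then have "w x * \<phi> x powr k \<le> C * \<phi> x"
        using b w(2,3)[of x] by (intro mult_mono) (auto intro: order_trans[OF w(2) w(3)])
      then show "norm (w x * \<phi> x powr k) \<le> norm (C * \<phi> x)" using b w(2)[of x] by simp
    qed
  qed
  define I where "I = (LINT x|lebesgue. w x * \<phi> x powr k)"
  have I: "I > 0"
  proof (rule ccontr)
    assume "\<not> I > 0"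
    moreover have "I \<ge> 0" unfolding I_def using w(2) by (intro Bochner_Integration.integral_nonneg) simp
    ultimately have "I = 0" by simp
    then have "AE x in lebesgue. w x * \<phi> x powr k = 0"
      unfolding I_def using i\<phi> w(2) by (subst (asm) integral_nonneg_eq_0_iff_AE) auto
    then have "AE x in lebesgue. \<not> \<phi> x > 0"
      using wpos
    proof eventually_elim
      case (elim x)
      show ?case
      proof
        assume "\<phi> x > 0"
        moreover have "x \<in> \<Omega>"
          using \<open>\<phi> x > 0\<close> inWD(2)[OF W\<phi>, of x] by (cases "x \<in> \<Omega>") auto
        ultimately show False using elim by simp
      qed
    qed
    moreover have "{x \<in> space lebesgue. \<phi> x > 0} \<in> sets lebesgue" by measurable
    ultimately have "emeasure lebesgue {x. \<phi> x > 0} = 0"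
      by (subst (asm) AE_iff_measurable[OF _ refl]) auto
    with \<phi>(3) show False by simp
  qed
  define D where "D = lam / k * I"
  have D: "D > 0" using lam k I by (simp add: D_def)
  define X where "X = xi \<phi> (grad \<phi>)"
  have X: "X \<ge> 0" by (simp add: X_def xi_nonneg)
  \<comment> \<open>Three demands: \<open>t \<le> 1\<close> lets the modular scale by
    \<open>t powr p\<close>, \<open>t \<le> M\<close> keeps the truncation inactive, and the last
    entry makes \<open>t powr (p - k) * X\<close> smaller than \<open>D\<close>.\<close>
  define t where "t = min (min 1 M) ((D / (X + 1)) powr (1 / (p - k)))"
  have t: "0 < t" "t \<le> 1" "t \<le> M" using M D X by (auto simp: t_def)
  have tp: "t powr (p - k) * X < D"
  proof -
    have "t powr (p - k) \<le> ((D / (X + 1)) powr (1 / (p - k))) powr (p - k)"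
      using t k by (intro powr_mono2) (auto simp: t_def)
    also have "\<dots> = D / (X + 1)" using k D X by (simp add: powr_powr)
    finally have "t powr (p - k) * X \<le> D / (X + 1) * X" using X by (rule mult_right_mono)
    also have "\<dots> < D" using D X by (simp add: field_simps)
    finally show ?thesis .
  qed
  have Wt: "inW (\<lambda>x. t * \<phi> x) (\<lambda>x. t *\<^sub>R grad \<phi> x)" by (rule inW_cmult[OF W\<phi>])
  have A: "V.AA (\<lambda>x. t * \<phi> x) (\<lambda>x. t *\<^sub>R grad \<phi> x) \<le> t powr p * X"
    using V.AA_bounds(2)[of "\<lambda>x. t * \<phi> x" "\<lambda>x. t *\<^sub>R grad \<phi> x"] xi_cmult_le(2)[OF inWD(3)[OF W\<phi>], of t] t
    by (simp add: X_def)
  have "t powr k * D = (LINT x|lebesgue. (lam * t powr k / k) * (w x * \<phi> x powr k))"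
    by (simp add: D_def I_def)
  also have "\<dots> \<le> V.Phi (\<lambda>x. t * \<phi> x)"
    unfolding V.Phi_def
  proof (rule integral_mono[OF integrable_mult_right[OF i\<phi>] V.F_integrable[OF inW_L1(1)[OF Wt]]])
    fix x
    have \<phi>x: "0 \<le> \<phi> x" "\<phi> x \<le> 1" using \<phi>(2) by auto
    have "t * \<phi> x \<le> t * 1" using \<phi>x t by (intro mult_left_mono) auto
    then have b: "0 \<le> t * \<phi> x" "t * \<phi> x \<le> M"
      using \<phi>x(1) t(1) t(3) by (simp_all only: mult_1_right mult_nonneg_nonneg less_imp_le)
    have "clip_prim k M (t * \<phi> x) = t powr k * \<phi> x powr k / k"
      using clip_prim_eq[OF b, of k] b(1) by (simp add: powr_mult)
    then show "lam * t powr k / k * (w x * \<phi> x powr k) \<le> lam * w x * clip_prim k M (t * \<phi> x) + clip_prim P M (t * \<phi> x)"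
      using clip_prim_nonneg[OF M P, of "t * \<phi> x"] by (simp add: mult_ac)
  qed
  finally have Ph: "t powr k * D \<le> V.Phi (\<lambda>x. t * \<phi> x)" .
  have "t powr p * X = t powr k * (t powr (p - k) * X)"
    by (simp add: powr_add[symmetric] mult.assoc[symmetric])
  also have "\<dots> < t powr k * D" using tp t by (intro mult_strict_left_mono) auto
  finally have "V.JJ (\<lambda>x. t * \<phi> x) (\<lambda>x. t *\<^sub>R grad \<phi> x) < 0"
    unfolding V.JJ_def using A Ph by linarith
  with Wt show ?thesis by blast
qed

text \<open>The hypothesis on \<open>stam\<close> says that the a priori bound equals the truncation
  height. The minimizer thus stays almost everywhere between 0 and \<open>M\<close>, where the
  truncated nonlinearity and its primitive coincide with the original ones.\<close>

lemma truncated_solution: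
  assumes w: "w \<in> borel_measurable lebesgue" "\<And>x. 0 \<le> w x" "\<And>x. w x \<le> C"
    and wpos: "AE x in lebesgue. x \<in> \<Omega> \<longrightarrow> 0 < w x"
    and w1: "AE x in lebesgue. x \<in> \<Omega> \<longrightarrow> w1 x = w x" and w1m: "(\<lambda>x. indicator \<Omega> x * w1 x) \<in> borel_measurable lebesgue"
    and k: "1 < k" "k < p" and P: "P = sobolev_exponent (real DIM('a)) p" "P > 1" and M: "M > 0" and lam: "lam > 0"
    and \<epsilon>: "\<epsilon> > 0" "lam * C * M powr (k - 1) + M powr (P - 1) \<le> \<epsilon>" and M\<epsilon>: "stam * \<epsilon> powr (1 / (p - 1)) = M"
  shows "\<exists>u. weak_solution \<Omega> s p q k a w1 lam u \<and> \<not> (AE x in lebesgue. u x = 0) \<and>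
     (AE x in lebesgue_on \<Omega>. 0 \<le> u x) \<and> energy \<Omega> s p q k a w1 lam u < 0"
proof -
  let ?f = "\<lambda>x t. lam * w x * clip_pow k M t + clip_pow P M t"
  let ?F = "\<lambda>x t. lam * w x * clip_prim k M t + clip_prim P M t"
  note V = truncated_variational[OF w k(1) P(2) M lam \<epsilon>(2)]
  interpret V: variational \<Omega> s p q a A ?f ?F \<epsilon> by (rule V)
  obtain u G where u0: "inW u G" "\<forall>v H. inW v H \<longrightarrow> V.JJ u G \<le> V.JJ v H"
    by (rule V.minimizer_exists)
  have uS: "u \<in> space_W \<Omega> s p q a" by (rule inW_imp_space_W[OF u0(1)])
  define G0 where "G0 = weak_gradient u"
  have u: "inW u G0" unfolding G0_def by (rule inW_weak_gradient[OF uS])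
  have min: "\<forall>v H. inW v H \<longrightarrow> V.JJ u G0 \<le> V.JJ v H"
    using u0(2) V.JJ_cong_gradient[OF u0(1) u] by simp
  have nn: "AE x in lebesgue. 0 \<le> u x" by (rule V.minimizer_nonneg[OF u min])
  have bd: "AE x in lebesgue. u x \<le> M" using V.minimizer_bounded[OF u min \<epsilon>(1)] unfolding M\<epsilon> .
  have neg: "V.JJ u G0 < 0"
  proof -
    obtain v H where "inW v H" "V.JJ v H < 0"
      using exists_negative_energy[OF w wpos k P(2) M lam V] by blast
    with min show ?thesis by fastforce
  qed
  have um[measurable]: "u \<in> borel_measurable lebesgue" by (rule finD(1)[OF inWD(3)[OF u]])
  note w1m[measurable] w(1)[measurable]
  note clipm[measurable] = clip_measurable[OF um]
  have [measurable]: "\<Omega> \<in> sets lebesgue" by (rule \<Omega>_sets)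
  \<comment> \<open>\<open>w1\<close> is known only on \<open>\<Omega>\<close>, so measurability is
    required of the product of \<open>g\<close> with the indicator. On the whole space the integrals
    are taken with \<open>w\<close>.\<close>
  have transfer: "(LINT x:\<Omega>|lebesgue. g x) = (LINT x|lebesgue. h x)"
    if "(\<lambda>x. indicator \<Omega> x *\<^sub>R g x) \<in> borel_measurable lebesgue" "h \<in> borel_measurable lebesgue"
      "AE x in lebesgue. (x \<in> \<Omega> \<longrightarrow> g x = h x) \<and> (x \<notin> \<Omega> \<longrightarrow> h x = 0)" for g h :: "'a \<Rightarrow> real"
    unfolding set_lebesgue_integral_def
    by (rule integral_cong_AE[OF that(1,2)]) (use that(3) in eventually_elim, auto simp: indicator_def)
  have ws: "weak_solution \<Omega> s p q k a w1 lam u"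
    unfolding weak_solution_def P(1)[symmetric]
  proof (intro conjI ballI uS)
    fix v assume v: "v \<in> space_W \<Omega> s p q a"
    have Wv: "inW v (weak_gradient v)" by (rule inW_weak_gradient[OF v])
    have vm[measurable]: "v \<in> borel_measurable lebesgue" by (rule finD(1)[OF inWD(3)[OF Wv]])
    have "(LINT x:\<Omega>|lebesgue. (lam * w1 x * \<bar>u x\<bar> powr (k - 2) * u x + \<bar>u x\<bar> powr (P - 2) * u x) * v x) = (LINT x|lebesgue. ?f x (u x) * v x)"
    proof (rule transfer)
      have "(\<lambda>x. (lam * (indicator \<Omega> x * w1 x) * \<bar>u x\<bar> powr (k - 2) * u x + indicator \<Omega> x * (\<bar>u x\<bar> powr (P - 2) * u x)) * v x) \<in> borel_measurable lebesgue"
        by measurable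
      moreover have "(\<lambda>x. (lam * (indicator \<Omega> x * w1 x) * \<bar>u x\<bar> powr (k - 2) * u x + indicator \<Omega> x * (\<bar>u x\<bar> powr (P - 2) * u x)) * v x) =
         (\<lambda>x. indicator \<Omega> x *\<^sub>R ((lam * w1 x * \<bar>u x\<bar> powr (k - 2) * u x + \<bar>u x\<bar> powr (P - 2) * u x) * v x))"
        by (auto simp: indicator_def)
      ultimately show "(\<lambda>x. indicator \<Omega> x *\<^sub>R ((lam * w1 x * \<bar>u x\<bar> powr (k - 2) * u x + \<bar>u x\<bar> powr (P - 2) * u x) * v x)) \<in> borel_measurable lebesgue"
        by simp
      show "(\<lambda>x. ?f x (u x) * v x) \<in> borel_measurable lebesgue" by measurable
      show "AE x in lebesgue. (x \<in> \<Omega> \<longrightarrow> (lam * w1 x * \<bar>u x\<bar> powr (k - 2) * u x + \<bar>u x\<bar> powr (P - 2) * u x) * v x = ?f x (u x) * v x) \<and>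
         (x \<notin> \<Omega> \<longrightarrow> ?f x (u x) * v x = 0)"
        using nn bd w1
      proof eventually_elim
        case (elim x)
        then show ?case
          using clip_pow_eq[of "u x" M k] clip_pow_eq[of "u x" M P] inWD(2)[OF Wv] by (simp add: mult.assoc)
      qed
    qed
    also have "\<dots> = V.DD u G0 v (weak_gradient v)"
      by (rule V.euler_lagrange[OF u min Wv, symmetric])
    finally show "(LINT x|lebesgue. (LINT y|lebesgue.
           \<bar>u x - u y\<bar> powr (p - 2) * (u x - u y) * (v x - v y) / norm (x - y) powr (real DIM('a) + p * s))) +
        (LINT x:\<Omega>|lebesgue. (norm (weak_gradient u x) powr (p - 2) *\<^sub>R weak_gradient u x +
            (a x * norm (weak_gradient u x) powr (q - 2)) *\<^sub>R weak_gradient u x) \<bullet> weak_gradient v x) =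
        (LINT x:\<Omega>|lebesgue. (lam * w1 x * \<bar>u x\<bar> powr (k - 2) * u x + \<bar>u x\<bar> powr (P - 2) * u x) * v x)"
      unfolding V.weak_form_eq[OF uS v] G0_def by simp
  qed
  have en: "energy \<Omega> s p q k a w1 lam u = V.JJ u G0"
  proof -
    define g1 where "g1 x = w x * (k * clip_prim k M (u x))" for x
    define g2 where "g2 x = P * clip_prim P M (u x)" for x
    have P0: "P \<noteq> 0" "k \<noteq> 0" using P(2) k by auto
    have z: "clip_prim r M (u x) = 0" if "x \<notin> \<Omega>" for r x
      using inWD(2)[OF u that] M by (simp add: clip_prim_def clip_def)
    have 1: "(LINT x:\<Omega>|lebesgue. w1 x * \<bar>u x\<bar> powr k) = (LINT x|lebesgue. g1 x)"
    proof (rule transfer)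
      have "(\<lambda>x. (indicator \<Omega> x * w1 x) * \<bar>u x\<bar> powr k) \<in> borel_measurable lebesgue" by measurable
      then show "(\<lambda>x. indicator \<Omega> x *\<^sub>R (w1 x * \<bar>u x\<bar> powr k)) \<in> borel_measurable lebesgue" by (simp add: mult.assoc)
      show "g1 \<in> borel_measurable lebesgue" unfolding g1_def by measurable
      show "AE x in lebesgue. (x \<in> \<Omega> \<longrightarrow> w1 x * \<bar>u x\<bar> powr k = g1 x) \<and> (x \<notin> \<Omega> \<longrightarrow> g1 x = 0)"
        using nn bd w1
      proof eventually_elim
        case (elim x)
        then show ?case
          using clip_prim_eq[of "u x" M k] z inWD(2)[OF u, of x] P0 by (cases "x \<in> \<Omega>") (simp_all add: g1_def)
      qed
    qed
    have 2: "(LINT x:\<Omega>|lebesgue. \<bar>u x\<bar> powr P) = (LINT x|lebesgue. g2 x)"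
    proof (rule transfer)
      show "(\<lambda>x. indicator \<Omega> x *\<^sub>R (\<bar>u x\<bar> powr P)) \<in> borel_measurable lebesgue" by measurable
      show "g2 \<in> borel_measurable lebesgue" unfolding g2_def by measurable
      show "AE x in lebesgue. (x \<in> \<Omega> \<longrightarrow> \<bar>u x\<bar> powr P = g2 x) \<and> (x \<notin> \<Omega> \<longrightarrow> g2 x = 0)"
        using nn bd
      proof eventually_elim
        case (elim x)
        then show ?case
          using clip_prim_eq[of "u x" M P] z inWD(2)[OF u, of x] P0 by (cases "x \<in> \<Omega>") (simp_all add: g2_def)
      qed
    qed
    have i1: "integrable lebesgue (\<lambda>x. w x * clip_prim k M (u x))" and i2: "integrable lebesgue (\<lambda>x. clip_prim P M (u x))"
    proof -
      note iF = V.F_integrable[OF inW_L1(1)[OF u]]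
      have n: "0 \<le> lam * w x * clip_prim k M (u x)" "0 \<le> clip_prim P M (u x)" for x
        using clip_prim_nonneg[OF M k(1)] clip_prim_nonneg[OF M P(2)] lam w(2)[of x] by simp_all
      show "integrable lebesgue (\<lambda>x. clip_prim P M (u x))"
        by (rule Bochner_Integration.integrable_bound[OF iF]) (measurable, use n in \<open>auto simp: abs_of_nonneg intro!: AE_I2\<close>)
      have "integrable lebesgue (\<lambda>x. lam * (w x * clip_prim k M (u x)))"
        by (rule Bochner_Integration.integrable_bound[OF iF]) (measurable, use n in \<open>auto simp: abs_of_nonneg mult.assoc intro!: AE_I2\<close>)
      then show "integrable lebesgue (\<lambda>x. w x * clip_prim k M (u x))" using lam by simp
    qed
    have "V.Phi u = (LINT x|lebesgue. lam * (w x * clip_prim k M (u x)) + clip_prim P M (u x))"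
      unfolding V.Phi_def by (simp add: mult.assoc)
    also have "\<dots> = lam * (LINT x|lebesgue. w x * clip_prim k M (u x)) + (LINT x|lebesgue. clip_prim P M (u x))"
      by (subst Bochner_Integration.integral_add[OF integrable_mult_right[OF i1] i2]) simp
    also have "\<dots> = lam / k * (LINT x|lebesgue. g1 x) + 1 / P * (LINT x|lebesgue. g2 x)"
    proof -
      have "(LINT x|lebesgue. g1 x) = k * (LINT x|lebesgue. w x * clip_prim k M (u x))"
        unfolding g1_def by (simp add: mult.left_commute)
      moreover have "(LINT x|lebesgue. g2 x) = P * (LINT x|lebesgue. clip_prim P M (u x))"
        unfolding g2_def by simp
      ultimately show ?thesis using P0 by simp
    qed
    finally have Ph: "V.Phi u = lam / k * (LINT x|lebesgue. g1 x) + 1 / P * (LINT x|lebesgue. g2 x)" .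
    show ?thesis
      unfolding energy_def P(1)[symmetric] V.energy_part_eq[OF uS] 1 2 V.JJ_def Ph G0_def by simp
  qed
  \<comment> \<open>The zero function has \<open>Phi\<close> equal to 0 and \<open>AA\<close>
    nonnegative, which contradicts the negative energy.\<close>
  have nz: "\<not> (AE x in lebesgue. u x = 0)"
  proof
    assume "AE x in lebesgue. u x = 0"
    then have "AE x in lebesgue. \<bar>u x\<bar> = 0" by simp
    then have "(LINT x|lebesgue. \<bar>u x\<bar>) = 0" by (rule integral_eq_zero_AE)
    then have "V.Phi u = 0"
      using V.Phi_lipschitz[OF inW_L1(1)[OF u], of "\<lambda>x. 0"] V.Phi_zero by simp
    moreover have "0 \<le> V.AA u G0"
    proof -
      have "0 \<le> xi u G0 / q" using xi_nonneg[of u G0] q0 by simp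
      with V.AA_bounds(1)[of u G0] show ?thesis by linarith
    qed
    ultimately show False using neg by (simp add: V.JJ_def)
  qed
  have "AE x in lebesgue. x \<in> \<Omega> \<longrightarrow> 0 \<le> u x"
    using nn by eventually_elim simp
  then have "AE x in lebesgue_on \<Omega>. 0 \<le> u x"
    using \<Omega>_sets by (simp add: AE_restrict_space_iff)
  with ws nz en neg show ?thesis by auto
qed

end

lemma borel_measurable_continuous_closed_zero:
  fixes a :: "'a::euclidean_space \<Rightarrow> real"
  assumes "closed S" "continuous_on S a" "\<And>x. x \<notin> S \<Longrightarrow> a x = 0"
  shows "a \<in> borel_measurable lebesgue"
proof -
  have "(\<lambda>x. indicator S x *\<^sub>R a x) \<in> borel_measurable borel"
    using assms(1,2) by (intro borel_measurable_continuous_on_indicator) auto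
  moreover have "(\<lambda>x. indicator S x *\<^sub>R a x) = a"
  proof (rule ext)
    fix x
    show "indicator S x *\<^sub>R a x = a x"
      using assms(3)[of x] by (cases "x \<in> S") auto
  qed
  ultimately have "a \<in> borel_measurable lborel" by simp
  then show ?thesis by (rule measurable_completion)
qed

text \<open>The threshold: \<open>M\<close> is so small that the critical power is absorbed by half of \<open>\<epsilon>\<close>, where
  \<open>\<epsilon>\<close> is the bound on the right-hand side for which the Stampacchia estimate returns \<open>M\<close>.\<close>

lemma truncation_parameters:
  fixes c p P k C :: real
  assumes "c > 0" "1 < p" "p < P" "C \<ge> 0"
  obtains M \<epsilon> lam1 where "M > 0" "\<epsilon> > 0" "lam1 > 0" "c * \<epsilon> powr (1 / (p - 1)) = M"
    "\<forall>lam. 0 < lam \<and> lam < lam1 \<longrightarrow> lam * C * M powr (k - 1) + M powr (P - 1) \<le> \<epsilon>"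
proof -
  \<comment> \<open>With \<open>M powr (P - p) = \<kappa>\<close>, splitting \<open>P - 1\<close>
    into \<open>P - p\<close> and \<open>p - 1\<close> gives
    \<open>M powr (P - 1) = \<epsilon> / 2\<close>.\<close>
  define \<kappa> where "\<kappa> = 1 / (2 * c powr (p - 1))"
  have \<kappa>: "\<kappa> > 0" using assms(1) by (simp add: \<kappa>_def)
  define M where "M = \<kappa> powr (1 / (P - p))"
  have M: "M > 0" using \<kappa> by (simp add: M_def)
  define \<epsilon> where "\<epsilon> = (M / c) powr (p - 1)"
  have \<epsilon>: "\<epsilon> > 0" using M assms(1) by (simp add: \<epsilon>_def)
  have 1: "c * \<epsilon> powr (1 / (p - 1)) = M"
    using M assms(1,2) by (simp add: \<epsilon>_def powr_powr)
  have MP: "M powr (P - p) = \<kappa>"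
    using \<kappa> assms(3) by (simp add: M_def powr_powr)
  have 2: "M powr (P - 1) = \<epsilon> / 2"
  proof -
    have "M powr (P - 1) = M powr (P - p) * M powr (p - 1)"
      by (simp add: powr_add[symmetric])
    also have "\<dots> = \<epsilon> / 2"
      unfolding MP \<kappa>_def \<epsilon>_def using M assms(1) by (simp add: powr_divide)
    finally show ?thesis .
  qed
  \<comment> \<open>\<open>C + 1\<close> instead of \<open>C\<close>, because \<open>C\<close> may
    be 0 and \<open>X\<close> becomes a denominator.\<close>
  define X where "X = (C + 1) * M powr (k - 1)"
  define lam1 where "lam1 = \<epsilon> / (2 * X)"
  have d: "X > 0" using assms(4) M by (simp add: X_def)
  then have l: "lam1 > 0" using \<epsilon> by (simp add: lam1_def)
  have "lam * C * M powr (k - 1) + M powr (P - 1) \<le> \<epsilon>" if lam: "0 < lam" "lam < lam1" for lam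
  proof -
    have "lam * C * M powr (k - 1) \<le> lam1 * (C + 1) * M powr (k - 1)"
      using lam assms(4) by (intro mult_right_mono mult_mono) auto
    also have "\<dots> = lam1 * X" by (simp add: X_def)
    also have "\<dots> = \<epsilon> / 2" using d unfolding lam1_def by simp
    finally show ?thesis unfolding 2 by simp
  qed
  with M \<epsilon> l 1 that show ?thesis by blast
qed

theorem theorem1p2:
  fixes \<Omega> :: "(real ^ 'n) set"
    and s p q k :: real
    and a w\<^sub>1 :: "real ^ 'n \<Rightarrow> real"
  assumes "CARD('n) \<ge> 2"
    and "smooth_bounded_domain \<Omega>"
    and "0 < s" "s < 1"
    and "1 < p" "p < q" "q < real CARD('n)"
    and "1 < k" "k < p" "q < sobolev_exponent (real CARD('n)) p"
    and w_meas: "w\<^sub>1 \<in> borel_measurable (lebesgue_on \<Omega>)"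
    and w_bounded: "\<exists>C. AE x in lebesgue_on \<Omega>. \<bar>w\<^sub>1 x\<bar> \<le> C"
    and w_pos: "AE x in lebesgue_on \<Omega>. w\<^sub>1 x > 0"
    and a_lipschitz: "\<exists>L. L-lipschitz_on (closure \<Omega>) a"
    and a_nonneg: "\<And>x. x \<in> closure \<Omega> \<Longrightarrow> 0 \<le> a x"
    and a_ext: "\<And>x. x \<notin> closure \<Omega> \<Longrightarrow> a x = 0"
  shows "\<exists>lam\<^sub>1>0. \<forall>lam. 0 < lam \<and> lam < lam\<^sub>1 \<longrightarrow>
           (\<exists>u. weak_solution \<Omega> s p q k a w\<^sub>1 lam u \<and>
                \<not> (AE x in lebesgue. u x = 0) \<and>
                (AE x in lebesgue_on \<Omega>. 0 \<le> u x) \<and>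
                energy \<Omega> s p q k a w\<^sub>1 lam u < 0)"
proof -
  have \<Omega>: "open \<Omega>" "bounded \<Omega>" "\<Omega> \<noteq> {}"
    using assms(2) by (auto simp: smooth_bounded_domain_def)
  have \<Omega>s: "\<Omega> \<in> sets lebesgue" using \<Omega>(1) by (simp add: borel_open)
  have ca: "continuous_on (closure \<Omega>) a"
    using a_lipschitz lipschitz_on_continuous_on by blast
  have a0: "0 \<le> a x" for x using a_nonneg[of x] a_ext[of x] by (cases "x \<in> closure \<Omega>") auto
  have am: "a \<in> borel_measurable lebesgue"
    by (rule borel_measurable_continuous_closed_zero[OF closed_closure ca a_ext])
  have "compact (closure \<Omega>)" using \<Omega>(2) by (simp add: compact_closure)
  then have "bounded (a ` closure \<Omega>)"
    using ca by (intro compact_imp_bounded compact_continuous_image)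
  then obtain A where A: "A > 0" "\<forall>x\<in>a ` closure \<Omega>. norm x \<le> A" unfolding bounded_pos by blast
  have aA: "a x \<le> A" for x
    using A a_ext[of x] by (cases "x \<in> closure \<Omega>") force+
  interpret double_phase \<Omega> s p q a A
    by unfold_locales (use \<Omega> assms(3-6) a0 am aA in auto)
  have dim: "real DIM(real ^ 'n) = real CARD('n)" by simp
  define P where "P = sobolev_exponent (real DIM(real ^ 'n)) p"
  have pP: "p < P" using assms(6,10) by (simp add: P_def)
  obtain C where C: "AE x in lebesgue_on \<Omega>. \<bar>w\<^sub>1 x\<bar> \<le> C" using w_bounded by blast
  \<comment> \<open>The sign of \<open>C\<close> is not given, and clipping at a negative height
    would not produce a nonnegative weight.\<close>
  define D where "D = max C 0"
  \<comment> \<open>A version of the weight that is nonnegative, bounded and measurable on the whole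
    space without exceptional points, and that agrees with \<open>w\<^sub>1\<close> almost
    everywhere in \<open>\<Omega>\<close>.\<close>
  define w where "w x = (if x \<in> \<Omega> then clip D (w\<^sub>1 x) else 0)" for x
  have D0: "D \<ge> 0" by (simp add: D_def)
  have w1m: "(\<lambda>x. indicator \<Omega> x * w\<^sub>1 x) \<in> borel_measurable lebesgue"
    using w_meas \<Omega>s by (simp add: borel_measurable_restrict_space_iff)
  have wm: "w \<in> borel_measurable lebesgue"
  proof -
    have "(\<lambda>x. clip D (indicator \<Omega> x * w\<^sub>1 x)) \<in> borel_measurable lebesgue"
      unfolding clip_def using w1m by measurable
    moreover have "(\<lambda>x. clip D (indicator \<Omega> x * w\<^sub>1 x)) = w"
      using D0 by (auto simp: w_def clip_def)
    ultimately show ?thesis by simp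
  qed
  have w0: "0 \<le> w x" "w x \<le> D" for x using D0 by (auto simp: w_def clip_def)
  have "AE x in lebesgue. x \<in> \<Omega> \<longrightarrow> \<bar>w\<^sub>1 x\<bar> \<le> C" "AE x in lebesgue. x \<in> \<Omega> \<longrightarrow> 0 < w\<^sub>1 x"
    using C w_pos \<Omega>s by (simp_all add: AE_restrict_space_iff)
  then have AE1: "AE x in lebesgue. x \<in> \<Omega> \<longrightarrow> 0 < w\<^sub>1 x \<and> \<bar>w\<^sub>1 x\<bar> \<le> C"
    by eventually_elim simp
  have ww: "AE x in lebesgue. x \<in> \<Omega> \<longrightarrow> w\<^sub>1 x = w x" and wp: "AE x in lebesgue. x \<in> \<Omega> \<longrightarrow> 0 < w x"
    using AE1 by (eventually_elim, force simp: w_def clip_def D_def)+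
  obtain M \<epsilon> lam1 where M: "M > 0" "\<epsilon> > 0" "lam1 > 0" "stam * \<epsilon> powr (1 / (p - 1)) = M"
    "\<forall>lam. 0 < lam \<and> lam < lam1 \<longrightarrow> lam * D * M powr (k - 1) + M powr (P - 1) \<le> \<epsilon>"
    by (rule truncation_parameters[OF stam_pos assms(5) pP D0])
  show ?thesis
  proof (intro exI[of _ lam1] conjI M(3) allI impI)
    fix lam assume lam: "0 < lam \<and> lam < lam1"
    show "\<exists>u. weak_solution \<Omega> s p q k a w\<^sub>1 lam u \<and> \<not> (AE x in lebesgue. u x = 0) \<and>
                (AE x in lebesgue_on \<Omega>. 0 \<le> u x) \<and> energy \<Omega> s p q k a w\<^sub>1 lam u < 0"
      by (rule truncated_solution[OF wm w0 wp ww w1m assms(8,9) P_def _ M(1) _ M(2) M(5)[rule_format, OF lam] M(4)])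
        (use pP assms(5) lam in auto)
  qed
qed

end
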